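(* Let $L$ be an even lattice of signature $(b_+,b_-)$, let $v\in\operatorname{Gr}(L_{\mathbb{R}})$, let $\Gamma$ be a finite index subgroup of $\operatorname{Mp}_2(\mathbb{Z})$, let $\tilde\Gamma$ be its image under the involution $(A,\phi)\mapsto(\tilde A,\tilde\phi)$, and let $k,l\in\frac12\mathbb{Z}$. For a modular form $G$ of weight $\big(k-\frac{b_-}{2},l-\frac{b_+}{2}\big)$ and representation $\rho_L$ with respect to $\tilde\Gamma$, let $\tilde G(\tau)=\omega_L\big(G(-\overline\tau)\big)$, which is a modular form of weight $\big(l-\frac{b_+}{2},k-\frac{b_-}{2}\big)$ and representation $\rho_L^*$ with respect to $\Gamma$, and write $\tilde\Phi_{L,v}^G$ for $\Phi_{L,v}^{\tilde G}$, which is a Jacobi form of weight $(l,k)$ and index $(L,v)$ with respect to $\Gamma$. Then the map $G\mapsto\tilde\Phi_{L,v}^G$ is an isomorphism between the space of modular forms of weight $\big(k-\frac{b_-}{2},l-\frac{b_+}{2}\big)$ and representation $\rho_L$ with respect to $\tilde\Gamma$ and the space of Jacobi forms of weight $(l,k)$ and index $(L,v)$ with respect to $\Gamma$. Moreover, $\tilde\Phi_{L,v}^G$ is skew-holomorphic if and only if $G$ is weakly holomorphic, a case which can occur (for non-zero $G$) only if $l=\frac{b_+}{2}$.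
   Context: Lattices. An even lattice is a free $\mathbb{Z}$-module $L$ of finite rank with a non-degenerate symmetric bilinear form $(\cdot,\cdot):L\times L\to\mathbb{Z}$ such that $\lambda^2:=(\lambda,\lambda)$ is even for every $\lambda\in L$. Put $L_{\mathbb{R}}=L\otimes\mathbb{R}$, $L_{\mathbb{C}}=L\otimes\mathbb{C}$; the pairing and $\lambda\mapsto\lambda^2$ are extended bilinearly (no complex conjugation). The signature of $L$ is that of $L_{\mathbb{R}}$. The dual lattice is $L^*=\{\lambda\in L_{\mathbb{R}}:(\lambda,L)\subseteq\mathbb{Z}\}\supseteq L$, and $D_L=L^*/L$ is a finite group. $\mathbb{C}[D_L]$ has basis $\{\mathfrak{e}_\gamma\}_{\gamma\in D_L}$. Write $\mathbf{e}(w)=e^{2\pi iw}$ and $\mathcal{H}=\{\tau=x+iy\in\mathbb{C}:y>0\}$. $\operatorname{Gr}(L_{\mathbb{R}})$ is the set of orthogonal decompositions $v$: $L_{\mathbb{R}}=v_+\oplus v_-$ with $v_+$ positive definite and $v_-$ negative definite; $\lambda_{v_\pm}$ is the orthogonal projection of $\lambda$ onto $v_\pm$, extended complex linearly to $\zeta\mapsto\zeta_{v_\pm}$ on $L_{\mathbb{C}}$. The Jacobi--Siegel theta function: for $\tau\in\mathcal{H}$, $\zeta\in L_{\mathbb{C}}$, $$\Theta_L(\tau,\zeta;v)=\sum_{\gamma\in D_L}\Big[\sum_{\lambda\in L+\gamma}\mathbf{e}\Big(\tau\tfrac{\lambda_{v_+}^2}{2}+\overline{\tau}\tfrac{\lambda_{v_-}^2}{2}+(\lambda,\zeta)\Big)\Big]\mathfrak{e}_\gamma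 .$$ Metaplectic group. For $A=\begin{pmatrix}a&b\\c&d\end{pmatrix}\in\operatorname{SL}_2(\mathbb{R})$ put $A\tau=\frac{a\tau+b}{c\tau+d}$, $j(A,\tau)=c\tau+d$, $j_A'=c$. $\operatorname{Mp}_2(\mathbb{R})$ is the group of pairs $(A,\phi)$ with $A\in\operatorname{SL}_2(\mathbb{R})$, $\phi:\mathcal{H}\to\mathbb{C}$ holomorphic, $\phi^2(\tau)=j(A,\tau)$, with product $(A,\phi)(B,\psi)=(AB,(\phi\circ B)\psi)$; $\operatorname{Mp}_2(\mathbb{Z})$ is the inverse image of $\operatorname{SL}_2(\mathbb{Z})$. It is generated by $T=\big(\begin{pmatrix}1&1\\0&1\end{pmatrix},1\big)$ and $S=\big(\begin{pmatrix}0&-1\\1&0\end{pmatrix},\sqrt{\tau}\big)$ with $\sqrt\tau\in\mathcal{H}$. The Weil representation $\rho_L$ of $\operatorname{Mp}_2(\mathbb{Z})$ on $\mathbb{C}[D_L]$ is given by $$\rho_L(T)\mathfrak{e}_\gamma=\mathbf{e}(\tfrac{\gamma^2}{2})\mathfrak{e}_\gamma,\qquad \rho_L(S)\mathfrak{e}_\gamma=\frac{\mathbf{e}\big(\frac{b_--b_+}{8}\big)}{\sqrt{|D_L|}}\sum_{\delta\in D_L}\mathbf{e}(-(\gamma,\delta))\mathfrak{e}_\delta .$$ $L(-1)$ is $L$ with the forms negated; $\mathbb{C}[D_{L(-1)}]$ has basis $\{\mathfrak{e}_\gamma^*\}_{\gamma\in D_L}$, regarded as dual to $\{\mathfrak{e}_\gamma\}$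 via the bilinear pairing $\langle\cdot,\cdot\rangle_L:\mathbb{C}[D_L]\times\mathbb{C}[D_{L(-1)}]\to\mathbb{C}$, $\langle\mathfrak{e}_\gamma,\mathfrak{e}_\delta^*\rangle_L=\delta_{\gamma,\delta}$. $\rho_L^*=\rho_{L(-1)}$ is the dual representation: $\langle\rho_L(A,\phi)U,\rho_L^*(A,\phi)V\rangle_L=\langle U,V\rangle_L$. Involution. For $(A,\phi)\in\operatorname{Mp}_2(\mathbb{R})$ with $A=\begin{pmatrix}a&b\\c&d\end{pmatrix}$, put $\tilde A=\begin{pmatrix}a&-b\\-c&d\end{pmatrix}$ and $\tilde\phi(\tau)=\overline{\phi(-\overline\tau)}$; $(A,\phi)\mapsto(\tilde A,\tilde\phi)$ is a group involution. $\omega_L:\mathbb{C}[D_L]\to\mathbb{C}[D_{L(-1)}]$ is the $\mathbb{C}$-linear map with $\omega_L(\mathfrak{e}_\gamma)=\mathfrak{e}_\gamma^*$. Growth. A function $f$ on $\mathcal{H}$ has at most linear exponential growth at the cusps if for every $A\in\operatorname{SL}_2(\mathbb{Z})$ there is a constant $C$ with $f(A\tau)=O(e^{Cy})$ as $y\to\infty$, uniformly for $x$ in bounded sets. Modular forms. For $p,q\in\frac12\mathbb{Z}$, a modular form of weight $(p,q)$ and representation $\rho$ (a representation of $\operatorname{Mp}_2(\mathbb{Z})$ on a finite-dimensional space $V_\rho$, here $\rho_L$ or $\rho_L^*$) with respect to a finite index subgroup $\Gamma$ is a smooth $F:\mathcal{H}\to V_\rho$ with $F(A\tau)=\phi(\tau)^{2p}\overline{\phi(\tau)}^{2q}\rho(A,\phi)F(\tau)$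 for all $\tau\in\mathcal{H}$, $(A,\phi)\in\Gamma$, and at most linear exponential growth at the cusps. It is weakly holomorphic if it is moreover holomorphic on $\mathcal{H}$. Jacobi forms. A Jacobi form of weight $(p,q)$ and index $(L,v)$ with respect to $\Gamma$ is a smooth $\Phi:\mathcal{H}\times L_{\mathbb{C}}\to\mathbb{C}$ such that: (1) for all $\tau,\zeta$ and $\sigma,\nu\in L$, $\Phi(\tau,\zeta+\tau\sigma_{v_+}+\overline\tau\sigma_{v_-}+\nu)=\mathbf{e}\big(-\tau\frac{\sigma_{v_+}^2}{2}-\overline\tau\frac{\sigma_{v_-}^2}{2}-(\sigma,\zeta)\big)\Phi(\tau,\zeta)$; (2) for all $\tau,\zeta$ and $(A,\phi)\in\Gamma$, $$\Phi\Big(A\tau,\tfrac{\zeta_{v_+}}{j(A,\tau)}+\tfrac{\zeta_{v_-}}{\overline{j(A,\tau)}}\Big)=\phi(\tau)^{2p}\overline{\phi(\tau)}^{2q}\,\mathbf{e}\Big(\tfrac{j_A'\zeta_{v_+}^2}{2j(A,\tau)}+\tfrac{j_A'\zeta_{v_-}^2}{2\overline{j(A,\tau)}}\Big)\Phi(\tau,\zeta);$$ (3) $\zeta\mapsto\Phi(\tau,\zeta)$ is holomorphic for each $\tau$; (4) the functions $f_\lambda$ ($\lambda\in L^*$) in the Fourier expansion $\Phi(\tau,\zeta)=\sum_{\lambda\in L^*}f_\lambda(\tau)\mathbf{e}\big(\tau\frac{\lambda_{v_+}^2}{2}+\overline\tau\frac{\lambda_{v_-}^2}{2}+(\lambda,\zeta)\big)$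 have at most linear exponential growth at the cusps. For a modular form $F$ of weight $\big(p-\frac{b_+}{2},q-\frac{b_-}{2}\big)$ and representation $\rho_L^*$ with respect to $\Gamma$, $\Phi_{L,v}^F(\tau,\zeta)=\langle\Theta_L(\tau,\zeta;v),F(\tau)\rangle_L$, a Jacobi form of weight $(p,q)$ and index $(L,v)$ with respect to $\Gamma$. Skew-holomorphic. $\Delta_{v_+}^h$ is the holomorphic Laplacian of $v_+$ acting on $\zeta$: for an orthonormal basis $e_1,\dots,e_{b_+}$ of $v_+$ and complex coordinates $\zeta_l$ of $\zeta_{v_+}$ along $e_l$, $\Delta_{v_+}^h=\sum_{l=1}^{b_+}\partial_{\zeta_l}^2$. A Jacobi form is skew-holomorphic if it is annihilated by $4\pi i\partial_\tau-\Delta_{v_+}^h$. *)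

theory Defs
  imports
    "HOL-Analysis.Analysis"
    "HOL-Algebra.Coset"
    "HOL-Library.Function_Algebras"
begin

section \<open>Even lattices\<close>

text \<open>
  The type \<open>'v\<close> plays the role of \<open>L\<otimes>\<real>\<close>, and \<open>lat\<close> is the image of the free module in it.
  The class \<open>real_normed_vector\<close> (rather than \<open>euclidean_space\<close>, which excludes
  dimension 0) only supplies the topology, which is norm-independent because \<open>even_lattice\<close> forces
  finite dimension. The field \<open>bform\<close> is the real-bilinear extension of the pairing.
\<close>

record 'v lattice_form =
  lat :: "'v set"
  bform :: "'v \<Rightarrow> 'v \<Rightarrow> real"

abbreviation qform :: "'v lattice_form \<Rightarrow> 'v \<Rightarrow> real" where
  "qform L x \<equiv> bform L x x"

definition even_lattice :: "'v::real_normed_vector lattice_form \<Rightarrow> bool" where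
  "even_lattice L \<longleftrightarrow>
     (\<exists>b. finite b \<and> independent b \<and> span b = UNIV \<and>
          lat L = {\<Sum>x\<in>b. of_int (c x) *\<^sub>R x | c :: 'v \<Rightarrow> int. True}) \<and>
     bilinear (bform L) \<and>
     (\<forall>x y. bform L x y = bform L y x) \<and>
     (\<forall>x. (\<forall>y. bform L x y = 0) \<longrightarrow> x = 0) \<and>
     (\<forall>x\<in>lat L. \<forall>y\<in>lat L. bform L x y \<in> \<int>) \<and>
     (\<forall>x\<in>lat L. \<exists>m::int. qform L x = 2 * of_int m)"

definition neg_lattice :: "'v lattice_form \<Rightarrow> 'v lattice_form" where
  "neg_lattice L = L\<lparr>bform := \<lambda>x y. - bform L x y\<rparr>"

definition grassmannian :: "'v::real_normed_vector lattice_form \<Rightarrow> ('v set \<times> 'v set) set" where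
  "grassmannian L = {(P, N).
     subspace P \<and> subspace N \<and>
     (\<forall>x\<in>P. \<forall>y\<in>N. bform L x y = 0) \<and>
     P \<inter> N = {0} \<and> (\<forall>x. \<exists>p\<in>P. \<exists>n\<in>N. x = p + n) \<and>
     (\<forall>x\<in>P. x \<noteq> 0 \<longrightarrow> qform L x > 0) \<and>
     (\<forall>x\<in>N. x \<noteq> 0 \<longrightarrow> qform L x < 0)}"

text \<open>Well defined by Sylvester's law of inertia.\<close>

definition signature :: "'v::real_normed_vector lattice_form \<Rightarrow> nat \<times> nat" where
  "signature L = (THE s. \<exists>(P, N) \<in> grassmannian L. s = (dim P, dim N))"

definition proj_plus :: "'v::real_normed_vector set \<times> 'v set \<Rightarrow> 'v \<Rightarrow> 'v" where
  "proj_plus v x = (THE p. p \<in> fst v \<and> x - p \<in> snd v)"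

definition proj_minus :: "'v::real_normed_vector set \<times> 'v set \<Rightarrow> 'v \<Rightarrow> 'v" where
  "proj_minus v x = (THE n. n \<in> snd v \<and> x - n \<in> fst v)"

definition dual_lattice :: "'v lattice_form \<Rightarrow> 'v set" where
  "dual_lattice L = {x. \<forall>y\<in>lat L. bform L x y \<in> \<int>}"

definition disc :: "'v::real_normed_vector lattice_form \<Rightarrow> 'v set set" where
  "disc L = dual_lattice L //
     {(x, y). x \<in> dual_lattice L \<and> y \<in> dual_lattice L \<and> x - y \<in> lat L}"

text \<open>
  A representative of a coset; \<open>qform\<close> modulo 2 and \<open>bform\<close> modulo 1 do not depend on its choice.
\<close>

definition rep :: "'v set \<Rightarrow> 'v" where
  "rep \<gamma> = (SOME x. x \<in> \<gamma>)"


section \<open>The complexification\<close>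

text \<open>The pair \<open>(x, y)\<close> of type \<open>'v \<times> 'v\<close> stands for \<open>x + \<i>y\<close>.\<close>

type_synonym 'v cplx = "'v \<times> 'v"

definition emb :: "'v::real_vector \<Rightarrow> 'v cplx" where
  "emb x = (x, 0)"

definition cscale :: "complex \<Rightarrow> 'v::real_vector cplx \<Rightarrow> 'v cplx" where
  "cscale c z = (Re c *\<^sub>R fst z - Im c *\<^sub>R snd z, Re c *\<^sub>R snd z + Im c *\<^sub>R fst z)"

definition cbform :: "'v lattice_form \<Rightarrow> 'v cplx \<Rightarrow> 'v cplx \<Rightarrow> complex" where
  "cbform L z w = Complex (bform L (fst z) (fst w) - bform L (snd z) (snd w))
                          (bform L (fst z) (snd w) + bform L (snd z) (fst w))"

abbreviation cqform :: "'v lattice_form \<Rightarrow> 'v cplx \<Rightarrow> complex" where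
  "cqform L z \<equiv> cbform L z z"

definition cproj_plus :: "'v::real_normed_vector set \<times> 'v set \<Rightarrow> 'v cplx \<Rightarrow> 'v cplx" where
  "cproj_plus v z = (proj_plus v (fst z), proj_plus v (snd z))"

definition cproj_minus :: "'v::real_normed_vector set \<times> 'v set \<Rightarrow> 'v cplx \<Rightarrow> 'v cplx" where
  "cproj_minus v z = (proj_minus v (fst z), proj_minus v (snd z))"


section \<open>Group algebra and theta function\<close>

definition ee :: "complex \<Rightarrow> complex" where
  "ee w = exp (2 * of_real pi * \<i> * w)"

definition upper_half_plane :: "complex set" where
  "upper_half_plane = {\<tau>. Im \<tau> > 0}"

definition group_algebra :: "'v::real_normed_vector lattice_form \<Rightarrow> ('v set \<Rightarrow> complex) set" where
  "group_algebra L = {U. \<forall>\<gamma>. \<gamma> \<notin> disc L \<longrightarrow> U \<gamma> = 0}"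

definition basis_vec :: "'i \<Rightarrow> 'i \<Rightarrow> complex" where
  "basis_vec \<gamma> = (\<lambda>\<delta>. if \<delta> = \<gamma> then 1 else 0)"

definition vscale :: "complex \<Rightarrow> ('i \<Rightarrow> complex) \<Rightarrow> ('i \<Rightarrow> complex)" where
  "vscale c U = (\<lambda>i. c * U i)"

definition pairing ::
  "'v::real_normed_vector lattice_form \<Rightarrow> ('v set \<Rightarrow> complex) \<Rightarrow> ('v set \<Rightarrow> complex) \<Rightarrow> complex" where
  "pairing L U V = (\<Sum>\<gamma>\<in>disc L. U \<gamma> * V \<gamma>)"

text \<open>
  The discriminant groups of \<open>L\<close> and \<open>L(-1)\<close> are the same set of cosets, so that both bases
  \<open>\<ee>\<^sub>\<gamma>\<close> and \<open>\<ee>\<^sub>\<gamma>\<^sup>*\<close> are rendered by \<open>basis_vec \<gamma>\<close>.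
\<close>

definition omega ::
  "'v::real_normed_vector lattice_form \<Rightarrow> ('v set \<Rightarrow> complex) \<Rightarrow> ('v set \<Rightarrow> complex)" where
  "omega L U = (\<Sum>\<gamma>\<in>disc L. vscale (U \<gamma>) (basis_vec \<gamma>))"

definition theta_term ::
  "'v::real_normed_vector lattice_form \<Rightarrow> 'v set \<times> 'v set \<Rightarrow> complex \<Rightarrow> 'v cplx \<Rightarrow> 'v \<Rightarrow> complex" where
  "theta_term L v \<tau> \<zeta> x =
     ee (\<tau> * of_real (qform L (proj_plus v x)) / 2
         + cnj \<tau> * of_real (qform L (proj_minus v x)) / 2
         + cbform L (emb x) \<zeta>)"

definition siegel_theta ::
  "'v::real_normed_vector lattice_form \<Rightarrow> 'v set \<times> 'v set \<Rightarrow> complex \<Rightarrow> 'v cplx \<Rightarrow> 'v set \<Rightarrow> complex" where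
  "siegel_theta L v \<tau> \<zeta> =
     (\<Sum>\<gamma>\<in>disc L. vscale (\<Sum>\<^sub>\<infinity>x\<in>\<gamma>. theta_term L v \<tau> \<zeta> x) (basis_vec \<gamma>))"


section \<open>The metaplectic group\<close>

definition mobius :: "real^2^2 \<Rightarrow> complex \<Rightarrow> complex" where
  "mobius A \<tau> = (of_real (A$1$1) * \<tau> + of_real (A$1$2)) / (of_real (A$2$1) * \<tau> + of_real (A$2$2))"

definition autj :: "real^2^2 \<Rightarrow> complex \<Rightarrow> complex" where
  "autj A \<tau> = of_real (A$2$1) * \<tau> + of_real (A$2$2)"

definition SL2Z :: "(real^2^2) set" where
  "SL2Z = {A. det A = 1 \<and> (\<forall>i j. A$i$j \<in> \<int>)}"

definition mat22 :: "real \<Rightarrow> real \<Rightarrow> real \<Rightarrow> real \<Rightarrow> real^2^2" where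
  "mat22 a b c d = vector [vector [a, b], vector [c, d]]"

text \<open>
  Functions on the upper half plane are total functions vanishing off it, so that equality of
  functions on the half plane is equality in HOL.
\<close>

type_synonym mp2 = "(real^2^2) \<times> (complex \<Rightarrow> complex)"

definition mp2_carrier :: "mp2 set" where
  "mp2_carrier = {(A, \<phi>). det A = 1 \<and> \<phi> holomorphic_on upper_half_plane \<and>
     (\<forall>\<tau>\<in>upper_half_plane. (\<phi> \<tau>)\<^sup>2 = autj A \<tau>) \<and>
     (\<forall>\<tau>. \<tau> \<notin> upper_half_plane \<longrightarrow> \<phi> \<tau> = 0)}"

definition mp2_mult :: "mp2 \<Rightarrow> mp2 \<Rightarrow> mp2" where
  "mp2_mult M N = (fst M ** fst N, \<lambda>\<tau>. snd M (mobius (fst N) \<tau>) * snd N \<tau>)"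

definition mp2_one :: mp2 where
  "mp2_one = (mat 1, \<lambda>\<tau>. if \<tau> \<in> upper_half_plane then 1 else 0)"

definition Mp2Z :: "mp2 monoid" where
  "Mp2Z = \<lparr>carrier = {M \<in> mp2_carrier. fst M \<in> SL2Z}, mult = mp2_mult, one = mp2_one\<rparr>"

definition gen_T :: mp2 where
  "gen_T = (mat22 1 1 0 1, \<lambda>\<tau>. if \<tau> \<in> upper_half_plane then 1 else 0)"

text \<open>The principal root \<open>csqrt\<close> maps the upper half plane to itself.\<close>

definition gen_S :: mp2 where
  "gen_S = (mat22 0 (-1) 1 0, \<lambda>\<tau>. if \<tau> \<in> upper_half_plane then csqrt \<tau> else 0)"

definition mp2_tilde :: "mp2 \<Rightarrow> mp2" where
  "mp2_tilde M =
     (mat22 (fst M $1$1) (- (fst M $1$2)) (- (fst M $2$1)) (fst M $2$2),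
      \<lambda>\<tau>. cnj (snd M (- cnj \<tau>)))"


section \<open>The Weil representation\<close>

definition representation_on ::
  "'g monoid \<Rightarrow> ('i \<Rightarrow> complex) set \<Rightarrow> ('g \<Rightarrow> ('i \<Rightarrow> complex) \<Rightarrow> ('i \<Rightarrow> complex)) \<Rightarrow> bool" where
  "representation_on G V \<rho> \<longleftrightarrow>
     (\<forall>g\<in>carrier G.
        (\<forall>U\<in>V. \<rho> g U \<in> V) \<and>
        (\<forall>U\<in>V. \<forall>W\<in>V. \<rho> g (U + W) = \<rho> g U + \<rho> g W) \<and>
        (\<forall>c. \<forall>U\<in>V. \<rho> g (vscale c U) = vscale c (\<rho> g U))) \<and>
     (\<forall>U\<in>V. \<rho> \<one>\<^bsub>G\<^esub> U = U) \<and>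
     (\<forall>g\<in>carrier G. \<forall>h\<in>carrier G. \<forall>U\<in>V. \<rho> (g \<otimes>\<^bsub>G\<^esub> h) U = \<rho> g (\<rho> h U))"

definition is_weil_rep ::
  "'v::real_normed_vector lattice_form \<Rightarrow> (mp2 \<Rightarrow> ('v set \<Rightarrow> complex) \<Rightarrow> ('v set \<Rightarrow> complex)) \<Rightarrow> bool" where
  "is_weil_rep L \<rho> \<longleftrightarrow>
     representation_on Mp2Z (group_algebra L) \<rho> \<and>
     (\<forall>\<gamma>\<in>disc L. \<rho> gen_T (basis_vec \<gamma>) =
        vscale (ee (of_real (qform L (rep \<gamma>)) / 2)) (basis_vec \<gamma>)) \<and>
     (\<forall>\<gamma>\<in>disc L. \<rho> gen_S (basis_vec \<gamma>) =
        vscale (ee ((of_nat (snd (signature L)) - of_nat (fst (signature L))) / 8)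
                / of_real (sqrt (real (card (disc L)))))
          (\<Sum>\<delta>\<in>disc L. vscale (ee (- of_real (bform L (rep \<gamma>) (rep \<delta>)))) (basis_vec \<delta>)))"

text \<open>
  The values on the generators determine the representation on all of \<open>Mp2Z\<close> (and on
  \<open>group_algebra L\<close>), so that the choice is unique where it matters.
\<close>

definition weil_rep ::
  "'v::real_normed_vector lattice_form \<Rightarrow> mp2 \<Rightarrow> ('v set \<Rightarrow> complex) \<Rightarrow> ('v set \<Rightarrow> complex)" where
  "weil_rep L = (SOME \<rho>. is_weil_rep L \<rho>)"

definition weil_rep_dual ::
  "'v::real_normed_vector lattice_form \<Rightarrow> mp2 \<Rightarrow> ('v set \<Rightarrow> complex) \<Rightarrow> ('v set \<Rightarrow> complex)" where
  "weil_rep_dual L = weil_rep (neg_lattice L)"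


section \<open>Smoothness and growth\<close>

text \<open>
  For open \<open>S\<close> in a finite-dimensional space, \<open>Ck_on n S f\<close> is the usual \<open>C\<^sup>n\<close> condition: all
  iterated directional derivatives up to order \<open>n\<close> exist and are continuous.
\<close>

primrec Ck_on ::
  "nat \<Rightarrow> 'a::real_normed_vector set \<Rightarrow> ('a \<Rightarrow> 'b::real_normed_vector) \<Rightarrow> bool" where
  "Ck_on 0 S f \<longleftrightarrow> continuous_on S f"
| "Ck_on (Suc n) S f \<longleftrightarrow>
     (\<forall>x\<in>S. f differentiable (at x)) \<and>
     (\<forall>u. Ck_on n S (\<lambda>x. frechet_derivative f (at x) u))"

definition smooth_on :: "'a::real_normed_vector set \<Rightarrow> ('a \<Rightarrow> 'b::real_normed_vector) \<Rightarrow> bool" where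
  "smooth_on S f \<longleftrightarrow> (\<forall>n. Ck_on n S f)"

definition lin_exp_growth :: "(complex \<Rightarrow> complex) \<Rightarrow> bool" where
  "lin_exp_growth f \<longleftrightarrow>
     (\<forall>A\<in>SL2Z. \<exists>C::real. \<forall>X. bounded X \<longrightarrow>
        (\<exists>K Y. \<forall>x\<in>X. \<forall>y. y > 0 \<and> y \<ge> Y \<longrightarrow>
           cmod (f (mobius A (Complex x y))) \<le> K * exp (C * y)))"


section \<open>Modular forms\<close>

text \<open>
  The value space \<open>V\<close> consists of functions on a finite index set, so that smoothness,
  holomorphy and growth of \<open>V\<close>-valued functions are componentwise notions. The
  weights lie in \<open>\<half>\<int>\<close>, hence \<open>\<lfloor>2 * p\<rfloor>\<close> is just \<open>2p\<close> as an integer.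
\<close>

definition modular_forms ::
  "('i \<Rightarrow> complex) set \<Rightarrow> (mp2 \<Rightarrow> ('i \<Rightarrow> complex) \<Rightarrow> ('i \<Rightarrow> complex)) \<Rightarrow>
   real \<Rightarrow> real \<Rightarrow> mp2 set \<Rightarrow> (complex \<Rightarrow> 'i \<Rightarrow> complex) set" where
  "modular_forms V \<rho> p q \<Gamma> = {F.
     (\<forall>\<tau>. F \<tau> \<in> V) \<and> (\<forall>\<tau>. \<tau> \<notin> upper_half_plane \<longrightarrow> F \<tau> = 0) \<and>
     (\<forall>i. smooth_on upper_half_plane (\<lambda>\<tau>. F \<tau> i)) \<and>
     (\<forall>\<tau>\<in>upper_half_plane. \<forall>(A, \<phi>)\<in>\<Gamma>.
        F (mobius A \<tau>) =
          vscale ((\<phi> \<tau>) powi \<lfloor>2 * p\<rfloor> * (cnj (\<phi> \<tau>)) powi \<lfloor>2 * q\<rfloor>) (\<rho> (A, \<phi>) (F \<tau>))) \<and>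
     (\<forall>i. lin_exp_growth (\<lambda>\<tau>. F \<tau> i))}"

definition weakly_holomorphic :: "(complex \<Rightarrow> 'i \<Rightarrow> complex) \<Rightarrow> bool" where
  "weakly_holomorphic F \<longleftrightarrow> (\<forall>i. (\<lambda>\<tau>. F \<tau> i) holomorphic_on upper_half_plane)"


section \<open>Jacobi forms\<close>

definition cholomorphic :: "('v::real_normed_vector cplx \<Rightarrow> complex) \<Rightarrow> bool" where
  "cholomorphic g \<longleftrightarrow>
     (\<forall>\<zeta>. \<exists>D. (g has_derivative D) (at \<zeta>) \<and> (\<forall>c \<xi>. D (cscale c \<xi>) = c * D \<xi>))"

definition jacobi_forms ::
  "'v::real_normed_vector lattice_form \<Rightarrow> 'v set \<times> 'v set \<Rightarrow> real \<Rightarrow> real \<Rightarrow> mp2 set \<Rightarrow>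
   (complex \<Rightarrow> 'v cplx \<Rightarrow> complex) set" where
  "jacobi_forms L v p q \<Gamma> = {\<Phi>.
     (\<forall>\<tau>. \<tau> \<notin> upper_half_plane \<longrightarrow> \<Phi> \<tau> = 0) \<and>
     smooth_on (upper_half_plane \<times> UNIV) (\<lambda>(\<tau>, \<zeta>). \<Phi> \<tau> \<zeta>) \<and>
     (\<forall>\<tau>\<in>upper_half_plane. \<forall>\<zeta>. \<forall>\<sigma>\<in>lat L. \<forall>\<nu>\<in>lat L.
        \<Phi> \<tau> (\<zeta> + cscale \<tau> (emb (proj_plus v \<sigma>)) + cscale (cnj \<tau>) (emb (proj_minus v \<sigma>)) + emb \<nu>) =
          ee (- \<tau> * of_real (qform L (proj_plus v \<sigma>)) / 2
              - cnj \<tau> * of_real (qform L (proj_minus v \<sigma>)) / 2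
              - cbform L (emb \<sigma>) \<zeta>) * \<Phi> \<tau> \<zeta>) \<and>
     (\<forall>\<tau>\<in>upper_half_plane. \<forall>\<zeta>. \<forall>(A, \<phi>)\<in>\<Gamma>.
        \<Phi> (mobius A \<tau>) (cscale (1 / autj A \<tau>) (cproj_plus v \<zeta>)
                         + cscale (1 / cnj (autj A \<tau>)) (cproj_minus v \<zeta>)) =
          (\<phi> \<tau>) powi \<lfloor>2 * p\<rfloor> * (cnj (\<phi> \<tau>)) powi \<lfloor>2 * q\<rfloor>
          * ee (of_real (A$2$1) * cqform L (cproj_plus v \<zeta>) / (2 * autj A \<tau>)
                + of_real (A$2$1) * cqform L (cproj_minus v \<zeta>) / (2 * cnj (autj A \<tau>)))
          * \<Phi> \<tau> \<zeta>) \<and>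
     (\<forall>\<tau>\<in>upper_half_plane. cholomorphic (\<Phi> \<tau>)) \<and>
     (\<exists>f. (\<forall>\<tau>\<in>upper_half_plane. \<forall>\<zeta>.
             ((\<lambda>x. f x \<tau> * theta_term L v \<tau> \<zeta> x) has_sum \<Phi> \<tau> \<zeta>) (dual_lattice L)) \<and>
          (\<forall>x\<in>dual_lattice L. lin_exp_growth (f x)))}"

definition theta_lift ::
  "'v::real_normed_vector lattice_form \<Rightarrow> 'v set \<times> 'v set \<Rightarrow> (complex \<Rightarrow> 'v set \<Rightarrow> complex) \<Rightarrow>
   complex \<Rightarrow> 'v cplx \<Rightarrow> complex" where
  "theta_lift L v F = (\<lambda>\<tau> \<zeta>. pairing L (siegel_theta L v \<tau> \<zeta>) (F \<tau>))"

definition tilde_form ::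
  "'v::real_normed_vector lattice_form \<Rightarrow> (complex \<Rightarrow> 'v set \<Rightarrow> complex) \<Rightarrow>
   complex \<Rightarrow> 'v set \<Rightarrow> complex" where
  "tilde_form L G = (\<lambda>\<tau>. omega L (G (- cnj \<tau>)))"

definition tilde_lift ::
  "'v::real_normed_vector lattice_form \<Rightarrow> 'v set \<times> 'v set \<Rightarrow> (complex \<Rightarrow> 'v set \<Rightarrow> complex) \<Rightarrow>
   complex \<Rightarrow> 'v cplx \<Rightarrow> complex" where
  "tilde_lift L v G = theta_lift L v (tilde_form L G)"


section \<open>Skew-holomorphic Jacobi forms\<close>

definition wirtinger :: "(complex \<Rightarrow> complex) \<Rightarrow> complex \<Rightarrow> complex" where
  "wirtinger f \<tau> =
     (frechet_derivative f (at \<tau>) 1 - \<i> * frechet_derivative f (at \<tau>) \<i>) / 2"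

definition orthonormal_basis ::
  "'v::real_normed_vector lattice_form \<Rightarrow> 'v set \<Rightarrow> 'v set \<Rightarrow> bool" where
  "orthonormal_basis L P E \<longleftrightarrow> finite E \<and> span E = P \<and>
     (\<forall>e\<in>E. \<forall>e'\<in>E. bform L e e' = (if e = e' then 1 else 0))"

definition cpartial :: "'v::real_normed_vector \<Rightarrow> ('v cplx \<Rightarrow> complex) \<Rightarrow> 'v cplx \<Rightarrow> complex" where
  "cpartial e g = (\<lambda>\<zeta>. deriv (\<lambda>w. g (\<zeta> + cscale w (emb e))) 0)"

text \<open>On holomorphic functions the Laplacian does not depend on the chosen basis.\<close>

definition hol_laplacian ::
  "'v::real_normed_vector lattice_form \<Rightarrow> 'v set \<Rightarrow> ('v cplx \<Rightarrow> complex) \<Rightarrow> 'v cplx \<Rightarrow> complex" where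
  "hol_laplacian L P g \<zeta> =
     (\<Sum>e\<in>(SOME E. orthonormal_basis L P E). cpartial e (cpartial e g) \<zeta>)"

definition skew_holomorphic ::
  "'v::real_normed_vector lattice_form \<Rightarrow> 'v set \<times> 'v set \<Rightarrow>
   (complex \<Rightarrow> 'v cplx \<Rightarrow> complex) \<Rightarrow> bool" where
  "skew_holomorphic L v \<Phi> \<longleftrightarrow>
     (\<forall>\<tau>\<in>upper_half_plane. \<forall>\<zeta>.
        4 * of_real pi * \<i> * wirtinger (\<lambda>\<tau>'. \<Phi> \<tau>' \<zeta>) \<tau> - hol_laplacian L (fst v) (\<Phi> \<tau>) \<zeta> = 0)"


section \<open>Isomorphisms of function spaces\<close>

definition fscale :: "complex \<Rightarrow> (complex \<Rightarrow> 'x \<Rightarrow> complex) \<Rightarrow> complex \<Rightarrow> 'x \<Rightarrow> complex" where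
  "fscale c F = (\<lambda>\<tau> x. c * F \<tau> x)"

definition linear_isomorphism ::
  "(complex \<Rightarrow> 'x \<Rightarrow> complex) set \<Rightarrow> (complex \<Rightarrow> 'y \<Rightarrow> complex) set \<Rightarrow>
   ((complex \<Rightarrow> 'x \<Rightarrow> complex) \<Rightarrow> (complex \<Rightarrow> 'y \<Rightarrow> complex)) \<Rightarrow> bool" where
  "linear_isomorphism V W f \<longleftrightarrow>
     module.subspace fscale V \<and> module.subspace fscale W \<and>
     (\<forall>F\<in>V. \<forall>G\<in>V. f (F + G) = f F + f G) \<and>
     (\<forall>c. \<forall>F\<in>V. f (fscale c F) = fscale c (f F)) \<and>
     bij_betw f V W"

end

theory Submission
  imports Defs "HOL-Complex_Analysis.Complex_Analysis"
begin

text \<open>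
  For fixed \<open>\<tau>\<close>, the Fourier coefficients along the lattice determine a holomorphic function of \<open>\<zeta>\<close>
  satisfying the elliptic law, and that law turns them, up to Gaussian factors, into a function on the
  discriminant group. So the function is a combination of the theta components \<open>\<theta>\<^sub>\<gamma>\<close>, which are
  linearly independent.

  The inversion formula follows from this without Poisson summation. The \<open>\<theta>\<^sub>\<gamma>\<close> transformed by \<open>S\<close>
  satisfy the elliptic law again, and comparing translates by the dual lattice fixes their expansion up to one
  scalar depending on \<open>\<tau>\<close>. The heat equation gives the logarithmic derivative of that scalar, and its
  value at the fixed point \<open>\<i>\<close> is positive with square \<open>1 / |D\<^sub>L|\<close>. As \<open>T\<close> and \<open>S\<close> generate
  \<open>Mp\<^sub>2(\<int>)\<close>, the transformation matrices of the theta components are the Weil representation, and the dual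
  representation is its twist by the involution.

  Hence the theta lift is a bijection from vector-valued modular forms onto Jacobi forms. Every theta term is
  annihilated by the heat operator, so a lift is skew-holomorphic exactly when its coefficients are
  antiholomorphic in \<open>\<tau>\<close>. Finally, a finite index subgroup contains an element with \<open>c \<noteq> 0\<close>, and a
  power of \<open>c \<tau>\<^sup>* + d\<close>, with \<open>\<tau>\<^sup>*\<close> the conjugate of \<open>\<tau>\<close>, is holomorphic only if it is constant;
  this forces \<open>l = b\<^sub>+ / 2\<close>.
\<close>


section \<open>Completeness of the trigonometric system\<close>

text \<open>The Weil representation is given only as a choice among representations with prescribed
  values on two generators, so its existence has to be proved. The theta components supply it: being
  linearly independent, they determine the matrix by which a metaplectic element acts on them, and
  this uniqueness turns composition into matrix multiplication. Relations between the generators are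
  never verified. Fourier analysis in several complex variables is reduced to one real variable:
  coefficients are taken along the vectors of a lattice basis one after the other and stay functions
  of the full complex argument. This matters because the elliptic law translates by vectors that are
  not real. The half-integral weight and the eighth root of unity have one source. In the
  logarithmic derivative of the inversion scalar each positive direction contributes
  \<open>1 / (2 * \<tau>)\<close> and each negative one \<open>1 / (2 * cnj \<tau>)\<close>; so the
  scalar is a constant times powers of the root of \<open>\<tau>\<close> and of its conjugate, and
  the root of \<open>\<i>\<close> is \<open>ee (1/8)\<close>.\<close>

lemma ee_add: "ee (x + y) = ee x * ee y"
  by (simp add: ee_def exp_add algebra_simps)

lemma ee_0 [simp]: "ee 0 = 1"
  by (simp add: ee_def)

lemma ee_nonzero [simp]: "ee x \<noteq> 0"
  by (simp add: ee_def)

lemma ee_minus: "ee (- x) = inverse (ee x)"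
  by (simp add: ee_def exp_minus)

lemma ee_int: "x \<in> \<int> \<Longrightarrow> ee (of_real x) = 1"
proof -
  assume "x \<in> \<int>"
  then obtain n where "x = of_int n" by (auto elim: Ints_cases)
  then have "ee (of_real x) = exp (2 * of_real pi * \<i> * of_int n)" by (simp add: ee_def)
  also have "\<dots> = 1" using exp_integer_2pi[of "of_int n"] by (simp add: mult_ac)
  finally show ?thesis .
qed

lemma ee_eq_1_iff: "ee (of_real x) = 1 \<longleftrightarrow> x \<in> \<int>"
proof
  assume "ee (of_real x) = 1"
  then obtain n :: int where "Im (2 * of_real pi * \<i> * of_real x) = of_int (2 * n) * pi"
    unfolding ee_def exp_eq_1 by blast
  then have "x = of_int n" by simp
  then show "x \<in> \<int>" by simp
qed (rule ee_int)

lemma norm_ee: "cmod (ee x) = exp (- 2 * pi * Im x)"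
  by (simp add: ee_def)

lemma norm_ee_of_real [simp]: "cmod (ee (of_real x)) = 1"
  by (simp add: norm_ee)

lemma ee_holomorphic [holomorphic_intros]:
  "f holomorphic_on S \<Longrightarrow> (\<lambda>z. ee (f z)) holomorphic_on S"
  unfolding ee_def by (intro holomorphic_intros)

lemma ee_continuous [continuous_intros]:
  "continuous_on S f \<Longrightarrow> continuous_on S (\<lambda>z. ee (f z))"
  unfolding ee_def by (intro continuous_intros)

lemma ee_power: "ee x ^ n = ee (of_nat n * x)"
  by (induction n) (auto simp: ee_add[symmetric] algebra_simps)

text \<open>Testing \<open>k\<close> against powers of the trigonometric polynomial
  \<open>1 - cos 2\<pi>t - cos 2\<pi>\<delta>\<close>, which concentrate at \<open>t = 1/2\<close>.\<close>

lemma fourier_complete_midpoint: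
  fixes k :: "real \<Rightarrow> complex"
  assumes cont: "continuous_on {0..1} k"
    and z: "\<And>m::int. integral {0..1} (\<lambda>t. k t * ee (of_int m * of_real t)) = 0"
  shows "k (1/2) = 0"
proof (rule ccontr)
  assume nz: "k (1/2) \<noteq> 0"
  \<comment> \<open>Multiplying by the conjugate of the value makes the product at
    \<open>1/2\<close> a positive real number, so that signs of real parts can be compared.\<close>
  define c where "c = cnj (k (1/2))"
  define h where "h = (\<lambda>t. Re (c * k t))"
  define a where "a = h (1/2)"
  have a: "a > 0"
    unfolding a_def h_def c_def using nz
    by (simp add: complex_eq_iff sum_squares_gt_zero_iff)
  have conth: "continuous_on {0..1} h"
    unfolding h_def by (intro continuous_intros cont)
  obtain d where d: "d > 0" "\<And>t. t \<in> {0..1} \<Longrightarrow> dist t (1/2) < d \<Longrightarrow> dist (h t) (h (1/2)) < a/2"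
    using conth[unfolded continuous_on_iff, rule_format, of "1/2" "a/2"] a by auto
  \<comment> \<open>The bound \<open>d/2\<close> keeps the closed interval inside the range of
    continuity; \<open>1/4\<close> keeps it inside \<open>{0..1}\<close> and its angles where the
    cosine decreases.\<close>
  define \<delta> where "\<delta> = min (d/2) (1/4)"
  have \<delta>: "0 < \<delta>" "\<delta> < d" "\<delta> \<le> 1/4" using d(1) by (auto simp: \<delta>_def)
  have h_ge: "h t \<ge> a/2" if "\<bar>t - 1/2\<bar> \<le> \<delta>" for t
  proof -
    have "t \<in> {0..1}" using that \<delta> by (auto simp: abs_if split: if_splits)
    moreover have "dist t (1/2) < d" using that \<delta> by (auto simp: dist_real_def)
    ultimately have "dist (h t) a < a/2" using d(2) a_def by auto
    then show ?thesis by (auto simp: dist_real_def abs_if field_simps split: if_splits)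
  qed
  have "compact (h ` {0..1})" by (intro compact_continuous_image conth) auto
  then obtain B where B: "\<And>t. t \<in> {0..1} \<Longrightarrow> \<bar>h t\<bar> \<le> B"
    using compact_imp_bounded bounded_iff by (metis imageI real_norm_def)
  define T where "T = (\<lambda>t. 1 - cos (2*pi*t) - cos (2*pi*\<delta>))"
  have contT: "continuous_on S T" for S unfolding T_def by (intro continuous_intros)
  have T_eq: "T t = 1 + cos (2*pi*\<bar>t-1/2\<bar>) - cos (2*pi*\<delta>)" for t
  proof -
    have "cos (2*pi*\<bar>t-1/2\<bar>) = cos (2*pi*(t-1/2))" by (simp add: abs_if) (metis cos_minus mult_minus_right minus_diff_eq)
    also have "\<dots> = cos (2*pi*t - pi)" by (simp add: algebra_simps)
    also have "\<dots> = - cos (2*pi*t)" by (simp add: cos_diff)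
    finally show ?thesis by (simp add: T_def)
  qed
  have T_near: "T t \<ge> 1" if "\<bar>t-1/2\<bar> \<le> \<delta>" for t
    unfolding T_eq using that \<delta> cos_monotone_0_pi_le[of "2*pi*\<bar>t-1/2\<bar>" "2*pi*\<delta>"]
    by (simp add: mult_left_le)
  have T_far: "\<bar>T t\<bar> \<le> 1" if "t \<in> {0..1}" "\<bar>t-1/2\<bar> > \<delta>" for t
  proof -
    have "\<bar>t-1/2\<bar> \<le> 1/2" using that by (auto simp: abs_if)
    then have "cos (2*pi*\<bar>t-1/2\<bar>) \<le> cos (2*pi*\<delta>)"
      using that \<delta> by (intro cos_monotone_0_pi_le) (auto simp: pi_gt_zero)
    moreover have "cos (2*pi*\<delta>) \<ge> 0" using \<delta> by (intro cos_ge_zero) (auto intro: order_trans[of _ 0])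
    moreover have "cos (2*pi*\<delta>) \<le> 1" "- 1 \<le> cos (2*pi*\<bar>t-1/2\<bar>)" by auto
    ultimately show ?thesis unfolding T_eq by linarith
  qed
  \<comment> \<open>The value of \<open>T\<close> at distance \<open>\<delta>/2\<close> from the
    midpoint: on the inner half of the interval \<open>T\<close> is at least \<open>r > 1\<close>,
    so its powers grow geometrically there.\<close>
  define r where "r = 1 + cos (2*pi*(\<delta>/2)) - cos (2*pi*\<delta>)"
  have r: "r > 1"
    unfolding r_def using \<delta> cos_mono_less_eq[of "2*pi*\<delta>" "2*pi*(\<delta>/2)"] by (simp add: pi_gt_zero)
  have T_r: "T t \<ge> r" if "\<bar>t-1/2\<bar> \<le> \<delta>/2" for t
    unfolding T_eq r_def using that \<delta> cos_monotone_0_pi_le[of "2*pi*\<bar>t-1/2\<bar>" "2*pi*(\<delta>/2)"]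
    by (simp add: mult_left_le)
  \<comment> \<open>\<open>T\<close> is a combination of characters of frequency -1, 0 and 1, so one
    more factor shifts \<open>m\<close> by at most one; hence the induction is over all
    \<open>m\<close> at once.\<close>
  have zN: "integral {0..1} (\<lambda>t. k t * of_real (T t ^ N) * ee (of_int m * of_real t)) = 0" for N and m :: int
  proof (induction N arbitrary: m)
    case 0 show ?case using z by simp
  next
    case (Suc N)
    define f where "f = (\<lambda>m::int. \<lambda>t. k t * of_real (T t ^ N) * ee (of_int m * of_real t))"
    have int: "f m integrable_on {0..1}" for m
      unfolding f_def by (intro integrable_continuous_real continuous_intros cont contT)
    have Tc: "complex_of_real (T t) = of_real (1 - cos (2*pi*\<delta>)) - (ee (of_real t) + ee (- of_real t)) / 2" for t
      by (simp add: T_def ee_def cos_exp_eq cos_of_real [symmetric] mult_ac)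
    have "k t * of_real (T t ^ Suc N) * ee (of_int m * of_real t)
        = of_real (1 - cos (2*pi*\<delta>)) * f m t - (1/2) * f (m+1) t - (1/2) * f (m-1) t" for t
    proof -
      have "ee (of_int (m+1) * of_real t) = ee (of_int m * of_real t) * ee (of_real t)"
        "ee (of_int (m-1) * of_real t) = ee (of_int m * of_real t) * ee (- of_real t)"
        by (simp_all add: ee_add[symmetric] algebra_simps)
      then show ?thesis
        unfolding f_def power_Suc of_real_mult Tc by (simp add: algebra_simps)
    qed
    then have "integral {0..1} (\<lambda>t. k t * of_real (T t ^ Suc N) * ee (of_int m * of_real t))
        = of_real (1 - cos (2*pi*\<delta>)) * integral {0..1} (f m) - (1/2) * integral {0..1} (f (m+1))
          - (1/2) * integral {0..1} (f (m-1))"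
      by (simp only: Henstock_Kurzweil_Integration.integral_diff integrable_diff integrable_on_mult_right int
            Henstock_Kurzweil_Integration.integral_mult_right)
    also have "\<dots> = 0" unfolding f_def Suc by simp
    finally show ?case .
  qed
  have zh: "integral {0..1} (\<lambda>t. h t * T t ^ N) = 0" for N
  proof -
    have "integral {0..1} (\<lambda>t. c * (k t * of_real (T t ^ N))) = 0"
      using zN[of N 0] by simp
    moreover have "(\<lambda>t. c * (k t * of_real (T t ^ N))) integrable_on {0..1}"
      by (intro integrable_continuous_real continuous_intros cont contT)
    ultimately have "((\<lambda>t. c * (k t * of_real (T t ^ N))) has_integral 0) {0..1}"
      using integrable_integral by fastforce
    then have "((\<lambda>t. Re (c * (k t * of_real (T t ^ N)))) has_integral Re 0) {0..1}"
      by (rule has_integral_Re)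
    then have "integral {0..1} (\<lambda>t. Re (c * (k t * of_real (T t ^ N)))) = Re 0"
      by (rule integral_unique)
    moreover have "(\<lambda>t. Re (c * (k t * of_real (T t ^ N)))) = (\<lambda>t. h t * T t ^ N)"
      by (simp add: h_def fun_eq_iff mult.assoc[symmetric] del: of_real_power)
    ultimately show ?thesis by simp
  qed
  \<comment> \<open>Adding \<open>B\<close> makes the integrand nonnegative on all of
    \<open>{0..1}\<close>: within \<open>\<delta>\<close> of the midpoint both factors are
    nonnegative, elsewhere \<open>T\<close> is at most one in absolute value. So the growing
    integral over the inner interval stays below the total, which is \<open>B\<close>.\<close>
  have bound: "\<delta> * (a/2 * r ^ N) \<le> B" for N
  proof -
    let ?g = "\<lambda>t. h t * T t ^ N + B"
    have B0: "B \<ge> 0" using B[of "1/2"] by auto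
    have int: "?g integrable_on {0..1}"
      by (intro integrable_continuous_real continuous_intros conth contT)
    have sub: "{1/2-\<delta>/2..1/2+\<delta>/2} \<subseteq> {0..1}" using \<delta> by auto
    have int': "?g integrable_on {1/2-\<delta>/2..1/2+\<delta>/2}"
      using integrable_subinterval_real[OF int sub] .
    have nn: "0 \<le> ?g t" if t: "t \<in> {0..1}" for t
    proof (cases "\<bar>t-1/2\<bar> \<le> \<delta>")
      case True
      then have "0 \<le> h t" "0 \<le> T t" using h_ge[OF True] T_near[OF True] a by linarith+
      then show ?thesis using B0 by simp
    next
      case False
      then have "\<bar>T t\<bar> \<le> 1" using T_far t by auto
      then have "\<bar>h t * T t ^ N\<bar> \<le> B * 1"
        unfolding abs_mult using B[OF t] by (intro mult_mono) (auto simp: power_abs power_le_one)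
      then show ?thesis by linarith
    qed
    have "\<delta> * (a/2 * r ^ N) = integral {1/2-\<delta>/2..1/2+\<delta>/2} (\<lambda>t. a/2 * r ^ N)"
      using \<delta> by simp
    also have "\<dots> \<le> integral {1/2-\<delta>/2..1/2+\<delta>/2} ?g"
    proof (rule integral_le[OF _ int'])
      fix t assume "t \<in> {1/2-\<delta>/2..1/2+\<delta>/2}"
      then have t: "\<bar>t-1/2\<bar> \<le> \<delta>/2" by (auto simp: abs_if)
      then have "a/2 * r ^ N \<le> h t * T t ^ N"
        using h_ge[of t] T_r[OF t] r a \<delta> by (intro mult_mono power_mono) auto
      then show "a/2 * r ^ N \<le> ?g t" using B0 by simp
    qed auto
    also have "\<dots> \<le> integral {0..1} ?g"
      by (rule integral_subset_le[OF sub int' int]) (rule ballI, rule nn)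
    also have "integral {0..1} ?g = integral {0..1} (\<lambda>t. h t * T t ^ N) + integral {0..1} (\<lambda>t::real. B)"
      by (rule Henstock_Kurzweil_Integration.integral_add; rule integrable_continuous_real)
         (intro continuous_intros conth contT)+
    also have "integral {0..1} (\<lambda>t. h t * T t ^ N) + integral {0..1} (\<lambda>t::real. B) = B" unfolding zh by simp
    finally show ?thesis .
  qed
  obtain N where "2 * B / (\<delta> * a) < r ^ N" using real_arch_pow[OF r, of "2 * B / (\<delta> * a)"] ..
  then have "2 * B < r ^ N * (\<delta> * a)" using \<delta> a by (simp add: pos_divide_less_eq)
  with bound[of N] show False by (simp add: mult_ac)
qed

section \<open>Smooth functions and exponential series\<close>

text \<open>Openness of \<open>S\<close> makes a derivative at a point of \<open>S\<close> depend
  only on the values on \<open>S\<close>, and this carries through every order.\<close>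

lemma Ck_on_cong:
  assumes "open S" "\<And>x. x \<in> S \<Longrightarrow> f x = g x"
  shows "Ck_on n S f \<longleftrightarrow> Ck_on n S g"
  using assms(2)
proof (induction n arbitrary: f g)
  case 0
  then show ?case by (simp cong: continuous_on_cong)
next
  case (Suc n)
  have d: "(f has_derivative D) (at x) \<longleftrightarrow> (g has_derivative D) (at x)" if "x \<in> S" for x D
    using has_derivative_transform_within_open[OF _ assms(1) that, of f D UNIV g]
      has_derivative_transform_within_open[OF _ assms(1) that, of g D UNIV f] Suc.prems by auto
  have "frechet_derivative f (at x) = frechet_derivative g (at x)" if "x \<in> S" for x
    using d[OF that] by (simp add: frechet_derivative_def)
  then have "Ck_on n S (\<lambda>x. frechet_derivative f (at x) u) \<longleftrightarrow>
      Ck_on n S (\<lambda>x. frechet_derivative g (at x) u)" for u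
    by (intro Suc.IH) simp
  then show ?case using d by (simp add: differentiable_def)
qed

text \<open>\<open>frechet_derivative\<close> is defined by choice; uniqueness of derivatives
  replaces it by whatever explicit formula \<open>D\<close> is at hand.\<close>

lemma Ck_on_SucI:
  assumes "open S" "\<And>x. x \<in> S \<Longrightarrow> (f has_derivative D x) (at x)"
    and "\<And>u. Ck_on n S (\<lambda>x. D x u)"
  shows "Ck_on (Suc n) S f"
proof -
  have "frechet_derivative f (at x) = D x" if "x \<in> S" for x
    using frechet_derivative_at[OF assms(2)[OF that]] by simp
  then have "Ck_on n S (\<lambda>x. frechet_derivative f (at x) u)" for u
    using assms(3)[of u] Ck_on_cong[OF assms(1), of "\<lambda>x. frechet_derivative f (at x) u" "\<lambda>x. D x u"] by simp
  then show ?thesis using assms(2) by (auto simp: differentiable_def)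
qed

lemma Ck_on_SucD:
  assumes "Ck_on (Suc n) S f" "x \<in> S"
  shows "(f has_derivative frechet_derivative f (at x)) (at x)"
  using assms by (simp add: frechet_derivative_works)

lemma Ck_on_imp_continuous: "Ck_on n S f \<Longrightarrow> continuous_on S f"
  by (cases n) (auto intro!: continuous_at_imp_continuous_on differentiable_imp_continuous_within)

lemma Ck_on_Suc_imp: "Ck_on (Suc n) S f \<Longrightarrow> Ck_on n S f"
proof (induction n arbitrary: f)
  case 0 then show ?case using Ck_on_imp_continuous by (metis Ck_on.simps(1))
next
  case (Suc n) then show ?case using Ck_on.simps(2) by blast
qed

lemma Ck_on_subset: "Ck_on n S f \<Longrightarrow> T \<subseteq> S \<Longrightarrow> Ck_on n T f"
  by (induction n arbitrary: f) (auto intro: continuous_on_subset)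

text \<open>Serves the theta coefficients of a Jacobi form, which are quotients whose denominator is
  known to be nonzero only near a chosen point.\<close>

lemma Ck_on_local:
  assumes "\<And>x. x \<in> S \<Longrightarrow> \<exists>U. open U \<and> x \<in> U \<and> Ck_on n (S \<inter> U) f"
  shows "Ck_on n S f"
  using assms
proof (induction n arbitrary: f)
  case 0
  show ?case unfolding Ck_on.simps continuous_on_def
  proof
    fix x assume "x \<in> S"
    with 0 obtain U where U: "open U" "x \<in> U" "continuous_on (S \<inter> U) f" by auto
    then have "(f \<longlongrightarrow> f x) (at x within S \<inter> U)" using \<open>x \<in> S\<close> by (auto simp: continuous_on_def)
    moreover have "at x within S = at x within S \<inter> U"
      by (rule at_within_nhd[of x U]) (use U in auto)
    ultimately show "(f \<longlongrightarrow> f x) (at x within S)" by simp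
  qed
next
  case (Suc n)
  have "Ck_on n S (\<lambda>x. frechet_derivative f (at x) u)" for u
    by (rule Suc.IH) (use Suc.prems in force)
  moreover have "f differentiable (at x)" if "x \<in> S" for x
    using Suc.prems[OF that] that by auto
  ultimately show ?case by auto
qed

lemma Ck_on_const: "open S \<Longrightarrow> Ck_on n S (\<lambda>x. c)"
proof (induction n arbitrary: c)
  case (Suc n)
  show ?case by (rule Ck_on_SucI[where D = "\<lambda>x u. 0"]) (use Suc in auto)
qed auto

lemma Ck_on_add:
  assumes "open S"
  shows "Ck_on n S f \<Longrightarrow> Ck_on n S g \<Longrightarrow> Ck_on n S (\<lambda>x. f x + g x)"
proof (induction n arbitrary: f g)
  case 0 then show ?case by (auto intro: continuous_intros)
next
  case (Suc n)
  show ?case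
    by (rule Ck_on_SucI[OF assms has_derivative_add[OF Ck_on_SucD[OF Suc.prems(1)] Ck_on_SucD[OF Suc.prems(2)]]])
       (assumption, assumption, rule Suc.IH, use Suc.prems in simp_all)
qed

lemma Ck_on_mult:
  fixes f g :: "'a::real_normed_vector \<Rightarrow> 'b::real_normed_algebra"
  assumes "open S"
  shows "Ck_on n S f \<Longrightarrow> Ck_on n S g \<Longrightarrow> Ck_on n S (\<lambda>x. f x * g x)"
proof (induction n arbitrary: f g)
  case 0 then show ?case by (auto intro: continuous_intros)
next
  case (Suc n)
  show ?case
    by (rule Ck_on_SucI[OF assms has_derivative_mult[OF Ck_on_SucD[OF Suc.prems(1)] Ck_on_SucD[OF Suc.prems(2)]]])
       (assumption, assumption, intro Ck_on_add[OF assms] Suc.IH Ck_on_Suc_imp[OF Suc.prems(1)] Ck_on_Suc_imp[OF Suc.prems(2)],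
        use Suc.prems in simp_all)
qed

lemma Ck_on_inverse:
  fixes f :: "'a::real_normed_vector \<Rightarrow> 'b::real_normed_div_algebra"
  assumes "open S" "\<And>x. x \<in> S \<Longrightarrow> f x \<noteq> 0"
  shows "Ck_on n S f \<Longrightarrow> Ck_on n S (\<lambda>x. inverse (f x))"
proof (induction n)
  case 0 then show ?case using assms by (auto intro: continuous_intros)
next
  case (Suc n)
  have f': "Ck_on n S (\<lambda>x. frechet_derivative f (at x) u)" for u using Suc.prems by simp
  have i: "Ck_on n S (\<lambda>x. inverse (f x))" using Suc.IH Ck_on_Suc_imp[OF Suc.prems] by simp
  have e: "(\<lambda>x. - (inverse (f x) * frechet_derivative f (at x) u * inverse (f x))) =
     (\<lambda>x. (-1) * (inverse (f x) * frechet_derivative f (at x) u * inverse (f x)))" for u by simp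
  have m: "Ck_on n S (\<lambda>x. - (inverse (f x) * frechet_derivative f (at x) u * inverse (f x)))" for u
    unfolding e by (intro Ck_on_mult Ck_on_const assms(1) f' i)
  show ?case
    by (rule Ck_on_SucI[OF assms(1) Deriv.has_derivative_inverse[OF _ Ck_on_SucD[OF Suc.prems]]])
       (rule assms(2), assumption, assumption, rule m)
qed

lemma Ck_on_sum:
  assumes "open S" "\<And>i. i \<in> I \<Longrightarrow> Ck_on n S (f i)"
  shows "Ck_on n S (\<lambda>x. \<Sum>i\<in>I. f i x)"
  using assms(2)
proof (induction I rule: infinite_finite_induct)
  case (insert x F) then show ?case by (simp add: Ck_on_add[OF assms(1)])
qed (auto intro: Ck_on_const assms)

text \<open>For an affine inner map the derivative of the composite is again a derivative of
  \<open>f\<close> composed with the same map, so the induction closes. This covers projections,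
  slices of constant \<open>\<zeta>\<close> and the reflection of the half plane.\<close>

lemma Ck_on_compose_affine:
  assumes "open S" "open T" "bounded_linear h" "\<And>x. x \<in> T \<Longrightarrow> a + h x \<in> S"
  shows "Ck_on n S f \<Longrightarrow> Ck_on n T (\<lambda>x. f (a + h x))"
proof (induction n arbitrary: f)
  case 0
  have "continuous_on T h" using assms(3) by (simp add: linear_continuous_on)
  then show ?case using 0 assms(4) by (auto intro!: continuous_on_compose2[of S f] continuous_intros)
next
  case (Suc n)
  have d: "((\<lambda>x. f (a + h x)) has_derivative (\<lambda>u. frechet_derivative f (at (a + h x)) (h u))) (at x)"
    if "x \<in> T" for x
  proof -
    have "((\<lambda>x. a + h x) has_derivative h) (at x)"
      using bounded_linear.has_derivative[OF assms(3) has_derivative_ident]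
      by (auto intro!: derivative_eq_intros)
    moreover have "(f has_derivative frechet_derivative f (at (a + h x))) (at (a + h x))"
      using Ck_on_SucD[OF Suc.prems assms(4)[OF that]] .
    ultimately show ?thesis by (rule has_derivative_compose)
  qed
  show ?case
    by (rule Ck_on_SucI[OF assms(2) d]) (use Suc in auto)
qed

lemma has_sum_minus:
  fixes f g :: "'i \<Rightarrow> 'a::real_normed_vector"
  assumes "(f has_sum a) A" "(g has_sum b) A"
  shows "((\<lambda>x. f x - g x) has_sum (a - b)) A"
  using has_sum_add[OF assms(1), of "\<lambda>x. - g x" "- b"] assms(2) by (simp add: has_sum_uminus)

section \<open>Termwise differentiation of series of exponentials of linear forms\<close>

text \<open>The slack \<open>\<delta> * N x\<close> in the exponent dominates everything: within
  distance \<open>\<delta>\<close> of \<open>z\<close> an exponential grows at most by the factor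
  \<open>exp (\<delta> * N x)\<close>, and a factor \<open>N x\<close> from differentiation costs at
  most \<open>exp (\<delta> * N x) / \<delta>\<close>.\<close>

lemma exp_series_has_derivative:
  fixes l :: "'i \<Rightarrow> 'a::real_normed_vector \<Rightarrow> complex" and p :: "'i \<Rightarrow> complex"
  assumes lin: "\<And>x. x \<in> X \<Longrightarrow> linear (l x)"
    and N: "\<And>x u. x \<in> X \<Longrightarrow> cmod (l x u) \<le> N x * norm u" "\<And>x. x \<in> X \<Longrightarrow> N x \<ge> 0"
    and \<delta>: "\<delta> > 0"
    and s: "(\<lambda>x. cmod (p x) * exp (Re (l x z) + \<delta> * N x)) summable_on X"
  shows "((\<lambda>z. \<Sum>\<^sub>\<infinity>x\<in>X. p x * exp (l x z)) has_derivative
          (\<lambda>u. \<Sum>\<^sub>\<infinity>x\<in>X. p x * l x u * exp (l x z))) (at z)"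
proof -
  define W where "W = (\<lambda>x. cmod (p x) * exp (Re (l x z) + \<delta> * N x))"
  have W0: "W x \<ge> 0" for x by (simp add: W_def)
  have sW: "W summable_on X" using s by (simp add: W_def[abs_def])
  have absW: "(\<lambda>x. f x) summable_on X" if "\<And>x. x \<in> X \<Longrightarrow> cmod (f x) \<le> C * W x" for f C
  proof -
    have "(\<lambda>x. C * W x) summable_on X" using sW by (rule summable_on_cmult_right)
    then have "(\<lambda>x. norm (f x)) summable_on X"
      by (rule Infinite_Sum.summable_on_comparison_test) (use that in auto)
    then show ?thesis by (rule abs_summable_summable)
  qed
  have add: "l x (u + w) = l x u + l x w" "l x (c *\<^sub>R u) = c *\<^sub>R l x u" if "x \<in> X" for x u w c
    using lin[OF that] by (auto simp: linear_add linear_scale)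
  have b0: "cmod (p x * exp (l x (z + h))) \<le> 1 * W x" if "x \<in> X" "norm h \<le> \<delta>" for x h
  proof -
    have "Re (l x h) \<le> cmod (l x h)" by (rule complex_Re_le_cmod)
    also have "\<dots> \<le> N x * norm h" using N that by auto
    also have "\<dots> \<le> N x * \<delta>" using N(2) that by (intro mult_left_mono) auto
    also have "\<dots> = \<delta> * N x" by simp
    finally have "exp (Re (l x (z + h))) \<le> exp (Re (l x z) + \<delta> * N x)" using add[OF that(1)] by simp
    then show ?thesis unfolding W_def norm_mult norm_exp_eq_Re by (simp add: mult_left_mono)
  qed
  have b1: "cmod (p x * l x u * exp (l x z)) \<le> (norm u / \<delta>) * W x" if "x \<in> X" for x u
  proof -
    have "\<delta> * N x \<le> exp (\<delta> * N x)" using exp_ge_add_one_self[of "\<delta> * N x"] by linarith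
    then have "N x \<le> exp (\<delta> * N x) / \<delta>" using \<delta> by (simp add: field_simps)
    then have "cmod (l x u) \<le> exp (\<delta> * N x) / \<delta> * norm u"
      using N(1)[OF that, of u] by (meson mult_right_mono norm_ge_zero order_trans)
    then have "cmod (p x) * cmod (l x u) * exp (Re (l x z)) \<le> cmod (p x) * (exp (\<delta> * N x) / \<delta> * norm u) * exp (Re (l x z))"
      by (intro mult_right_mono mult_left_mono) auto
    then show ?thesis unfolding W_def norm_mult norm_exp_eq_Re exp_add by (simp add: mult_ac)
  qed
  \<comment> \<open>On half the radius the exponential uses half of the slack; the other half
    absorbs the square of \<open>N x\<close> in the Taylor remainder.\<close>
  have b2: "cmod (p x * exp (l x (z + h)) - p x * exp (l x z) - p x * l x h * exp (l x z)) \<le> (8 / \<delta>\<^sup>2 * (norm h)\<^sup>2) * W x"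
    if "x \<in> X" "norm h \<le> \<delta>/2" for x h
  proof -
    let ?w = "l x h"
    have w: "cmod ?w \<le> N x * norm h" using N that by auto
    have w2: "cmod ?w \<le> \<delta> * N x / 2"
    proof -
      have "N x * norm h \<le> N x * (\<delta>/2)" using that N(2)[OF that(1)] by (intro mult_left_mono) auto
      with w show ?thesis by (simp add: mult.commute)
    qed
    have "cmod (exp ?w - (1 + ?w)) \<le> exp \<bar>Re ?w\<bar> * (cmod ?w)\<^sup>2"
      using Taylor_exp[of ?w 1] by (simp add: power2_eq_square)
    also have "\<dots> \<le> exp (\<delta> * N x / 2) * (N x * norm h)\<^sup>2"
      using w w2 abs_Re_le_cmod[of ?w] by (intro mult_mono power_mono) auto
    also have "\<dots> \<le> exp (\<delta> * N x / 2) * (8 / \<delta>\<^sup>2 * exp (\<delta> * N x / 2) * (norm h)\<^sup>2)"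
    proof -
      \<comment> \<open>The inequality \<open>t\<^sup>2 / 2 \<le> exp t\<close> at
        \<open>t = \<delta> * N x / 2\<close>; the constant \<open>8 / \<delta>\<^sup>2\<close>
        comes from here.\<close>
      have "(\<delta> * N x / 2)\<^sup>2 / 2 \<le> exp (\<delta> * N x / 2)"
        using exp_lower_Taylor_quadratic[of "\<delta> * N x / 2"] mult_nonneg_nonneg[of \<delta> "N x"] N(2)[OF that(1)] \<delta>
        by linarith
      then have "(N x)\<^sup>2 \<le> 8 / \<delta>\<^sup>2 * exp (\<delta> * N x / 2)" using \<delta> by (simp add: field_simps power2_eq_square)
      then show ?thesis unfolding power_mult_distrib by (intro mult_left_mono mult_right_mono) auto
    qed
    also have "\<dots> = 8 / \<delta>\<^sup>2 * (norm h)\<^sup>2 * exp (\<delta> * N x)"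
      by (simp add: mult_ac) (simp flip: exp_add)
    finally have *: "cmod (exp ?w - (1 + ?w)) \<le> 8 / \<delta>\<^sup>2 * (norm h)\<^sup>2 * exp (\<delta> * N x)" .
    have "p x * exp (l x (z + h)) - p x * exp (l x z) - p x * l x h * exp (l x z)
        = p x * exp (l x z) * (exp ?w - (1 + ?w))"
      using add[OF that(1)] by (simp add: exp_add algebra_simps)
    then have "cmod (p x * exp (l x (z + h)) - p x * exp (l x z) - p x * l x h * exp (l x z))
        = cmod (p x) * exp (Re (l x z)) * cmod (exp ?w - (1 + ?w))" by (simp add: norm_mult)
    also have "\<dots> \<le> cmod (p x) * exp (Re (l x z)) * (8 / \<delta>\<^sup>2 * (norm h)\<^sup>2 * exp (\<delta> * N x))"
      by (intro mult_left_mono *) auto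
    also have "\<dots> = (8 / \<delta>\<^sup>2 * (norm h)\<^sup>2) * W x" by (simp add: W_def exp_add mult_ac)
    finally show ?thesis .
  qed
  define f where "f = (\<lambda>z. \<Sum>\<^sub>\<infinity>x\<in>X. p x * exp (l x z))"
  define D where "D = (\<lambda>u. \<Sum>\<^sub>\<infinity>x\<in>X. p x * l x u * exp (l x z))"
  have s0: "(\<lambda>x. p x * exp (l x (z + h))) summable_on X" if "norm h \<le> \<delta>" for h
    by (rule absW[where C = 1]) (use b0 that in auto)
  have s00: "(\<lambda>x. p x * exp (l x z)) summable_on X" using s0[of 0] \<delta> by simp
  have s1: "(\<lambda>x. p x * l x u * exp (l x z)) summable_on X" for u
    by (rule absW[OF b1])
  have infsum_bound: "cmod (\<Sum>\<^sub>\<infinity>x\<in>X. f x) \<le> C * (\<Sum>\<^sub>\<infinity>x\<in>X. W x)"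
    if "\<And>x. x \<in> X \<Longrightarrow> cmod (f x) \<le> C * W x" for f C
  proof -
    have sC: "(\<lambda>x. C * W x) summable_on X" using sW by (rule summable_on_cmult_right)
    have "(\<lambda>x. norm (f x)) summable_on X"
      by (rule Infinite_Sum.summable_on_comparison_test[OF sC]) (use that in auto)
    then have "cmod (\<Sum>\<^sub>\<infinity>x\<in>X. f x) \<le> (\<Sum>\<^sub>\<infinity>x\<in>X. C * W x)"
      using that norm_infsum_le[OF has_sum_infsum[OF abs_summable_summable] has_sum_infsum[OF sC]] by blast
    then show ?thesis using infsum_cmult_right'[of C W X] by simp
  qed
  have blD: "bounded_linear D"
  proof (rule bounded_linear_intro[where K = "1/\<delta> * (\<Sum>\<^sub>\<infinity>x\<in>X. W x)"])
    show "D (u + w) = D u + D w" for u w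
    proof -
      have "D u + D w = (\<Sum>\<^sub>\<infinity>x\<in>X. p x * l x u * exp (l x z) + p x * l x w * exp (l x z))"
        unfolding D_def by (rule infsum_add[symmetric, OF s1 s1])
      also have "\<dots> = D (u + w)" unfolding D_def
        by (rule infsum_cong) (use add in \<open>simp add: algebra_simps\<close>)
      finally show ?thesis ..
    qed
    show "D (r *\<^sub>R u) = r *\<^sub>R D u" for r u
    proof -
      have "D (r *\<^sub>R u) = (\<Sum>\<^sub>\<infinity>x\<in>X. of_real r * (p x * l x u * exp (l x z)))" unfolding D_def
        by (rule infsum_cong) (use add in \<open>simp add: scaleR_conv_of_real algebra_simps\<close>)
      also have "\<dots> = of_real r * D u" unfolding D_def by (rule infsum_cmult_right')
      finally show ?thesis by (simp add: scaleR_conv_of_real)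
    qed
    show "norm (D u) \<le> norm u * (1/\<delta> * (\<Sum>\<^sub>\<infinity>x\<in>X. W x))" for u
      using infsum_bound[OF b1, of u] unfolding D_def by (simp add: mult_ac)
  qed
  let ?C = "8 / \<delta>\<^sup>2 * (\<Sum>\<^sub>\<infinity>x\<in>X. W x)"
  have rem: "cmod (f (z + h) - f z - D h) \<le> ?C * (norm h)\<^sup>2" if h: "norm h \<le> \<delta>/2" for h
  proof -
    have h': "norm h \<le> \<delta>" using h \<delta> by linarith
    have "f (z + h) - f z - D h = (\<Sum>\<^sub>\<infinity>x\<in>X. p x * exp (l x (z + h)) - p x * exp (l x z) - p x * l x h * exp (l x z))"
      unfolding f_def D_def
      by (intro infsumI[symmetric] has_sum_minus has_sum_infsum s0[OF h'] s00 s1)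
    also have "cmod \<dots> \<le> (8 / \<delta>\<^sup>2 * (norm h)\<^sup>2) * (\<Sum>\<^sub>\<infinity>x\<in>X. W x)"
      by (rule infsum_bound) (use b2 h in auto)
    finally show ?thesis by (simp add: mult_ac)
  qed
  have "(\<lambda>h. norm (f (z + h) - f z - D h) / norm h) \<midarrow>0\<rightarrow> 0"
  proof (rule Lim_null_comparison)
    have "eventually (\<lambda>h::'a. norm h < \<delta>/2) (at 0)"
      using \<delta> by (auto simp: eventually_at dist_norm intro!: exI[of _ "\<delta>/2"])
    then show "eventually (\<lambda>h. norm (norm (f (z + h) - f z - D h) / norm h) \<le> ?C * norm h) (at 0)"
    proof eventually_elim
      case (elim h)
      show ?case
      proof (cases "h = 0")
        case False
        then show ?thesis using rem[of h] elim by (simp add: divide_le_eq power2_eq_square mult_ac)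
      qed simp
    qed
    show "(\<lambda>h::'a. ?C * norm h) \<midarrow>0\<rightarrow> 0"
      by (rule tendsto_mult_right_zero[OF tendsto_norm_zero[OF tendsto_ident_at]])
  qed
  then show ?thesis using blD unfolding has_derivative_at f_def D_def by simp
qed

text \<open>Differentiating multiplies the coefficient by \<open>l x u\<close>, of size at most
  \<open>N x * norm u\<close>. Half of the slack pays for that factor and half remains, so the
  summability condition reproduces itself at every order; this is why \<open>\<delta>\<close> may
  depend on \<open>p\<close> and \<open>z\<close>.\<close>

lemma exp_series_Ck:
  fixes l :: "'i \<Rightarrow> 'a::real_normed_vector \<Rightarrow> complex" and p :: "'i \<Rightarrow> complex"
  assumes lin: "\<And>x. x \<in> X \<Longrightarrow> linear (l x)"
    and N: "\<And>x u. x \<in> X \<Longrightarrow> cmod (l x u) \<le> N x * norm u" "\<And>x. x \<in> X \<Longrightarrow> N x \<ge> 0"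
    and S: "open S"
    and s: "\<And>z. z \<in> S \<Longrightarrow> \<exists>\<delta>>0. (\<lambda>x. cmod (p x) * exp (Re (l x z) + \<delta> * N x)) summable_on X"
  shows "Ck_on n S (\<lambda>z. \<Sum>\<^sub>\<infinity>x\<in>X. p x * exp (l x z))"
  using s
proof (induction n arbitrary: p)
  case 0
  have "continuous (at z) (\<lambda>z. \<Sum>\<^sub>\<infinity>x\<in>X. p x * exp (l x z))" if z: "z \<in> S" for z
  proof -
    obtain \<delta> where "\<delta> > 0" "(\<lambda>x. cmod (p x) * exp (Re (l x z) + \<delta> * N x)) summable_on X"
      using 0 z by blast
    then show ?thesis by (intro has_derivative_continuous[OF exp_series_has_derivative[OF lin N]])
  qed
  then show ?case by (simp add: continuous_at_imp_continuous_on)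
next
  case (Suc n)
  show ?case
  proof (rule Ck_on_SucI[OF S, where D = "\<lambda>z u. \<Sum>\<^sub>\<infinity>x\<in>X. p x * l x u * exp (l x z)"])
    fix z assume "z \<in> S"
    then obtain \<delta> where "\<delta> > 0" "(\<lambda>x. cmod (p x) * exp (Re (l x z) + \<delta> * N x)) summable_on X"
      using Suc.prems by blast
    then show "((\<lambda>z. \<Sum>\<^sub>\<infinity>x\<in>X. p x * exp (l x z)) has_derivative
          (\<lambda>u. \<Sum>\<^sub>\<infinity>x\<in>X. p x * l x u * exp (l x z))) (at z)"
      by (intro exp_series_has_derivative[OF lin N])
  next
    fix u
    show "Ck_on n S (\<lambda>z. \<Sum>\<^sub>\<infinity>x\<in>X. p x * l x u * exp (l x z))"
    proof (rule Suc.IH)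
      fix z assume "z \<in> S"
      then obtain \<delta> where \<delta>: "\<delta> > 0" and s: "(\<lambda>x. cmod (p x) * exp (Re (l x z) + \<delta> * N x)) summable_on X"
        using Suc.prems by blast
      have "(\<lambda>x. cmod (p x * l x u) * exp (Re (l x z) + (\<delta>/2) * N x)) summable_on X"
      proof (rule Infinite_Sum.summable_on_comparison_test)
        show "(\<lambda>x. (2 * norm u / \<delta>) * (cmod (p x) * exp (Re (l x z) + \<delta> * N x))) summable_on X"
          using s by (rule summable_on_cmult_right)
        fix x assume x: "x \<in> X"
        have "\<delta>/2 * N x \<le> exp (\<delta>/2 * N x)" using exp_ge_add_one_self[of "\<delta>/2 * N x"] by linarith
        then have "N x \<le> 2 / \<delta> * exp (\<delta>/2 * N x)" using \<delta> by (simp add: field_simps)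
        then have "cmod (l x u) \<le> 2 / \<delta> * exp (\<delta>/2 * N x) * norm u"
          using N(1)[OF x, of u] by (meson mult_right_mono norm_ge_zero order_trans)
        then have "cmod (p x) * cmod (l x u) * exp (Re (l x z) + (\<delta>/2) * N x)
            \<le> cmod (p x) * (2 / \<delta> * exp (\<delta>/2 * N x) * norm u) * exp (Re (l x z) + (\<delta>/2) * N x)"
          by (intro mult_right_mono mult_left_mono) auto
        also have "\<dots> = (2 * norm u / \<delta>) * (cmod (p x) * exp (Re (l x z) + \<delta> * N x))"
        proof -
          have "exp (\<delta>/2 * N x) * exp (Re (l x z) + (\<delta>/2) * N x) = exp (Re (l x z) + \<delta> * N x)"
            by (simp flip: exp_add add: field_simps)
          then show ?thesis by (simp add: mult_ac)
        qed
        finally show "cmod (p x * l x u) * exp (Re (l x z) + (\<delta>/2) * N x)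
            \<le> (2 * norm u / \<delta>) * (cmod (p x) * exp (Re (l x z) + \<delta> * N x))"
          by (simp add: norm_mult)
      qed auto
      then show "\<exists>\<delta>>0. (\<lambda>x. cmod (p x * l x u) * exp (Re (l x z) + \<delta> * N x)) summable_on X"
        using \<delta> by (intro exI[of _ "\<delta>/2"]) auto
    qed
  qed
qed

section \<open>Finite-dimensional normed spaces and orthonormal bases\<close>

text \<open>Norm equivalence, one basis vector at a time: the span of the earlier vectors is closed,
  so the new vector has a positive distance \<open>d\<close> from it, and \<open>1/d\<close> bounds
  its coordinate.\<close>

lemma coordinates_bounded:
  fixes b :: "'v::real_normed_vector set"
  assumes "finite b" "independent b"
  shows "\<exists>K>0. \<forall>c. \<forall>e\<in>b. \<bar>c e\<bar> \<le> K * norm (\<Sum>e\<in>b. c e *\<^sub>R e)"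
  using assms
proof (induction b rule: finite_induct)
  case empty
  show ?case by (intro exI[of _ 1]) auto
next
  case (insert a B)
  have ind: "independent B" and aB: "a \<notin> span B"
    using insert.prems insert.hyps by (auto simp: real_vector.independent_insert)
  obtain K where K: "K > 0" "\<And>c e. e \<in> B \<Longrightarrow> \<bar>c e\<bar> \<le> K * norm (\<Sum>e\<in>B. c e *\<^sub>R e)"
    using insert.IH[OF ind] by auto
  \<comment> \<open>Otherwise \<open>a\<close> is a limit of points of the span. By the bound for
    \<open>B\<close> their coordinates are Cauchy, and the limits of the coordinates put
    \<open>a\<close> into the span.\<close>
  have "\<exists>d>0. \<forall>y\<in>span B. d \<le> norm (a - y)"
  proof (rule ccontr)
    assume "\<not> ?thesis"
    then have "\<exists>y\<in>span B. norm (a - y) < 1 / real (Suc n)" for n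
      by (metis not_less of_nat_0_less_iff zero_less_Suc zero_less_divide_1_iff)
    then obtain y where y: "\<And>n. y n \<in> span B" "\<And>n. norm (a - y n) < 1 / real (Suc n)" by metis
    have "\<exists>c. y n = (\<Sum>e\<in>B. c e *\<^sub>R e)" for n
      using y(1)[of n] unfolding real_vector.span_finite[OF insert.hyps(1)] by auto
    then obtain c where c: "\<And>n. y n = (\<Sum>e\<in>B. c n e *\<^sub>R e)" by metis
    have "(\<lambda>n. norm (y n - a)) \<longlonglongrightarrow> 0"
    proof (rule tendsto_sandwich[OF _ _ tendsto_const LIMSEQ_inverse_real_of_nat])
      show "\<forall>\<^sub>F n in sequentially. norm (y n - a) \<le> inverse (real (Suc n))"
        using y(2) by (intro always_eventually allI less_imp_le) (simp add: norm_minus_commute inverse_eq_divide)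
    qed auto
    then have ya: "y \<longlonglongrightarrow> a" using tendsto_norm_zero_iff LIM_zero_iff by metis
    then have Cy: "Cauchy y" by (rule LIMSEQ_imp_Cauchy)
    have "Cauchy (\<lambda>n. c n e)" if e: "e \<in> B" for e
    proof (rule metric_CauchyI)
      fix r :: real assume "r > 0"
      then obtain M where M: "\<And>m n. m \<ge> M \<Longrightarrow> n \<ge> M \<Longrightarrow> dist (y m) (y n) < r / K"
        using metric_CauchyD[OF Cy, of "r / K"] K(1) by auto
      have "dist (c m e) (c n e) < r" if "m \<ge> M" "n \<ge> M" for m n
      proof -
        have "\<bar>c m e - c n e\<bar> \<le> K * norm (\<Sum>e\<in>B. (c m e - c n e) *\<^sub>R e)" by (rule K(2)[OF e])
        also have "(\<Sum>e\<in>B. (c m e - c n e) *\<^sub>R e) = y m - y n"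
          unfolding c by (simp add: scaleR_diff_left sum_subtractf)
        also have "K * norm (y m - y n) < K * (r / K)"
          using M[OF that] K(1) by (intro mult_strict_left_mono) (auto simp: dist_norm)
        finally show ?thesis using K(1) by (simp add: dist_real_def)
      qed
      then show "\<exists>M. \<forall>m\<ge>M. \<forall>n\<ge>M. dist (c m e) (c n e) < r" by blast
    qed
    then have "\<exists>l. (\<lambda>n. c n e) \<longlonglongrightarrow> l" if "e \<in> B" for e
      using that Cauchy_convergent_iff convergent_def by blast
    then obtain l where l: "\<And>e. e \<in> B \<Longrightarrow> (\<lambda>n. c n e) \<longlonglongrightarrow> l e" by metis
    have "(\<lambda>n. \<Sum>e\<in>B. c n e *\<^sub>R e) \<longlonglongrightarrow> (\<Sum>e\<in>B. l e *\<^sub>R e)"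
      by (intro tendsto_sum tendsto_scaleR l tendsto_const)
    then have "y \<longlonglongrightarrow> (\<Sum>e\<in>B. l e *\<^sub>R e)" by (simp add: c[abs_def])
    then have "a = (\<Sum>e\<in>B. l e *\<^sub>R e)" using ya LIMSEQ_unique by blast
    then have "a \<in> span B"
      by (simp add: real_vector.span_sum real_vector.span_scale real_vector.span_base)
    with aB show False ..
  qed
  then obtain d where d: "d > 0" "\<And>y. y \<in> span B \<Longrightarrow> d \<le> norm (a - y)" by auto
  have ca: "\<bar>c a\<bar> \<le> (1/d) * norm (\<Sum>e\<in>insert a B. c e *\<^sub>R e)" for c
  proof (cases "c a = 0")
    case False
    \<comment> \<open>Chosen such that \<open>c a *\<^sub>R (a - ?y)\<close> is the whole
      combination, while \<open>a - ?y\<close> has norm at least \<open>d\<close>.\<close>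
    let ?y = "- (1 / c a) *\<^sub>R (\<Sum>e\<in>B. c e *\<^sub>R e)"
    have "?y \<in> span B"
      by (intro real_vector.span_scale real_vector.span_sum real_vector.span_base)
    then have "d \<le> norm (a - ?y)" by (rule d(2))
    then have "\<bar>c a\<bar> * d \<le> \<bar>c a\<bar> * norm (a - ?y)" by (intro mult_left_mono) auto
    also have "\<dots> = norm (c a *\<^sub>R (a - ?y))" by simp
    also have "c a *\<^sub>R (a - ?y) = (\<Sum>e\<in>insert a B. c e *\<^sub>R e)"
      using False insert.hyps by (simp add: scaleR_right_diff_distrib scaleR_add_right)
    finally show ?thesis using d(1) by (simp add: field_simps)
  qed (use d(1) in auto)
  have cB: "\<bar>c e\<bar> \<le> (K * (1 + norm a / d)) * norm (\<Sum>e\<in>insert a B. c e *\<^sub>R e)" if "e \<in> B" for c e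
  proof -
    have "\<bar>c e\<bar> \<le> K * norm (\<Sum>e\<in>B. c e *\<^sub>R e)" by (rule K(2)[OF that])
    also have "(\<Sum>e\<in>B. c e *\<^sub>R e) = (\<Sum>e\<in>insert a B. c e *\<^sub>R e) - c a *\<^sub>R a"
      using insert.hyps by simp
    also have "norm \<dots> \<le> norm (\<Sum>e\<in>insert a B. c e *\<^sub>R e) + \<bar>c a\<bar> * norm a"
      by (rule order_trans[OF norm_triangle_ineq4]) simp
    also have "\<dots> \<le> norm (\<Sum>e\<in>insert a B. c e *\<^sub>R e) + (1/d * norm (\<Sum>e\<in>insert a B. c e *\<^sub>R e)) * norm a"
      by (intro add_left_mono mult_right_mono ca) auto
    finally show ?thesis using K(1) by (simp add: algebra_simps)
  qed
  let ?K = "max (1/d) (K * (1 + norm a / d))"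
  have "\<bar>c e\<bar> \<le> ?K * norm (\<Sum>e\<in>insert a B. c e *\<^sub>R e)" if "e \<in> insert a B" for c e
  proof -
    let ?n = "norm (\<Sum>e\<in>insert a B. c e *\<^sub>R e)"
    have "1/d * ?n \<le> ?K * ?n" "(K * (1 + norm a / d)) * ?n \<le> ?K * ?n"
      by (intro mult_right_mono; simp)+
    then show ?thesis using that ca[of c] cB[of e c] by fastforce
  qed
  moreover have "?K > 0" using d(1) by (simp add: less_max_iff_disj)
  ultimately show ?case by blast
qed

lemma finite_span_sumE:
  assumes "finite b" "span b = UNIV"
  obtains c where "x = (\<Sum>e\<in>b. c e *\<^sub>R e)"
proof -
  have "x \<in> span b" using assms by simp
  then show ?thesis unfolding real_vector.span_finite[OF assms(1)] using that by auto
qed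

lemma linear_findim_bounded:
  fixes f :: "'v::real_normed_vector \<Rightarrow> 'w::real_normed_vector" and b :: "'v set"
  assumes "finite b" "independent b" "span b = UNIV" "linear f"
  shows "bounded_linear f"
proof -
  obtain K where K: "K > 0" "\<And>c e. e \<in> b \<Longrightarrow> \<bar>c e\<bar> \<le> K * norm (\<Sum>e\<in>b. c e *\<^sub>R e)"
    using coordinates_bounded[OF assms(1,2)] by auto
  have "norm (f x) \<le> norm x * (K * (\<Sum>e\<in>b. norm (f e)))" for x
  proof -
    obtain c where c: "x = (\<Sum>e\<in>b. c e *\<^sub>R e)" using finite_span_sumE[OF assms(1,3)] .
    have "f x = (\<Sum>e\<in>b. c e *\<^sub>R f e)"
      unfolding c using assms(4) by (simp add: linear_sum linear_scale)
    also have "norm \<dots> \<le> (\<Sum>e\<in>b. norm (c e *\<^sub>R f e))" by (rule norm_sum)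
    also have "\<dots> \<le> (\<Sum>e\<in>b. (K * norm x) * norm (f e))"
      using K(2) c by (intro sum_mono) (auto intro!: mult_right_mono)
    finally show ?thesis by (simp add: sum_distrib_left mult_ac)
  qed
  then show ?thesis
    using assms(4) by (intro bounded_linear_intro[where K = "K * (\<Sum>e\<in>b. norm (f e))"])
      (auto simp: linear_add linear_scale)
qed

text \<open>Gram-Schmidt for a form that is positive on the span. \<open>S\<close> may be dependent,
  and a vector equal to its projection \<open>p\<close> is dropped; this serves the projections of a
  lattice basis onto a definite part.\<close>

lemma orthonormal_exists:
  fixes B :: "'v::real_vector \<Rightarrow> 'v \<Rightarrow> real"
  assumes bil: "bilinear B" and sym: "\<And>x y. B x y = B y x" and "finite S"
    and pos: "\<And>x. x \<in> span S \<Longrightarrow> x \<noteq> 0 \<Longrightarrow> B x x > 0"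
  shows "\<exists>E. finite E \<and> span E = span S \<and> (\<forall>e\<in>E. \<forall>e'\<in>E. B e e' = (if e = e' then 1 else 0))"
  using assms(3) pos
proof (induction S rule: finite_induct)
  case empty show ?case by (intro exI[of _ "{}"]) auto
next
  case (insert a S)
  have lin: "linear (\<lambda>x. B x y)" "linear (B x)" for x y using bil by (auto simp: bilinear_def)
  have "span S \<subseteq> span (insert a S)" by (rule real_vector.span_mono) auto
  then obtain E where E: "finite E" "span E = span S" "\<And>e e'. e \<in> E \<Longrightarrow> e' \<in> E \<Longrightarrow> B e e' = (if e = e' then 1 else 0)"
    using insert by (metis subsetD)
  define p where "p = (\<Sum>e\<in>E. B a e *\<^sub>R e)"
  have pE: "p \<in> span E"
    unfolding p_def by (intro real_vector.span_sum real_vector.span_scale real_vector.span_base)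
  have pe: "B p e = B a e" if "e \<in> E" for e
  proof -
    have "B p e = (\<Sum>f\<in>E. B a f * B f e)"
      unfolding p_def linear_sum[OF lin(1)] linear_scale[OF lin(1)] by simp
    also have "\<dots> = (\<Sum>f\<in>E. if f = e then B a f else 0)"
      by (rule sum.cong) (use E(3) that in auto)
    finally show ?thesis using that E(1) by simp
  qed
  show ?case
  proof (cases "a = p")
    case True
    then have "a \<in> span S" using pE E(2) by simp
    then have "span (insert a S) = span S" by (rule real_vector.span_redundant)
    then show ?thesis using E by auto
  next
    case False
    let ?u0 = "a - p"
    have "?u0 \<in> span (insert a S)"
      using pE E(2) \<open>span S \<subseteq> span (insert a S)\<close>
      by (intro real_vector.span_diff) (auto intro: real_vector.span_base)
    then have pos0: "B ?u0 ?u0 > 0" using insert.prems False by auto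
    define r where "r = sqrt (B ?u0 ?u0)"
    have r: "r > 0" "r * r = B ?u0 ?u0" using pos0 by (auto simp: r_def)
    define u where "u = (1/r) *\<^sub>R ?u0"
    have ue: "B u e = 0" "B e u = 0" if "e \<in> E" for e
    proof -
      show "B u e = 0" unfolding u_def linear_scale[OF lin(1)] linear_diff[OF lin(1)] using pe[OF that] by simp
      then show "B e u = 0" using sym by metis
    qed
    have uu: "B u u = 1"
      unfolding u_def linear_scale[OF lin(1)] linear_scale[OF lin(2)] using r pos0 by (simp add: field_simps)
    have "u \<notin> E" using uu ue by force
    have a_eq: "a = r *\<^sub>R u + p" using r by (simp add: u_def)
    have "span (insert u E) = span (insert a S)"
    proof (rule real_vector.span_eq[THEN iffD2], intro conjI)
      have "insert u E \<subseteq> span (insert a S)"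
        using \<open>?u0 \<in> span (insert a S)\<close> E(2) \<open>span S \<subseteq> _\<close> real_vector.span_superset[of E]
        by (auto simp: u_def intro!: real_vector.span_scale)
      then show "insert u E \<subseteq> span (insert a S)" .
      have sE: "span E \<subseteq> span (insert u E)" by (rule real_vector.span_mono) auto
      have "a \<in> span (insert u E)"
        unfolding a_eq using pE sE
        by (intro real_vector.span_add real_vector.span_scale) (auto intro: real_vector.span_base)
      moreover have "S \<subseteq> span (insert u E)"
        using real_vector.span_superset[of S] sE E(2) by auto
      ultimately show "insert a S \<subseteq> span (insert u E)" by auto
    qed
    moreover have "\<forall>e\<in>insert u E. \<forall>e'\<in>insert u E. B e e' = (if e = e' then 1 else 0)"
      using E(3) ue uu \<open>u \<notin> E\<close> by auto
    ultimately show ?thesis using E(1) by (intro exI[of _ "insert u E"]) auto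
  qed
qed

section \<open>Lattices with a point of the Grassmannian\<close>

text \<open>An even lattice with one chosen basis, whose existence alone is asserted by
  \<open>even_lattice\<close>, and a fixed decomposition into definite parts.\<close>

locale lat_gr =
  fixes L :: "'v::real_normed_vector lattice_form" and b :: "'v set" and v :: "'v set \<times> 'v set"
  assumes finb: "finite b" and indb: "independent b" and spanb: "span b = UNIV"
    and lat_eq: "lat L = {\<Sum>x\<in>b. of_int (c x) *\<^sub>R x | c :: 'v \<Rightarrow> int. True}"
    and bil: "bilinear (bform L)"
    and sym: "bform L x y = bform L y x"
    and int: "x \<in> lat L \<Longrightarrow> y \<in> lat L \<Longrightarrow> bform L x y \<in> \<int>"
    and evn: "x \<in> lat L \<Longrightarrow> \<exists>m::int. qform L x = 2 * of_int m"
    and gr: "v \<in> grassmannian L"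

lemma even_lattice_lat_gr:
  assumes "even_lattice L" "v \<in> grassmannian L"
  obtains b where "lat_gr L b v"
proof -
  note e = assms(1)[unfolded even_lattice_def]
  from e[THEN conjunct1] obtain b where b: "finite b" "independent b" "span b = UNIV"
      "lat L = {\<Sum>x\<in>b. of_int (c x) *\<^sub>R x | c :: 'a \<Rightarrow> int. True}"
    by (elim exE conjE)
  note e2 = e[THEN conjunct2]
  have r: "bilinear (bform L)" "\<And>x y. bform L x y = bform L y x"
    "\<And>x y. x \<in> lat L \<Longrightarrow> y \<in> lat L \<Longrightarrow> bform L x y \<in> \<int>"
    "\<And>x. x \<in> lat L \<Longrightarrow> \<exists>m::int. qform L x = 2 * of_int m"
    using e2[THEN conjunct1] e2[THEN conjunct2, THEN conjunct1]
      e2[THEN conjunct2, THEN conjunct2, THEN conjunct2, THEN conjunct1]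
      e2[THEN conjunct2, THEN conjunct2, THEN conjunct2, THEN conjunct2] by simp_all
  have "lat_gr L b v" by (rule lat_gr.intro; fact b r assms(2))
  then show ?thesis by (rule that)
qed

context lat_gr
begin

lemma lin: "linear (bform L x)" "linear (\<lambda>x. bform L x y)"
  using bil by (auto simp: bilinear_def)

lemma bf_add: "bform L (x + y) z = bform L x z + bform L y z" "bform L z (x + y) = bform L z x + bform L z y"
  by (rule linear_add[OF lin(2)] linear_add[OF lin(1)])+

lemma bf_diff: "bform L (x - y) z = bform L x z - bform L y z" "bform L z (x - y) = bform L z x - bform L z y"
  by (rule linear_diff[OF lin(2)] linear_diff[OF lin(1)])+

lemma bf_scale: "bform L (r *\<^sub>R x) z = r * bform L x z" "bform L z (r *\<^sub>R x) = r * bform L z x"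
  using linear_scale[OF lin(2)] linear_scale[OF lin(1)] by simp_all

lemma bf_minus: "bform L (- x) z = - bform L x z" "bform L z (- x) = - bform L z x"
  by (rule linear_neg[OF lin(2)] linear_neg[OF lin(1)])+

lemma bf_0 [simp]: "bform L 0 z = 0" "bform L z 0 = 0"
  by (rule linear_0[OF lin(2)] linear_0[OF lin(1)])+

lemma bf_sum: "bform L (sum f A) z = (\<Sum>i\<in>A. bform L (f i) z)" "bform L z (sum f A) = (\<Sum>i\<in>A. bform L z (f i))"
  by (rule linear_sum[OF lin(2)] linear_sum[OF lin(1)])+

lemmas bf_simps = bf_add bf_diff bf_scale bf_minus

abbreviation "P \<equiv> fst v"
abbreviation "N \<equiv> snd v"

lemma gr_facts:
  shows subP: "subspace P" and subN: "subspace N"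
    and orth: "\<And>x y. x \<in> P \<Longrightarrow> y \<in> N \<Longrightarrow> bform L x y = 0"
    and PN: "P \<inter> N = {0}"
    and decomp: "\<And>x. \<exists>p\<in>P. \<exists>n\<in>N. x = p + n"
    and posP: "\<And>x. x \<in> P \<Longrightarrow> x \<noteq> 0 \<Longrightarrow> qform L x > 0"
    and negN: "\<And>x. x \<in> N \<Longrightarrow> x \<noteq> 0 \<Longrightarrow> qform L x < 0"
  using gr unfolding grassmannian_def by (auto split: prod.splits)

definition "pp = proj_plus v"
definition "pm = proj_minus v"

lemma decomp_unique:
  assumes "p \<in> P" "n \<in> N" "p' \<in> P" "n' \<in> N" "p + n = p' + n'"
  shows "p = p'" "n = n'"
proof -
  have "p - p' = n' - n" using assms(5) by (simp add: algebra_simps)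
  moreover have "p - p' \<in> P" "n' - n \<in> N"
    using assms subP subN by (auto intro: real_vector.subspace_diff)
  ultimately have "p - p' \<in> P \<inter> N" "n' - n \<in> P \<inter> N" by auto
  then show "p = p'" "n = n'" unfolding PN by auto
qed

lemma proj_eqI:
  assumes "p \<in> P" "n \<in> N"
  shows "pp (p + n) = p" "pm (p + n) = n"
proof -
  show "pp (p + n) = p" unfolding pp_def proj_plus_def
  proof (rule the_equality)
    fix p' assume p': "p' \<in> P \<and> p + n - p' \<in> N"
    show "p' = p" by (rule decomp_unique(1)[of p' "p + n - p'" p n]) (use p' assms in auto)
  qed (use assms in auto)
  show "pm (p + n) = n" unfolding pm_def proj_minus_def
  proof (rule the_equality)
    fix n' assume n': "n' \<in> N \<and> p + n - n' \<in> P"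
    show "n' = n" by (rule decomp_unique(2)[of "p + n - n'" n' p n]) (use n' assms in auto)
  qed (use assms in auto)
qed

lemma pp_in [simp, intro]: "pp x \<in> P" and pm_in [simp, intro]: "pm x \<in> N" and pp_pm: "pp x + pm x = x"
proof -
  obtain p n where "p \<in> P" "n \<in> N" "x = p + n" using decomp by blast
  then show "pp x \<in> P" "pm x \<in> N" "pp x + pm x = x" using proj_eqI by auto
qed

lemma pp_add: "pp (x + y) = pp x + pp y" and pm_add: "pm (x + y) = pm x + pm y"
proof -
  have "x + y = (pp x + pp y) + (pm x + pm y)" using pp_pm[of x] pp_pm[of y] by (metis add.commute add.left_commute)
  then show "pp (x + y) = pp x + pp y" "pm (x + y) = pm x + pm y"
    using proj_eqI[of "pp x + pp y" "pm x + pm y"] subP subN by (auto intro: real_vector.subspace_add)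
qed

lemma pp_scale: "pp (r *\<^sub>R x) = r *\<^sub>R pp x" and pm_scale: "pm (r *\<^sub>R x) = r *\<^sub>R pm x"
proof -
  have "r *\<^sub>R x = r *\<^sub>R pp x + r *\<^sub>R pm x" using pp_pm[of x] by (metis scaleR_add_right)
  then show "pp (r *\<^sub>R x) = r *\<^sub>R pp x" "pm (r *\<^sub>R x) = r *\<^sub>R pm x"
    using proj_eqI[of "r *\<^sub>R pp x" "r *\<^sub>R pm x"] subP subN by (auto intro: real_vector.subspace_scale)
qed

lemma lin_pp: "linear pp" and lin_pm: "linear pm"
  by (auto intro!: linearI simp: pp_add pm_add pp_scale pm_scale)

lemma proj_P: "x \<in> P \<Longrightarrow> pp x = x" "x \<in> P \<Longrightarrow> pm x = 0"
  using proj_eqI[of x 0] subN by (auto simp: real_vector.subspace_0)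

lemma proj_N: "x \<in> N \<Longrightarrow> pm x = x" "x \<in> N \<Longrightarrow> pp x = 0"
  using proj_eqI[of 0 x] subP by (auto simp: real_vector.subspace_0)

lemma proj_idem [simp]: "pp (pp x) = pp x" "pm (pm x) = pm x" "pm (pp x) = 0" "pp (pm x) = 0"
  by (auto simp: proj_P proj_N)

lemma bf_pp_pm [simp]: "bform L (pp x) (pm y) = 0" "bform L (pm x) (pp y) = 0"
  using orth[of "pp x" "pm y"] orth[of "pp y" "pm x"] sym by auto

lemma bf_split: "bform L x y = bform L (pp x) (pp y) + bform L (pm x) (pm y)"
  by (subst (1 2) pp_pm[symmetric]) (simp add: bf_add del: pp_pm)

lemma finspan_P: "P = span (pp ` b)" and finspan_N: "N = span (pm ` b)"
proof -
  have "range pp = P" using proj_P by (auto simp: image_iff) (metis)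
  then show "P = span (pp ` b)" using real_vector.linear_span_image[OF lin_pp, of b] spanb by simp
  have "range pm = N" using proj_N by (auto simp: image_iff) (metis)
  then show "N = span (pm ` b)" using real_vector.linear_span_image[OF lin_pm, of b] spanb by simp
qed

text \<open>The same choice as inside \<open>hol_laplacian\<close>, so that the Laplacian is
  literally a sum over \<open>Ep\<close>. \<open>Em\<close> is orthonormal for the negated form,
  whence the value -1 on its vectors.\<close>

definition "Ep = (SOME E. orthonormal_basis L P E)"
definition "Em = (SOME E. orthonormal_basis (neg_lattice L) N E)"

lemma bform_neg: "bform (neg_lattice L) x y = - bform L x y"
  by (simp add: neg_lattice_def)

lemma Ep: "finite Ep" "span Ep = P" "\<And>e e'. e \<in> Ep \<Longrightarrow> e' \<in> Ep \<Longrightarrow> bform L e e' = (if e = e' then 1 else 0)"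
proof -
  have "\<exists>E. orthonormal_basis L P E"
    unfolding orthonormal_basis_def finspan_P
    by (rule orthonormal_exists[OF bil sym]) (simp_all add: finb posP finspan_P[symmetric])
  from someI_ex[OF this] have *: "orthonormal_basis L P Ep" unfolding Ep_def[symmetric] .
  note * = *[unfolded orthonormal_basis_def]
  show "finite Ep" "span Ep = P" by (rule *[THEN conjunct1] *[THEN conjunct2, THEN conjunct1])+
  show "bform L e e' = (if e = e' then 1 else 0)" if "e \<in> Ep" "e' \<in> Ep" for e e'
    using *[THEN conjunct2, THEN conjunct2] that by blast
qed

lemma bil_neg: "bilinear (\<lambda>x y. - bform L x y)"
  using bil unfolding bilinear_def by (auto intro: linear_compose_neg)

lemma Em: "finite Em" "span Em = N" "\<And>e e'. e \<in> Em \<Longrightarrow> e' \<in> Em \<Longrightarrow> bform L e e' = (if e = e' then -1 else 0)"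
proof -
  have "\<exists>E. orthonormal_basis (neg_lattice L) N E"
    unfolding orthonormal_basis_def bform_neg finspan_N
    by (rule orthonormal_exists[OF bil_neg]) (simp_all add: finb negN finspan_N[symmetric] sym)
  from someI_ex[OF this] have *: "orthonormal_basis (neg_lattice L) N Em" unfolding Em_def[symmetric] .
  note * = *[unfolded orthonormal_basis_def bform_neg]
  show "finite Em" "span Em = N" by (rule *[THEN conjunct1] *[THEN conjunct2, THEN conjunct1])+
  show "bform L e e' = (if e = e' then -1 else 0)" if "e \<in> Em" "e' \<in> Em" for e e'
  proof -
    have "- bform L e e' = (if e = e' then 1 else 0)"
      using *[THEN conjunct2, THEN conjunct2] that by blast
    then show ?thesis by (auto split: if_splits)
  qed
qed

lemma Ep_P: "e \<in> Ep \<Longrightarrow> e \<in> P" using Ep(2) real_vector.span_base by blast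
lemma Em_N: "e \<in> Em \<Longrightarrow> e \<in> N" using Em(2) real_vector.span_base by blast

lemma pp_eq: "pp x = (\<Sum>e\<in>Ep. bform L x e *\<^sub>R e)"
proof -
  have "pp x \<in> span Ep" using Ep(2) by simp
  then obtain c where c: "pp x = (\<Sum>e\<in>Ep. c e *\<^sub>R e)"
    unfolding real_vector.span_finite[OF Ep(1)] by auto
  have "bform L x e = c e" if "e \<in> Ep" for e
  proof -
    have "bform L x e = bform L (pp x) e" using bf_split[of x e] proj_P[OF Ep_P[OF that]] by simp
    also have "\<dots> = (\<Sum>f\<in>Ep. if f = e then c f else 0)"
      unfolding c bf_sum bf_scale by (rule sum.cong) (use Ep(3) that in auto)
    finally show ?thesis using that Ep(1) by simp
  qed
  then show ?thesis unfolding c by auto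
qed

lemma pm_eq: "pm x = - (\<Sum>e\<in>Em. bform L x e *\<^sub>R e)"
proof -
  have "pm x \<in> span Em" using Em(2) by simp
  then obtain c where c: "pm x = (\<Sum>e\<in>Em. c e *\<^sub>R e)"
    unfolding real_vector.span_finite[OF Em(1)] by auto
  have "bform L x e = - c e" if "e \<in> Em" for e
  proof -
    have "bform L x e = bform L (pm x) e" using bf_split[of x e] proj_N[OF Em_N[OF that]] by simp
    also have "\<dots> = (\<Sum>f\<in>Em. if f = e then - c f else 0)"
      unfolding c bf_sum bf_scale by (rule sum.cong) (use Em(3) that in auto)
    finally show ?thesis using that Em(1) by simp
  qed
  then show ?thesis unfolding c by (simp add: sum_negf)
qed

definition "qp x = qform L (pp x)"
definition "qm x = qform L (pm x)"

lemma qp_eq: "qp x = (\<Sum>e\<in>Ep. (bform L x e)\<^sup>2)"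
proof -
  have "qp x = bform L x (pp x)" unfolding qp_def by (subst (2) bf_split) simp
  also have "\<dots> = (\<Sum>e\<in>Ep. (bform L x e)\<^sup>2)"
    unfolding pp_eq[of x] bf_sum bf_scale by (simp add: power2_eq_square)
  finally show ?thesis .
qed

lemma qm_eq: "qm x = - (\<Sum>e\<in>Em. (bform L x e)\<^sup>2)"
proof -
  have "qm x = bform L x (pm x)" unfolding qm_def by (subst (2) bf_split) simp
  also have "\<dots> = - (\<Sum>e\<in>Em. (bform L x e)\<^sup>2)"
    unfolding pm_eq[of x] bf_minus bf_sum bf_scale by (simp add: power2_eq_square)
  finally show ?thesis .
qed

lemma dim_P: "dim P = card Ep"
proof -
  have "independent Ep"
    unfolding real_vector.independent_explicit_finite_subsets
  proof (intro allI impI ballI)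
    fix A u e assume A: "A \<subseteq> Ep" "finite A" "(\<Sum>f\<in>A. u f *\<^sub>R f) = 0" "e \<in> A"
    then have "0 = bform L (\<Sum>f\<in>A. u f *\<^sub>R f) e" by simp
    also have "\<dots> = (\<Sum>f\<in>A. if f = e then u f else 0)"
      unfolding bf_sum bf_scale
      by (rule sum.cong) (simp_all add: Ep(3)[OF subsetD[OF A(1)] subsetD[OF A(1) A(4)]])
    finally show "u e = 0" using A(2,4) by simp
  qed
  moreover have "span Ep = span P" using Ep(2) real_vector.span_span by metis
  ultimately show ?thesis using real_vector.dim_eq_card by blast
qed

text \<open>Negating the form swaps the definite parts. Statements on the positive part thereby
  yield statements on the negative one, and the dual representation becomes a Weil representation
  within the same locale.\<close>

lemma lat_gr_neg: "lat_gr (neg_lattice L) b (prod.swap v)"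
proof
  show "lat (neg_lattice L) = {\<Sum>x\<in>b. of_int (c x) *\<^sub>R x | c :: 'v \<Rightarrow> int. True}"
    using lat_eq by (simp add: neg_lattice_def)
  show "bilinear (bform (neg_lattice L))" unfolding neg_lattice_def using bil_neg by simp
  show "bform (neg_lattice L) x y = bform (neg_lattice L) y x" for x y unfolding bform_neg using sym by auto
  show "bform (neg_lattice L) x y \<in> \<int>" if "x \<in> lat (neg_lattice L)" "y \<in> lat (neg_lattice L)" for x y
    unfolding bform_neg using int[of x y] that by (auto simp: neg_lattice_def)
  show "\<exists>m::int. qform (neg_lattice L) x = 2 * of_int m" if x: "x \<in> lat (neg_lattice L)" for x
  proof -
    obtain m :: int where "qform L x = 2 * of_int m" using evn[of x] x by (auto simp: neg_lattice_def)
    then show ?thesis unfolding bform_neg by (intro exI[of _ "- m"]) simp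
  qed
  have d: "\<exists>p\<in>N. \<exists>n\<in>P. x = p + n" for x
    using pp_pm[of x] by (intro bexI[of _ "pm x"] bexI[of _ "pp x"]) (auto simp: add.commute)
  have o: "bform L x y = 0" if "x \<in> N" "y \<in> P" for x y using orth[OF that(2,1)] sym by simp
  show "prod.swap v \<in> grassmannian (neg_lattice L)"
    unfolding grassmannian_def prod.swap_def case_prod_conv mem_Collect_eq bform_neg
    using subP subN PN posP negN o d by (simp add: Int_commute)
qed (use finb indb spanb in auto)

end

section \<open>Sylvester's law of inertia\<close>

text \<open>Projecting one positive part to the other along the negative part is injective: a
  nonzero vector in the kernel would lie in \<open>snd v'\<close> and have positive and negative
  norm at once.\<close>

lemma lat_gr_dim_le:
  assumes "lat_gr L b v" "lat_gr L b v'"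
  shows "dim (fst v) \<le> dim (fst v')"
proof -
  interpret A: lat_gr L b v by fact
  interpret B: lat_gr L b v' by fact
  have inj: "x = 0" if "x \<in> fst v" "B.pp x = 0" for x
  proof (rule ccontr)
    assume "x \<noteq> 0"
    then have "qform L x > 0" using A.posP that by auto
    moreover have "x \<in> snd v'" using B.pp_pm[of x] that B.pm_in[of x] by simp
    ultimately show False using B.negN[of x] \<open>x \<noteq> 0\<close> by force
  qed
  have indE: "\<And>u e. e \<in> A.Ep \<Longrightarrow> (\<Sum>f\<in>A.Ep. u f *\<^sub>R f) = 0 \<Longrightarrow> u e = 0"
  proof -
    fix u e assume e: "e \<in> A.Ep" "(\<Sum>f\<in>A.Ep. u f *\<^sub>R f) = 0"
    then have "0 = bform L (\<Sum>f\<in>A.Ep. u f *\<^sub>R f) e" by simp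
    also have "\<dots> = (\<Sum>f\<in>A.Ep. if f = e then u f else 0)"
      unfolding A.bf_sum A.bf_scale by (rule sum.cong) (use e A.Ep(3) in auto)
    finally show "u e = 0" using e A.Ep(1) by simp
  qed
  have injE: "inj_on B.pp A.Ep"
  proof (rule inj_onI)
    fix e f assume "e \<in> A.Ep" "f \<in> A.Ep" "B.pp e = B.pp f"
    then have "B.pp (e - f) = 0" "e - f \<in> fst v"
      by (simp_all add: linear_diff[OF B.lin_pp] real_vector.subspace_diff[OF A.subP] A.Ep_P)
    then show "e = f" using inj[of "e - f"] by simp
  qed
  have "independent (B.pp ` A.Ep)"
    unfolding real_vector.independent_explicit_module
  proof (intro allI impI)
    fix T u w assume T: "finite T" "T \<subseteq> B.pp ` A.Ep" "(\<Sum>f\<in>T. u f *\<^sub>R f) = 0" "w \<in> T"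
    obtain S where S: "S \<subseteq> A.Ep" "T = B.pp ` S" "inj_on B.pp S"
      using T(2) injE by (metis inj_on_subset subset_image_iff)
    have "(\<Sum>f\<in>S. u (B.pp f) *\<^sub>R B.pp f) = 0"
      using T(3) S by (simp add: sum.reindex)
    then have "B.pp (\<Sum>f\<in>S. u (B.pp f) *\<^sub>R f) = 0"
      by (simp add: linear_sum[OF B.lin_pp] B.pp_scale)
    moreover have "(\<Sum>f\<in>S. u (B.pp f) *\<^sub>R f) \<in> fst v"
      by (intro real_vector.subspace_sum[OF A.subP] real_vector.subspace_scale[OF A.subP] A.Ep_P subsetD[OF S(1)])
    ultimately have "(\<Sum>f\<in>S. u (B.pp f) *\<^sub>R f) = 0" by (rule inj[rotated])
    then have "(\<Sum>f\<in>A.Ep. (if f \<in> S then u (B.pp f) else 0) *\<^sub>R f) = 0"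
      using S(1) A.Ep(1) by (simp add: if_distrib[of "\<lambda>c. c *\<^sub>R _"] sum.If_cases Int_absorb1 cong: if_cong)
    moreover obtain e where "e \<in> S" "w = B.pp e" using T(4) S(2) by auto
    ultimately show "u w = 0" using indE[of e "\<lambda>f. if f \<in> S then u (B.pp f) else 0"] S(1) by auto
  qed
  moreover have "B.pp ` A.Ep \<subseteq> span B.Ep" using B.Ep(2) by auto
  ultimately have "card (B.pp ` A.Ep) \<le> card B.Ep"
    using real_vector.independent_span_bound[OF B.Ep(1)] by blast
  then show ?thesis using A.dim_P B.dim_P card_image[OF injE] by simp
qed

text \<open>Evaluates the definite description in \<open>signature\<close>: the inequality of
  dimensions is applied in both directions, and to the negated lattice for the negative
  parts.\<close>

lemma (in lat_gr) signature_eq: "signature L = (card Ep, card Em)"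
proof -
  have other: "lat_gr L b w" if "w \<in> grassmannian L" for w
    by (rule lat_gr.intro; fact finb indb spanb lat_eq bil sym int evn that)
  have P: "dim (fst w) = dim P" if "w \<in> grassmannian L" for w
    using lat_gr_dim_le other[OF that] other[OF gr] by (metis order_antisym)
  have N: "dim (snd w) = dim N" if "w \<in> grassmannian L" for w
    using lat_gr_dim_le[OF lat_gr.lat_gr_neg[OF other[OF that]] lat_gr_neg]
      lat_gr_dim_le[OF lat_gr_neg lat_gr.lat_gr_neg[OF other[OF that]]] by simp
  have "signature L = (dim P, dim N)"
    unfolding signature_def
  proof (rule the_equality)
    show "\<exists>(P', N')\<in>grassmannian L. (dim P, dim N) = (dim P', dim N')"
      using gr by (intro bexI[of _ v]) (simp_all add: case_prod_unfold)
    show "s = (dim P, dim N)" if "\<exists>(P', N')\<in>grassmannian L. s = (dim P', dim N')" for s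
      using that P N by (auto simp: case_prod_unfold)
  qed
  moreover have "dim N = card Em"
  proof -
    interpret M: lat_gr "neg_lattice L" b "prod.swap v" by (rule lat_gr_neg)
    have "M.Ep = Em" unfolding M.Ep_def Em_def by simp
    then show ?thesis using M.dim_P by simp
  qed
  ultimately show ?thesis using dim_P by simp
qed

section \<open>Dual lattice, discriminant group and Gaussian sums\<close>

lemma exp_abs_int_summable: "(\<lambda>m::int. exp (- \<bar>real_of_int m\<bar>)) summable_on UNIV"
proof -
  have s: "(\<lambda>n::nat. exp (- real n)) summable_on UNIV"
  proof (rule norm_summable_imp_summable_on)
    have "summable (\<lambda>n. exp (-1::real) ^ n)" by (rule summable_geometric) simp
    then show "summable (\<lambda>n. norm (exp (- real n)))" by (simp add: exp_of_nat_mult[symmetric])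
  qed
  have "(\<lambda>m::int. exp (- \<bar>real_of_int m\<bar>)) summable_on range int"
    by (subst summable_on_reindex) (use s in \<open>auto simp: o_def\<close>)
  moreover have "(\<lambda>m::int. exp (- \<bar>real_of_int m\<bar>)) summable_on range (\<lambda>n. - int n)"
    by (subst summable_on_reindex) (use s in \<open>auto simp: o_def inj_on_def\<close>)
  ultimately have "(\<lambda>m::int. exp (- \<bar>real_of_int m\<bar>)) summable_on (range int \<union> range (\<lambda>n. - int n))"
    by (rule summable_on_union)
  moreover have "range int \<union> range (\<lambda>n. - int n) = UNIV"
    by (auto simp: image_iff) (metis int_cases2)
  ultimately show ?thesis by simp
qed

text \<open>A finite set of functions lies in a finite box, over which the sum of products is a
  product of sums.\<close>

lemma summable_on_PiE_prod:
  fixes f :: "'b \<Rightarrow> real"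
  assumes "finite A" "f summable_on UNIV" "\<And>y. f y \<ge> 0"
  shows "(\<lambda>g. \<Prod>x\<in>A. f (g x)) summable_on PiE A (\<lambda>_. UNIV)"
proof (rule nonneg_bdd_above_summable_on)
  show "0 \<le> (\<Prod>x\<in>A. f (g x))" for g using assms(3) by (intro prod_nonneg) auto
  show "bdd_above (sum (\<lambda>g. \<Prod>x\<in>A. f (g x)) ` {F. F \<subseteq> PiE A (\<lambda>_. UNIV) \<and> finite F})"
  proof (intro bdd_aboveI2)
    fix F assume F: "F \<in> {F. F \<subseteq> PiE A (\<lambda>_. (UNIV :: 'b set)) \<and> finite F}"
    define G where "G = (\<Union>g\<in>F. g ` A)"
    have finG: "finite G" unfolding G_def using F assms(1) by auto
    have "sum (\<lambda>g. \<Prod>x\<in>A. f (g x)) F \<le> sum (\<lambda>g. \<Prod>x\<in>A. f (g x)) (PiE A (\<lambda>_. G))"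
      using F finG assms(1,3)
      by (intro sum_mono2 prod_nonneg finite_PiE) (auto simp: PiE_iff G_def)
    also have "\<dots> = (\<Prod>x\<in>A. \<Sum>y\<in>G. f y)"
      by (rule prod_sum_PiE[symmetric]) (use assms(1) finG in auto)
    also have "\<dots> \<le> (\<Prod>x\<in>A. infsum f UNIV)"
      using finG assms(2,3) by (intro prod_mono conjI sum_nonneg finite_sum_le_infsum) auto
    finally show "sum (\<lambda>g. \<Prod>x\<in>A. f (g x)) F \<le> (\<Prod>x\<in>A. infsum f UNIV)" .
  qed
qed

context lat_gr
begin

lemma functional_bounded: "\<exists>K\<ge>0. \<forall>y. \<bar>bform L x y\<bar> \<le> K * norm y"
proof -
  have "bounded_linear (bform L x)"
    by (rule linear_findim_bounded[OF finb indb spanb lin(1)])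
  then obtain K where "K \<ge> 0" "\<And>y. norm (bform L x y) \<le> norm y * K"
    using bounded_linear.nonneg_bounded by blast
  then show ?thesis by (intro exI[of _ K]) (simp add: mult.commute)
qed

lemma bform_bounded: "\<exists>K>0. \<forall>x y. \<bar>bform L x y\<bar> \<le> K * norm x * norm y"
proof -
  obtain K0 where K0: "K0 > 0" "\<And>c e. e \<in> b \<Longrightarrow> \<bar>c e\<bar> \<le> K0 * norm (\<Sum>e\<in>b. c e *\<^sub>R e)"
    using coordinates_bounded[OF finb indb] by auto
  obtain K where K: "\<And>e. K e \<ge> 0" "\<And>e y. \<bar>bform L e y\<bar> \<le> K e * norm y"
    using functional_bounded by metis
  have "\<bar>bform L x y\<bar> \<le> (K0 * (\<Sum>e\<in>b. K e)) * norm x * norm y" for x y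
  proof -
    obtain c where c: "x = (\<Sum>e\<in>b. c e *\<^sub>R e)" using finite_span_sumE[OF finb spanb] .
    have "\<bar>bform L x y\<bar> = \<bar>\<Sum>e\<in>b. c e * bform L e y\<bar>" unfolding c bf_sum bf_scale ..
    also have "\<dots> \<le> (\<Sum>e\<in>b. \<bar>c e * bform L e y\<bar>)" by (rule sum_abs)
    also have "\<dots> \<le> (\<Sum>e\<in>b. (K0 * norm x) * (K e * norm y))"
      unfolding abs_mult by (intro sum_mono mult_mono K) (use K0 c in auto)
    finally show ?thesis by (simp add: sum_distrib_left sum_distrib_right mult_ac)
  qed
  then have "\<bar>bform L x y\<bar> \<le> (K0 * (\<Sum>e\<in>b. K e) + 1) * norm x * norm y" for x y
    by (rule order_trans) (intro mult_right_mono, auto)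
  moreover have "K0 * (\<Sum>e\<in>b. K e) + 1 > 0"
    using K0 K by (intro add_nonneg_pos mult_nonneg_nonneg sum_nonneg) auto
  ultimately show ?thesis by blast
qed

lemma qp_nonneg: "qp x \<ge> 0" and qm_nonpos: "qm x \<le> 0"
  unfolding qp_eq qm_eq by (auto intro: sum_nonneg)

text \<open>\<open>qp x - qm x\<close> is the sum of the squared pairings with \<open>Ep\<close> and
  \<open>Em\<close>, and up to sign these pairings are the coordinates of \<open>x\<close>.
  Multiplied by \<open>pi * Im \<tau>\<close> it is the Gaussian decay of a theta term.\<close>

lemma majorant: "\<exists>c>0. \<forall>x. qp x - qm x \<ge> c * (norm x)\<^sup>2"
proof -
  define A1 where "A1 = (\<Sum>e\<in>Ep. (norm e)\<^sup>2)"
  define A2 where "A2 = (\<Sum>e\<in>Em. (norm e)\<^sup>2)"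
  have A: "A1 \<ge> 0" "A2 \<ge> 0" unfolding A1_def A2_def by (auto intro: sum_nonneg)
  have "(norm x)\<^sup>2 \<le> 2 * (A1 + A2 + 1) * (qp x - qm x)" for x
  proof -
    define s1 where "s1 = (\<Sum>e\<in>Ep. \<bar>bform L x e\<bar> * norm e)"
    define s2 where "s2 = (\<Sum>e\<in>Em. \<bar>bform L x e\<bar> * norm e)"
    have "norm (pp x) \<le> s1" unfolding pp_eq s1_def by (rule order_trans[OF norm_sum]) simp
    moreover have "norm (pm x) \<le> s2" unfolding pm_eq s2_def norm_minus_cancel by (rule order_trans[OF norm_sum]) simp
    moreover have "norm x \<le> norm (pp x) + norm (pm x)" by (metis norm_triangle_ineq pp_pm)
    ultimately have "norm x \<le> s1 + s2" by linarith
    then have "(norm x)\<^sup>2 \<le> (s1 + s2)\<^sup>2" by (intro power_mono) auto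
    also have "\<dots> \<le> 2 * s1\<^sup>2 + 2 * s2\<^sup>2" using sum_squares_bound[of s1 s2] by (simp add: power2_sum)
    finally have 1: "(norm x)\<^sup>2 \<le> 2 * s1\<^sup>2 + 2 * s2\<^sup>2" .
    have "s1\<^sup>2 \<le> (\<Sum>e\<in>Ep. \<bar>bform L x e\<bar>\<^sup>2) * A1" unfolding s1_def A1_def by (rule Cauchy_Schwarz_ineq_sum)
    then have 2: "s1\<^sup>2 \<le> qp x * A1" by (simp add: qp_eq)
    have "s2\<^sup>2 \<le> (\<Sum>e\<in>Em. \<bar>bform L x e\<bar>\<^sup>2) * A2" unfolding s2_def A2_def by (rule Cauchy_Schwarz_ineq_sum)
    then have 3: "s2\<^sup>2 \<le> - qm x * A2" by (simp add: qm_eq)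
    have "0 \<le> qp x * A2" "0 \<le> - qm x * A1" "0 \<le> qp x" "qm x \<le> 0"
      using A qp_nonneg qm_nonpos by (auto intro: mult_nonneg_nonneg simp: mult_nonpos_nonneg)
    with 1 2 3 show ?thesis by (simp add: algebra_simps)
  qed
  then have "qp x - qm x \<ge> 1 / (2 * (A1 + A2 + 1)) * (norm x)\<^sup>2" for x
    using A by (simp add: field_simps)
  then show ?thesis using A by (intro exI[of _ "1 / (2 * (A1 + A2 + 1))"]) auto
qed

text \<open>Expanding \<open>x\<close> in \<open>Ep\<close> and \<open>Em\<close> writes each
  coordinate functional as the pairing with an explicit vector; the minus sign compensates the norm
  -1 on \<open>Em\<close>.\<close>

lemma dual_basis_exists: "\<exists>dl. \<forall>e\<in>b. \<forall>e'\<in>b. bform L (dl e) e' = (if e = e' then 1 else 0)"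
proof -
  define rp where "rp = real_vector.representation b"
  have sp: "x \<in> span b" for x using spanb by simp
  have lr: "linear (\<lambda>x. rp x e)" for e
    by (rule linearI) (simp_all add: rp_def real_vector.representation_add[OF indb sp sp]
        real_vector.representation_scale[OF indb sp])
  define dl where "dl = (\<lambda>e. (\<Sum>f\<in>Ep. rp f e *\<^sub>R f) - (\<Sum>f\<in>Em. rp f e *\<^sub>R f))"
  have "bform L (dl e) x = rp x e" for e x
  proof -
    have "rp x e = rp (pp x + pm x) e" by (simp add: pp_pm)
    also have "\<dots> = rp (pp x) e + rp (pm x) e" by (rule linear_add[OF lr])
    also have "rp (pp x) e = (\<Sum>f\<in>Ep. bform L x f * rp f e)"
      unfolding pp_eq[of x] linear_sum[OF lr] linear_scale[OF lr] by simp
    also have "rp (pm x) e = - (\<Sum>f\<in>Em. bform L x f * rp f e)"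
      unfolding pm_eq[of x] linear_neg[OF lr] linear_sum[OF lr] linear_scale[OF lr] by simp
    finally show ?thesis unfolding dl_def bf_diff bf_sum bf_scale by (simp add: sym mult.commute)
  qed
  then show ?thesis
    by (intro exI[of _ dl]) (simp add: rp_def real_vector.representation_basis[OF indb])
qed

definition "dl = (SOME dl. \<forall>e\<in>b. \<forall>e'\<in>b. bform L (dl e) e' = (if e = e' then 1 else 0))"

lemma dl: "e \<in> b \<Longrightarrow> e' \<in> b \<Longrightarrow> bform L (dl e) e' = (if e = e' then 1 else 0)"
  using someI_ex[OF dual_basis_exists, folded dl_def] by blast

lemma expand_dl: "x = (\<Sum>e\<in>b. bform L x (dl e) *\<^sub>R e)"
proof -
  obtain c where c: "x = (\<Sum>e\<in>b. c e *\<^sub>R e)" using finite_span_sumE[OF finb spanb] .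
  have "bform L x (dl e) = c e" if "e \<in> b" for e
  proof -
    have "bform L x (dl e) = (\<Sum>f\<in>b. if f = e then c f else 0)"
      unfolding c bf_sum bf_scale by (rule sum.cong) (use dl that sym in auto)
    then show ?thesis using that finb by simp
  qed
  then show ?thesis unfolding c by auto
qed

lemma nondeg: "(\<And>e. e \<in> b \<Longrightarrow> bform L z e = 0) \<Longrightarrow> z = 0"
proof -
  assume z: "\<And>e. e \<in> b \<Longrightarrow> bform L z e = 0"
  have "bform L z y = 0" for y
    by (subst expand_dl[of y]) (simp add: bf_sum bf_scale z)
  then show ?thesis by (subst expand_dl[of z]) simp
qed

abbreviation "Ld \<equiv> dual_lattice L"

lemma b_lat: "e \<in> b \<Longrightarrow> e \<in> lat L"
proof -
  assume e: "e \<in> b"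
  have "(\<Sum>x\<in>b. of_int (if x = e then 1 else 0) *\<^sub>R x) = (\<Sum>x\<in>b. if x = e then x else 0)"
    by (rule sum.cong) auto
  also have "\<dots> = e" using e finb by simp
  finally show ?thesis unfolding lat_eq by (intro CollectI exI[of _ "\<lambda>x. if x = e then 1 else 0"]) simp
qed

lemma Ld_iff: "x \<in> Ld \<longleftrightarrow> (\<forall>e\<in>b. bform L x e \<in> \<int>)"
proof
  assume "\<forall>e\<in>b. bform L x e \<in> \<int>"
  then have "bform L x y \<in> \<int>" if "y \<in> lat L" for y
    using that unfolding lat_eq by (auto simp: bf_sum bf_scale intro!: Ints_sum Ints_mult)
  then show "x \<in> Ld" by (simp add: dual_lattice_def)
qed (auto simp: dual_lattice_def b_lat)

lemma lat_iff: "x \<in> lat L \<longleftrightarrow> (\<forall>e\<in>b. bform L x (dl e) \<in> \<int>)"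
proof
  assume "x \<in> lat L"
  then obtain c :: "'v \<Rightarrow> int" where c: "x = (\<Sum>e\<in>b. of_int (c e) *\<^sub>R e)" unfolding lat_eq by auto
  show "\<forall>e\<in>b. bform L x (dl e) \<in> \<int>"
  proof
    fix e assume e: "e \<in> b"
    have "bform L x (dl e) = (\<Sum>f\<in>b. if f = e then of_int (c f) else 0)"
      unfolding c bf_sum bf_scale by (rule sum.cong) (use dl e sym in auto)
    then show "bform L x (dl e) \<in> \<int>" using e finb by simp
  qed
next
  assume "\<forall>e\<in>b. bform L x (dl e) \<in> \<int>"
  then have "\<forall>e\<in>b. bform L x (dl e) = of_int \<lfloor>bform L x (dl e)\<rfloor>" by (auto elim: Ints_cases)
  then have "x = (\<Sum>e\<in>b. of_int \<lfloor>bform L x (dl e)\<rfloor> *\<^sub>R e)"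
    by (subst expand_dl[of x]) (rule sum.cong, auto)
  then show "x \<in> lat L"
    unfolding lat_eq by (intro CollectI exI[of _ "\<lambda>e. \<lfloor>bform L x (dl e)\<rfloor>"] conjI TrueI)
qed

lemma lat_add: "x \<in> lat L \<Longrightarrow> y \<in> lat L \<Longrightarrow> x + y \<in> lat L"
  and lat_diff: "x \<in> lat L \<Longrightarrow> y \<in> lat L \<Longrightarrow> x - y \<in> lat L"
  and lat_minus: "x \<in> lat L \<Longrightarrow> - x \<in> lat L"
  and lat_0: "0 \<in> lat L"
  unfolding lat_iff by (auto simp: bf_simps)

lemma Ld_add: "x \<in> Ld \<Longrightarrow> y \<in> Ld \<Longrightarrow> x + y \<in> Ld"
  and Ld_diff: "x \<in> Ld \<Longrightarrow> y \<in> Ld \<Longrightarrow> x - y \<in> Ld"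
  and Ld_minus: "x \<in> Ld \<Longrightarrow> - x \<in> Ld"
  and Ld_0: "0 \<in> Ld"
  unfolding Ld_iff by (auto simp: bf_simps)

lemma lat_Ld: "x \<in> lat L \<Longrightarrow> x \<in> Ld"
  using int by (auto simp: dual_lattice_def)

lemma dl_Ld: "e \<in> b \<Longrightarrow> dl e \<in> Ld"
  unfolding Ld_iff using dl by auto

lemma Ld_lat_Ints: "x \<in> Ld \<Longrightarrow> y \<in> lat L \<Longrightarrow> bform L x y \<in> \<int>"
  by (simp add: dual_lattice_def)

text \<open>Biduality: the pairings with the dual basis are the coordinates. It supplies the
  nontrivial characters for \<open>character_sum\<close>.\<close>

lemma Ld_Ld_lat: "(\<And>y. y \<in> Ld \<Longrightarrow> bform L x y \<in> \<int>) \<Longrightarrow> x \<in> lat L"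
  unfolding lat_iff using dl_Ld by auto

text \<open>Integer frequency vectors along \<open>b\<close> correspond to dual lattice vectors, by
  which the Fourier analysis is indexed.\<close>

lemma Ld_of_int_exists: "\<exists>\<mu>\<in>Ld. \<forall>e\<in>b. bform L \<mu> e = of_int (m e)"
proof -
  let ?\<mu> = "\<Sum>e\<in>b. of_int (m e) *\<^sub>R dl e"
  have *: "bform L ?\<mu> f = of_int (m f)" if "f \<in> b" for f
  proof -
    have "bform L ?\<mu> f = (\<Sum>e\<in>b. if e = f then of_int (m e) else 0)"
      unfolding bf_sum bf_scale by (rule sum.cong) (use dl that in auto)
    then show ?thesis using that finb by simp
  qed
  then have "?\<mu> \<in> Ld" unfolding Ld_iff by simp
  with * show ?thesis by blast
qed

definition "cls x = {y \<in> Ld. x - y \<in> lat L}"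

lemma disc_eq: "disc L = cls ` Ld"
  unfolding disc_def quotient_def cls_def by auto

lemma cls_self: "x \<in> Ld \<Longrightarrow> x \<in> cls x"
  by (simp add: cls_def lat_0)

lemma cls_eq_iff: "x \<in> Ld \<Longrightarrow> y \<in> Ld \<Longrightarrow> cls x = cls y \<longleftrightarrow> x - y \<in> lat L"
proof
  assume "x \<in> Ld" "y \<in> Ld" "cls x = cls y"
  then have "y \<in> cls x" using cls_self by simp
  then show "x - y \<in> lat L" by (simp add: cls_def)
next
  assume xy: "x - y \<in> lat L"
  have "x - z \<in> lat L \<longleftrightarrow> y - z \<in> lat L" for z
    using lat_add[OF xy, of "y - z"] lat_diff[OF _ xy, of "x - z"] by auto
  then show "cls x = cls y" unfolding cls_def by simp
qed

lemma disc_cases: "\<gamma> \<in> disc L \<Longrightarrow> x \<in> \<gamma> \<Longrightarrow> x \<in> Ld \<and> \<gamma> = cls x"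
proof -
  assume "\<gamma> \<in> disc L" "x \<in> \<gamma>"
  then obtain y where y: "y \<in> Ld" "\<gamma> = cls y" unfolding disc_eq by auto
  then have "x \<in> Ld" "y - x \<in> lat L" using \<open>x \<in> \<gamma>\<close> by (auto simp: cls_def)
  then show ?thesis using y cls_eq_iff by auto
qed

lemma rep_in: "\<gamma> \<in> disc L \<Longrightarrow> rep \<gamma> \<in> \<gamma>"
  unfolding disc_eq rep_def using cls_self by (auto intro: someI[of "\<lambda>x. x \<in> _"])

lemma rep_Ld: "\<gamma> \<in> disc L \<Longrightarrow> rep \<gamma> \<in> Ld"
  and cls_rep: "\<gamma> \<in> disc L \<Longrightarrow> cls (rep \<gamma>) = \<gamma>"
  using disc_cases rep_in by blast+

lemma cls_disc: "x \<in> Ld \<Longrightarrow> cls x \<in> disc L"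
  by (simp add: disc_eq)

lemma rep_cls: "x \<in> Ld \<Longrightarrow> x - rep (cls x) \<in> lat L"
  using cls_eq_iff[of x "rep (cls x)"] cls_rep[OF cls_disc] rep_Ld[OF cls_disc] by auto

lemma cls_translate: "x \<in> Ld \<Longrightarrow> cls x = (\<lambda>s. s + x) ` lat L"
proof -
  assume x: "x \<in> Ld"
  have "y \<in> cls x \<Longrightarrow> y = - (x - y) + x \<and> - (x - y) \<in> lat L" for y
    using lat_minus[of "x - y"] unfolding cls_def by auto
  moreover have "s + x \<in> cls x" if "s \<in> lat L" for s
    using lat_minus[OF that] Ld_add[OF lat_Ld[OF that] x] by (simp add: cls_def)
  ultimately show ?thesis by blast
qed

lemma disc_disjoint: "\<gamma> \<in> disc L \<Longrightarrow> \<delta> \<in> disc L \<Longrightarrow> \<gamma> \<noteq> \<delta> \<Longrightarrow> \<gamma> \<inter> \<delta> = {}"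
  using disc_cases by blast

lemma Union_disc: "\<Union>(disc L) = Ld"
  using cls_self disc_cases cls_disc by blast

text \<open>Rounding the coordinates down moves a representative into a fundamental parallelepiped
  \<open>F\<close>. There the pairings with \<open>b\<close> are integers of bounded size, and they
  determine the vector.\<close>

lemma finite_disc: "finite (disc L)"
proof -
  define F where "F = {x \<in> Ld. \<forall>e\<in>b. 0 \<le> bform L x (dl e) \<and> bform L x (dl e) < 1}"
  define M where "M = (\<lambda>f. \<Sum>e\<in>b. \<bar>bform L e f\<bar>)"
  define h where "h = (\<lambda>x. restrict (bform L x) b)"
  have bound: "\<bar>bform L x f\<bar> \<le> M f" if "x \<in> F" for x f
  proof -
    have "bform L x f = (\<Sum>e\<in>b. bform L x (dl e) * bform L e f)"
      by (subst expand_dl[of x]) (simp add: bf_sum bf_scale)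
    also have "\<bar>\<dots>\<bar> \<le> (\<Sum>e\<in>b. \<bar>bform L x (dl e) * bform L e f\<bar>)" by (rule sum_abs)
    also have "\<dots> \<le> (\<Sum>e\<in>b. 1 * \<bar>bform L e f\<bar>)"
      unfolding abs_mult by (intro sum_mono mult_right_mono) (use that in \<open>auto simp: F_def\<close>)
    finally show ?thesis by (simp add: M_def)
  qed
  have "h ` F \<subseteq> PiE b (\<lambda>f. {k \<in> \<int>. \<bar>k\<bar> \<le> M f})"
    using bound by (auto simp: h_def F_def Ld_iff)
  then have "finite (h ` F)"
    by (rule finite_subset) (intro finite_PiE finb finite_abs_int_segment)
  moreover have "inj_on h F"
  proof (rule inj_onI)
    fix x y assume "h x = h y"
    then have "bform L x e = bform L y e" if "e \<in> b" for e
      using that unfolding h_def by (metis restrict_apply')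
    then show "x = y" using nondeg[of "x - y"] by (simp add: bf_diff)
  qed
  ultimately have finF: "finite F" by (rule finite_imageD)
  have "disc L \<subseteq> cls ` F"
  proof
    fix \<gamma> assume "\<gamma> \<in> disc L"
    then obtain x where x: "x \<in> Ld" "\<gamma> = cls x" by (auto simp: disc_eq)
    define s where "s = (\<Sum>e\<in>b. of_int \<lfloor>bform L x (dl e)\<rfloor> *\<^sub>R e)"
    have s: "s \<in> lat L" unfolding s_def lat_eq
      by (intro CollectI exI[of _ "\<lambda>e. \<lfloor>bform L x (dl e)\<rfloor>"] conjI TrueI refl)
    have sd: "bform L s (dl e) = of_int \<lfloor>bform L x (dl e)\<rfloor>" if "e \<in> b" for e
    proof -
      have "bform L s (dl e) = (\<Sum>f\<in>b. if f = e then of_int \<lfloor>bform L x (dl f)\<rfloor> else 0)"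
        unfolding s_def bf_sum bf_scale by (rule sum.cong) (use dl that sym in auto)
      then show ?thesis using that finb by simp
    qed
    have "x - s \<in> F"
      unfolding F_def using x s sd by (auto simp: Ld_diff lat_Ld bf_diff) linarith+
    moreover have "cls (x - s) = \<gamma>"
      using x s cls_eq_iff[of "x - s" x] by (simp add: Ld_diff lat_Ld lat_minus)
    ultimately show "\<gamma> \<in> cls ` F" by blast
  qed
  then show ?thesis using finF by (meson finite_imageI finite_subset)
qed

lemma card_disc_pos: "card (disc L) > 0"
  using finite_disc cls_disc[OF Ld_0] by (auto simp: card_gt_0_iff)

text \<open>A dual vector is determined by its integer pairings with \<open>b\<close>, so this is
  part of a product of one-dimensional geometric sums.\<close>

lemma lattice_exp_summable: "(\<lambda>x. exp (- (\<Sum>e\<in>b. \<bar>bform L x e\<bar>))) summable_on Ld"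
proof -
  define h where "h = (\<lambda>x. restrict (\<lambda>e. \<lfloor>bform L x e\<rfloor>) b)"
  have fl: "of_int \<lfloor>bform L x e\<rfloor> = bform L x e" if "x \<in> Ld" "e \<in> b" for x e
    using that unfolding Ld_iff by (auto elim: Ints_cases)
  have inj: "inj_on h Ld"
  proof (rule inj_onI)
    fix x y assume xy: "x \<in> Ld" "y \<in> Ld" "h x = h y"
    have "bform L x e = bform L y e" if "e \<in> b" for e
      using that xy fl[OF xy(1) that] fl[OF xy(2) that] unfolding h_def by (metis restrict_apply')
    then show "x = y" using nondeg[of "x - y"] by (simp add: bf_diff)
  qed
  have "(\<lambda>g. \<Prod>e\<in>b. exp (- \<bar>real_of_int (g e)\<bar>)) summable_on PiE b (\<lambda>_. UNIV)"
    by (rule summable_on_PiE_prod[OF finb exp_abs_int_summable]) auto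
  then have "(\<lambda>g. \<Prod>e\<in>b. exp (- \<bar>real_of_int (g e)\<bar>)) summable_on h ` Ld"
    by (rule summable_on_subset_banach) (auto simp: h_def)
  then have "((\<lambda>g. \<Prod>e\<in>b. exp (- \<bar>real_of_int (g e)\<bar>)) \<circ> h) summable_on Ld"
    using summable_on_reindex[OF inj] by blast
  moreover have "((\<lambda>g. \<Prod>e\<in>b. exp (- \<bar>real_of_int (g e)\<bar>)) \<circ> h) x = exp (- (\<Sum>e\<in>b. \<bar>bform L x e\<bar>))"
    if "x \<in> Ld" for x
  proof -
    have "(\<Sum>e\<in>b. \<bar>real_of_int \<lfloor>bform L x e\<rfloor>\<bar>) = (\<Sum>e\<in>b. \<bar>bform L x e\<bar>)"
      by (rule sum.cong) (simp_all only: fl[OF that])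
    then show ?thesis by (simp add: h_def exp_sum[OF finb, symmetric] sum_negf)
  qed
  ultimately show ?thesis by (simp cong: summable_on_cong)
qed

text \<open>Completing the square trades the Gaussian for linear decay of any prescribed rate;
  \<open>D\<close> is the rate that beats the pairings with \<open>b\<close>.\<close>

lemma gauss_summable:
  assumes "a > 0"
  shows "(\<lambda>x. exp (- a * (norm (x + s))\<^sup>2 + C * norm (x + s))) summable_on Ld"
proof -
  obtain K where K: "\<And>e. K e \<ge> 0" "\<And>e y. \<bar>bform L e y\<bar> \<le> K e * norm y"
    using functional_bounded by metis
  define D where "D = (\<Sum>e\<in>b. K e)"
  define M where "M = (C + D)\<^sup>2 / (4 * a) + (\<Sum>e\<in>b. \<bar>bform L s e\<bar>)"
  have "exp (- a * (norm (x + s))\<^sup>2 + C * norm (x + s)) \<le> exp M * exp (- (\<Sum>e\<in>b. \<bar>bform L x e\<bar>))" for x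
  proof -
    let ?t = "norm (x + s)"
    have "0 \<le> (2 * a * ?t - (C + D))\<^sup>2" by simp
    then have "0 \<le> (2 * a * ?t - (C + D))\<^sup>2 / (4 * a)" using assms by simp
    also have "\<dots> = a * ?t\<^sup>2 - (C + D) * ?t + (C + D)\<^sup>2 / (4 * a)"
      using assms by (simp add: field_simps power2_eq_square)
    finally have 1: "- a * ?t\<^sup>2 + C * ?t \<le> (C + D)\<^sup>2 / (4 * a) - D * ?t" by (simp add: algebra_simps)
    have "(\<Sum>e\<in>b. \<bar>bform L x e\<bar>) \<le> (\<Sum>e\<in>b. K e * ?t + \<bar>bform L s e\<bar>)"
    proof (rule sum_mono)
      fix e assume "e \<in> b"
      have "\<bar>bform L x e\<bar> \<le> \<bar>bform L (x + s) e\<bar> + \<bar>bform L s e\<bar>" unfolding bf_add by linarith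
      then show "\<bar>bform L x e\<bar> \<le> K e * ?t + \<bar>bform L s e\<bar>" using K(2)[of e "x + s"] sym[of e "x + s"] by linarith
    qed
    also have "\<dots> = D * ?t + (\<Sum>e\<in>b. \<bar>bform L s e\<bar>)" by (simp add: D_def sum.distrib sum_distrib_right)
    finally have "- a * ?t\<^sup>2 + C * ?t \<le> M + - (\<Sum>e\<in>b. \<bar>bform L x e\<bar>)" using 1 unfolding M_def by linarith
    then show ?thesis by (simp flip: exp_add)
  qed
  then show ?thesis
    by (intro Infinite_Sum.summable_on_comparison_test[OF summable_on_cmult_right[OF lattice_exp_summable]]) auto
qed

end

lemma sum_apply: "(\<Sum>i\<in>A. f i) x = (\<Sum>i\<in>A. f i x)"
  for f :: "'i \<Rightarrow> 'x \<Rightarrow> 'b::comm_monoid_add"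
  by (induction A rule: infinite_finite_induct) (auto simp: zero_fun_def plus_fun_def)

section \<open>The complexified quadratic space\<close>

lemma upper_half_plane_iff: "\<tau> \<in> upper_half_plane \<longleftrightarrow> Im \<tau> > 0"
  by (simp add: upper_half_plane_def)

lemma cscale_simps:
  "cscale (a + c) z = cscale a z + cscale c z" "cscale a (z + w) = cscale a z + cscale a w"
  "cscale a (cscale c z) = cscale (a * c) z" "cscale 1 z = z" "cscale a (- z) = - cscale a z"
  "cscale a 0 = 0" "cscale 0 z = 0"
  by (auto simp: cscale_def prod_eq_iff algebra_simps)

lemma cscale_of_real: "cscale (of_real r) z = r *\<^sub>R z"
  by (simp add: cscale_def prod_eq_iff)

lemma emb_simps: "emb (x + y) = emb x + emb y" "emb (x - y) = emb x - emb y" "emb (- x) = - emb x"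
    "emb 0 = 0" "emb (r *\<^sub>R x) = cscale (of_real r) (emb x)"
  by (auto simp: emb_def prod_eq_iff cscale_def)

lemma bounded_linear_cscale: "bounded_linear (\<lambda>c. cscale c z)"
proof (rule bounded_linear_intro[where K = "2 * (norm (fst z) + norm (snd z))"])
  show "norm (cscale c z) \<le> norm c * (2 * (norm (fst z) + norm (snd z)))" for c
  proof -
    have "norm (cscale c z) \<le> norm (fst (cscale c z)) + norm (snd (cscale c z))"
      by (simp add: norm_prod_def sqrt_sum_squares_le_sum)
    also have "\<dots> \<le> (norm c * norm (fst z) + norm c * norm (snd z)) + (norm c * norm (snd z) + norm c * norm (fst z))"
      unfolding cscale_def fst_conv snd_conv
      by (intro add_mono order_trans[OF norm_triangle_ineq4] order_trans[OF norm_triangle_ineq])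
         (auto intro!: mult_right_mono abs_Re_le_cmod abs_Im_le_cmod)
    finally show ?thesis by (simp add: algebra_simps)
  qed
qed (auto simp: cscale_def prod_eq_iff algebra_simps)

context lat_gr
begin

definition "cp z = (pp (fst z), pp (snd z))"
definition "cm z = (pm (fst z), pm (snd z))"

lemma cproj_eq: "cproj_plus v = cp" "cproj_minus v = cm"
  by (auto simp: fun_eq_iff cproj_plus_def cproj_minus_def cp_def cm_def pp_def pm_def)

abbreviation "Bc \<equiv> cbform L"

definition "Bp z w = Bc (cp z) (cp w)"
definition "Bm z w = Bc (cm z) (cm w)"

text \<open>Multiplication by \<open>\<tau>\<close> on the positive and by its conjugate on the
  negative part: an action of the complex numbers that commutes with scalars. It puts both parts
  into one formula: elliptic translations are by \<open>mv \<tau> (emb \<sigma>)\<close>, the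
  modular action is \<open>mv (1 / j)\<close>.\<close>

definition "mv \<tau> z = cscale \<tau> (cp z) + cscale (cnj \<tau>) (cm z)"

text \<open>Equal to \<open>Bc (mv \<tau> z) z\<close>. Half of its value at \<open>emb x\<close> is
  the exponent of a theta term at \<open>\<zeta> = 0\<close>; with \<open>1 / j\<close> in place of
  \<open>\<tau>\<close> it gives the exponential factor of the modular law.\<close>

definition "Q \<tau> z = \<tau> * Bp z z + cnj \<tau> * Bm z z"

lemma Bc_add: "Bc (z + z') w = Bc z w + Bc z' w" "Bc w (z + z') = Bc w z + Bc w z'"
  by (auto simp: cbform_def complex_eq_iff bf_simps)

lemma Bc_cscale: "Bc (cscale c z) w = c * Bc z w" "Bc w (cscale c z) = c * Bc w z"
  by (auto simp: cbform_def complex_eq_iff bf_simps cscale_def algebra_simps)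

lemma Bc_sym: "Bc z w = Bc w z"
  by (auto simp: cbform_def complex_eq_iff sym[of "fst z"] sym[of "snd z"])

lemma Bc_minus: "Bc (- z) w = - Bc z w" "Bc w (- z) = - Bc w z"
  by (auto simp: cbform_def complex_eq_iff bf_simps)

lemma Bc_0 [simp]: "Bc 0 w = 0" "Bc w 0 = 0"
  by (auto simp: cbform_def complex_eq_iff)

lemma Bc_emb: "Bc (emb x) (emb y) = of_real (bform L x y)"
  by (simp add: cbform_def emb_def complex_eq_iff)

lemma cp_add: "cp (z + w) = cp z + cp w" and cm_add: "cm (z + w) = cm z + cm w"
  by (auto simp: cp_def cm_def pp_add pm_add)

lemma pp_neg: "pp (- x) = - pp x" and pm_neg: "pm (- x) = - pm x"
  by (auto simp: linear_neg[OF lin_pp] linear_neg[OF lin_pm])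

lemma pp_diff: "pp (x - y) = pp x - pp y" and pm_diff: "pm (x - y) = pm x - pm y"
  by (auto simp: linear_diff[OF lin_pp] linear_diff[OF lin_pm])

lemma pp_0 [simp]: "pp 0 = 0" and pm_0 [simp]: "pm 0 = 0"
  by (auto simp: linear_0[OF lin_pp] linear_0[OF lin_pm])

lemma cp_minus: "cp (- z) = - cp z" and cm_minus: "cm (- z) = - cm z"
  by (auto simp: cp_def cm_def pp_neg pm_neg)

lemma cp_cscale: "cp (cscale c z) = cscale c (cp z)" and cm_cscale: "cm (cscale c z) = cscale c (cm z)"
  by (auto simp: cp_def cm_def cscale_def pp_add pm_add pp_diff pm_diff pp_scale pm_scale)

lemma cp_idem [simp]: "cp (cp z) = cp z" "cm (cm z) = cm z" "cp (cm z) = 0" "cm (cp z) = 0" "cp 0 = 0" "cm 0 = 0"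
  by (auto simp: cp_def cm_def zero_prod_def)

lemma cp_cm: "cp z + cm z = z"
  by (simp add: cp_def cm_def prod_eq_iff pp_pm)

lemma cp_emb: "cp (emb x) = emb (pp x)" and cm_emb: "cm (emb x) = emb (pm x)"
  by (auto simp: cp_def cm_def emb_def)

lemma Bc_split: "Bc z w = Bp z w + Bm z w"
  by (simp add: Bp_def Bm_def cp_def cm_def cbform_def complex_eq_iff bf_split[of "fst z"] bf_split[of "snd z"])

lemma Bpm_add: "Bp (z + z') w = Bp z w + Bp z' w" "Bp w (z + z') = Bp w z + Bp w z'"
    "Bm (z + z') w = Bm z w + Bm z' w" "Bm w (z + z') = Bm w z + Bm w z'"
  by (auto simp: Bp_def Bm_def cp_add cm_add Bc_add)

lemma Bpm_minus: "Bp (- z) w = - Bp z w" "Bp w (- z) = - Bp w z"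
    "Bm (- z) w = - Bm z w" "Bm w (- z) = - Bm w z"
  by (auto simp: Bp_def Bm_def cp_minus cm_minus Bc_minus)

lemma Bpm_cscale: "Bp (cscale c z) w = c * Bp z w" "Bp w (cscale c z) = c * Bp w z"
    "Bm (cscale c z) w = c * Bm z w" "Bm w (cscale c z) = c * Bm w z"
  by (auto simp: Bp_def Bm_def cp_cscale cm_cscale Bc_cscale)

lemma Bpm_mv: "Bp (mv c z) w = c * Bp z w" "Bp w (mv c z) = c * Bp w z"
    "Bm (mv c z) w = cnj c * Bm z w" "Bm w (mv c z) = cnj c * Bm w z"
  by (auto simp: Bp_def Bm_def mv_def cp_cscale cm_cscale cp_add cm_add cscale_simps Bc_cscale)

lemma Bpm_sym: "Bp z w = Bp w z" "Bm z w = Bm w z"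
  unfolding Bp_def Bm_def by (rule Bc_sym)+

lemma Bpm_0 [simp]: "Bp 0 w = 0" "Bp w 0 = 0" "Bm 0 w = 0" "Bm w 0 = 0"
  by (auto simp: Bp_def Bm_def)

lemma Bpm_emb: "Bp (emb x) (emb x) = of_real (qp x)" "Bm (emb x) (emb x) = of_real (qm x)"
  by (auto simp: Bp_def Bm_def cp_emb cm_emb Bc_emb qp_def qm_def)

lemma qform_split: "qform L x = qp x + qm x"
  using bf_split[of x x] by (simp add: qp_def qm_def)

lemmas B_simps = Bc_split Bpm_add Bpm_minus Bpm_cscale Bpm_mv

lemma mv_add: "mv c (z + w) = mv c z + mv c w"
  by (simp add: mv_def cp_add cm_add cscale_simps algebra_simps)

lemma mv_minus: "mv c (- z) = - mv c z"
  by (simp add: mv_def cp_minus cm_minus cscale_simps)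

lemma mv_0 [simp]: "mv c 0 = 0"
  by (simp add: mv_def cscale_simps)

lemma mv_mv: "mv a (mv c z) = mv (a * c) z"
  by (simp add: mv_def cp_cscale cm_cscale cp_add cm_add cscale_simps)

lemma mv_plus: "mv (a + c) z = mv a z + mv c z"
  by (simp add: mv_def cscale_simps algebra_simps)

lemma mv_of_real: "mv (of_real r) z = cscale (of_real r) z"
  by (simp add: mv_def cscale_simps[symmetric] cp_cm)

lemma mv_1 [simp]: "mv 1 z = z"
  using mv_of_real[of 1 z] by (simp add: cscale_simps)

lemma mv_neg: "mv (- c) z = - mv c z"
proof -
  have "mv (- c) z + mv c z = mv 0 z" by (simp add: mv_plus[symmetric])
  also have "\<dots> = 0" using mv_of_real[of 0 z] by (simp add: cscale_simps)
  finally show ?thesis by (simp add: eq_neg_iff_add_eq_0)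
qed

lemma theta_term_eq: "theta_term L v \<tau> \<zeta> x = ee (Q \<tau> (emb x) / 2 + Bc (emb x) \<zeta>)"
  by (simp add: theta_term_def Q_def Bpm_emb qp_def qm_def pp_def pm_def add_divide_distrib)

section \<open>Theta series\<close>

text \<open>The exponent of a theta term as a form in the pair of \<open>\<tau>\<close> and
  \<open>\<zeta>\<close>, only real-linear because of the conjugate. Both variables can thus be
  differentiated at once.\<close>

definition "lx x u = 2 * of_real pi * \<i> *
  (fst u * of_real (qp x) / 2 + cnj (fst u) * of_real (qm x) / 2 + Bc (emb x) (snd u))"

lemma theta_term_lx: "theta_term L v \<tau> \<zeta> x = exp (lx x (\<tau>, \<zeta>))"
  unfolding theta_term_eq lx_def ee_def Q_def Bpm_emb by (simp add: add_divide_distrib)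

lemma linear_lx: "linear (lx x)"
  by (rule linearI)
     (auto simp: lx_def Bc_add cscale_of_real[symmetric] Bc_cscale scaleR_conv_of_real ring_distribs add_divide_distrib)

lemma lx_bound: "\<exists>K\<ge>0. \<forall>x u. cmod (lx x u) \<le> K * ((norm x)\<^sup>2 + norm x) * norm u"
proof -
  obtain K where K: "K > 0" "\<And>x y. \<bar>bform L x y\<bar> \<le> K * norm x * norm y" using bform_bounded by blast
  define K2 where "K2 = (\<Sum>e\<in>Ep. (K * norm e)\<^sup>2) + (\<Sum>e\<in>Em. (K * norm e)\<^sup>2)"
  have K2: "K2 \<ge> 0" unfolding K2_def by (intro add_nonneg_nonneg sum_nonneg) auto
  have be: "(bform L x e)\<^sup>2 \<le> (K * norm e)\<^sup>2 * (norm x)\<^sup>2" for x e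
  proof -
    have "(bform L x e)\<^sup>2 \<le> (K * norm x * norm e)\<^sup>2"
      using K(2)[of x e] by (metis abs_ge_zero power2_abs power_mono)
    then show ?thesis by (simp add: power_mult_distrib mult_ac)
  qed
  have qp: "\<bar>qp x\<bar> \<le> K2 * (norm x)\<^sup>2" and qm: "\<bar>qm x\<bar> \<le> K2 * (norm x)\<^sup>2" for x
  proof -
    have "\<bar>qp x\<bar> = (\<Sum>e\<in>Ep. (bform L x e)\<^sup>2)" unfolding qp_eq by (simp add: sum_nonneg)
    also have "\<dots> \<le> (\<Sum>e\<in>Ep. (K * norm e)\<^sup>2 * (norm x)\<^sup>2)" by (intro sum_mono be)
    also have "\<dots> \<le> K2 * (norm x)\<^sup>2"
      unfolding K2_def distrib_right sum_distrib_right by (simp add: sum_nonneg)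
    finally show "\<bar>qp x\<bar> \<le> K2 * (norm x)\<^sup>2" .
    have "\<bar>qm x\<bar> = (\<Sum>e\<in>Em. (bform L x e)\<^sup>2)" unfolding qm_eq by (simp add: sum_nonneg)
    also have "\<dots> \<le> (\<Sum>e\<in>Em. (K * norm e)\<^sup>2 * (norm x)\<^sup>2)" by (intro sum_mono be)
    also have "\<dots> \<le> K2 * (norm x)\<^sup>2"
      unfolding K2_def distrib_right sum_distrib_right by (simp add: sum_nonneg)
    finally show "\<bar>qm x\<bar> \<le> K2 * (norm x)\<^sup>2" .
  qed
  have "cmod (lx x u) \<le> (2 * pi * (K2 + 2 * K)) * ((norm x)\<^sup>2 + norm x) * norm u" for x u
  proof -
    obtain s \<xi> where u: "u = (s, \<xi>)" by (cases u)
    have s: "cmod s \<le> norm u" and \<xi>: "norm \<xi> \<le> norm u"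
      unfolding u by (simp_all add: norm_prod_def real_le_rsqrt)
    have \<xi>12: "norm (fst \<xi>) \<le> norm u" "norm (snd \<xi>) \<le> norm u"
      using \<xi> norm_fst_le[of "fst \<xi>" "snd \<xi>"] norm_snd_le[of "snd \<xi>" "fst \<xi>"] by auto
    have "cmod (s * of_real (qp x) / 2) \<le> norm u * (K2 * (norm x)\<^sup>2) / 2"
      unfolding norm_mult norm_divide by (auto intro!: mult_mono divide_right_mono s qp)
    moreover have "cmod (cnj s * of_real (qm x) / 2) \<le> norm u * (K2 * (norm x)\<^sup>2) / 2"
      unfolding norm_mult norm_divide by (auto intro!: mult_mono divide_right_mono s qm)
    moreover have "cmod (Bc (emb x) \<xi>) \<le> 2 * (K * norm x * norm u)"
    proof -
      have "cmod (Bc (emb x) \<xi>) \<le> \<bar>bform L x (fst \<xi>)\<bar> + \<bar>bform L x (snd \<xi>)\<bar>"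
        using cmod_le[of "Bc (emb x) \<xi>"] by (simp add: cbform_def emb_def)
      also have "\<dots> \<le> K * norm x * norm u + K * norm x * norm u"
        using K by (intro add_mono order_trans[OF K(2)] mult_left_mono \<xi>12) auto
      finally show ?thesis by simp
    qed
    ultimately have "cmod (s * of_real (qp x) / 2 + cnj s * of_real (qm x) / 2 + Bc (emb x) \<xi>)
        \<le> norm u * (K2 * (norm x)\<^sup>2) / 2 + norm u * (K2 * (norm x)\<^sup>2) / 2 + 2 * (K * norm x * norm u)"
      by (intro order_trans[OF norm_triangle_ineq] add_mono) auto
    also have "\<dots> \<le> (K2 + 2 * K) * ((norm x)\<^sup>2 + norm x) * norm u"
      using K2 K(1) by (simp add: algebra_simps)
    finally have "2 * pi * cmod (s * of_real (qp x) / 2 + cnj s * of_real (qm x) / 2 + Bc (emb x) \<xi>)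
        \<le> 2 * pi * ((K2 + 2 * K) * ((norm x)\<^sup>2 + norm x) * norm u)" by (intro mult_left_mono) auto
    moreover have "cmod (lx x u) = 2 * pi * cmod (s * of_real (qp x) / 2 + cnj s * of_real (qm x) / 2 + Bc (emb x) \<xi>)"
      unfolding lx_def u norm_mult by simp
    ultimately show ?thesis by (simp only: mult.assoc)
  qed
  moreover have "2 * pi * (K2 + 2 * K) \<ge> 0" using K2 K(1) by simp
  ultimately show ?thesis by blast
qed

text \<open>A bound for the functional \<open>lx x\<close> that is quadratic in
  \<open>norm x\<close>, so that a small multiple of it is absorbed by the Gaussian decay.\<close>

definition "Nx (x::'v) = (SOME K. K \<ge> 0 \<and> (\<forall>x u. cmod (lx x u) \<le> K * ((norm x)\<^sup>2 + norm x) * norm u)) * ((norm x)\<^sup>2 + norm x)"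

lemma Nx: "\<exists>K\<ge>0. \<forall>x. Nx x = K * ((norm x)\<^sup>2 + norm x)" and lx_Nx: "cmod (lx x u) \<le> Nx x * norm u"
  and Nx_nonneg: "Nx x \<ge> 0"
proof -
  define K where "K = (SOME K. K \<ge> 0 \<and> (\<forall>x u. cmod (lx x u) \<le> K * ((norm x)\<^sup>2 + norm x) * norm u))"
  have K: "K \<ge> 0" "\<And>x u. cmod (lx x u) \<le> K * ((norm x)\<^sup>2 + norm x) * norm u"
    using someI_ex[OF lx_bound, folded K_def] by blast+
  have N: "Nx x = K * ((norm x)\<^sup>2 + norm x)" for x unfolding Nx_def K_def ..
  show "\<exists>K\<ge>0. \<forall>x. Nx x = K * ((norm x)\<^sup>2 + norm x)" using K(1) N by blast
  show "cmod (lx x u) \<le> Nx x * norm u" using K(2) by (simp add: N)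
  show "Nx x \<ge> 0" unfolding N using K(1) by simp
qed

text \<open>Besides cosets this admits translates by arbitrary real vectors, which occur when the
  inversion law is expanded around a real point.\<close>

definition "lattice_subset Y \<longleftrightarrow> (\<exists>s. Y \<subseteq> (\<lambda>x. x + s) ` Ld)"

text \<open>Coefficients that the Gaussian dominates. They contain the pairings and are closed under
  sums and products, hence include the polynomials that differentiation produces.\<close>

definition "exp_bounded p \<longleftrightarrow> (\<exists>A D. A \<ge> 0 \<and> (\<forall>x. cmod (p x) \<le> A * exp (D * norm x)))" for p :: "'v \<Rightarrow> complex"

lemma lattice_subset_Ld: "Y \<subseteq> Ld \<Longrightarrow> lattice_subset Y"
  unfolding lattice_subset_def by (intro exI[of _ 0]) auto

lemma lattice_subset_disc: "\<gamma> \<in> disc L \<Longrightarrow> lattice_subset \<gamma>"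
  using Union_disc by (intro lattice_subset_Ld) auto

lemma lattice_subset_gauss: "lattice_subset Y \<Longrightarrow> a > 0 \<Longrightarrow> (\<lambda>x. exp (- a * (norm x)\<^sup>2 + C * norm x)) summable_on Y"
proof -
  assume "lattice_subset Y" "a > 0"
  then obtain s where s: "Y \<subseteq> (\<lambda>x. x + s) ` Ld" unfolding lattice_subset_def by blast
  have "(\<lambda>x. exp (- a * (norm x)\<^sup>2 + C * norm x)) summable_on (\<lambda>x. x + s) ` Ld"
    by (subst summable_on_reindex) (use gauss_summable[OF \<open>a > 0\<close>] in \<open>auto simp: o_def inj_on_def\<close>)
  then show ?thesis using s by (rule summable_on_subset_banach)
qed

lemma exp_bounded_const: "exp_bounded (\<lambda>x. c)"
  unfolding exp_bounded_def by (intro exI[of _ "cmod c"] exI[of _ 0]) auto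

lemma exp_bounded_mult: "exp_bounded p \<Longrightarrow> exp_bounded q \<Longrightarrow> exp_bounded (\<lambda>x. p x * q x)"
proof -
  assume "exp_bounded p" "exp_bounded q"
  then obtain A D A' D' where 1: "A \<ge> 0" "\<And>x. cmod (p x) \<le> A * exp (D * norm x)"
    "A' \<ge> 0" "\<And>x. cmod (q x) \<le> A' * exp (D' * norm x)" unfolding exp_bounded_def by blast
  have "cmod (p x * q x) \<le> (A * A') * exp ((D + D') * norm x)" for x
  proof -
    have e: "exp ((D + D') * norm x) = exp (D * norm x) * exp (D' * norm x)" by (simp add: distrib_right exp_add)
    show ?thesis
      using mult_mono[OF 1(2)[of x] 1(4)[of x]] 1(1) unfolding e norm_mult by (simp add: mult.assoc mult.left_commute)
  qed
  then show ?thesis unfolding exp_bounded_def using 1 by (intro exI[of _ "A * A'"] exI[of _ "D + D'"]) auto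
qed

lemma exp_bounded_bform: "exp_bounded (\<lambda>x. of_real (bform L x e))"
proof -
  obtain K where K: "K \<ge> 0" "\<And>y. \<bar>bform L e y\<bar> \<le> K * norm y" using functional_bounded by blast
  have "\<bar>bform L x e\<bar> \<le> K * exp (1 * norm x)" for x
  proof -
    have "norm x \<le> exp (norm x)" using exp_ge_add_one_self[of "norm x"] by linarith
    then have "K * norm x \<le> K * exp (norm x)" using K(1) by (rule mult_left_mono)
    then show ?thesis using K(2)[of x] sym[of x e] by simp
  qed
  then show ?thesis unfolding exp_bounded_def using K(1) by (intro exI[of _ K] exI[of _ 1]) auto
qed

lemma theta_adm:
  assumes "lattice_subset Y" "exp_bounded p" "Im (fst z) > 0"
  shows "\<exists>\<delta>>0. (\<lambda>x. cmod (p x) * exp (Re (lx x z) + \<delta> * Nx x)) summable_on Y"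
proof -
  obtain \<tau> \<zeta> where z: "z = (\<tau>, \<zeta>)" by (cases z)
  have y: "Im \<tau> > 0" using assms(3) z by simp
  obtain c where c: "c > 0" "\<And>x. c * (norm x)\<^sup>2 \<le> qp x - qm x" using majorant by blast
  obtain K where K: "K \<ge> 0" "\<And>x. Nx x = K * ((norm x)\<^sup>2 + norm x)" using Nx by blast
  obtain A D where p: "A \<ge> 0" "\<And>x. cmod (p x) \<le> A * exp (D * norm x)" using assms(2) unfolding exp_bounded_def by blast
  obtain M where M: "M \<ge> 0" "\<And>x. \<bar>bform L (snd \<zeta>) x\<bar> \<le> M * norm x" using functional_bounded by blast
  define \<alpha> where "\<alpha> = pi * Im \<tau> * c"
  have \<alpha>: "\<alpha> > 0" unfolding \<alpha>_def using y c by simp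
  \<comment> \<open>Small enough that \<open>\<delta> * K\<close> uses at most half of the decay
    \<open>\<alpha>\<close>; the summand 1 covers the case \<open>K = 0\<close>.\<close>
  define \<delta> where "\<delta> = \<alpha> / (2 * (K + 1))"
  have \<delta>: "\<delta> > 0" "\<delta> * K \<le> \<alpha> / 2" using \<alpha> K(1) by (auto simp: \<delta>_def field_simps)
  have B: "cmod (p x) * exp (Re (lx x z) + \<delta> * Nx x) \<le> A * exp (- (\<alpha>/2) * (norm x)\<^sup>2 + (D + 2 * pi * M + \<delta> * K) * norm x)" for x
  proof -
    have "Re (lx x z) = - pi * Im \<tau> * (qp x - qm x) - 2 * pi * bform L x (snd \<zeta>)"
      by (simp add: lx_def z cbform_def emb_def algebra_simps)
    also have "\<dots> \<le> - pi * Im \<tau> * (c * (norm x)\<^sup>2) + 2 * pi * (M * norm x)"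
    proof -
      have "pi * Im \<tau> * (c * (norm x)\<^sup>2) \<le> pi * Im \<tau> * (qp x - qm x)" using y c(2)[of x] by (intro mult_left_mono) auto
      moreover have "2 * pi * (- bform L x (snd \<zeta>)) \<le> 2 * pi * (M * norm x)"
        using M(2)[of x] sym[of x "snd \<zeta>"] by (intro mult_left_mono) auto
      ultimately show ?thesis by linarith
    qed
    also have "\<dots> = - \<alpha> * (norm x)\<^sup>2 + 2 * pi * M * norm x" by (simp add: \<alpha>_def)
    finally have 1: "Re (lx x z) \<le> - \<alpha> * (norm x)\<^sup>2 + 2 * pi * M * norm x" .
    have "\<delta> * Nx x = (\<delta> * K) * (norm x)\<^sup>2 + \<delta> * K * norm x" unfolding K(2) by (simp add: algebra_simps)
    also have "\<dots> \<le> \<alpha> / 2 * (norm x)\<^sup>2 + \<delta> * K * norm x" using \<delta>(2) by (intro add_right_mono mult_right_mono) auto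
    finally have "Re (lx x z) + \<delta> * Nx x \<le> - (\<alpha>/2) * (norm x)\<^sup>2 + (2 * pi * M + \<delta> * K) * norm x"
      using 1 by (simp add: algebra_simps)
    then have "cmod (p x) * exp (Re (lx x z) + \<delta> * Nx x)
        \<le> (A * exp (D * norm x)) * exp (- (\<alpha>/2) * (norm x)\<^sup>2 + (2 * pi * M + \<delta> * K) * norm x)"
      using p by (intro mult_mono) auto
    also have "\<dots> = A * exp (- (\<alpha>/2) * (norm x)\<^sup>2 + (D + 2 * pi * M + \<delta> * K) * norm x)"
      by (simp add: algebra_simps flip: exp_add)
    finally show ?thesis .
  qed
  have S: "(\<lambda>x. A * exp (- (\<alpha>/2) * (norm x)\<^sup>2 + (D + 2 * pi * M + \<delta> * K) * norm x)) summable_on Y"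
    by (intro summable_on_cmult_right lattice_subset_gauss assms) (use \<alpha> in auto)
  have "(\<lambda>x. cmod (p x) * exp (Re (lx x z) + \<delta> * Nx x)) summable_on Y"
    by (rule Infinite_Sum.summable_on_comparison_test[OF S B]) simp
  then show ?thesis using \<delta>(1) by blast
qed

section \<open>Weighted theta series and their derivatives\<close>

text \<open>The weight \<open>p\<close> keeps derivatives inside the family: a derivative along
  \<open>\<xi>\<close> multiplies it by \<open>2 * pi * \<i>\<close> times the pairing with
  \<open>\<xi>\<close>, a derivative in \<open>\<tau>\<close> by multiples of \<open>qp\<close> and
  \<open>qm\<close>.\<close>

definition "TH Y p \<tau> \<zeta> = (\<Sum>\<^sub>\<infinity>x\<in>Y. p x * theta_term L v \<tau> \<zeta> x)"

abbreviation "th Y \<equiv> TH Y (\<lambda>x. 1)"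

abbreviation "UH \<equiv> upper_half_plane"

lemma TH_summable:
  assumes "lattice_subset Y" "exp_bounded p" "\<tau> \<in> UH"
  shows "(\<lambda>x. p x * theta_term L v \<tau> \<zeta> x) summable_on Y"
proof -
  obtain \<delta> where "\<delta> > 0" and s: "(\<lambda>x. cmod (p x) * exp (Re (lx x (\<tau>, \<zeta>)) + \<delta> * Nx x)) summable_on Y"
    using theta_adm[OF assms(1,2), of "(\<tau>, \<zeta>)"] assms(3) by (auto simp: upper_half_plane_iff)
  have "norm (p x * theta_term L v \<tau> \<zeta> x) \<le> cmod (p x) * exp (Re (lx x (\<tau>, \<zeta>)) + \<delta> * Nx x)" for x
    unfolding theta_term_lx norm_mult norm_exp_eq_Re
    using \<open>\<delta> > 0\<close> Nx_nonneg[of x] by (intro mult_left_mono) simp_all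
  then have "(\<lambda>x. norm (p x * theta_term L v \<tau> \<zeta> x)) summable_on Y"
    by (intro Infinite_Sum.summable_on_comparison_test[OF s]) simp_all
  then show ?thesis by (rule abs_summable_summable)
qed

lemma TH_has_sum:
  "lattice_subset Y \<Longrightarrow> exp_bounded p \<Longrightarrow> \<tau> \<in> UH \<Longrightarrow> ((\<lambda>x. p x * theta_term L v \<tau> \<zeta> x) has_sum TH Y p \<tau> \<zeta>) Y"
  unfolding TH_def by (intro has_sum_infsum TH_summable)

lemma TH_has_derivative:
  assumes "lattice_subset Y" "exp_bounded p" "\<tau> \<in> UH"
  shows "((\<lambda>z. TH Y p (fst z) (snd z)) has_derivative (\<lambda>u. TH Y (\<lambda>x. p x * lx x u) \<tau> \<zeta>)) (at (\<tau>, \<zeta>))"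
proof -
  obtain \<delta> where "\<delta> > 0" "(\<lambda>x. cmod (p x) * exp (Re (lx x (\<tau>, \<zeta>)) + \<delta> * Nx x)) summable_on Y"
    using theta_adm[OF assms(1,2), of "(\<tau>, \<zeta>)"] assms(3) by (auto simp: upper_half_plane_iff)
  from exp_series_has_derivative[OF linear_lx lx_Nx Nx_nonneg this]
  show ?thesis unfolding TH_def theta_term_lx by simp
qed

lemma TH_Ck:
  assumes "lattice_subset Y" "exp_bounded p"
  shows "Ck_on n (UH \<times> UNIV) (\<lambda>z. TH Y p (fst z) (snd z))"
  unfolding TH_def theta_term_lx prod.collapse
proof (rule exp_series_Ck[OF linear_lx lx_Nx Nx_nonneg])
  show "open (UH \<times> (UNIV :: ('v \<times> 'v) set))"
    unfolding upper_half_plane_def by (intro open_Times open_halfspace_Im_gt) auto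
qed (use theta_adm[OF assms] in \<open>auto simp: upper_half_plane_iff\<close>)

lemma TH_cmult: "TH Y (\<lambda>x. c * p x) \<tau> \<zeta> = c * TH Y p \<tau> \<zeta>"
  unfolding TH_def by (simp add: mult.assoc infsum_cmult_right')

lemma TH_add:
  "lattice_subset Y \<Longrightarrow> exp_bounded p \<Longrightarrow> exp_bounded p' \<Longrightarrow> \<tau> \<in> UH \<Longrightarrow> TH Y (\<lambda>x. p x + p' x) \<tau> \<zeta> = TH Y p \<tau> \<zeta> + TH Y p' \<tau> \<zeta>"
  unfolding TH_def by (simp add: distrib_right infsum_add TH_summable)

lemma TH_sum:
  assumes "lattice_subset Y" "finite I" "\<And>i. i \<in> I \<Longrightarrow> exp_bounded (p i)" "\<tau> \<in> UH"
  shows "TH Y (\<lambda>x. \<Sum>i\<in>I. p i x) \<tau> \<zeta> = (\<Sum>i\<in>I. TH Y (p i) \<tau> \<zeta>)"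
proof -
  have "((\<lambda>x. \<Sum>i\<in>I. p i x * theta_term L v \<tau> \<zeta> x) has_sum (\<Sum>i\<in>I. TH Y (p i) \<tau> \<zeta>)) Y"
    using assms(2,3)
    by (induction I rule: finite_induct) (auto intro!: has_sum_add TH_has_sum[OF assms(1) _ assms(4)])
  then show ?thesis unfolding TH_def[of Y "\<lambda>x. \<Sum>i\<in>I. p i x"]
    by (simp add: sum_distrib_right[symmetric] infsumI)
qed

lemma exp_bounded_add: "exp_bounded p \<Longrightarrow> exp_bounded q \<Longrightarrow> exp_bounded (\<lambda>x. p x + q x)"
proof -
  assume "exp_bounded p" "exp_bounded q"
  then obtain A D A' D' where 1: "A \<ge> 0" "\<And>x. cmod (p x) \<le> A * exp (D * norm x)"
    "A' \<ge> 0" "\<And>x. cmod (q x) \<le> A' * exp (D' * norm x)" unfolding exp_bounded_def by blast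
  have "cmod (p x + q x) \<le> (A + A') * exp (max D D' * norm x)" for x
  proof -
    have "cmod (p x + q x) \<le> A * exp (D * norm x) + A' * exp (D' * norm x)"
      using 1(2)[of x] 1(4)[of x] by (intro order_trans[OF norm_triangle_ineq]) auto
    also have "\<dots> \<le> A * exp (max D D' * norm x) + A' * exp (max D D' * norm x)"
      using 1 by (intro add_mono mult_left_mono) (auto intro: mult_right_mono)
    finally show ?thesis by (simp add: distrib_right)
  qed
  then show ?thesis unfolding exp_bounded_def using 1 by (intro exI[of _ "A + A'"] exI[of _ "max D D'"]) auto
qed

lemma exp_bounded_sum: "finite I \<Longrightarrow> (\<And>i. i \<in> I \<Longrightarrow> exp_bounded (p i)) \<Longrightarrow> exp_bounded (\<lambda>x. \<Sum>i\<in>I. p i x)"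
  by (induction I rule: finite_induct) (auto intro: exp_bounded_add exp_bounded_const)

lemma exp_bounded_qp: "exp_bounded (\<lambda>x. of_real (qp x))" and exp_bounded_qm: "exp_bounded (\<lambda>x. of_real (qm x))"
proof -
  have s: "exp_bounded (\<lambda>x. of_real (bform L x e) * of_real (bform L x e))" for e by (intro exp_bounded_mult exp_bounded_bform)
  have "exp_bounded (\<lambda>x. \<Sum>e\<in>Ep. of_real (bform L x e) * of_real (bform L x e))" by (intro exp_bounded_sum s Ep)
  then show "exp_bounded (\<lambda>x. of_real (qp x))" by (simp add: qp_eq power2_eq_square)
  have "exp_bounded (\<lambda>x. (-1) * (\<Sum>e\<in>Em. of_real (bform L x e) * of_real (bform L x e)))"
    by (intro exp_bounded_sum s Em exp_bounded_mult exp_bounded_const)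
  then show "exp_bounded (\<lambda>x. of_real (qm x))" by (simp add: qm_eq power2_eq_square)
qed

lemma TH_has_derivative_\<zeta>:
  assumes "lattice_subset Y" "exp_bounded p" "\<tau> \<in> UH"
  shows "(TH Y p \<tau> has_derivative (\<lambda>\<xi>. TH Y (\<lambda>x. p x * (2 * of_real pi * \<i> * Bc (emb x) \<xi>)) \<tau> \<zeta>)) (at \<zeta>)"
proof -
  have "((\<lambda>\<zeta>'. (\<tau>, \<zeta>')) has_derivative (\<lambda>\<xi>. (0, \<xi>))) (at \<zeta>)"
    by (auto intro!: derivative_eq_intros)
  from has_derivative_compose[OF this TH_has_derivative[OF assms]]
  show ?thesis by (simp add: lx_def)
qed

text \<open>The terms in \<open>s\<close> and in \<open>cnj s\<close> are the two Wirtinger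
  derivatives; the first carries only \<open>qp\<close>, the second only \<open>qm\<close>.\<close>

lemma TH_has_derivative_\<tau>:
  assumes "lattice_subset Y" "exp_bounded p" "\<tau> \<in> UH"
  shows "((\<lambda>\<tau>. TH Y p \<tau> \<zeta>) has_derivative
     (\<lambda>s. of_real pi * \<i> * (s * TH Y (\<lambda>x. p x * of_real (qp x)) \<tau> \<zeta> + cnj s * TH Y (\<lambda>x. p x * of_real (qm x)) \<tau> \<zeta>))) (at \<tau>)"
proof -
  have "((\<lambda>\<tau>'. (\<tau>', \<zeta>)) has_derivative (\<lambda>s. (s, 0))) (at \<tau>)"
    by (auto intro!: derivative_eq_intros)
  from has_derivative_compose[OF this TH_has_derivative[OF assms]]
  have "((\<lambda>\<tau>. TH Y p \<tau> \<zeta>) has_derivative (\<lambda>s. TH Y (\<lambda>x. p x * lx x (s, 0)) \<tau> \<zeta>)) (at \<tau>)" by simp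
  moreover have "TH Y (\<lambda>x. p x * lx x (s, 0)) \<tau> \<zeta> =
      of_real pi * \<i> * (s * TH Y (\<lambda>x. p x * of_real (qp x)) \<tau> \<zeta> + cnj s * TH Y (\<lambda>x. p x * of_real (qm x)) \<tau> \<zeta>)" for s
  proof -
    have "(\<lambda>x. p x * lx x (s, 0)) = (\<lambda>x. (of_real pi * \<i> * s) * (p x * of_real (qp x)) + (of_real pi * \<i> * cnj s) * (p x * of_real (qm x)))"
      by (auto simp: lx_def fun_eq_iff field_simps)
    then show ?thesis
      by (simp add: TH_add TH_cmult assms exp_bounded_mult exp_bounded_const exp_bounded_qp exp_bounded_qm distrib_left mult.assoc)
  qed
  ultimately show ?thesis by simp
qed

lemma TH_line_derivative:
  assumes "lattice_subset Y" "exp_bounded p" "\<tau> \<in> UH"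
  shows "((\<lambda>w. TH Y p \<tau> (\<zeta> + cscale w \<xi>)) has_field_derivative
     2 * of_real pi * \<i> * TH Y (\<lambda>x. p x * Bc (emb x) \<xi>) \<tau> (\<zeta> + cscale w \<xi>)) (at w)"
proof -
  have "((\<lambda>w. \<zeta> + cscale w \<xi>) has_derivative (\<lambda>h. cscale h \<xi>)) (at w)"
    using has_derivative_add[OF has_derivative_const bounded_linear.has_derivative[OF bounded_linear_cscale has_derivative_ident]]
    by simp
  from has_derivative_compose[OF this TH_has_derivative_\<zeta>[OF assms]]
  have "((\<lambda>w. TH Y p \<tau> (\<zeta> + cscale w \<xi>)) has_derivative
    (\<lambda>h. TH Y (\<lambda>x. p x * (2 * of_real pi * \<i> * Bc (emb x) (cscale h \<xi>))) \<tau> (\<zeta> + cscale w \<xi>))) (at w)" .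
  moreover have "TH Y (\<lambda>x. p x * (2 * of_real pi * \<i> * Bc (emb x) (cscale h \<xi>))) \<tau> \<zeta>' =
      2 * of_real pi * \<i> * TH Y (\<lambda>x. p x * Bc (emb x) \<xi>) \<tau> \<zeta>' * h" for h \<zeta>'
  proof -
    have "(\<lambda>x. p x * (2 * of_real pi * \<i> * Bc (emb x) (cscale h \<xi>))) =
        (\<lambda>x. (h * (2 * of_real pi * \<i>)) * (p x * Bc (emb x) \<xi>))"
      by (auto simp: fun_eq_iff Bc_cscale)
    then show ?thesis by (simp only: TH_cmult) simp
  qed
  ultimately show ?thesis unfolding has_field_derivative_def by (simp only:)
qed

lemma TH_cholomorphic:
  assumes "lattice_subset Y" "exp_bounded p" "\<tau> \<in> UH"
  shows "cholomorphic (TH Y p \<tau>)"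
  unfolding cholomorphic_def
proof (intro allI exI conjI)
  fix \<zeta> c \<xi>
  show "(TH Y p \<tau> has_derivative (\<lambda>\<xi>. TH Y (\<lambda>x. p x * (2 * of_real pi * \<i> * Bc (emb x) \<xi>)) \<tau> \<zeta>)) (at \<zeta>)"
    by (rule TH_has_derivative_\<zeta>[OF assms])
  have "(\<lambda>x. p x * (2 * of_real pi * \<i> * Bc (emb x) (cscale c \<xi>))) =
      (\<lambda>x. c * (p x * (2 * of_real pi * \<i> * Bc (emb x) \<xi>)))"
    by (auto simp: fun_eq_iff Bc_cscale)
  then show "TH Y (\<lambda>x. p x * (2 * of_real pi * \<i> * Bc (emb x) (cscale c \<xi>))) \<tau> \<zeta> =
      c * TH Y (\<lambda>x. p x * (2 * of_real pi * \<i> * Bc (emb x) \<xi>)) \<tau> \<zeta>"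
    by (simp only: TH_cmult)
qed

section \<open>Translation and period laws of theta series\<close>

text \<open>Completing the square replaces the index \<open>x\<close> by
  \<open>x + \<sigma>\<close>. For \<open>\<sigma>\<close> in the lattice each coset is preserved,
  for \<open>\<sigma>\<close> in its dual the cosets are permuted, and for a general real vector the
  index set itself moves.\<close>

lemma th_shift:
  "th Y \<tau> (\<zeta> + mv \<tau> (emb \<sigma>)) = ee (- Q \<tau> (emb \<sigma>) / 2 - Bc (emb \<sigma>) \<zeta>) * th ((\<lambda>x. x + \<sigma>) ` Y) \<tau> \<zeta>"
proof -
  have "theta_term L v \<tau> (\<zeta> + mv \<tau> (emb \<sigma>)) x = ee (- Q \<tau> (emb \<sigma>) / 2 - Bc (emb \<sigma>) \<zeta>) * theta_term L v \<tau> \<zeta> (x + \<sigma>)" for x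
    unfolding theta_term_eq ee_add[symmetric] emb_simps Q_def B_simps
    by (rule arg_cong[of _ _ ee]) (simp add: field_simps Bpm_sym[of "emb \<sigma>" "emb x"])
  then have "th Y \<tau> (\<zeta> + mv \<tau> (emb \<sigma>)) = ee (- Q \<tau> (emb \<sigma>) / 2 - Bc (emb \<sigma>) \<zeta>) * (\<Sum>\<^sub>\<infinity>x\<in>Y. theta_term L v \<tau> \<zeta> (x + \<sigma>))"
    unfolding TH_def by (simp add: infsum_cmult_right')
  also have "(\<Sum>\<^sub>\<infinity>x\<in>Y. theta_term L v \<tau> \<zeta> (x + \<sigma>)) = th ((\<lambda>x. x + \<sigma>) ` Y) \<tau> \<zeta>"
    unfolding TH_def by (subst infsum_reindex) (auto simp: o_def inj_on_def)
  finally show ?thesis .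
qed

lemma cls_add_image: "x \<in> Ld \<Longrightarrow> \<sigma> \<in> Ld \<Longrightarrow> (\<lambda>y. y + \<sigma>) ` cls x = cls (x + \<sigma>)"
  by (simp add: cls_translate Ld_add image_image add.assoc)

lemma th_cls_shift:
  "x \<in> Ld \<Longrightarrow> \<sigma> \<in> Ld \<Longrightarrow>
    th (cls x) \<tau> (\<zeta> + mv \<tau> (emb \<sigma>)) = ee (- Q \<tau> (emb \<sigma>) / 2 - Bc (emb \<sigma>) \<zeta>) * th (cls (x + \<sigma>)) \<tau> \<zeta>"
  by (simp add: th_shift cls_add_image)

lemma ee_int_add: "n \<in> \<int> \<Longrightarrow> ee (w + of_real n) = ee w"
  by (simp add: ee_add ee_int)

lemma cls_bform_mod: "y \<in> cls x \<Longrightarrow> \<nu> \<in> Ld \<Longrightarrow> ee (of_real (bform L y \<nu>)) = ee (of_real (bform L x \<nu>))"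
proof -
  assume y: "y \<in> cls x" "\<nu> \<in> Ld"
  then have "bform L (x - y) \<nu> \<in> \<int>" using Ld_lat_Ints[of \<nu> "x - y"] sym by (simp add: cls_def)
  from ee_int_add[OF this, of "of_real (bform L y \<nu>)"] show ?thesis by (simp add: bf_diff)
qed

lemma cls_qform_mod: "y \<in> cls x \<Longrightarrow> x \<in> Ld \<Longrightarrow> ee (of_real (qform L y) / 2) = ee (of_real (qform L x) / 2)"
proof -
  assume y: "y \<in> cls x" "x \<in> Ld"
  define s where "s = x - y"
  have s: "s \<in> lat L" using y by (simp add: cls_def s_def)
  \<comment> \<open>Evenness of the lattice makes half of \<open>qform L s\<close> an integer; the
    mixed term is integral because \<open>x\<close> is dual.\<close>
  obtain m :: int where m: "qform L s = 2 * of_int m" using evn[OF s] by blast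
  have yx: "y = x - s" by (simp add: s_def)
  have "qform L x / 2 = qform L y / 2 + (bform L x s - of_int m)"
    unfolding yx bf_diff using m sym[of s x] by (simp add: field_simps)
  moreover have "bform L x s - of_int m \<in> \<int>" using Ld_lat_Ints[OF y(2) s] by auto
  ultimately have "ee (of_real (qform L x / 2)) = ee (of_real (qform L y / 2))"
    using ee_int_add[of "bform L x s - of_int m" "of_real (qform L y / 2)"] by (simp only: of_real_add)
  then show ?thesis by simp
qed

text \<open>Dual vectors as real periods act on the components by characters, whereas translations
  by \<open>mv \<tau>\<close> of dual vectors permute them. The interplay of the two actions
  determines the inversion law up to a scalar.\<close>

lemma th_cls_period:
  assumes "x \<in> Ld" "\<nu> \<in> Ld"
  shows "th (cls x) \<tau> (\<zeta> + emb \<nu>) = ee (of_real (bform L x \<nu>)) * th (cls x) \<tau> \<zeta>"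
proof -
  have "theta_term L v \<tau> (\<zeta> + emb \<nu>) y = ee (of_real (bform L x \<nu>)) * theta_term L v \<tau> \<zeta> y" if "y \<in> cls x" for y
    unfolding theta_term_eq Bc_add Bc_emb add.assoc[symmetric] ee_add[of _ "of_real (bform L y \<nu>)"]
      cls_bform_mod[OF that assms(2)] by simp
  then have "th (cls x) \<tau> (\<zeta> + emb \<nu>) = (\<Sum>\<^sub>\<infinity>y\<in>cls x. ee (of_real (bform L x \<nu>)) * theta_term L v \<tau> \<zeta> y)"
    unfolding TH_def by (intro infsum_cong) simp
  then show ?thesis unfolding TH_def by (simp add: infsum_cmult_right')
qed

lemma th_cls_T:
  assumes "x \<in> Ld"
  shows "th (cls x) (\<tau> + of_int n) \<zeta> = ee (of_real (qform L x) / 2) powi n * th (cls x) \<tau> \<zeta>"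
proof -
  have "theta_term L v (\<tau> + of_int n) \<zeta> y = ee (of_real (qform L x) / 2) powi n * theta_term L v \<tau> \<zeta> y" if "y \<in> cls x" for y
  proof -
    have "Q (\<tau> + of_int n) (emb y) / 2 + Bc (emb y) \<zeta> = (Q \<tau> (emb y) / 2 + Bc (emb y) \<zeta>) + of_int n * (of_real (qform L y) / 2)"
      unfolding Q_def Bpm_emb qform_split by (simp add: field_simps)
    then have "theta_term L v (\<tau> + of_int n) \<zeta> y = theta_term L v \<tau> \<zeta> y * ee (of_int n * (of_real (qform L y) / 2))"
      unfolding theta_term_eq ee_add[symmetric] by (simp only:)
    also have "ee (of_int n * w) = ee w powi n" for w
      unfolding ee_def by (simp add: exp_power_int mult_ac)
    finally show ?thesis by (simp only: cls_qform_mod[OF that assms] mult.commute)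
  qed
  then have "th (cls x) (\<tau> + of_int n) \<zeta> = (\<Sum>\<^sub>\<infinity>y\<in>cls x. ee (of_real (qform L x) / 2) powi n * theta_term L v \<tau> \<zeta> y)"
    unfolding TH_def by (intro infsum_cong) simp
  then show ?thesis unfolding TH_def by (simp add: infsum_cmult_right')
qed

lemma siegel_theta_eq: "siegel_theta L v \<tau> \<zeta> \<gamma> = (if \<gamma> \<in> disc L then th \<gamma> \<tau> \<zeta> else 0)"
proof -
  have "siegel_theta L v \<tau> \<zeta> \<gamma> = (\<Sum>\<delta>\<in>disc L. if \<delta> = \<gamma> then th \<gamma> \<tau> \<zeta> else 0)"
    unfolding siegel_theta_def sum_apply vscale_def basis_vec_def TH_def by (rule sum.cong) auto
  then show ?thesis by (simp add: finite_disc)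
qed

end

section \<open>Fourier coefficients along lattice directions\<close>

text \<open>Morera: the integral over a triangle is interchanged with the parameter integral and
  vanishes for every parameter.\<close>

lemma holomorphic_integral_param:
  fixes h :: "complex \<Rightarrow> real \<Rightarrow> complex"
  assumes cont: "continuous_on (UNIV \<times> {0..1}) (\<lambda>(w, t). h w t)"
    and hol: "\<And>t. t \<in> {0..1} \<Longrightarrow> (\<lambda>w. h w t) holomorphic_on UNIV"
  shows "(\<lambda>w. integral {0..1} (h w)) holomorphic_on UNIV"
proof -
  let ?G = "\<lambda>w. integral {0..1} (h w)"
  have contG: "continuous_on UNIV ?G"
    using integral_continuous_on_param[of UNIV 0 1 h] cont by (simp add: cbox_interval)
  define I where "I = (\<lambda>a c t. contour_integral (linepath a c) (\<lambda>w. h w t))"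
  have Ieq: "I a c t = integral {0..1} (\<lambda>s. h (linepath a c s) t * (c - a))" for a c t
    unfolding I_def contour_integral_integral by simp
  have ch: "continuous_on ({0..1} \<times> {0..1}) (\<lambda>(s, t). h (linepath a c s) t * (c - a))" for a c
  proof -
    have "continuous_on ({0..1} \<times> {0..1}) (\<lambda>x. (\<lambda>(w, t). h w t) (linepath a c (fst x), snd x))"
      by (rule continuous_on_compose2[OF cont])
         (auto intro!: continuous_intros simp: linepath_def)
    then have "continuous_on ({0..1} \<times> {0..1}) (\<lambda>x. h (linepath a c (fst x)) (snd x) * (c - a))"
      by (intro continuous_intros) simp
    then show ?thesis by (simp add: case_prod_unfold)
  qed
  have contI: "continuous_on {0..1} (I a c)" for a c
  proof -
    have "continuous_on ({0..1} \<times> {0..1}) (\<lambda>(t, s). h (linepath a c s) t * (c - a))"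
    proof -
      have "continuous_on ({0..1} \<times> {0..1}) (\<lambda>x. (\<lambda>(s, t). h (linepath a c s) t * (c - a)) (snd x, fst x))"
        by (rule continuous_on_compose2[OF ch]) (auto intro!: continuous_intros)
      then show ?thesis unfolding case_prod_unfold fst_conv snd_conv .
    qed
    from integral_continuous_on_param[of "{0..1}" 0 1 "\<lambda>t s. h (linepath a c s) t * (c - a)"] this
    show ?thesis unfolding Ieq[abs_def] by (simp add: cbox_interval)
  qed
  have swap: "contour_integral (linepath a c) ?G = integral {0..1} (I a c)" for a c
  proof -
    have "contour_integral (linepath a c) ?G = integral {0..1} (\<lambda>s. integral {0..1} (\<lambda>t. h (linepath a c s) t * (c - a)))"
      unfolding contour_integral_integral by simp
    also have "\<dots> = integral {0..1} (\<lambda>t. integral {0..1} (\<lambda>s. h (linepath a c s) t * (c - a)))"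
    proof -
      have "continuous_on (cbox (0, 0) (1, 1)) (\<lambda>(s, t). h (linepath a c s) t * (c - a))"
        by (simp only: cbox_Pair_eq) (simp only: cbox_interval ch)
      from integral_swap_continuous[OF this] show ?thesis by (simp only: cbox_interval)
    qed
    finally show ?thesis unfolding Ieq[abs_def] .
  qed
  have "?G analytic_on UNIV"
  proof (rule Morera_triangle[OF contG open_UNIV], intro impI)
    fix a c d :: complex
    have "contour_integral (linepath a c) ?G + contour_integral (linepath c d) ?G + contour_integral (linepath d a) ?G
        = integral {0..1} (\<lambda>t. I a c t + I c d t + I d a t)"
      unfolding swap
      by (simp add: Henstock_Kurzweil_Integration.integral_add integrable_add integrable_continuous_real contI)
    also have "\<dots> = integral {0..1} (\<lambda>t::real. 0)"
    proof (rule Henstock_Kurzweil_Integration.integral_cong)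
      fix t :: real assume t: "t \<in> {0..1}"
      obtain g where g: "\<And>w. w \<in> UNIV \<Longrightarrow> (g has_field_derivative h w t) (at w within UNIV)"
        using holomorphic_convex_primitive'[OF convex_UNIV open_UNIV hol[OF t]] by blast
      have "I x y t = g y - g x" for x y
        unfolding I_def
        using contour_integral_primitive[OF g, where g = "linepath x y"]
        by (intro contour_integral_unique) simp
      then show "I a c t + I c d t + I d a t = 0" by simp
    qed
    finally show "contour_integral (linepath a c) ?G + contour_integral (linepath c d) ?G + contour_integral (linepath d a) ?G = 0" by simp
  qed
  then show ?thesis by (rule analytic_imp_holomorphic)
qed

section \<open>Iterated Fourier coefficients\<close>

text \<open>Continuity and holomorphy along complex lines: enough for one-variable arguments, and
  preserved by averaging over a real segment, which is all that the Fourier operators do.\<close>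

definition line_holomorphic :: "('v::real_normed_vector cplx \<Rightarrow> complex) \<Rightarrow> bool" where
  "line_holomorphic f \<longleftrightarrow> continuous_on UNIV f \<and> (\<forall>\<zeta> \<xi>. (\<lambda>w. f (\<zeta> + cscale w \<xi>)) holomorphic_on UNIV)"

text \<open>The coefficient of frequency \<open>m\<close> along \<open>e\<close>, kept as a function
  of the full complex argument, so that the operators of several basis vectors can be applied in
  succession.\<close>

definition fourier_op :: "'v::real_normed_vector \<Rightarrow> int \<Rightarrow> ('v cplx \<Rightarrow> complex) \<Rightarrow> 'v cplx \<Rightarrow> complex" where
  "fourier_op e m f \<zeta> = integral {0..1} (\<lambda>t. f (\<zeta> + t *\<^sub>R emb e) * ee (- (of_int m * of_real t)))"

primrec fourier_ops :: "'v::real_normed_vector list \<Rightarrow> ('v \<Rightarrow> int) \<Rightarrow> ('v cplx \<Rightarrow> complex) \<Rightarrow> 'v cplx \<Rightarrow> complex" where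
  "fourier_ops [] mm f = f"
| "fourier_ops (e # es) mm f = fourier_op e (mm e) (fourier_ops es mm f)"

lemma continuous_line_holomorphic_comp: "line_holomorphic f \<Longrightarrow> continuous_on S g \<Longrightarrow> continuous_on S (\<lambda>x. f (g x))"
  unfolding line_holomorphic_def by (rule continuous_on_compose2[of UNIV f]) auto

lemma line_holomorphic_add: "line_holomorphic f \<Longrightarrow> line_holomorphic g \<Longrightarrow> line_holomorphic (\<lambda>\<zeta>. f \<zeta> + g \<zeta>)"
  and line_holomorphic_diff: "line_holomorphic f \<Longrightarrow> line_holomorphic g \<Longrightarrow> line_holomorphic (\<lambda>\<zeta>. f \<zeta> - g \<zeta>)"
  and line_holomorphic_mult: "line_holomorphic f \<Longrightarrow> line_holomorphic g \<Longrightarrow> line_holomorphic (\<lambda>\<zeta>. f \<zeta> * g \<zeta>)"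
  and line_holomorphic_const: "line_holomorphic (\<lambda>\<zeta>. c)"
  unfolding line_holomorphic_def by (auto intro!: continuous_intros holomorphic_intros)

lemma line_holomorphic_sum: "(\<And>i. i \<in> I \<Longrightarrow> line_holomorphic (f i)) \<Longrightarrow> line_holomorphic (\<lambda>\<zeta>. \<Sum>i\<in>I. f i \<zeta>)"
  by (induction I rule: infinite_finite_induct) (auto intro: line_holomorphic_add line_holomorphic_const)

lemma fourier_op_integrand_continuous:
  "line_holomorphic f \<Longrightarrow> continuous_on S (\<lambda>t. f (\<zeta> + t *\<^sub>R emb e) * ee (- (of_int m * of_real t)))"
  by (intro continuous_intros continuous_line_holomorphic_comp)

lemma line_holomorphic_fourier_op: "line_holomorphic f \<Longrightarrow> line_holomorphic (fourier_op e m f)"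
  unfolding line_holomorphic_def[of "fourier_op e m f"]
proof (intro conjI allI)
  assume f: "line_holomorphic f"
  have "continuous_on (UNIV \<times> {0..1}) (\<lambda>(\<zeta>, t). f (\<zeta> + t *\<^sub>R emb e) * ee (- (of_int m * of_real t)))"
    unfolding case_prod_unfold by (intro continuous_intros continuous_line_holomorphic_comp[OF f])
  then show "continuous_on UNIV (fourier_op e m f)"
    unfolding fourier_op_def[abs_def]
    using integral_continuous_on_param[of UNIV 0 1 "\<lambda>\<zeta> t. f (\<zeta> + t *\<^sub>R emb e) * ee (- (of_int m * of_real t))"]
    by (simp add: cbox_interval)
  fix \<zeta> \<xi> :: "'a cplx"
  show "(\<lambda>w. fourier_op e m f (\<zeta> + cscale w \<xi>)) holomorphic_on UNIV"
    unfolding fourier_op_def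
  proof (rule holomorphic_integral_param)
    show "continuous_on (UNIV \<times> {0..1}) (\<lambda>(w, t). f (\<zeta> + cscale w \<xi> + t *\<^sub>R emb e) * ee (- (of_int m * of_real t)))"
      unfolding case_prod_unfold
      by (intro continuous_intros continuous_line_holomorphic_comp[OF f] bounded_linear.continuous_on[OF bounded_linear_cscale])
    fix t :: real
    have "(\<lambda>w. f (\<zeta> + t *\<^sub>R emb e + cscale w \<xi>)) holomorphic_on UNIV" using f unfolding line_holomorphic_def by blast
    moreover have "\<zeta> + t *\<^sub>R emb e + cscale w \<xi> = \<zeta> + cscale w \<xi> + t *\<^sub>R emb e" for w by simp
    ultimately show "(\<lambda>w. f (\<zeta> + cscale w \<xi> + t *\<^sub>R emb e) * ee (- (of_int m * of_real t))) holomorphic_on UNIV"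
      by (auto intro!: holomorphic_intros)
  qed
qed

lemma line_holomorphic_fourier_ops: "line_holomorphic f \<Longrightarrow> line_holomorphic (fourier_ops es mm f)"
  by (induction es) (auto intro: line_holomorphic_fourier_op)

lemma fourier_op_quasi:
  assumes "\<And>\<zeta>. f (\<zeta> + \<xi>) = c * f \<zeta>"
  shows "fourier_op e m f (\<zeta> + \<xi>) = c * fourier_op e m f \<zeta>"
proof -
  have "f (\<zeta> + \<xi> + t *\<^sub>R emb e) = c * f (\<zeta> + t *\<^sub>R emb e)" for t
    using assms[of "\<zeta> + t *\<^sub>R emb e"] by (simp add: algebra_simps)
  then have "fourier_op e m f (\<zeta> + \<xi>) = integral {0..1} (\<lambda>t. c * (f (\<zeta> + t *\<^sub>R emb e) * ee (- (of_int m * of_real t))))"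
    unfolding fourier_op_def by (simp add: mult.assoc)
  then show ?thesis unfolding fourier_op_def by (simp only: Henstock_Kurzweil_Integration.integral_mult_right)
qed

lemma fourier_ops_quasi:
  "(\<And>\<zeta>. f (\<zeta> + \<xi>) = c * f \<zeta>) \<Longrightarrow> fourier_ops es mm f (\<zeta> + \<xi>) = c * fourier_ops es mm f \<zeta>"
  by (induction es arbitrary: \<zeta>) (auto intro: fourier_op_quasi)

text \<open>For real \<open>w\<close> this is a substitution. For complex \<open>w\<close>, the
  integral of the periodic entire function \<open>F\<close> from \<open>u\<close> to
  \<open>u + 1\<close> is \<open>R (u + 1) - R u\<close>, whose derivative
  \<open>F (u + 1) - F u\<close> vanishes.\<close>

lemma fourier_op_shift:
  assumes f: "line_holomorphic f" and per: "\<And>\<zeta>. f (\<zeta> + emb e) = f \<zeta>"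
  shows "fourier_op e m f (\<zeta> + cscale w (emb e)) = ee (of_int m * w) * fourier_op e m f \<zeta>"
proof -
  define F where "F = (\<lambda>u. f (\<zeta> + cscale u (emb e)) * ee (- (of_int m * u)))"
  have "(\<lambda>u. f (\<zeta> + cscale u (emb e))) holomorphic_on UNIV" using f unfolding line_holomorphic_def by blast
  then have "F holomorphic_on UNIV"
    unfolding F_def by (auto intro!: holomorphic_intros)
  then obtain R where R: "\<And>u. (R has_field_derivative F u) (at u)"
    using holomorphic_convex_primitive'[OF convex_UNIV open_UNIV] by (metis UNIV_I)
  have perF: "F (u + 1) = F u" for u
  proof -
    have "f (\<zeta> + cscale (u + 1) (emb e)) = f (\<zeta> + cscale u (emb e))"
      using per[of "\<zeta> + cscale u (emb e)"] by (simp add: cscale_simps add.assoc)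
    moreover have "ee (- (of_int m * (u + 1))) = ee (- (of_int m * u))"
    proof -
      have "ee (- (of_int m * (u + 1))) = ee (- (of_int m * u)) * ee (of_real (- of_int m))"
        by (simp add: ee_add[symmetric] algebra_simps)
      also have "ee (of_real (- of_int m)) = 1" by (rule ee_int) simp
      finally show ?thesis by simp
    qed
    ultimately show ?thesis by (simp add: F_def)
  qed
  have int: "integral {0..1} (\<lambda>t. F (u + of_real t)) = R (u + 1) - R u" for u
  proof -
    have "((\<lambda>t. R (u + of_real t)) has_vector_derivative F (u + of_real t)) (at t within {0..1})" for t
    proof -
      have "((\<lambda>z. R (u + z)) has_field_derivative F (u + of_real t)) (at (of_real t))"
        using R[of "u + of_real t"] DERIV_shift[of R "F (u + of_real t)" "of_real t" u] by (simp add: add.commute)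
      then show ?thesis by (rule has_vector_derivative_real_field)
    qed
    then have "((\<lambda>t. F (u + of_real t)) has_integral (R (u + of_real 1) - R (u + of_real 0))) {0..1}"
      by (intro fundamental_theorem_of_calculus) auto
    then show ?thesis by (simp add: integral_unique)
  qed
  have "((\<lambda>u. R (u + 1) - R u) has_field_derivative 0) (at u)" for u
  proof -
    have "((\<lambda>u. R (u + 1)) has_field_derivative F (u + 1)) (at u)" using R[of "u + 1"] by (simp add: DERIV_shift)
    from DERIV_diff[OF this R[of u]] show ?thesis by (simp add: perF)
  qed
  then have "(\<lambda>u. R (u + 1) - R u) constant_on UNIV"
    by (intro has_field_derivative_0_imp_constant_on) auto
  then have const: "R (w + 1) - R w = R (0 + 1) - R 0"
    unfolding constant_on_def by (metis UNIV_I)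
  have "ee (- (of_int m * w)) * fourier_op e m f (\<zeta> + cscale w (emb e)) = integral {0..1} (\<lambda>t. F (w + of_real t))"
  proof -
    have "F (w + of_real t) = ee (- (of_int m * w)) * (f (\<zeta> + cscale w (emb e) + t *\<^sub>R emb e) * ee (- (of_int m * of_real t)))" for t
    proof -
      have "ee (- (of_int m * (w + of_real t))) = ee (- (of_int m * w)) * ee (- (of_int m * of_real t))"
        by (simp add: ee_add[symmetric] algebra_simps)
      then show ?thesis unfolding F_def by (simp add: cscale_simps cscale_of_real add.assoc)
    qed
    then show ?thesis unfolding fourier_op_def by (simp only: Henstock_Kurzweil_Integration.integral_mult_right)
  qed
  also have "\<dots> = integral {0..1} (\<lambda>t. F (0 + of_real t))" by (simp only: int const)
  also have "\<dots> = fourier_op e m f \<zeta>" unfolding fourier_op_def F_def by (simp add: cscale_of_real)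
  finally have "ee (of_int m * w) * (ee (- (of_int m * w)) * fourier_op e m f (\<zeta> + cscale w (emb e))) = ee (of_int m * w) * fourier_op e m f \<zeta>"
    by simp
  moreover have "ee (of_int m * w) * ee (- (of_int m * w)) = 1" by (simp add: ee_add[symmetric])
  ultimately show ?thesis by (simp add: mult.assoc[symmetric])
qed

lemma fourier_ops_shift:
  assumes f: "line_holomorphic f" and per: "\<And>e \<zeta>. e \<in> set es \<Longrightarrow> f (\<zeta> + emb e) = f \<zeta>"
  shows "e \<in> set es \<Longrightarrow> fourier_ops es mm f (\<zeta> + cscale w (emb e)) = ee (of_int (mm e) * w) * fourier_ops es mm f \<zeta>"
  using per
proof (induction es arbitrary: \<zeta>)
  case (Cons a es)
  show ?case
  proof (cases "e = a")
    case True
    have "fourier_ops es mm f (\<zeta> + emb a) = fourier_ops es mm f \<zeta>" for \<zeta>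
      using fourier_ops_quasi[of f "emb a" 1] Cons.prems(2) by simp
    then show ?thesis using fourier_op_shift[OF line_holomorphic_fourier_ops[OF f]] True by simp
  next
    case False
    then have "fourier_ops es mm f (\<zeta> + cscale w (emb e)) = ee (of_int (mm e) * w) * fourier_ops es mm f \<zeta>" for \<zeta>
      using Cons by simp
    then show ?thesis by (simp add: fourier_op_quasi)
  qed
qed simp

lemma fourier_op_complete:
  assumes f: "line_holomorphic f" and z: "\<And>m \<zeta>. fourier_op e m f \<zeta> = 0"
  shows "f \<zeta> = 0"
proof -
  \<comment> \<open>Recentred so that the midpoint of the segment is \<open>\<zeta>\<close>
    itself.\<close>
  define k where "k = (\<lambda>t. f (\<zeta> - (1/2) *\<^sub>R emb e + t *\<^sub>R emb e))"
  have "k (1/2) = 0"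
  proof (rule fourier_complete_midpoint)
    show "continuous_on {0..1} k" unfolding k_def by (intro continuous_intros continuous_line_holomorphic_comp[OF f])
    fix m :: int
    show "integral {0..1} (\<lambda>t. k t * ee (of_int m * of_real t)) = 0"
      using z[of "- m" "\<zeta> - (1/2) *\<^sub>R emb e"] unfolding fourier_op_def k_def by simp
  qed
  then show ?thesis by (simp add: k_def)
qed

lemma fourier_ops_cong: "(\<And>e. e \<in> set es \<Longrightarrow> mm e = mm' e) \<Longrightarrow> fourier_ops es mm f = fourier_ops es mm' f"
  by (induction es) auto

lemma fourier_ops_complete:
  assumes "line_holomorphic f" "distinct es" "\<And>mm \<zeta>. fourier_ops es mm f \<zeta> = 0"
  shows "f \<zeta> = 0"
  using assms
proof (induction es arbitrary: \<zeta>)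
  case (Cons e es)
  have "fourier_ops es mm f \<zeta> = 0" for mm \<zeta>
  proof (rule fourier_op_complete[OF line_holomorphic_fourier_ops[OF Cons.prems(1)], where e = e])
    fix m \<zeta>
    \<comment> \<open>As \<open>e\<close> does not occur in \<open>es\<close>, changing the
      frequency at \<open>e\<close> leaves the inner operators as they are, so every frequency of
      the outer one is available.\<close>
    have "fourier_ops es mm f = fourier_ops es (mm(e := m)) f" using Cons.prems(2) by (intro fourier_ops_cong) auto
    then show "fourier_op e m (fourier_ops es mm f) \<zeta> = 0"
      using Cons.prems(3)[of "mm(e := m)" \<zeta>] by (simp only: fourier_ops.simps fun_upd_same)
  qed
  then show ?case using Cons by simp
qed simp

lemma fourier_ops_diff:
  assumes "line_holomorphic f" "line_holomorphic g"
  shows "fourier_ops es mm (\<lambda>\<zeta>. f \<zeta> - g \<zeta>) \<zeta> = fourier_ops es mm f \<zeta> - fourier_ops es mm g \<zeta>"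
proof (induction es arbitrary: \<zeta>)
  case (Cons e es)
  have "fourier_op e (mm e) (fourier_ops es mm (\<lambda>\<zeta>. f \<zeta> - g \<zeta>)) \<zeta>
      = fourier_op e (mm e) (\<lambda>\<zeta>. fourier_ops es mm f \<zeta> - fourier_ops es mm g \<zeta>) \<zeta>" unfolding fourier_op_def using Cons by simp
  also have "\<dots> = fourier_op e (mm e) (fourier_ops es mm f) \<zeta> - fourier_op e (mm e) (fourier_ops es mm g) \<zeta>"
    unfolding fourier_op_def left_diff_distrib
    by (intro Henstock_Kurzweil_Integration.integral_diff integrable_continuous_real
        fourier_op_integrand_continuous line_holomorphic_fourier_ops assms)
  finally show ?case by simp
qed simp

lemma fourier_ops_translate: "fourier_ops es mm (\<lambda>\<zeta>. f (\<zeta> + \<xi>)) \<zeta> = fourier_ops es mm f (\<zeta> + \<xi>)"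
  by (induction es arbitrary: \<zeta>) (auto simp: fourier_op_def add.assoc add.commute add.left_commute)

text \<open>A factor that is a character along every basis direction shifts the frequencies. Applied
  to the factor of the elliptic law, this relates coefficients whose indices differ by a lattice
  vector.\<close>

lemma fourier_ops_twist:
  assumes "\<And>e \<zeta> t. e \<in> set es \<Longrightarrow> q (\<zeta> + t *\<^sub>R emb e) = q \<zeta> * ee (of_int (n e) * of_real t)"
  shows "fourier_ops es mm (\<lambda>\<zeta>. q \<zeta> * f \<zeta>) \<zeta> = q \<zeta> * fourier_ops es (\<lambda>e. mm e - n e) f \<zeta>"
  using assms
proof (induction es arbitrary: \<zeta>)
  case (Cons e es)
  let ?g = "fourier_ops es (\<lambda>e. mm e - n e) f"
  have IH: "fourier_ops es mm (\<lambda>\<zeta>. q \<zeta> * f \<zeta>) \<zeta> = q \<zeta> * ?g \<zeta>" for \<zeta> using Cons by auto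
  have "q (\<zeta> + t *\<^sub>R emb e) * ?g (\<zeta> + t *\<^sub>R emb e) * ee (- (of_int (mm e) * of_real t))
      = q \<zeta> * (?g (\<zeta> + t *\<^sub>R emb e) * ee (- (of_int (mm e - n e) * of_real t)))" for t :: real
  proof -
    have "ee (of_int (n e) * of_real t) * ee (- (of_int (mm e) * of_real t)) = ee (- (of_int (mm e - n e) * of_real t))"
      by (simp add: ee_add[symmetric] algebra_simps)
    then show ?thesis using Cons.prems[of e \<zeta> t] by (simp add: mult_ac)
  qed
  then show ?case
    unfolding fourier_ops.simps fourier_op_def IH by (simp only: Henstock_Kurzweil_Integration.integral_mult_right)
qed simp

lemma integral_ee_int: "((\<lambda>t. ee (of_int k * of_real t)) has_integral (if k = 0 then 1 else 0)) {0..1}"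
proof (cases "k = 0")
  case True
  then show ?thesis using has_integral_const_real[of "1::complex" 0 1] by simp
next
  case False
  define c where "c = 2 * of_real pi * \<i> * of_int k"
  have c: "c \<noteq> 0" using False by (simp add: c_def)
  have "((\<lambda>t. exp (c * of_real t) / c) has_vector_derivative ee (of_int k * of_real t)) (at t within {0..1})" for t
  proof -
    have "((\<lambda>z. exp (c * z) / c) has_field_derivative exp (c * of_real t)) (at (of_real t))"
      using c by (auto intro!: derivative_eq_intros)
    then have "((\<lambda>t. exp (c * of_real t) / c) has_vector_derivative exp (c * of_real t)) (at t within {0..1})"
      by (rule has_vector_derivative_real_field)
    moreover have "exp (c * of_real t) = ee (of_int k * of_real t)" by (simp add: ee_def c_def mult_ac)
    ultimately show ?thesis by simp
  qed
  then have "((\<lambda>t. ee (of_int k * of_real t)) has_integral (exp (c * of_real 1) / c - exp (c * of_real 0) / c)) {0..1}"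
    by (intro fundamental_theorem_of_calculus) auto
  moreover have "exp c = 1"
    using ee_int[of "of_int k"] by (simp add: ee_def c_def)
  ultimately show ?thesis using False by simp
qed

context lat_gr
begin

section \<open>Fourier series over the dual lattice\<close>

definition "efun x \<zeta> = ee (Bc (emb x) \<zeta>)"

lemma efun_add: "efun x (\<zeta> + \<xi>) = efun x \<zeta> * efun x \<xi>"
  by (simp add: efun_def Bc_add ee_add)

lemma efun_emb: "efun x (emb y) = ee (of_real (bform L x y))"
  by (simp add: efun_def Bc_emb)

lemma efun_0 [simp]: "efun x 0 = 1"
  by (simp add: efun_def)

lemma efun_nonzero [simp]: "efun x \<zeta> \<noteq> 0"
  by (simp add: efun_def)

lemma theta_term_efun: "theta_term L v \<tau> \<zeta> x = ee (Q \<tau> (emb x) / 2) * efun x \<zeta>"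
  by (simp add: theta_term_eq efun_def ee_add)

text \<open>Termwise integration: along a real direction the absolute value of a term is constant,
  so the series at \<open>\<zeta>\<close> itself is a majorant and convergence on the segment is
  uniform. Only the terms of frequency \<open>m\<close> survive.\<close>

lemma fourier_op_series:
  assumes X: "X \<subseteq> Ld" and e: "e \<in> b"
    and s: "\<And>x'. ((\<lambda>x. p x * efun x (\<zeta> + emb x')) has_sum g (\<zeta> + emb x')) X"
  shows "((\<lambda>x. p x * efun x \<zeta>) has_sum fourier_op e m g \<zeta>) {x \<in> X. bform L x e = of_int m}"
proof -
  define C where "C = (\<lambda>x (t::real). p x * efun x (\<zeta> + t *\<^sub>R emb e) * ee (- (of_int m * of_real t)))"
  have emb_t: "\<zeta> + t *\<^sub>R emb e = \<zeta> + emb (t *\<^sub>R e)" for t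
    by (simp add: emb_simps cscale_of_real)
  have norm: "cmod (C x t) \<le> cmod (p x * efun x \<zeta>)" for x t
    unfolding C_def emb_t efun_add efun_emb norm_mult
    using norm_ee_of_real[of "- (of_int m * t)"] by simp
  have "(\<lambda>x. p x * efun x \<zeta>) summable_on X" using s[of 0] by (auto simp: emb_simps summable_on_def)
  then have sM: "(\<lambda>x. cmod (p x * efun x \<zeta>)) summable_on X"
    by (rule summable_on_iff_abs_summable_on_complex[THEN iffD1])
  define G where "G = (\<lambda>t::real. g (\<zeta> + t *\<^sub>R emb e) * ee (- (of_int m * of_real t)))"
  have hs: "((\<lambda>x. C x t) has_sum G t) X" for t
    unfolding C_def G_def emb_t by (intro has_sum_cmult_left s)
  have u: "uniform_limit (cbox 0 1) (\<lambda>F t. \<Sum>x\<in>F. C x t) G (finite_subsets_at_top X)"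
    by (rule Weierstrass_m_test_general'[OF _ hs sM]) (rule norm)
  have CE: "C x t = p x * efun x \<zeta> * ee (of_int (\<lfloor>bform L x e\<rfloor> - m) * of_real t)" if "x \<in> X" for x t
  proof -
    have "bform L x e \<in> \<int>" using X that e by (auto simp: Ld_iff)
    then have fl: "bform L x e = of_int \<lfloor>bform L x e\<rfloor>" by (auto elim: Ints_cases)
    have "ee (of_real (bform L x (t *\<^sub>R e))) * ee (- (of_int m * of_real t)) = ee (of_int (\<lfloor>bform L x e\<rfloor> - m) * of_real t)"
      unfolding bf_scale by (subst fl) (simp add: ee_add[symmetric] algebra_simps)
    then show ?thesis unfolding C_def emb_t efun_add efun_emb by (simp add: mult.assoc)
  qed
  have contC: "continuous_on (cbox 0 1) (\<lambda>t. \<Sum>x\<in>F. C x t)" for F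
    unfolding C_def emb_t efun_add efun_emb bf_scale by (intro continuous_intros)
  obtain I J where I: "\<And>F. ((\<lambda>t. \<Sum>x\<in>F. C x t) has_integral I F) (cbox 0 1)"
    and J: "(G has_integral J) (cbox 0 1)" and lim: "(I \<longlongrightarrow> J) (finite_subsets_at_top X)"
    using uniform_limit_integral_cbox[OF u contC] by (metis finite_subsets_at_top_neq_bot)
  have IF: "I F = (\<Sum>x\<in>F. if bform L x e = of_int m then p x * efun x \<zeta> else 0)" if "finite F" "F \<subseteq> X" for F
  proof -
    have "((\<lambda>t. \<Sum>x\<in>F. C x t) has_integral (\<Sum>x\<in>F. p x * efun x \<zeta> * (if \<lfloor>bform L x e\<rfloor> - m = 0 then 1 else 0))) {0..1}"
    proof (rule has_integral_sum[OF that(1)])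
      fix x assume "x \<in> F"
      then have "x \<in> X" using that by auto
      from has_integral_mult_right[OF integral_ee_int, of "p x * efun x \<zeta>"]
      show "(C x has_integral p x * efun x \<zeta> * (if \<lfloor>bform L x e\<rfloor> - m = 0 then 1 else 0)) {0..1}"
        unfolding CE[OF \<open>x \<in> X\<close>, abs_def] .
    qed
    then have "I F = (\<Sum>x\<in>F. p x * efun x \<zeta> * (if \<lfloor>bform L x e\<rfloor> - m = 0 then 1 else 0))"
      using I[of F] has_integral_unique by (simp add: cbox_interval) blast
    also have "\<dots> = (\<Sum>x\<in>F. if bform L x e = of_int m then p x * efun x \<zeta> else 0)"
    proof (rule sum.cong[OF refl])
      fix x assume "x \<in> F"
      then have "bform L x e \<in> \<int>" using X that e by (auto simp: Ld_iff)
      then show "p x * efun x \<zeta> * (if \<lfloor>bform L x e\<rfloor> - m = 0 then 1 else 0) = (if bform L x e = of_int m then p x * efun x \<zeta> else 0)"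
        by (auto elim!: Ints_cases)
    qed
    finally show ?thesis .
  qed
  have "((\<lambda>F. \<Sum>x\<in>F. if bform L x e = of_int m then p x * efun x \<zeta> else 0) \<longlongrightarrow> J) (finite_subsets_at_top X)"
    by (rule Lim_transform_eventually[OF lim]) (use IF in \<open>auto simp: eventually_finite_subsets_at_top\<close>)
  then have "((\<lambda>x. if bform L x e = of_int m then p x * efun x \<zeta> else 0) has_sum J) X"
    by (simp add: has_sum_def)
  moreover have "J = fourier_op e m g \<zeta>"
    using J unfolding fourier_op_def G_def by (simp add: cbox_interval integral_unique)
  ultimately have "((\<lambda>x. if bform L x e = of_int m then p x * efun x \<zeta> else 0) has_sum fourier_op e m g \<zeta>) X" by simp
  then show ?thesis by (rule has_sum_cong_neutral[THEN iffD1, rotated -1]) auto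
qed

text \<open>The hypothesis covers all real translates of \<open>\<zeta>\<close>, because each
  further integration moves the argument along a real direction.\<close>

lemma fourier_ops_series:
  assumes X: "X \<subseteq> Ld" and s: "\<And>x'. ((\<lambda>x. p x * efun x (\<zeta> + emb x')) has_sum f (\<zeta> + emb x')) X"
  shows "set es \<subseteq> b \<Longrightarrow>
    ((\<lambda>x. p x * efun x (\<zeta> + emb x')) has_sum fourier_ops es mm f (\<zeta> + emb x')) {x \<in> X. \<forall>e\<in>set es. bform L x e = of_int (mm e)}"
proof (induction es arbitrary: x')
  case Nil then show ?case using s by simp
next
  case (Cons e es)
  have "((\<lambda>x. p x * efun x (\<zeta> + emb x')) has_sum fourier_op e (mm e) (fourier_ops es mm f) (\<zeta> + emb x'))
      {x \<in> {x \<in> X. \<forall>e\<in>set es. bform L x e = of_int (mm e)}. bform L x e = of_int (mm e)}"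
  proof (rule fourier_op_series)
    fix y
    show "((\<lambda>x. p x * efun x (\<zeta> + emb x' + emb y)) has_sum fourier_ops es mm f (\<zeta> + emb x' + emb y))
        {x \<in> X. \<forall>e\<in>set es. bform L x e = of_int (mm e)}"
      using Cons.IH[of "x' + y"] Cons.prems by (simp add: emb_simps add.assoc)
  qed (use X Cons.prems in auto)
  moreover have "{x \<in> {x \<in> X. \<forall>e\<in>set es. bform L x e = of_int (mm e)}. bform L x e = of_int (mm e)} =
      {x \<in> X. \<forall>e\<in>set (e # es). bform L x e = of_int (mm e)}" by auto
  ultimately show ?case by simp
qed

definition "bl = (SOME es. set es = b \<and> distinct es)"

lemma bl: "set bl = b" "distinct bl"
  using someI_ex[OF finite_distinct_list[OF finb], folded bl_def] by auto

definition "mmf \<mu> e = \<lfloor>bform L \<mu> e\<rfloor>"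

lemma mmf: "\<mu> \<in> Ld \<Longrightarrow> e \<in> b \<Longrightarrow> of_int (mmf \<mu> e) = bform L \<mu> e"
  unfolding mmf_def by (auto simp: Ld_iff elim!: Ints_cases)

lemma Ld_eqI: "(\<And>e. e \<in> b \<Longrightarrow> bform L x e = bform L y e) \<Longrightarrow> x = y"
  using nondeg[of "x - y"] by (simp add: bf_diff)

text \<open>Frequencies along all of \<open>b\<close> single out one dual vector, so at most one
  term of the series is left.\<close>

lemma fourier_coefficient:
  assumes X: "X \<subseteq> Ld" and s: "\<And>x'. ((\<lambda>x. p x * efun x (\<zeta> + emb x')) has_sum f (\<zeta> + emb x')) X" and \<mu>: "\<mu> \<in> Ld"
  shows "fourier_ops bl (mmf \<mu>) f \<zeta> = (if \<mu> \<in> X then p \<mu> * efun \<mu> \<zeta> else 0)"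
proof -
  have *: "((\<lambda>x. p x * efun x (\<zeta> + emb 0)) has_sum fourier_ops bl (mmf \<mu>) f (\<zeta> + emb 0))
      {x \<in> X. \<forall>e\<in>set bl. bform L x e = of_int (mmf \<mu> e)}"
    by (rule fourier_ops_series[OF X s]) (simp add: bl)
  have "x = \<mu>" if "\<forall>e\<in>set bl. bform L x e = of_int (mmf \<mu> e)" for x
    using that mmf[OF \<mu>] by (intro Ld_eqI) (simp add: bl)
  then have "{x \<in> X. \<forall>e\<in>set bl. bform L x e = of_int (mmf \<mu> e)} = (if \<mu> \<in> X then {\<mu>} else {})"
    using mmf[OF \<mu>] by (auto simp: bl)
  with * have "((\<lambda>x. p x * efun x \<zeta>) has_sum fourier_ops bl (mmf \<mu>) f \<zeta>) (if \<mu> \<in> X then {\<mu>} else {})"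
    by (simp add: emb_simps)
  moreover have "((\<lambda>x. p x * efun x \<zeta>) has_sum (if \<mu> \<in> X then p \<mu> * efun \<mu> \<zeta> else 0)) (if \<mu> \<in> X then {\<mu>} else {})"
    using has_sum_finite[of "{\<mu>}" "\<lambda>x. p x * efun x \<zeta>"] by (cases "\<mu> \<in> X") simp_all
  ultimately show ?thesis by (rule has_sum_unique)
qed

lemma fourier_ops_zero: "fourier_ops es mm (\<lambda>_. 0) \<zeta> = 0"
  by (induction es arbitrary: \<zeta>) (auto simp: fourier_op_def)

lemma fourier_unique:
  assumes X: "X \<subseteq> Ld" and s: "\<And>x'. ((\<lambda>x. p x * efun x (\<zeta> + emb x')) has_sum 0) X" and \<mu>: "\<mu> \<in> X"
  shows "p \<mu> = 0"
  using fourier_coefficient[of X p \<zeta> "\<lambda>_. 0" \<mu>] X s \<mu> by (auto simp: fourier_ops_zero)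

lemma th_series_has_sum:
  assumes "\<tau> \<in> UH"
  shows "((\<lambda>x. c (cls x) * ee (Q \<tau> (emb x) / 2) * efun x \<zeta>) has_sum (\<Sum>\<gamma>\<in>disc L. c \<gamma> * th \<gamma> \<tau> \<zeta>)) Ld"
proof -
  let ?f = "\<lambda>x. c (cls x) * ee (Q \<tau> (emb x) / 2) * efun x \<zeta>"
  have part: "(?f has_sum (c \<gamma> * th \<gamma> \<tau> \<zeta>)) \<gamma>" if "\<gamma> \<in> disc L" for \<gamma>
  proof -
    have "((\<lambda>x. c \<gamma> * (1 * theta_term L v \<tau> \<zeta> x)) has_sum (c \<gamma> * th \<gamma> \<tau> \<zeta>)) \<gamma>"
      by (intro has_sum_cmult_right TH_has_sum lattice_subset_disc that exp_bounded_const assms)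
    then show ?thesis
      by (rule has_sum_cong[THEN iffD1, rotated]) (use disc_cases[OF that] in \<open>simp add: theta_term_efun mult.assoc\<close>)
  qed
  have "(?f has_sum (\<Sum>\<gamma>\<in>D. c \<gamma> * th \<gamma> \<tau> \<zeta>)) (\<Union>D)" if "D \<subseteq> disc L" for D
    using finite_subset[OF that finite_disc] that
  proof (induction D rule: finite_induct)
    case (insert \<gamma> D)
    have "\<gamma> \<inter> \<Union>D = {}" using disc_disjoint insert.prems insert.hyps(2) by blast
    moreover have "(?f has_sum (c \<gamma> * th \<gamma> \<tau> \<zeta>)) \<gamma>" using insert.prems by (intro part) simp
    moreover have "(?f has_sum (\<Sum>\<gamma>\<in>D. c \<gamma> * th \<gamma> \<tau> \<zeta>)) (\<Union>D)" using insert by simp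
    ultimately have "(?f has_sum (c \<gamma> * th \<gamma> \<tau> \<zeta> + (\<Sum>\<gamma>\<in>D. c \<gamma> * th \<gamma> \<tau> \<zeta>))) (\<gamma> \<union> \<Union>D)"
      by (intro has_sum_Un_disjoint)
    then show ?case using insert.hyps by simp
  qed simp
  from this[of "disc L"] show ?thesis by (simp add: Union_disc)
qed

text \<open>Components of different cosets have disjoint frequencies; the coefficient at the
  representative of \<open>\<gamma>\<close> is \<open>c \<gamma>\<close> times a nonvanishing
  Gaussian factor. The real translates of a single point already decide.\<close>

lemma th_independent:
  assumes "\<tau> \<in> UH" "\<And>x'. (\<Sum>\<gamma>\<in>disc L. c \<gamma> * th \<gamma> \<tau> (\<zeta> + emb x')) = 0" "\<gamma> \<in> disc L"
  shows "c \<gamma> = 0"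
proof -
  have hs: "((\<lambda>x. c (cls x) * ee (Q \<tau> (emb x) / 2) * efun x \<zeta>) has_sum (\<Sum>\<gamma>\<in>disc L. c \<gamma> * th \<gamma> \<tau> \<zeta>)) Ld" for \<zeta>
    by (rule th_series_has_sum[OF assms(1)])
  have "((\<lambda>x. c (cls x) * ee (Q \<tau> (emb x) / 2) * efun x (\<zeta> + emb x')) has_sum 0) Ld" for x'
    using hs[of "\<zeta> + emb x'"] unfolding assms(2) .
  from fourier_unique[OF subset_refl this rep_Ld[OF assms(3)]]
  have "c (cls (rep \<gamma>)) * ee (Q \<tau> (emb (rep \<gamma>)) / 2) = 0" .
  then show ?thesis using cls_rep[OF assms(3)] by simp
qed

lemma line_holomorphic_TH:
  assumes "lattice_subset Y" "exp_bounded p" "\<tau> \<in> UH"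
  shows "line_holomorphic (TH Y p \<tau>)"
  unfolding line_holomorphic_def
proof (intro conjI allI)
  show "continuous_on UNIV (TH Y p \<tau>)"
    using has_derivative_continuous[OF TH_has_derivative_\<zeta>[OF assms]] by (simp add: continuous_at_imp_continuous_on)
  show "(\<lambda>w. TH Y p \<tau> (\<zeta> + cscale w \<xi>)) holomorphic_on UNIV" for \<zeta> \<xi>
    unfolding holomorphic_on_def field_differentiable_def
    by (intro ballI exI) (rule TH_line_derivative[OF assms])
qed

lemma expand_dl_cplx: "\<zeta> = (\<Sum>e\<in>b. cscale (Bc (emb (dl e)) \<zeta>) (emb e))"
proof -
  have "fst (\<Sum>e\<in>b. cscale (Bc (emb (dl e)) \<zeta>) (emb e)) = (\<Sum>e\<in>b. bform L (fst \<zeta>) (dl e) *\<^sub>R e)"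
    by (simp add: fst_sum cscale_def emb_def cbform_def sym)
  moreover have "snd (\<Sum>e\<in>b. cscale (Bc (emb (dl e)) \<zeta>) (emb e)) = (\<Sum>e\<in>b. bform L (snd \<zeta>) (dl e) *\<^sub>R e)"
    by (simp add: snd_sum cscale_def emb_def cbform_def sym)
  ultimately show ?thesis using expand_dl by (simp add: prod_eq_iff)
qed

text \<open>A periodic entire function has Fourier coefficients \<open>c exp(2\<pi>i(\<mu>,\<zeta>))\<close> also at complex \<open>\<zeta>\<close>;
  this is what links the coefficients of an elliptic function to each other.\<close>

lemma fourier_ops_efun:
  assumes f: "line_holomorphic f" and per: "\<And>\<nu> \<zeta>. \<nu> \<in> lat L \<Longrightarrow> f (\<zeta> + emb \<nu>) = f \<zeta>" and \<mu>: "\<mu> \<in> Ld"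
  shows "fourier_ops bl (mmf \<mu>) f \<zeta> = fourier_ops bl (mmf \<mu>) f 0 * efun \<mu> \<zeta>"
proof -
  define g where "g = fourier_ops bl (mmf \<mu>) f"
  have step: "g (\<xi> + cscale w (emb e)) = efun \<mu> (cscale w (emb e)) * g \<xi>" if "e \<in> b" for \<xi> w e
    unfolding g_def using fourier_ops_shift[OF f, of bl e "mmf \<mu>" \<xi> w] per b_lat that
    by (simp add: bl efun_def Bc_cscale Bc_emb mult.commute mmf[OF \<mu> that, symmetric])
  have "g (\<Sum>e\<in>D. cscale (w e) (emb e)) = g 0 * efun \<mu> (\<Sum>e\<in>D. cscale (w e) (emb e))" if "D \<subseteq> b" for D w
    using finite_subset[OF that finb] that
  proof (induction D rule: finite_induct)
    case (insert e D)
    then show ?case using step[of e "\<Sum>e\<in>D. cscale (w e) (emb e)" "w e"]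
      by (simp add: add.commute efun_add mult_ac)
  qed simp
  from this[OF subset_refl, of "\<lambda>e. Bc (emb (dl e)) \<zeta>"] show ?thesis
    unfolding g_def expand_dl_cplx[symmetric] .
qed

theorem elliptic_is_theta:
  assumes \<tau>: "\<tau> \<in> UH" and f: "line_holomorphic f"
    and per: "\<And>\<nu> \<zeta>. \<nu> \<in> lat L \<Longrightarrow> f (\<zeta> + emb \<nu>) = f \<zeta>"
    and ell: "\<And>\<sigma> \<zeta>. \<sigma> \<in> lat L \<Longrightarrow> f (\<zeta> + mv \<tau> (emb \<sigma>)) = ee (- Q \<tau> (emb \<sigma>) / 2 - Bc (emb \<sigma>) \<zeta>) * f \<zeta>"
  shows "\<exists>c. \<forall>\<zeta>. f \<zeta> = (\<Sum>\<gamma>\<in>disc L. c \<gamma> * th \<gamma> \<tau> \<zeta>)"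
proof -
  define A where "A = (\<lambda>\<mu>. fourier_ops bl (mmf \<mu>) f 0)"
  have fA: "fourier_ops bl (mmf \<mu>) f \<zeta> = A \<mu> * efun \<mu> \<zeta>" if "\<mu> \<in> Ld" for \<mu> \<zeta>
    unfolding A_def by (rule fourier_ops_efun[OF f per that])
  \<comment> \<open>The coefficient at \<open>\<mu>\<close> of the translate by
    \<open>mv \<tau> (emb \<sigma>)\<close> is computed twice: from \<open>fA\<close> at a non-real
    argument, and from the elliptic law, whose factor moves the index to
    \<open>\<mu> + \<sigma>\<close>.\<close>
  have A_add: "A (\<mu> + \<sigma>) = A \<mu> * ee (Bc (emb \<mu>) (mv \<tau> (emb \<sigma>)) + Q \<tau> (emb \<sigma>) / 2)" if \<mu>: "\<mu> \<in> Ld" and \<sigma>: "\<sigma> \<in> lat L" for \<mu> \<sigma>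
  proof -
    let ?k = "\<lambda>\<zeta>. ee (- Q \<tau> (emb \<sigma>) / 2 - Bc (emb \<sigma>) \<zeta>)"
    have \<sigma>L: "\<sigma> \<in> Ld" using \<sigma> by (rule lat_Ld)
    have "A \<mu> * efun \<mu> (0 + mv \<tau> (emb \<sigma>)) = fourier_ops bl (mmf \<mu>) f (0 + mv \<tau> (emb \<sigma>))" by (rule fA[OF \<mu>, symmetric])
    also have "\<dots> = fourier_ops bl (mmf \<mu>) (\<lambda>\<zeta>. f (\<zeta> + mv \<tau> (emb \<sigma>))) 0" by (rule fourier_ops_translate[symmetric])
    also have "\<dots> = fourier_ops bl (mmf \<mu>) (\<lambda>\<zeta>. ?k \<zeta> * f \<zeta>) 0" by (simp only: ell[OF \<sigma>])
    also have "\<dots> = ?k 0 * fourier_ops bl (\<lambda>e. mmf \<mu> e - (- mmf \<sigma> e)) f 0"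
    proof (rule fourier_ops_twist)
      fix e \<zeta> and t :: real assume "e \<in> set bl"
      then have "e \<in> b" by (simp add: bl)
      then have "Bc (emb \<sigma>) (t *\<^sub>R emb e) = of_int (mmf \<sigma> e) * of_real t"
        by (simp add: cscale_of_real[symmetric] Bc_cscale Bc_emb mult.commute mmf[OF \<sigma>L, symmetric])
      then have "- Q \<tau> (emb \<sigma>) / 2 - Bc (emb \<sigma>) (\<zeta> + t *\<^sub>R emb e) =
          (- Q \<tau> (emb \<sigma>) / 2 - Bc (emb \<sigma>) \<zeta>) + of_int (- mmf \<sigma> e) * of_real t"
        by (simp add: Bc_add)
      then show "?k (\<zeta> + t *\<^sub>R emb e) = ?k \<zeta> * ee (of_int (- mmf \<sigma> e) * of_real t)"
        by (simp only: ee_add)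
    qed
    also have "fourier_ops bl (\<lambda>e. mmf \<mu> e - (- mmf \<sigma> e)) f = fourier_ops bl (mmf (\<mu> + \<sigma>)) f"
    proof (rule fourier_ops_cong)
      fix e assume "e \<in> set bl"
      then have "e \<in> b" by (simp add: bl)
      then have "real_of_int (mmf \<mu> e - (- mmf \<sigma> e)) = of_int (mmf (\<mu> + \<sigma>) e)"
        using mmf[OF \<mu>] mmf[OF \<sigma>L] mmf[OF Ld_add[OF \<mu> \<sigma>L]] by (simp add: bf_add)
      then show "mmf \<mu> e - (- mmf \<sigma> e) = mmf (\<mu> + \<sigma>) e" by (simp only: of_int_eq_iff)
    qed
    finally have *: "A \<mu> * efun \<mu> (mv \<tau> (emb \<sigma>)) = ee (- Q \<tau> (emb \<sigma>) / 2) * A (\<mu> + \<sigma>)" by (simp add: A_def)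
    have "A (\<mu> + \<sigma>) = ee (Q \<tau> (emb \<sigma>) / 2) * (ee (- Q \<tau> (emb \<sigma>) / 2) * A (\<mu> + \<sigma>))"
      by (simp add: mult.assoc[symmetric] ee_add[symmetric])
    also have "\<dots> = A \<mu> * (efun \<mu> (mv \<tau> (emb \<sigma>)) * ee (Q \<tau> (emb \<sigma>) / 2))" unfolding *[symmetric] by (simp add: mult_ac)
    finally show ?thesis unfolding efun_def ee_add[symmetric] .
  qed
  \<comment> \<open>Dividing by the Gaussian \<open>ee (Q \<tau> (emb \<mu>) / 2)\<close> leaves a
    function of the coset, since the exponent in \<open>A_add\<close> is exactly the difference of
    the two Gaussian exponents.\<close>
  define c where "c = (\<lambda>\<gamma>. A (rep \<gamma>) * ee (- Q \<tau> (emb (rep \<gamma>)) / 2))"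
  have Ac: "A \<mu> = c (cls \<mu>) * ee (Q \<tau> (emb \<mu>) / 2)" if \<mu>: "\<mu> \<in> Ld" for \<mu>
  proof -
    define r where "r = rep (cls \<mu>)"
    define \<sigma> where "\<sigma> = \<mu> - r"
    have r: "r \<in> Ld" unfolding r_def by (rule rep_Ld[OF cls_disc[OF \<mu>]])
    have "\<sigma> \<in> lat L" unfolding \<sigma>_def r_def by (rule rep_cls[OF \<mu>])
    have \<mu>r: "\<mu> = r + \<sigma>" by (simp add: \<sigma>_def)
    let ?X = "Bc (emb r) (mv \<tau> (emb \<sigma>)) + Q \<tau> (emb \<sigma>) / 2"
    have q: "Q \<tau> (emb \<mu>) / 2 = Q \<tau> (emb r) / 2 + ?X"
      unfolding \<mu>r emb_simps Q_def B_simps by (simp add: field_simps Bpm_sym[of "emb \<sigma>" "emb r"])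
    have "ee (- Q \<tau> (emb r) / 2) * ee (Q \<tau> (emb r) / 2) = 1" by (simp add: ee_add[symmetric])
    then have "A r * ee (- Q \<tau> (emb r) / 2) * (ee (Q \<tau> (emb r) / 2) * ee ?X) = A r * ee ?X"
      by (metis mult.assoc mult_1)
    then show ?thesis
      unfolding c_def r_def[symmetric] q ee_add[of "Q \<tau> (emb r) / 2"]
      using A_add[OF r \<open>\<sigma> \<in> lat L\<close>] \<mu>r by simp
  qed
  define G where "G = (\<lambda>\<zeta>. \<Sum>\<gamma>\<in>disc L. c \<gamma> * th \<gamma> \<tau> \<zeta>)"
  have lG: "line_holomorphic G"
    unfolding G_def by (intro line_holomorphic_sum line_holomorphic_mult line_holomorphic_const line_holomorphic_TH lattice_subset_disc exp_bounded_const \<tau>)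
  have Gs: "((\<lambda>x. c (cls x) * ee (Q \<tau> (emb x) / 2) * efun x \<zeta>) has_sum G \<zeta>) Ld" for \<zeta>
    unfolding G_def by (rule th_series_has_sum[OF \<tau>])
  have "f \<zeta> - G \<zeta> = 0" for \<zeta>
  proof (rule fourier_ops_complete[OF line_holomorphic_diff[OF f lG] bl(2)])
    fix mm \<zeta>
    \<comment> \<open>Every integer frequency vector belongs to a dual vector, so it suffices to
      compare the coefficients indexed by \<open>Ld\<close>.\<close>
    obtain \<mu> where \<mu>: "\<mu> \<in> Ld" "\<And>e. e \<in> b \<Longrightarrow> bform L \<mu> e = of_int (mm e)"       using Ld_of_int_exists[of mm] by blast
    have mm: "fourier_ops bl mm h = fourier_ops bl (mmf \<mu>) h" for h
      by (rule fourier_ops_cong) (use \<mu> in \<open>simp add: bl mmf_def\<close>)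
    have "fourier_ops bl (mmf \<mu>) G \<zeta> = c (cls \<mu>) * ee (Q \<tau> (emb \<mu>) / 2) * efun \<mu> \<zeta>"
      using fourier_coefficient[OF subset_refl Gs \<mu>(1)] \<mu>(1) by simp
    then show "fourier_ops bl mm (\<lambda>\<zeta>. f \<zeta> - G \<zeta>) \<zeta> = 0"
      unfolding mm fourier_ops_diff[OF f lG] fA[OF \<mu>(1)] Ac[OF \<mu>(1)] by simp
  qed
  then have "\<forall>\<zeta>. f \<zeta> = G \<zeta>" by simp
  then show ?thesis unfolding G_def by blast
qed

end

section \<open>The inversion formula\<close>

text \<open>Compares second derivatives at the origin. The Gaussian has first derivative zero there,
  so its only contribution is \<open>2 * pi * \<i> * \<alpha> * h 0\<close>.\<close>

lemma second_derivative_gauss: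
  fixes h k :: "complex \<Rightarrow> complex"
  assumes eq: "\<And>w. ee (\<alpha> * w\<^sup>2 / 2) * h w = c * k w"
    and h: "\<And>w. (h has_field_derivative h1 w) (at w)" "(h1 has_field_derivative h2) (at 0)"
    and k: "\<And>w. (k has_field_derivative k1 w) (at w)" "(k1 has_field_derivative k2) (at 0)"
  shows "2 * of_real pi * \<i> * \<alpha> * h 0 + h2 = c * k2"
proof -
  have e: "((\<lambda>w. ee (\<alpha> * w\<^sup>2 / 2)) has_field_derivative 2 * of_real pi * \<i> * \<alpha> * w * ee (\<alpha> * w\<^sup>2 / 2)) (at w)" for w
    unfolding ee_def by (auto intro!: derivative_eq_intros)
  let ?E = "\<lambda>w. 2 * of_real pi * \<i> * \<alpha> * w * ee (\<alpha> * w\<^sup>2 / 2)"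
  have 1: "?E w * h w + h1 w * ee (\<alpha> * w\<^sup>2 / 2) = c * k1 w" for w
  proof (rule DERIV_unique)
    show "((\<lambda>w. ee (\<alpha> * w\<^sup>2 / 2) * h w) has_field_derivative ?E w * h w + h1 w * ee (\<alpha> * w\<^sup>2 / 2)) (at w)"
      by (rule DERIV_mult[OF e h(1)])
    show "((\<lambda>w. ee (\<alpha> * w\<^sup>2 / 2) * h w) has_field_derivative c * k1 w) (at w)"
      unfolding eq by (rule DERIV_cmult[OF k(1)])
  qed
  have "((\<lambda>w. ?E w * h w + h1 w * ee (\<alpha> * w\<^sup>2 / 2)) has_field_derivative 2 * of_real pi * \<i> * \<alpha> * h 0 + h2) (at 0)"
    by (rule derivative_eq_intros e h refl | simp)+
  moreover have "((\<lambda>w. ?E w * h w + h1 w * ee (\<alpha> * w\<^sup>2 / 2)) has_field_derivative c * k2) (at 0)"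
    unfolding 1 by (rule DERIV_cmult[OF k(2)])
  ultimately show ?thesis by (rule DERIV_unique)
qed

lemma sum_affine:
  fixes K M N :: complex
  assumes "\<And>e. e \<in> E \<Longrightarrow> K - M * f e = N * g e"
  shows "of_nat (card E) * K - M * sum f E = N * sum g E"
proof -
  have "(\<Sum>e\<in>E. K - M * f e) = (\<Sum>e\<in>E. N * g e)" by (rule sum.cong[OF refl assms])
  then show ?thesis by (simp add: sum_subtractf sum_distrib_left)
qed

text \<open>Used with \<open>p = pi\<close>, the dimension \<open>n\<close> and the inversion scalar
  \<open>d\<close>: on the positive part \<open>c = \<tau>\<close> and \<open>s = -1\<close>, on the
  negative part \<open>c = cnj \<tau>\<close> and \<open>s = 1\<close>.\<close>

lemma heat_algebra:
  fixes p c C T U s n d :: complex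
  assumes "p \<noteq> 0" "c \<noteq> 0" and eq: "n * (2 * p * \<i> * (s / c) * U) - 4 * p\<^sup>2 * (1 / c)\<^sup>2 * T = (- 4 * p\<^sup>2 * d) * C"
  shows "p * \<i> * (T / c\<^sup>2 - d * C) = - s * n / (2 * c) * U"
proof -
  have "4 * p\<^sup>2 * (T / c\<^sup>2 - d * C) = n * (2 * p * \<i> * (s / c) * U)"
    using eq by (simp add: algebra_simps power_divide)
  then have "\<i> * (4 * p\<^sup>2 * (T / c\<^sup>2 - d * C)) = \<i> * (n * (2 * p * \<i> * (s / c) * U))" by simp
  then have "(4 * p) * (p * \<i> * (T / c\<^sup>2 - d * C)) = (4 * p) * (- s * n / (2 * c) * U)"
    using assms(2) by (simp add: power2_eq_square mult_ac)
  moreover have "4 * p \<noteq> 0" using assms(1) by simp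
  ultimately show ?thesis using mult_left_cancel by blast
qed

context lat_gr
begin

lemma UH_nonzero: "\<tau> \<in> UH \<Longrightarrow> \<tau> \<noteq> 0"
  by (auto simp: upper_half_plane_iff)

lemma UH_inv: "\<tau> \<in> UH \<Longrightarrow> - 1 / \<tau> \<in> UH"
  by (auto simp: upper_half_plane_iff Im_divide power2_eq_square intro!: divide_pos_pos add_nonneg_pos)

lemma bounded_bilinear_bform: "bounded_bilinear (bform L)"
proof
  obtain K where "\<And>x y. \<bar>bform L x y\<bar> \<le> K * norm x * norm y" using bform_bounded by blast
  then show "\<exists>K. \<forall>a b. norm (bform L a b) \<le> norm a * norm b * K"
    by (intro exI[of _ K]) (simp add: mult_ac)
qed (auto simp: bf_simps)

lemma bounded_linear_pp: "bounded_linear pp" and bounded_linear_pm: "bounded_linear pm"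
  by (rule linear_findim_bounded[OF finb indb spanb lin_pp] linear_findim_bounded[OF finb indb spanb lin_pm])+

lemmas [continuous_intros] = bounded_bilinear.continuous_on[OF bounded_bilinear_bform]
  bounded_linear.continuous_on[OF bounded_linear_pp] bounded_linear.continuous_on[OF bounded_linear_pm]

lemma continuous_Bc: "continuous_on S f \<Longrightarrow> continuous_on S g \<Longrightarrow> continuous_on S (\<lambda>x. Bc (f x) (g x))"
  unfolding cbform_def Complex_eq by (intro continuous_intros)

lemma continuous_cp: "continuous_on S f \<Longrightarrow> continuous_on S (\<lambda>x. cp (f x))"
  and continuous_cm: "continuous_on S f \<Longrightarrow> continuous_on S (\<lambda>x. cm (f x))"
  unfolding cp_def cm_def by (intro continuous_intros; simp)+

lemma continuous_cscale: "continuous_on S f \<Longrightarrow> continuous_on S g \<Longrightarrow> continuous_on S (\<lambda>x. cscale (f x) (g x))"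
  for f :: "'a::topological_space \<Rightarrow> complex" and g :: "'a \<Rightarrow> 'v \<times> 'v"
  unfolding cscale_def by (intro continuous_intros; simp)+

lemma continuous_mv: "continuous_on S f \<Longrightarrow> continuous_on S (\<lambda>x. mv c (f x))"
  unfolding mv_def by (intro continuous_intros continuous_cscale continuous_cp continuous_cm)

lemma mv_cscale: "mv c (cscale w \<xi>) = cscale w (mv c \<xi>)"
  by (simp add: mv_def cp_cscale cm_cscale cscale_simps mult.commute)

lemma line_holomorphic_mv: "line_holomorphic f \<Longrightarrow> line_holomorphic (\<lambda>\<zeta>. f (mv c \<zeta>))"
  unfolding line_holomorphic_def[of "\<lambda>\<zeta>. f (mv c \<zeta>)"] mv_add mv_cscale
proof (intro conjI allI)
  assume f: "line_holomorphic f"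
  show "continuous_on UNIV (\<lambda>\<zeta>. f (mv c \<zeta>))"
    by (intro continuous_line_holomorphic_comp[OF f] continuous_mv continuous_on_id)
  show "(\<lambda>w. f (mv c \<zeta> + cscale w (mv c \<xi>))) holomorphic_on UNIV" for \<zeta> \<xi>
    using f unfolding line_holomorphic_def by blast
qed

lemma line_holomorphic_Q: "line_holomorphic (Q c)"
proof -
  have "continuous_on UNIV (Q c)"
    unfolding Q_def[abs_def] Bp_def Bm_def
    by (intro continuous_intros continuous_Bc continuous_cp continuous_cm)
  then show ?thesis
    unfolding line_holomorphic_def Q_def Bpm_add Bpm_cscale by (intro conjI allI holomorphic_intros)
qed

lemma line_holomorphic_ee: "line_holomorphic f \<Longrightarrow> line_holomorphic (\<lambda>\<zeta>. ee (f \<zeta>))"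
  unfolding line_holomorphic_def by (auto intro!: continuous_intros holomorphic_intros)

text \<open>The theta component transformed by \<open>S\<close>, with the exponential factor of the
  index brought to this side and the weight left out; the weight is found only afterwards.\<close>

definition "slashed_th x \<tau> \<zeta> = ee (- Q (1 / \<tau>) \<zeta> / 2) * th (cls x) (- 1 / \<tau>) (mv (1 / \<tau>) \<zeta>)"

lemma line_holomorphic_slashed_th: "x \<in> Ld \<Longrightarrow> \<tau> \<in> UH \<Longrightarrow> line_holomorphic (slashed_th x \<tau>)"
proof -
  assume x: "x \<in> Ld" and \<tau>: "\<tau> \<in> UH"
  have "line_holomorphic (\<lambda>\<zeta>. ee ((- 1 / 2) * Q (1 / \<tau>) \<zeta>) * th (cls x) (- 1 / \<tau>) (mv (1 / \<tau>) \<zeta>))"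
    by (intro line_holomorphic_mult line_holomorphic_ee line_holomorphic_const line_holomorphic_Q line_holomorphic_mv line_holomorphic_TH lattice_subset_disc cls_disc x exp_bounded_const UH_inv \<tau>)
  then show ?thesis by (simp add: slashed_th_def[abs_def])
qed

text \<open>\<open>S\<close> exchanges the two kinds of translation:
  \<open>mv \<tau> (emb \<sigma>)\<close> becomes the real period \<open>\<sigma>\<close> of the
  component at \<open>- 1 / \<tau>\<close>, and a real period becomes a translation that permutes
  the components.\<close>

lemma slashed_th_shift:
  assumes "x \<in> Ld" "\<sigma> \<in> Ld" "\<tau> \<in> UH"
  shows "slashed_th x \<tau> (\<zeta> + mv \<tau> (emb \<sigma>)) =
    ee (of_real (bform L x \<sigma>)) * (ee (- Q \<tau> (emb \<sigma>) / 2 - Bc (emb \<sigma>) \<zeta>) * slashed_th x \<tau> \<zeta>)"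
proof -
  have \<tau>0: "\<tau> \<noteq> 0" "cnj \<tau> \<noteq> 0" using UH_nonzero[OF assms(3)] by auto
  have m: "mv (1 / \<tau>) (\<zeta> + mv \<tau> (emb \<sigma>)) = mv (1 / \<tau>) \<zeta> + emb \<sigma>"
    using \<tau>0 by (simp add: mv_add mv_mv)
  have q: "- Q (1 / \<tau>) (\<zeta> + mv \<tau> (emb \<sigma>)) / 2 = (- Q \<tau> (emb \<sigma>) / 2 - Bc (emb \<sigma>) \<zeta>) + (- Q (1 / \<tau>) \<zeta> / 2)"
    unfolding Q_def B_simps using \<tau>0 Bpm_sym[of "emb \<sigma>" \<zeta>] by (simp add: field_simps)
  show ?thesis
    unfolding slashed_th_def m q ee_add th_cls_period[OF assms(1,2)] by (simp add: mult_ac)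
qed

lemma slashed_th_period:
  assumes "x \<in> Ld" "\<nu> \<in> Ld" "\<tau> \<in> UH"
  shows "slashed_th x \<tau> (\<zeta> + emb \<nu>) = slashed_th (x - \<nu>) \<tau> \<zeta>"
proof -
  have \<tau>0: "\<tau> \<noteq> 0" "cnj \<tau> \<noteq> 0" using UH_nonzero[OF assms(3)] by auto
  have m: "mv (1 / \<tau>) (\<zeta> + emb \<nu>) = mv (1 / \<tau>) \<zeta> + mv (- 1 / \<tau>) (emb (- \<nu>))"
    using mv_neg[of "1 / \<tau>"] by (simp add: mv_add emb_simps mv_minus)
  have "- Q (1 / \<tau>) (\<zeta> + emb \<nu>) / 2 + (- Q (- 1 / \<tau>) (emb (- \<nu>)) / 2 - Bc (emb (- \<nu>)) (mv (1 / \<tau>) \<zeta>)) = - Q (1 / \<tau>) \<zeta> / 2"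
    unfolding Q_def emb_simps B_simps using \<tau>0 Bpm_sym[of "emb \<nu>" \<zeta>] by (simp add: field_simps)
  then have e: "ee (- Q (1 / \<tau>) (\<zeta> + emb \<nu>) / 2) * ee (- Q (- 1 / \<tau>) (emb (- \<nu>)) / 2 - Bc (emb (- \<nu>)) (mv (1 / \<tau>) \<zeta>)) = ee (- Q (1 / \<tau>) \<zeta> / 2)"
    unfolding ee_add[symmetric] by simp
  show ?thesis
    unfolding slashed_th_def m th_cls_shift[OF assms(1) Ld_minus[OF assms(2)]] mult.assoc[symmetric] e by simp
qed

definition "tr \<sigma> \<gamma> = (\<lambda>y. y + \<sigma>) ` (\<gamma> :: 'v set)"

lemma tr_cls: "x \<in> Ld \<Longrightarrow> \<sigma> \<in> Ld \<Longrightarrow> tr \<sigma> (cls x) = cls (x + \<sigma>)"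
  unfolding tr_def by (rule cls_add_image)

lemma tr_disc: "\<gamma> \<in> disc L \<Longrightarrow> \<sigma> \<in> Ld \<Longrightarrow> tr \<sigma> \<gamma> \<in> disc L"
  unfolding disc_eq using tr_cls Ld_add by auto

lemma tr_tr: "tr \<sigma> (tr (- \<sigma>) \<gamma>) = \<gamma>"
  by (auto simp: tr_def image_image)

lemma sum_disc_tr:
  assumes "\<sigma> \<in> Ld"
  shows "(\<Sum>\<gamma>\<in>disc L. f (tr \<sigma> \<gamma>)) = (\<Sum>\<gamma>\<in>disc L. f \<gamma>)"
proof -
  have "tr (- \<sigma>) (tr \<sigma> \<gamma>) = \<gamma>" for \<gamma> using tr_tr[of "- \<sigma>" \<gamma>] by simp
  then have "bij_betw (tr \<sigma>) (disc L) (disc L)"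
    by (intro bij_betw_byWitness[where f' = "tr (- \<sigma>)"] image_subsetI ballI tr_tr tr_disc assms Ld_minus)
  then show ?thesis by (rule sum.reindex_bij_betw)
qed

lemma th_disc_shift:
  "\<gamma> \<in> disc L \<Longrightarrow> \<sigma> \<in> Ld \<Longrightarrow> th \<gamma> \<tau> (\<zeta> + mv \<tau> (emb \<sigma>)) = ee (- Q \<tau> (emb \<sigma>) / 2 - Bc (emb \<sigma>) \<zeta>) * th (tr \<sigma> \<gamma>) \<tau> \<zeta>"
  by (simp add: th_shift tr_def)

lemma th_disc_period:
  "\<gamma> \<in> disc L \<Longrightarrow> \<nu> \<in> Ld \<Longrightarrow> th \<gamma> \<tau> (\<zeta> + emb \<nu>) = ee (of_real (bform L (rep \<gamma>) \<nu>)) * th \<gamma> \<tau> \<zeta>"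
  using th_cls_period[OF rep_Ld, of \<gamma> \<nu>] by (simp add: cls_rep)

lemma th_eq_coeffs:
  assumes "\<tau> \<in> UH" "\<And>\<zeta>. (\<Sum>\<gamma>\<in>disc L. c \<gamma> * th \<gamma> \<tau> \<zeta>) = (\<Sum>\<gamma>\<in>disc L. c' \<gamma> * th \<gamma> \<tau> \<zeta>)" "\<gamma> \<in> disc L"
  shows "c \<gamma> = c' \<gamma>"
proof -
  have "c \<gamma> - c' \<gamma> = 0"
    by (rule th_independent[OF assms(1) _ assms(3), where \<zeta> = 0])
       (simp add: left_diff_distrib sum_subtractf assms(2))
  then show ?thesis by simp
qed

lemma bform_rep_cls: "x \<in> Ld \<Longrightarrow> y \<in> Ld \<Longrightarrow> ee (of_real (bform L x (rep (cls y)))) = ee (of_real (bform L x y))"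
  using cls_bform_mod[OF rep_in[OF cls_disc], of y x] sym by simp

lemma slashed_th_expansion:
  assumes \<tau>: "\<tau> \<in> UH"
  shows "\<exists>c. \<forall>x\<in>Ld. \<forall>\<zeta>. slashed_th x \<tau> \<zeta> = c * (\<Sum>\<gamma>\<in>disc L. ee (- of_real (bform L x (rep \<gamma>))) * th \<gamma> \<tau> \<zeta>)"
proof -
  have "\<exists>C. \<forall>\<zeta>. slashed_th x \<tau> \<zeta> = (\<Sum>\<gamma>\<in>disc L. C \<gamma> * th \<gamma> \<tau> \<zeta>)" if x: "x \<in> Ld" for x
  proof (rule elliptic_is_theta[OF \<tau> line_holomorphic_slashed_th[OF x \<tau>]])
    fix \<nu> \<zeta> assume \<nu>: "\<nu> \<in> lat L"
    have "cls (x - \<nu>) = cls x" using \<nu> x by (subst cls_eq_iff) (auto intro: Ld_diff lat_Ld lat_minus)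
    then show "slashed_th x \<tau> (\<zeta> + emb \<nu>) = slashed_th x \<tau> \<zeta>"
      using slashed_th_period[OF x lat_Ld[OF \<nu>] \<tau>] by (simp add: slashed_th_def)
    show "slashed_th x \<tau> (\<zeta> + mv \<tau> (emb \<nu>)) = ee (- Q \<tau> (emb \<nu>) / 2 - Bc (emb \<nu>) \<zeta>) * slashed_th x \<tau> \<zeta>"
      using slashed_th_shift[OF x lat_Ld[OF \<nu>] \<tau>] ee_int[OF Ld_lat_Ints[OF x \<nu>]] by simp
  qed
  then have "\<forall>x\<in>Ld. \<exists>C. \<forall>\<zeta>. slashed_th x \<tau> \<zeta> = (\<Sum>\<gamma>\<in>disc L. C \<gamma> * th \<gamma> \<tau> \<zeta>)" by (rule ballI)
  from bchoice[OF this] obtain C where C: "\<And>x \<zeta>. x \<in> Ld \<Longrightarrow> slashed_th x \<tau> \<zeta> = (\<Sum>\<gamma>\<in>disc L. C x \<gamma> * th \<gamma> \<tau> \<zeta>)"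
    by (elim exE) (rule that, drule (1) bspec, erule spec)
  \<comment> \<open>Translation by \<open>mv \<tau> (emb y)\<close> acts on
    \<open>slashed_th x\<close> by a character and on the theta components by a permutation. All
    coefficients thus follow from the one at \<open>cls 0\<close>.\<close>
  have 1: "ee (of_real (bform L x y)) * C x (cls y) = C x (cls 0)" if x: "x \<in> Ld" and y: "y \<in> Ld" for x y
  proof -
    have "ee (of_real (bform L x y)) * C x (cls y) = C x (tr (- y) (cls y))"
    proof (rule th_eq_coeffs[OF \<tau> _ cls_disc[OF y]])
      fix \<zeta>
      let ?k = "ee (- Q \<tau> (emb y) / 2 - Bc (emb y) \<zeta>)"
      have "?k * (\<Sum>\<gamma>\<in>disc L. ee (of_real (bform L x y)) * C x \<gamma> * th \<gamma> \<tau> \<zeta>) = slashed_th x \<tau> (\<zeta> + mv \<tau> (emb y))"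
        unfolding slashed_th_shift[OF x y \<tau>] unfolding C[OF x] by (simp add: sum_distrib_left sum_distrib_right mult_ac)
      also have "\<dots> = (\<Sum>\<gamma>\<in>disc L. C x \<gamma> * (?k * th (tr y \<gamma>) \<tau> \<zeta>))"
        unfolding C[OF x] by (intro sum.cong refl) (simp add: th_disc_shift[OF _ y])
      also have "\<dots> = ?k * (\<Sum>\<gamma>\<in>disc L. C x (tr (- y) (tr y \<gamma>)) * th (tr y \<gamma>) \<tau> \<zeta>)"
        using tr_tr[of "- y"] by (simp add: sum_distrib_left mult_ac)
      also have "(\<Sum>\<gamma>\<in>disc L. C x (tr (- y) (tr y \<gamma>)) * th (tr y \<gamma>) \<tau> \<zeta>) = (\<Sum>\<gamma>\<in>disc L. C x (tr (- y) \<gamma>) * th \<gamma> \<tau> \<zeta>)"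
        by (rule sum_disc_tr[OF y])
      finally show "(\<Sum>\<gamma>\<in>disc L. ee (of_real (bform L x y)) * C x \<gamma> * th \<gamma> \<tau> \<zeta>) = (\<Sum>\<gamma>\<in>disc L. C x (tr (- y) \<gamma>) * th \<gamma> \<tau> \<zeta>)"
        by simp
    qed
    then show ?thesis using tr_cls[OF y Ld_minus[OF y]] by simp
  qed
  \<comment> \<open>The real period \<open>x\<close> turns \<open>slashed_th x\<close> into
    \<open>slashed_th 0\<close>, and on the component of \<open>cls 0\<close> it acts trivially; so
    the coefficient there does not depend on \<open>x\<close>.\<close>
  have 2: "C x (cls 0) = C 0 (cls 0)" if x: "x \<in> Ld" for x
  proof -
    have "ee (of_real (bform L (rep (cls 0)) x)) * C x (cls 0) = C 0 (cls 0)"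
    proof (rule th_eq_coeffs[OF \<tau> _ cls_disc[OF Ld_0]])
      fix \<zeta>
      have "(\<Sum>\<gamma>\<in>disc L. ee (of_real (bform L (rep \<gamma>) x)) * C x \<gamma> * th \<gamma> \<tau> \<zeta>) = slashed_th x \<tau> (\<zeta> + emb x)"
        unfolding C[OF x] by (intro sum.cong refl) (simp add: th_disc_period[OF _ x])
      also have "\<dots> = (\<Sum>\<gamma>\<in>disc L. C 0 \<gamma> * th \<gamma> \<tau> \<zeta>)"
        using slashed_th_period[OF x x \<tau>] C[OF Ld_0] by simp
      finally show "(\<Sum>\<gamma>\<in>disc L. ee (of_real (bform L (rep \<gamma>) x)) * C x \<gamma> * th \<gamma> \<tau> \<zeta>) = (\<Sum>\<gamma>\<in>disc L. C 0 \<gamma> * th \<gamma> \<tau> \<zeta>)" .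
    qed
    moreover have "ee (of_real (bform L (rep (cls 0)) x)) = 1"
      using bform_rep_cls[OF x Ld_0] sym[of x] by simp
    ultimately show ?thesis by simp
  qed
  have "C x \<gamma> = C 0 (cls 0) * ee (- of_real (bform L x (rep \<gamma>)))" if x: "x \<in> Ld" and \<gamma>: "\<gamma> \<in> disc L" for x \<gamma>
    using 1[OF x rep_Ld[OF \<gamma>]] 2[OF x] unfolding cls_rep[OF \<gamma>] by (simp add: ee_minus field_simps)
  then have "slashed_th x \<tau> \<zeta> = C 0 (cls 0) * (\<Sum>\<gamma>\<in>disc L. ee (- of_real (bform L x (rep \<gamma>))) * th \<gamma> \<tau> \<zeta>)" if "x \<in> Ld" for x \<zeta>
    unfolding C[OF that] sum_distrib_left using that by (intro sum.cong refl) (simp add: mult_ac)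
  then show ?thesis by blast
qed

text \<open>Chosen separately at each \<open>\<tau>\<close>, so its regularity is still open;
  differentiability will come from writing it as a quotient of theta values.\<close>

definition "inversion_factor \<tau> = (SOME c. \<forall>x\<in>Ld. \<forall>\<zeta>. slashed_th x \<tau> \<zeta> = c * (\<Sum>\<gamma>\<in>disc L. ee (- of_real (bform L x (rep \<gamma>))) * th \<gamma> \<tau> \<zeta>))"

lemma inversion_factor: "\<tau> \<in> UH \<Longrightarrow> x \<in> Ld \<Longrightarrow>
    slashed_th x \<tau> \<zeta> = inversion_factor \<tau> * (\<Sum>\<gamma>\<in>disc L. ee (- of_real (bform L x (rep \<gamma>))) * th \<gamma> \<tau> \<zeta>)"
  using someI_ex[OF slashed_th_expansion, folded inversion_factor_def] by blast

text \<open>For nontrivial \<open>\<delta>\<close>, biduality gives a dual vector \<open>y\<close>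
  with a nontrivial character value. Translating the sum by \<open>y\<close> multiplies it by that
  value, so it vanishes.\<close>

lemma character_sum:
  assumes \<delta>: "\<delta> \<in> disc L"
  shows "(\<Sum>\<gamma>\<in>disc L. ee (of_real (bform L (rep \<gamma>) (rep \<delta>)))) = (if \<delta> = cls 0 then of_nat (card (disc L)) else 0)"
proof (cases "\<delta> = cls 0")
  case True
  have "ee (of_real (bform L (rep \<gamma>) (rep \<delta>))) = 1" if "\<gamma> \<in> disc L" for \<gamma>
    unfolding True using bform_rep_cls[OF rep_Ld[OF that] Ld_0] by simp
  then show ?thesis using True by simp
next
  case False
  have "\<exists>y\<in>Ld. bform L (rep \<delta>) y \<notin> \<int>"
  proof (rule ccontr)
    assume "\<not> ?thesis"
    then have "rep \<delta> \<in> lat L" by (intro Ld_Ld_lat) auto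
    then have "cls (rep \<delta>) = cls 0" using cls_eq_iff[OF rep_Ld[OF \<delta>] Ld_0] by simp
    with False show False by (simp add: cls_rep[OF \<delta>])
  qed
  then obtain y where y: "y \<in> Ld" "bform L (rep \<delta>) y \<notin> \<int>" by blast
  let ?f = "\<lambda>\<gamma>. ee (of_real (bform L (rep \<gamma>) (rep \<delta>)))"
  have "?f (tr y \<gamma>) = ee (of_real (bform L (rep \<delta>) y)) * ?f \<gamma>" if \<gamma>: "\<gamma> \<in> disc L" for \<gamma>
  proof -
    have "tr y \<gamma> = cls (rep \<gamma> + y)" using tr_cls[OF rep_Ld[OF \<gamma>] y(1)] by (simp add: cls_rep[OF \<gamma>])
    then have "?f (tr y \<gamma>) = ee (of_real (bform L (rep \<gamma> + y) (rep \<delta>)))"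
      using bform_rep_cls[OF rep_Ld[OF \<delta>] Ld_add[OF rep_Ld[OF \<gamma>] y(1)]] sym by simp
    then show ?thesis by (simp add: bf_add ee_add sym[of y] mult.commute)
  qed
  then have "(\<Sum>\<gamma>\<in>disc L. ?f (tr y \<gamma>)) = ee (of_real (bform L (rep \<delta>) y)) * (\<Sum>\<gamma>\<in>disc L. ?f \<gamma>)"
    by (simp add: sum_distrib_left)
  then have "(\<Sum>\<gamma>\<in>disc L. ?f \<gamma>) = ee (of_real (bform L (rep \<delta>) y)) * (\<Sum>\<gamma>\<in>disc L. ?f \<gamma>)"
    using sum_disc_tr[OF y(1), of ?f] by simp
  moreover have "ee (of_real (bform L (rep \<delta>) y)) \<noteq> 1" using y(2) ee_eq_1_iff by blast
  ultimately show ?thesis using False by simp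
qed

lemma character_sum':
  assumes \<delta>: "\<delta> \<in> disc L"
  shows "(\<Sum>\<gamma>\<in>disc L. ee (- of_real (bform L (rep \<gamma>) (rep \<delta>)))) = (if \<delta> = cls 0 then of_nat (card (disc L)) else 0)"
proof -
  have "ee (- of_real r) = cnj (ee (of_real r))" for r by (simp add: ee_def exp_cnj)
  then have "(\<Sum>\<gamma>\<in>disc L. ee (- of_real (bform L (rep \<gamma>) (rep \<delta>)))) = cnj (\<Sum>\<gamma>\<in>disc L. ee (of_real (bform L (rep \<gamma>) (rep \<delta>))))"
    by simp
  then show ?thesis unfolding character_sum[OF \<delta>] by simp
qed

text \<open>At \<open>\<zeta> = 0\<close> the law relates nonnegative real theta constants. With
  \<open>T\<close> their sum and \<open>K\<close> the scalar, the class of zero gives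
  \<open>r (cls 0) = K * T\<close>, and summing the law over all classes gives
  \<open>T = K * |D| * r (cls 0)\<close>.\<close>

lemma inversion_factor_i: "inversion_factor \<i> = of_real (1 / sqrt (card (disc L)))"
proof -
  have i: "\<i> \<in> UH" by (simp add: upper_half_plane_iff)
  define t where "t = (\<lambda>\<gamma>. th \<gamma> \<i> 0)"
  define r where "r = (\<lambda>\<gamma>. \<Sum>\<^sub>\<infinity>x\<in>\<gamma>. exp (- pi * (qp x - qm x)))"
  have tm: "1 * theta_term L v \<i> 0 x = of_real (exp (- pi * (qp x - qm x)))" for x
  proof -
    have "2 * of_real pi * \<i> * (Q \<i> (emb x) / 2 + Bc (emb x) 0) = of_real (- pi * (qp x - qm x))"
      unfolding Q_def Bpm_emb by (simp add: field_simps)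
    then show ?thesis by (simp only: theta_term_eq ee_def exp_of_real mult_1)
  qed
  have ts: "((\<lambda>x. complex_of_real (exp (- pi * (qp x - qm x)))) has_sum t \<gamma>) \<gamma>" if "\<gamma> \<in> disc L" for \<gamma>
    using TH_has_sum[OF lattice_subset_disc[OF that] exp_bounded_const[of 1] i, of 0] unfolding tm t_def .
  have sr: "(\<lambda>x. exp (- pi * (qp x - qm x))) summable_on \<gamma>" if "\<gamma> \<in> disc L" for \<gamma>
    using has_sum_Re[OF ts[OF that]] by (auto simp: summable_on_def)
  have tr: "t \<gamma> = of_real (r \<gamma>)" if "\<gamma> \<in> disc L" for \<gamma>
    using has_sum_unique[OF ts[OF that] has_sum_of_real[OF has_sum_infsum[OF sr[OF that]]]] by (simp add: r_def)
  have r0: "r \<gamma> \<ge> 0" for \<gamma> unfolding r_def by (rule infsum_nonneg) simp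
  have r1: "r (cls 0) > 0"
  proof -
    have c0: "cls 0 \<in> disc L" by (rule cls_disc[OF Ld_0])
    have "(\<Sum>x\<in>{0}. exp (- pi * (qp x - qm x))) \<le> r (cls 0)"
      unfolding r_def using cls_self[OF Ld_0] by (intro finite_sum_le_infsum sr c0) auto
    then show ?thesis by (simp, intro less_le_trans[OF exp_gt_zero])
  qed
  define T where "T = (\<Sum>\<gamma>\<in>disc L. r \<gamma>)"
  have T: "T > 0"
    unfolding T_def using r0 r1 finite_disc cls_disc[OF Ld_0] by (intro sum_pos2[of _ "cls 0"]) auto
  have law: "t (cls x) = inversion_factor \<i> * (\<Sum>\<gamma>\<in>disc L. ee (- of_real (bform L x (rep \<gamma>))) * t \<gamma>)" if "x \<in> Ld" for x
    using inversion_factor[OF i that, of 0] by (simp add: slashed_th_def t_def Q_def)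
  have 1: "of_real (r (cls 0)) = inversion_factor \<i> * of_real T"
    using law[OF Ld_0] tr cls_disc[OF Ld_0] by (simp add: T_def)
  have "of_real T = (\<Sum>\<gamma>\<in>disc L. t \<gamma>)" unfolding T_def using tr by simp
  also have "\<dots> = (\<Sum>\<gamma>\<in>disc L. inversion_factor \<i> * (\<Sum>\<delta>\<in>disc L. ee (- of_real (bform L (rep \<gamma>) (rep \<delta>))) * t \<delta>))"
    by (rule sum.cong[OF refl]) (use law[OF rep_Ld] in \<open>simp add: cls_rep\<close>)
  also have "\<dots> = inversion_factor \<i> * (\<Sum>\<delta>\<in>disc L. (\<Sum>\<gamma>\<in>disc L. ee (- of_real (bform L (rep \<gamma>) (rep \<delta>)))) * t \<delta>)"
    unfolding sum_distrib_left[symmetric] sum_distrib_right by (subst sum.swap) simp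
  also have "(\<Sum>\<delta>\<in>disc L. (\<Sum>\<gamma>\<in>disc L. ee (- of_real (bform L (rep \<gamma>) (rep \<delta>)))) * t \<delta>) =
      (\<Sum>\<delta>\<in>disc L. if \<delta> = cls 0 then of_nat (card (disc L)) * t (cls 0) else 0)"
    by (rule sum.cong[OF refl]) (simp add: character_sum')
  also have "\<dots> = of_nat (card (disc L)) * of_real (r (cls 0))"
    using finite_disc cls_disc[OF Ld_0] tr by simp
  finally have 2: "of_real T = inversion_factor \<i> * (of_nat (card (disc L)) * of_real (r (cls 0)))" .
  define s where "s = r (cls 0) / T"
  have s: "s > 0" using r1 T by (simp add: s_def)
  have sci: "inversion_factor \<i> = of_real s" using 1 T by (simp add: s_def field_simps)
  have "complex_of_real T = of_real (s * (card (disc L) * (s * T)))"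
    using 2 T unfolding sci by (simp add: s_def)
  then have "T = s * (card (disc L) * (s * T))" by (simp only: of_real_eq_iff)
  then have "s\<^sup>2 = 1 / card (disc L)" using T card_disc_pos by (simp add: power2_eq_square field_simps)
  then have "s = sqrt (1 / card (disc L))" using s by (metis real_sqrt_unique less_imp_le)
  then show ?thesis using sci by (simp add: real_sqrt_divide)
qed

section \<open>The differential equation of the inversion scalar\<close>

lemma sum_th_disc:
  assumes "\<tau> \<in> UH"
  shows "(\<Sum>\<gamma>\<in>disc L. th \<gamma> \<tau> \<zeta>) = th Ld \<tau> \<zeta>"
proof -
  have "((\<lambda>x. 1 * theta_term L v \<tau> \<zeta> x) has_sum (\<Sum>\<gamma>\<in>disc L. th \<gamma> \<tau> \<zeta>)) Ld"
    using th_series_has_sum[OF assms, of "\<lambda>_. 1" \<zeta>] by (simp add: theta_term_efun)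
  then show ?thesis unfolding TH_def[of Ld] by (simp add: infsumI)
qed

lemma lat_cls_0: "lat L = cls 0"
  using cls_translate[OF Ld_0] by simp

text \<open>A real translation \<open>a\<close> is moved into the index set, so that the left side
  is expanded at the origin while the theta series on the right is evaluated near
  \<open>emb a\<close>, where it can be made nonzero.\<close>

lemma inversion_factor_translated:
  assumes \<tau>: "\<tau> \<in> UH"
  shows "ee (- Q (1 / \<tau>) \<xi> / 2) * th ((\<lambda>x. x - a) ` lat L) (- 1 / \<tau>) (mv (1 / \<tau>) \<xi>) = inversion_factor \<tau> * th Ld \<tau> (emb a + \<xi>)"
proof -
  have \<tau>0: "\<tau> \<noteq> 0" "cnj \<tau> \<noteq> 0" using UH_nonzero[OF \<tau>] by auto
  have m: "mv (1 / \<tau>) (emb a + \<xi>) = mv (1 / \<tau>) \<xi> + mv (- 1 / \<tau>) (emb (- a))"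
    using mv_neg[of "1 / \<tau>"] by (simp add: mv_add emb_simps mv_minus add.commute)
  have "- Q (1 / \<tau>) (emb a + \<xi>) / 2 + (- Q (- 1 / \<tau>) (emb (- a)) / 2 - Bc (emb (- a)) (mv (1 / \<tau>) \<xi>)) = - Q (1 / \<tau>) \<xi> / 2"
    unfolding Q_def emb_simps B_simps using \<tau>0 Bpm_sym[of "emb a" \<xi>] by (simp add: field_simps)
  then have e: "ee (- Q (1 / \<tau>) (emb a + \<xi>) / 2) * ee (- Q (- 1 / \<tau>) (emb (- a)) / 2 - Bc (emb (- a)) (mv (1 / \<tau>) \<xi>)) = ee (- Q (1 / \<tau>) \<xi> / 2)"
    unfolding ee_add[symmetric] by simp
  have "slashed_th 0 \<tau> (emb a + \<xi>) = ee (- Q (1 / \<tau>) \<xi> / 2) * th ((\<lambda>x. x + - a) ` cls 0) (- 1 / \<tau>) (mv (1 / \<tau>) \<xi>)"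
    unfolding slashed_th_def m th_shift mult.assoc[symmetric] e ..
  moreover have "slashed_th 0 \<tau> (emb a + \<xi>) = inversion_factor \<tau> * th Ld \<tau> (emb a + \<xi>)"
    using inversion_factor[OF \<tau> Ld_0] sum_th_disc[OF \<tau>] by simp
  ultimately show ?thesis by (simp add: lat_cls_0)
qed

lemma lattice_subset_lat_translate: "lattice_subset ((\<lambda>x. x - a) ` lat L)"
  unfolding lattice_subset_def by (intro exI[of _ "- a"]) (use lat_Ld in auto)

text \<open>Along an eigenline of \<open>mv (1 / \<tau>)\<close> with eigenvalue
  \<open>\<kappa>\<close> the law has the shape of \<open>second_derivative_gauss\<close>; two
  derivatives bring down the squared pairing with \<open>e\<close> and the factor
  \<open>- 4 * pi\<^sup>2\<close>.\<close>

lemma inversion_factor_second_order: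
  fixes a :: 'v
  assumes \<tau>: "\<tau> \<in> UH" and \<kappa>: "\<And>w. mv (1 / \<tau>) (cscale w (emb e)) = cscale (w * \<kappa>) (emb e)"
    and q: "\<And>w. - Q (1 / \<tau>) (cscale w (emb e)) = \<alpha> * w\<^sup>2"
  defines "Y \<equiv> (\<lambda>x. x - a) ` lat L"
  shows "2 * of_real pi * \<i> * \<alpha> * th Y (- 1 / \<tau>) 0
      - 4 * (of_real pi)\<^sup>2 * \<kappa>\<^sup>2 * TH Y (\<lambda>x. of_real (bform L x e) * of_real (bform L x e)) (- 1 / \<tau>) 0
    = (- 4 * (of_real pi)\<^sup>2 * inversion_factor \<tau>) * TH Ld (\<lambda>x. of_real (bform L x e) * of_real (bform L x e)) \<tau> (emb a)"
proof -
  let ?\<tau>' = "- 1 / \<tau>" and ?k = "2 * complex_of_real pi * \<i>"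
  have gY: "lattice_subset Y" unfolding Y_def by (rule lattice_subset_lat_translate)
  have gL: "lattice_subset Ld" by (rule lattice_subset_Ld) simp
  have \<tau>': "?\<tau>' \<in> UH" by (rule UH_inv[OF \<tau>])
  have k2: "?k * ?k = - 4 * (of_real pi)\<^sup>2" by (simp add: power2_eq_square)
  define p1 where "p1 = (\<lambda>x. complex_of_real (bform L x e))"
  have ebd1: "exp_bounded p1" unfolding p1_def by (rule exp_bounded_bform)
  have line: "((\<lambda>w. TH Y' p t (z + cscale (w * c) (emb e))) has_field_derivative
      c * ?k * TH Y' (\<lambda>x. p x * p1 x) t (z + cscale (w * c) (emb e))) (at w)"
    if "lattice_subset Y'" "exp_bounded p" "t \<in> UH" for Y' p t z c w
  proof -
    have "((\<lambda>w. w * c) has_field_derivative c) (at w)" by (auto intro!: derivative_eq_intros)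
    from DERIV_chain2[OF TH_line_derivative[OF that, of z "emb e" "w * c"] this]
    show ?thesis by (simp add: p1_def Bc_emb mult_ac)
  qed
  let ?h = "\<lambda>w. th Y ?\<tau>' (0 + cscale (w * \<kappa>) (emb e))"
  let ?h1 = "\<lambda>w. \<kappa> * ?k * TH Y (\<lambda>x. 1 * p1 x) ?\<tau>' (0 + cscale (w * \<kappa>) (emb e))"
  let ?h2 = "\<lambda>w. \<kappa> * ?k * (\<kappa> * ?k * TH Y (\<lambda>x. (1 * p1 x) * p1 x) ?\<tau>' (0 + cscale (w * \<kappa>) (emb e)))"
  let ?g = "\<lambda>w. th Ld \<tau> (emb a + cscale (w * 1) (emb e))"
  let ?g1 = "\<lambda>w. 1 * ?k * TH Ld (\<lambda>x. 1 * p1 x) \<tau> (emb a + cscale (w * 1) (emb e))"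
  let ?g2 = "\<lambda>w. 1 * ?k * (1 * ?k * TH Ld (\<lambda>x. (1 * p1 x) * p1 x) \<tau> (emb a + cscale (w * 1) (emb e)))"
  have "?k * \<alpha> * ?h 0 + ?h2 0 = inversion_factor \<tau> * ?g2 0"
  proof (rule second_derivative_gauss)
    fix w
    show "ee (\<alpha> * w\<^sup>2 / 2) * ?h w = inversion_factor \<tau> * ?g w"
      using inversion_factor_translated[OF \<tau>, of "cscale w (emb e)" a] unfolding \<kappa> q Y_def by simp
    show "(?h has_field_derivative ?h1 w) (at w)" by (rule line[OF gY exp_bounded_const \<tau>'])
    show "(?g has_field_derivative ?g1 w) (at w)" by (rule line[OF gL exp_bounded_const \<tau>])
    show "(?h1 has_field_derivative ?h2 0) (at 0)"
      by (intro DERIV_cmult line gY \<tau>' exp_bounded_mult exp_bounded_const ebd1)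
    show "(?g1 has_field_derivative ?g2 0) (at 0)"
      by (intro DERIV_cmult line gL \<tau> exp_bounded_mult exp_bounded_const ebd1)
  qed
  then have "?k * \<alpha> * th Y ?\<tau>' 0 + (?k * ?k) * \<kappa>\<^sup>2 * TH Y (\<lambda>x. p1 x * p1 x) ?\<tau>' 0
      = (?k * ?k) * (inversion_factor \<tau> * TH Ld (\<lambda>x. p1 x * p1 x) \<tau> (emb a))"
    by (simp add: cscale_simps power2_eq_square mult_ac)
  then show ?thesis unfolding k2 p1_def by (simp add: Y_def mult.assoc)
qed

lemma Bpm_Ep: "e \<in> Ep \<Longrightarrow> Bp (emb e) (emb e) = 1" "e \<in> Ep \<Longrightarrow> Bm (emb e) (emb e) = 0"
  "e \<in> Ep \<Longrightarrow> mv c (emb e) = cscale c (emb e)"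
  using proj_P[OF Ep_P] Ep(3) by (auto simp: Bpm_emb qp_def qm_def mv_def cp_emb cm_emb emb_simps cscale_simps)

lemma Bpm_Em: "e \<in> Em \<Longrightarrow> Bp (emb e) (emb e) = 0" "e \<in> Em \<Longrightarrow> Bm (emb e) (emb e) = - 1"
  "e \<in> Em \<Longrightarrow> mv c (emb e) = cscale (cnj c) (emb e)"
  using proj_N[OF Em_N] Em(3) by (auto simp: Bpm_emb qp_def qm_def mv_def cp_emb cm_emb emb_simps cscale_simps)

lemma TH_qp: "lattice_subset Y \<Longrightarrow> \<tau> \<in> UH \<Longrightarrow>
    TH Y (\<lambda>x. of_real (qp x)) \<tau> \<zeta> = (\<Sum>e\<in>Ep. TH Y (\<lambda>x. of_real (bform L x e) * of_real (bform L x e)) \<tau> \<zeta>)"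
  using TH_sum[of Y Ep "\<lambda>e x. of_real (bform L x e) * of_real (bform L x e)" \<tau> \<zeta>] Ep(1)
  by (simp add: exp_bounded_mult exp_bounded_bform qp_eq power2_eq_square)

lemma TH_qm: "lattice_subset Y \<Longrightarrow> \<tau> \<in> UH \<Longrightarrow>
    TH Y (\<lambda>x. of_real (qm x)) \<tau> \<zeta> = - (\<Sum>e\<in>Em. TH Y (\<lambda>x. of_real (bform L x e) * of_real (bform L x e)) \<tau> \<zeta>)"
  using TH_sum[of Y Em "\<lambda>e x. of_real (bform L x e) * of_real (bform L x e)" \<tau> \<zeta>] Em(1)
    TH_cmult[of Y "-1" "\<lambda>x. \<Sum>e\<in>Em. of_real (bform L x e) * of_real (bform L x e)" \<tau> \<zeta>]
  by (simp add: exp_bounded_mult exp_bounded_bform qm_eq power2_eq_square)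

text \<open>Sum over an orthonormal basis: the squared pairings add up to \<open>qp\<close>,
  respectively \<open>- qm\<close>, and each basis vector contributes one Gaussian term, so that the
  dimension appears as a factor.\<close>

lemma inversion_factor_heat:
  fixes a :: 'v
  assumes \<tau>: "\<tau> \<in> UH"
  defines "Y \<equiv> (\<lambda>x. x - a) ` lat L"
  shows "of_real pi * \<i> * (TH Y (\<lambda>x. of_real (qp x)) (- 1 / \<tau>) 0 / \<tau>\<^sup>2 - inversion_factor \<tau> * TH Ld (\<lambda>x. of_real (qp x)) \<tau> (emb a))
      = of_nat (card Ep) / (2 * \<tau>) * th Y (- 1 / \<tau>) 0" (is ?A)
    and "of_real pi * \<i> * (TH Y (\<lambda>x. of_real (qm x)) (- 1 / \<tau>) 0 / (cnj \<tau>)\<^sup>2 - inversion_factor \<tau> * TH Ld (\<lambda>x. of_real (qm x)) \<tau> (emb a))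
      = of_nat (card Em) / (2 * cnj \<tau>) * th Y (- 1 / \<tau>) 0" (is ?B)
proof -
  have \<tau>0: "\<tau> \<noteq> 0" "cnj \<tau> \<noteq> 0" using UH_nonzero[OF \<tau>] by auto
  have gY: "lattice_subset Y" unfolding Y_def by (rule lattice_subset_lat_translate)
  have gL: "lattice_subset Ld" by (rule lattice_subset_Ld) simp
  have \<tau>': "- 1 / \<tau> \<in> UH" by (rule UH_inv[OF \<tau>])
  let ?T = "\<lambda>Y \<tau> \<zeta> e. TH Y (\<lambda>x. of_real (bform L x e) * of_real (bform L x e)) \<tau> \<zeta>"
  have P: "2 * of_real pi * \<i> * (- 1 / \<tau>) * th Y (- 1 / \<tau>) 0 - 4 * (of_real pi)\<^sup>2 * (1 / \<tau>)\<^sup>2 * ?T Y (- 1 / \<tau>) 0 e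
      = (- 4 * (of_real pi)\<^sup>2 * inversion_factor \<tau>) * ?T Ld \<tau> (emb a) e" if "e \<in> Ep" for e
    unfolding Y_def
  proof (rule inversion_factor_second_order[OF \<tau>])
    show "mv (1 / \<tau>) (cscale w (emb e)) = cscale (w * (1 / \<tau>)) (emb e)" for w
      unfolding mv_cscale Bpm_Ep(3)[OF that] cscale_simps by simp
    show "- Q (1 / \<tau>) (cscale w (emb e)) = - 1 / \<tau> * w\<^sup>2" for w
      unfolding Q_def Bpm_cscale Bpm_Ep(1,2)[OF that] by (simp add: power2_eq_square)
  qed
  from heat_algebra[OF _ \<tau>0(1) sum_affine[OF P]]
  show ?A unfolding TH_qp[OF gY \<tau>'] TH_qp[OF gL \<tau>] by simp
  have N: "2 * of_real pi * \<i> * (1 / cnj \<tau>) * th Y (- 1 / \<tau>) 0 - 4 * (of_real pi)\<^sup>2 * (1 / cnj \<tau>)\<^sup>2 * ?T Y (- 1 / \<tau>) 0 e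
      = (- 4 * (of_real pi)\<^sup>2 * inversion_factor \<tau>) * ?T Ld \<tau> (emb a) e" if "e \<in> Em" for e
    unfolding Y_def
  proof (rule inversion_factor_second_order[OF \<tau>])
    show "mv (1 / \<tau>) (cscale w (emb e)) = cscale (w * (1 / cnj \<tau>)) (emb e)" for w
      unfolding mv_cscale Bpm_Em(3)[OF that] cscale_simps by simp
    show "- Q (1 / \<tau>) (cscale w (emb e)) = 1 / cnj \<tau> * w\<^sup>2" for w
      unfolding Q_def Bpm_cscale Bpm_Em(1,2)[OF that] by (simp add: power2_eq_square)
  qed
  from heat_algebra[OF _ \<tau>0(2) sum_affine[OF N]]
  have "of_real pi * \<i> * ((\<Sum>e\<in>Em. ?T Y (- 1 / \<tau>) 0 e) / (cnj \<tau>)\<^sup>2 - inversion_factor \<tau> * (\<Sum>e\<in>Em. ?T Ld \<tau> (emb a) e))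
      = - (of_nat (card Em) / (2 * cnj \<tau>) * th Y (- 1 / \<tau>) 0)" by simp
  from arg_cong[OF this, of uminus]
  show ?B unfolding TH_qm[OF gY \<tau>'] TH_qm[OF gL \<tau>] by (simp add: right_diff_distrib)
qed

text \<open>The scalar is the quotient of \<open>U\<close> by \<open>V\<close>. In its derivative
  the weighted theta series cancel by the heat relations, which leaves the terms with the
  dimensions.\<close>

lemma inversion_factor_has_derivative:
  assumes \<tau>: "\<tau> \<in> UH"
  shows "(inversion_factor has_derivative (\<lambda>s. (of_nat (card Ep) * s / (2 * \<tau>) + of_nat (card Em) * cnj s / (2 * cnj \<tau>)) * inversion_factor \<tau>)) (at \<tau>)"
proof -
  have gL: "lattice_subset Ld" by (rule lattice_subset_Ld) simp
  have \<tau>': "- 1 / \<tau> \<in> UH" by (rule UH_inv[OF \<tau>])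
  have \<tau>0: "\<tau> \<noteq> 0" using UH_nonzero[OF \<tau>] .
  \<comment> \<open>By linear independence the sum of all components is nonzero at some real point;
    there the division is made.\<close>
  have "\<exists>a. th Ld \<tau> (emb a) \<noteq> 0"
  proof (rule ccontr)
    assume "\<not> ?thesis"
    then have "(\<Sum>\<gamma>\<in>disc L. 1 * th \<gamma> \<tau> (0 + emb x')) = 0" for x' using sum_th_disc[OF \<tau>] by simp
    from th_independent[OF \<tau> this cls_disc[OF Ld_0]] show False by simp
  qed
  then obtain a where a: "th Ld \<tau> (emb a) \<noteq> 0" by blast
  define Y where "Y = (\<lambda>x. x - a) ` lat L"
  have gY: "lattice_subset Y" unfolding Y_def by (rule lattice_subset_lat_translate)
  define U where "U = (\<lambda>t. th Y (- 1 / t) 0)"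
  define V where "V = (\<lambda>t. th Ld t (emb a))"
  have UV: "U t = inversion_factor t * V t" if "t \<in> UH" for t
    using inversion_factor_translated[OF that, of 0 a] by (simp add: U_def V_def Y_def Q_def)
  define Tp where "Tp = TH Y (\<lambda>x. of_real (qp x)) (- 1 / \<tau>) 0"
  define Tm where "Tm = TH Y (\<lambda>x. of_real (qm x)) (- 1 / \<tau>) 0"
  define Vp where "Vp = TH Ld (\<lambda>x. of_real (qp x)) \<tau> (emb a)"
  define Vm where "Vm = TH Ld (\<lambda>x. of_real (qm x)) \<tau> (emb a)"
  have dV: "(V has_derivative (\<lambda>s. of_real pi * \<i> * (s * Vp + cnj s * Vm))) (at \<tau>)"
    using TH_has_derivative_\<tau>[OF gL exp_bounded_const \<tau>, of 1 "emb a"] by (simp add: V_def Vp_def Vm_def)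
  have "((\<lambda>t. - 1 / t) has_derivative (\<lambda>s. s / \<tau>\<^sup>2)) (at \<tau>)"
    using \<tau>0 by (auto intro!: derivative_eq_intros simp: power2_eq_square)
  from has_derivative_compose[OF this TH_has_derivative_\<tau>[OF gY exp_bounded_const \<tau>', of 1 0]]
  have dU: "(U has_derivative (\<lambda>s. of_real pi * \<i> * (s / \<tau>\<^sup>2 * Tp + cnj (s / \<tau>\<^sup>2) * Tm))) (at \<tau>)"
    by (simp add: U_def Tp_def Tm_def)
  have V0: "V \<tau> \<noteq> 0" using a by (simp add: V_def)
  have dUV: "((\<lambda>t. U t / V t) has_derivative (\<lambda>s. (of_nat (card Ep) * s / (2 * \<tau>) + of_nat (card Em) * cnj s / (2 * cnj \<tau>)) * inversion_factor \<tau>)) (at \<tau>)"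
  proof (rule has_derivative_eq_rhs[OF has_derivative_divide'[OF dU dV V0]], rule ext)
    fix s
    have h: "of_real pi * \<i> * (Tp / \<tau>\<^sup>2 - inversion_factor \<tau> * Vp) = of_nat (card Ep) / (2 * \<tau>) * (inversion_factor \<tau> * V \<tau>)"
      "of_real pi * \<i> * (Tm / (cnj \<tau>)\<^sup>2 - inversion_factor \<tau> * Vm) = of_nat (card Em) / (2 * cnj \<tau>) * (inversion_factor \<tau> * V \<tau>)"
      using inversion_factor_heat[OF \<tau>, of a] UV[OF \<tau>] by (simp_all add: Tp_def Tm_def Vp_def Vm_def U_def Y_def)
    let ?dU = "of_real pi * \<i> * (s / \<tau>\<^sup>2 * Tp + cnj (s / \<tau>\<^sup>2) * Tm)"
    let ?dV = "of_real pi * \<i> * (s * Vp + cnj s * Vm)"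
    have "?dU - inversion_factor \<tau> * ?dV = s * (of_real pi * \<i> * (Tp / \<tau>\<^sup>2 - inversion_factor \<tau> * Vp)) + cnj s * (of_real pi * \<i> * (Tm / (cnj \<tau>)\<^sup>2 - inversion_factor \<tau> * Vm))"
      by (simp add: algebra_simps)
    also have "\<dots> = (of_nat (card Ep) * s / (2 * \<tau>) + of_nat (card Em) * cnj s / (2 * cnj \<tau>)) * inversion_factor \<tau> * V \<tau>"
      unfolding h by (simp add: algebra_simps)
    finally have "?dU - inversion_factor \<tau> * ?dV = (of_nat (card Ep) * s / (2 * \<tau>) + of_nat (card Em) * cnj s / (2 * cnj \<tau>)) * inversion_factor \<tau> * V \<tau>" .
    moreover have "(?dU * V \<tau> - U \<tau> * ?dV) / (V \<tau> * V \<tau>) = (?dU - inversion_factor \<tau> * ?dV) / V \<tau>"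
      unfolding UV[OF \<tau>] using V0 by (simp add: field_simps)
    ultimately show "(?dU * V \<tau> - U \<tau> * ?dV) / (V \<tau> * V \<tau>) = (of_nat (card Ep) * s / (2 * \<tau>) + of_nat (card Em) * cnj s / (2 * cnj \<tau>)) * inversion_factor \<tau>"
      using V0 by simp
  qed
  have oUH: "open UH" unfolding upper_half_plane_def by (rule open_halfspace_Im_gt)
  have "\<forall>\<^sub>F t in at \<tau>. V t \<noteq> 0"
    using has_derivative_continuous[OF dV] V0 by (auto simp: continuous_at intro: tendsto_imp_eventually_ne)
  moreover have "\<forall>\<^sub>F t in at \<tau>. t \<in> UH" using oUH \<tau> by (rule eventually_at_in_open')
  ultimately have "\<forall>\<^sub>F t in at \<tau>. U t / V t = inversion_factor t"
    by eventually_elim (simp add: UV)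
  from has_derivative_transform_eventually[OF dUV this] show ?thesis using UV[OF \<tau>] V0 by simp
qed

lemma csqrt_has_derivative: "\<tau> \<in> UH \<Longrightarrow> (csqrt has_field_derivative csqrt \<tau> / (2 * \<tau>)) (at \<tau>)"
proof -
  assume \<tau>: "\<tau> \<in> UH"
  then have "\<tau> \<notin> \<real>\<^sub>\<le>\<^sub>0" by (auto simp: upper_half_plane_iff complex_nonpos_Reals_iff)
  then have "(csqrt has_field_derivative inverse (2 * csqrt \<tau>)) (at \<tau>)" by (rule has_field_derivative_csqrt)
  moreover have "inverse (2 * csqrt \<tau>) = csqrt \<tau> / (2 * \<tau>)"
  proof -
    define r where "r = csqrt \<tau>"
    have r: "r \<noteq> 0" "\<tau> = r * r"
      using UH_nonzero[OF \<tau>] power2_csqrt[of \<tau>] by (auto simp: r_def power2_eq_square)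
    have "inverse (2 * r) = r / (2 * (r * r))" using r(1) by (simp add: field_simps)
    then show ?thesis unfolding r_def[symmetric] r(2)[symmetric] .
  qed
  ultimately show ?thesis by (simp only:)
qed

text \<open>Solves the same differential equation as \<open>inversion_factor\<close>, and is the
  weight factor carried by \<open>gen_S\<close>.\<close>

definition "inversion_weight \<tau> = csqrt \<tau> ^ card Ep * cnj (csqrt \<tau>) ^ card Em"

lemma inversion_weight_nonzero: "\<tau> \<in> UH \<Longrightarrow> inversion_weight \<tau> \<noteq> 0"
  using UH_nonzero by (auto simp: inversion_weight_def)

lemma power_log_derivative:
  fixes f :: "complex \<Rightarrow> complex"
  assumes "(f has_derivative (\<lambda>s. d s * f t)) (at t)"
  shows "((\<lambda>t. f t ^ n) has_derivative (\<lambda>s. of_nat n * d s * f t ^ n)) (at t)"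
proof (rule has_derivative_eq_rhs[OF has_derivative_power[OF assms]], rule ext)
  show "of_nat n * (d s * f t) * f t ^ (n - 1) = of_nat n * d s * f t ^ n" for s
    by (cases n) auto
qed

lemma inversion_weight_has_derivative:
  assumes \<tau>: "\<tau> \<in> UH"
  shows "(inversion_weight has_derivative (\<lambda>s. (of_nat (card Ep) * s / (2 * \<tau>) + of_nat (card Em) * cnj s / (2 * cnj \<tau>)) * inversion_weight \<tau>)) (at \<tau>)"
proof -
  have d: "(csqrt has_derivative (\<lambda>s. s / (2 * \<tau>) * csqrt \<tau>)) (at \<tau>)"
    using csqrt_has_derivative[OF \<tau>] unfolding has_field_derivative_def
    by (rule has_derivative_eq_rhs) (auto simp: fun_eq_iff)
  have d': "((\<lambda>t. cnj (csqrt t)) has_derivative (\<lambda>s. cnj s / (2 * cnj \<tau>) * cnj (csqrt \<tau>))) (at \<tau>)"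
    using bounded_linear.has_derivative[OF bounded_linear_cnj d] by simp
  show ?thesis
    unfolding inversion_weight_def[abs_def]
    by (rule has_derivative_eq_rhs[OF has_derivative_mult[OF power_log_derivative[OF d] power_log_derivative[OF d']]])
       (auto simp: fun_eq_iff algebra_simps)
qed

text \<open>The root of \<open>\<i>\<close> in the upper half plane is \<open>ee (1/8)\<close>; its
  inverse powers are the eighth root of unity in the Weil representation.\<close>

lemma inversion_weight_i: "inversion_weight \<i> = ee ((of_nat (card Ep) - of_nat (card Em)) / 8)"
proof -
  have c: "csqrt \<i> = ee (1/8)"
  proof -
    have "csqrt \<i> = exp (Ln \<i> / 2)" by (rule csqrt_exp_Ln) simp
    also have "Ln \<i> / 2 = 2 * of_real pi * \<i> * (1/8)" by (simp add: Ln_ii)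
    finally show ?thesis unfolding ee_def .
  qed
  have "cnj (ee (1/8)) = ee (- 1/8)" by (simp add: ee_def exp_cnj)
  then show ?thesis unfolding inversion_weight_def c by (simp add: ee_power ee_add[symmetric] diff_divide_distrib)
qed

text \<open>The quotient of the two solutions has derivative zero on a convex set, so it is
  constant, and its value is read off at \<open>\<i>\<close>.\<close>

lemma inversion_factor_eq:
  assumes \<tau>: "\<tau> \<in> UH"
  shows "inversion_factor \<tau> = ee ((of_nat (card Em) - of_nat (card Ep)) / 8) / of_real (sqrt (card (disc L))) * inversion_weight \<tau>"
proof -
  have "((\<lambda>t. inversion_factor t / inversion_weight t) has_derivative (\<lambda>s. 0)) (at t within UH)" if t: "t \<in> UH" for t
    by (rule has_derivative_at_withinI,
        rule has_derivative_eq_rhs[OF has_derivative_divide'[OF inversion_factor_has_derivative[OF t] inversion_weight_has_derivative[OF t] inversion_weight_nonzero[OF t]]])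
       (auto simp: fun_eq_iff algebra_simps)
  then obtain K where K: "\<And>t. t \<in> UH \<Longrightarrow> inversion_factor t / inversion_weight t = K"
    using has_derivative_zero_constant[of UH "\<lambda>t. inversion_factor t / inversion_weight t"]
    by (metis convex_halfspace_Im_gt upper_half_plane_def)
  have "K = inversion_factor \<i> / inversion_weight \<i>" using K[of \<i>] by (simp add: upper_half_plane_iff)
  also have "\<dots> = ee ((of_nat (card Em) - of_nat (card Ep)) / 8) / of_real (sqrt (card (disc L)))"
  proof -
    have "ee ((of_nat (card Ep) - of_nat (card Em)) / 8) * ee ((of_nat (card Em) - of_nat (card Ep)) / 8) = 1"
      by (simp add: ee_add[symmetric] add_divide_distrib[symmetric])
    then have "ee ((of_nat (card Em) - of_nat (card Ep)) / 8) = 1 / ee ((of_nat (card Ep) - of_nat (card Em)) / 8)"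
      by (simp add: nonzero_eq_divide_eq mult.commute)
    then show ?thesis unfolding inversion_factor_i inversion_weight_i by simp
  qed
  finally show ?thesis using K[OF \<tau>] inversion_weight_nonzero[OF \<tau>] by (simp add: field_simps)
qed

theorem th_inversion:
  assumes \<tau>: "\<tau> \<in> UH" and x: "x \<in> Ld"
  shows "th (cls x) (- 1 / \<tau>) (mv (1 / \<tau>) \<zeta>) =
    inversion_weight \<tau> * ee (Q (1 / \<tau>) \<zeta> / 2) *
    (ee ((of_nat (card Em) - of_nat (card Ep)) / 8) / of_real (sqrt (card (disc L))) *
      (\<Sum>\<gamma>\<in>disc L. ee (- of_real (bform L x (rep \<gamma>))) * th \<gamma> \<tau> \<zeta>))"
proof -
  have "th (cls x) (- 1 / \<tau>) (mv (1 / \<tau>) \<zeta>) = ee (Q (1 / \<tau>) \<zeta> / 2) * slashed_th x \<tau> \<zeta>"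
    unfolding slashed_th_def mult.assoc[symmetric] ee_add[symmetric] by simp
  then show ?thesis unfolding inversion_factor[OF \<tau> x] inversion_factor_eq[OF \<tau>] by (simp add: mult_ac)
qed

end

no_notation fps_nth (infixl "$" 75)

section \<open>The metaplectic group\<close>

lemma open_upper_half_plane: "open upper_half_plane"
  unfolding upper_half_plane_def by (rule open_halfspace_Im_gt)

lemma convex_upper_half_plane: "convex upper_half_plane"
  unfolding upper_half_plane_def by (rule convex_halfspace_Im_gt)

lemma mat22_nth [simp]:
  "mat22 a b c d $ 1 $ 1 = a" "mat22 a b c d $ 1 $ 2 = b"
  "mat22 a b c d $ 2 $ 1 = c" "mat22 a b c d $ 2 $ 2 = d"
  unfolding mat22_def by (simp_all only: vector_2)

lemma mat2_eq_iff:
  fixes A B :: "real^2^2"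
  shows "A = B \<longleftrightarrow> A$1$1 = B$1$1 \<and> A$1$2 = B$1$2 \<and> A$2$1 = B$2$1 \<and> A$2$2 = B$2$2"
  by (simp only: vec_eq_iff forall_2 conj_assoc)

lemma mat2_mult_nth:
  fixes A B :: "real^2^2"
  shows "(A ** B) $ i $ j = A$i$1 * B$1$j + A$i$2 * B$2$j"
  by (simp add: matrix_matrix_mult_def sum_2)

lemma mat2_one_nth [simp]:
  "(mat 1 :: real^2^2) $ 1 $ 1 = 1" "(mat 1 :: real^2^2) $ 1 $ 2 = 0"
  "(mat 1 :: real^2^2) $ 2 $ 1 = 0" "(mat 1 :: real^2^2) $ 2 $ 2 = 1"
  by (auto simp: mat_def)

lemma autj_nonzero:
  assumes "det A = 1" "\<tau> \<in> upper_half_plane"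
  shows "autj A \<tau> \<noteq> 0"
proof
  assume "autj A \<tau> = 0"
  then have "A$2$1 * Im \<tau> = 0" "A$2$1 * Re \<tau> + A$2$2 = 0" by (auto simp: autj_def complex_eq_iff)
  then have "A$2$1 = 0" "A$2$2 = 0" using assms(2) by (auto simp: upper_half_plane_iff)
  then show False using assms(1) by (simp add: det_2)
qed

lemma mobius_in:
  assumes "det A = 1" "\<tau> \<in> upper_half_plane"
  shows "mobius A \<tau> \<in> upper_half_plane"
proof -
  let ?j = "autj A \<tau>"
  have j: "?j \<noteq> 0" by (rule autj_nonzero[OF assms])
  have "Im (mobius A \<tau>) = det A * Im \<tau> / ((Re ?j)\<^sup>2 + (Im ?j)\<^sup>2)"
    unfolding mobius_def autj_def[symmetric] Im_divide by (simp add: autj_def det_2 algebra_simps)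
  also have "\<dots> > 0"
    using assms j by (intro divide_pos_pos)
      (auto simp: upper_half_plane_iff complex_eq_iff sum_power2_gt_zero_iff)
  finally show ?thesis by (simp add: upper_half_plane_iff)
qed

lemma mobius_eq: "mobius A \<tau> = (of_real (A$1$1) * \<tau> + of_real (A$1$2)) / autj A \<tau>"
  by (simp add: mobius_def autj_def)

lemma autj_mult:
  assumes "det B = 1" "\<tau> \<in> upper_half_plane"
  shows "autj (A ** B) \<tau> = autj A (mobius B \<tau>) * autj B \<tau>"
  using autj_nonzero[OF assms] unfolding mobius_eq
  by (simp add: autj_def[of A] autj_def[of "A ** B"] mat2_mult_nth field_simps) (simp add: autj_def algebra_simps)

lemma mobius_mult:
  assumes "det A = 1" "det B = 1" "\<tau> \<in> upper_half_plane"
  shows "mobius (A ** B) \<tau> = mobius A (mobius B \<tau>)"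
proof -
  have j: "autj B \<tau> \<noteq> 0" "autj A (mobius B \<tau>) \<noteq> 0"
    using autj_nonzero mobius_in assms by blast+
  have "of_real ((A ** B)$1$1) * \<tau> + of_real ((A ** B)$1$2) =
      (of_real (A$1$1) * mobius B \<tau> + of_real (A$1$2)) * autj B \<tau>"
    unfolding mobius_eq[of B] using j(1) by (simp add: mat2_mult_nth field_simps) (simp add: autj_def algebra_simps)
  then show ?thesis
    unfolding mobius_eq[of "A ** B"] mobius_eq[of A] autj_mult[OF assms(2,3)] using j by simp
qed

lemma mobius_one [simp]: "mobius (mat 1) \<tau> = \<tau>"
  by (simp add: mobius_def)

lemma mobius_holomorphic: "det A = 1 \<Longrightarrow> mobius A holomorphic_on upper_half_plane"
  using autj_nonzero unfolding mobius_def[abs_def] autj_def by (intro holomorphic_intros) auto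

lemma mp2_carrierD:
  assumes "M \<in> mp2_carrier"
  shows "det (fst M) = 1" "snd M holomorphic_on upper_half_plane"
    "\<And>\<tau>. \<tau> \<in> upper_half_plane \<Longrightarrow> (snd M \<tau>)\<^sup>2 = autj (fst M) \<tau>"
    "\<And>\<tau>. \<tau> \<notin> upper_half_plane \<Longrightarrow> snd M \<tau> = 0"
  using assms by (auto simp: mp2_carrier_def)

lemma mp2_snd_nonzero: "M \<in> mp2_carrier \<Longrightarrow> \<tau> \<in> upper_half_plane \<Longrightarrow> snd M \<tau> \<noteq> 0"
  using mp2_carrierD(3)[of M \<tau>] autj_nonzero[OF mp2_carrierD(1)] by fastforce

lemma mp2_carrierI:
  assumes "det A = 1" "\<phi> holomorphic_on upper_half_plane"
    "\<And>\<tau>. \<tau> \<in> upper_half_plane \<Longrightarrow> (\<phi> \<tau>)\<^sup>2 = autj A \<tau>"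
    "\<And>\<tau>. \<tau> \<notin> upper_half_plane \<Longrightarrow> \<phi> \<tau> = 0"
  shows "(A, \<phi>) \<in> mp2_carrier"
  using assms by (auto simp: mp2_carrier_def)

lemma mp2_mult_closed:
  assumes M: "M \<in> mp2_carrier" and N: "N \<in> mp2_carrier"
  shows "mp2_mult M N \<in> mp2_carrier"
  unfolding mp2_mult_def
proof (rule mp2_carrierI)
  note M' = mp2_carrierD[OF M] and N' = mp2_carrierD[OF N]
  show "det (fst M ** fst N) = 1" using M' N' by (simp add: det_mul)
  have "snd M \<circ> mobius (fst N) holomorphic_on upper_half_plane"
    by (rule holomorphic_on_compose_gen[OF mobius_holomorphic[OF N'(1)] M'(2)])
       (use mobius_in[OF N'(1)] in auto)
  then show "(\<lambda>\<tau>. snd M (mobius (fst N) \<tau>) * snd N \<tau>) holomorphic_on upper_half_plane"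
    by (intro holomorphic_on_mult N'(2)) (simp add: o_def)
  show "(snd M (mobius (fst N) \<tau>) * snd N \<tau>)\<^sup>2 = autj (fst M ** fst N) \<tau>" if "\<tau> \<in> upper_half_plane" for \<tau>
    using M'(3)[OF mobius_in[OF N'(1) that]] N'(3)[OF that] autj_mult[OF N'(1) that] by (simp add: power_mult_distrib)
  show "snd M (mobius (fst N) \<tau>) * snd N \<tau> = 0" if "\<tau> \<notin> upper_half_plane" for \<tau>
    using N'(4)[OF that] by simp
qed

lemma mp2_mult_assoc:
  assumes "M \<in> mp2_carrier" "N \<in> mp2_carrier" "K \<in> mp2_carrier"
  shows "mp2_mult (mp2_mult M N) K = mp2_mult M (mp2_mult N K)"
proof -
  have "snd (mp2_mult (mp2_mult M N) K) \<tau> = snd (mp2_mult M (mp2_mult N K)) \<tau>" for \<tau>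
  proof (cases "\<tau> \<in> upper_half_plane")
    case True
    then show ?thesis
      using mobius_mult[OF mp2_carrierD(1)[OF assms(2)] mp2_carrierD(1)[OF assms(3)] True] by (simp add: mp2_mult_def)
  next
    case False
    then show ?thesis using mp2_carrierD(4)[OF assms(3)] by (simp add: mp2_mult_def)
  qed
  then show ?thesis by (simp add: mp2_mult_def matrix_mul_assoc fun_eq_iff)
qed

lemma mp2_one_closed: "mp2_one \<in> mp2_carrier"
  unfolding mp2_one_def
  by (rule mp2_carrierI)
     (auto simp: autj_def intro: holomorphic_transform[of "\<lambda>_. 1"])

lemma mp2_mult_one:
  assumes M: "M \<in> mp2_carrier"
  shows "mp2_mult mp2_one M = M" "mp2_mult M mp2_one = M"
proof -
  have "(if mobius (fst M) \<tau> \<in> upper_half_plane then 1 else 0) * snd M \<tau> = snd M \<tau>" for \<tau>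
    using mobius_in[OF mp2_carrierD(1)[OF M]] mp2_carrierD(4)[OF M] by (cases "\<tau> \<in> upper_half_plane") auto
  then have "snd (mp2_mult mp2_one M) = snd M" by (intro ext) (simp only: mp2_mult_def mp2_one_def fst_conv snd_conv)
  then show "mp2_mult mp2_one M = M" by (simp add: prod_eq_iff) (simp add: mp2_mult_def mp2_one_def)
  have "snd M \<tau> * (if \<tau> \<in> upper_half_plane then 1 else 0) = snd M \<tau>" for \<tau>
    using mp2_carrierD(4)[OF M] by auto
  then have "snd (mp2_mult M mp2_one) = snd M"
    by (intro ext) (simp only: mp2_mult_def mp2_one_def fst_conv snd_conv mobius_one)
  then show "mp2_mult M mp2_one = M" by (simp add: prod_eq_iff) (simp add: mp2_mult_def mp2_one_def)
qed

text \<open>The matrix is the adjugate, which inverts a matrix of determinant one; the root is then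
  forced by the product law.\<close>

definition mp2_inv :: "mp2 \<Rightarrow> mp2" where
  "mp2_inv M = (let B = mat22 (fst M$2$2) (- fst M$1$2) (- fst M$2$1) (fst M$1$1) in
     (B, \<lambda>\<tau>. if \<tau> \<in> upper_half_plane then 1 / snd M (mobius B \<tau>) else 0))"

lemma mp2_inv:
  assumes M: "M \<in> mp2_carrier"
  shows "mp2_inv M \<in> mp2_carrier" "mp2_mult (mp2_inv M) M = mp2_one"
proof -
  let ?A = "fst M"
  define B where "B = mat22 (?A$2$2) (- ?A$1$2) (- ?A$2$1) (?A$1$1)"
  note M' = mp2_carrierD[OF M]
  have dB: "det B = 1" using M'(1) by (simp add: B_def det_2 mult.commute)
  have BA: "B ** ?A = mat 1" "?A ** B = mat 1"
    using M'(1) by (auto simp: mat2_eq_iff mat2_mult_nth B_def det_2 algebra_simps)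
  have inv: "mp2_inv M = (B, \<lambda>\<tau>. if \<tau> \<in> upper_half_plane then 1 / snd M (mobius B \<tau>) else 0)"
    unfolding mp2_inv_def B_def Let_def ..
  show "mp2_inv M \<in> mp2_carrier" unfolding inv
  proof (rule mp2_carrierI[OF dB])
    have "snd M \<circ> mobius B holomorphic_on upper_half_plane"
      by (rule holomorphic_on_compose_gen[OF mobius_holomorphic[OF dB] M'(2)]) (use mobius_in[OF dB] in auto)
    then have "(\<lambda>\<tau>. 1 / snd M (mobius B \<tau>)) holomorphic_on upper_half_plane"
      using mp2_snd_nonzero[OF M mobius_in[OF dB]] by (intro holomorphic_intros) (auto simp: o_def)
    then show "(\<lambda>\<tau>. if \<tau> \<in> upper_half_plane then 1 / snd M (mobius B \<tau>) else 0) holomorphic_on upper_half_plane"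
      by (rule holomorphic_transform) auto
    show "(if \<tau> \<in> upper_half_plane then 1 / snd M (mobius B \<tau>) else 0)\<^sup>2 = autj B \<tau>" if \<tau>: "\<tau> \<in> upper_half_plane" for \<tau>
    proof -
      have "autj (?A ** B) \<tau> = 1" unfolding BA by (simp add: autj_def)
      then have "autj ?A (mobius B \<tau>) * autj B \<tau> = 1" using autj_mult[OF dB \<tau>] by simp
      then show ?thesis
        using M'(3)[OF mobius_in[OF dB \<tau>]] \<tau> by (simp add: power_divide) (metis mult.commute nonzero_eq_divide_eq mult_zero_left zero_neq_one)
    qed
  qed auto
  have "snd (mp2_mult (mp2_inv M) M) \<tau> = snd mp2_one \<tau>" for \<tau>
  proof (cases "\<tau> \<in> upper_half_plane")
    case True
    have "mobius B (mobius ?A \<tau>) = \<tau>" using mobius_mult[OF dB M'(1) True] BA by simp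
    then show ?thesis
      using True mobius_in[OF M'(1) True] mp2_snd_nonzero[OF M True] by (simp add: mp2_mult_def inv mp2_one_def)
  next
    case False then show ?thesis using M'(4) by (simp add: mp2_mult_def mp2_one_def)
  qed
  then show "mp2_mult (mp2_inv M) M = mp2_one" using BA by (simp add: prod_eq_iff mp2_mult_def inv mp2_one_def fun_eq_iff)
qed

lemma SL2Z_mult: "A \<in> SL2Z \<Longrightarrow> B \<in> SL2Z \<Longrightarrow> A ** B \<in> SL2Z"
  by (auto simp: SL2Z_def det_mul mat2_mult_nth)

lemma SL2Z_iff: "A \<in> SL2Z \<longleftrightarrow> det A = 1 \<and> A$1$1 \<in> \<int> \<and> A$1$2 \<in> \<int> \<and> A$2$1 \<in> \<int> \<and> A$2$2 \<in> \<int>"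
  by (auto simp: SL2Z_def forall_2)

lemma Mp2Z_simps [simp]: "carrier Mp2Z = {M \<in> mp2_carrier. fst M \<in> SL2Z}" "mult Mp2Z = mp2_mult" "one Mp2Z = mp2_one"
  by (auto simp: Mp2Z_def)

lemma group_Mp2Z: "group Mp2Z"
proof (rule groupI)
  show "\<one>\<^bsub>Mp2Z\<^esub> \<in> carrier Mp2Z" using mp2_one_closed by (simp add: mp2_one_def SL2Z_iff det_2)
  show "x \<otimes>\<^bsub>Mp2Z\<^esub> y \<in> carrier Mp2Z" if "x \<in> carrier Mp2Z" "y \<in> carrier Mp2Z" for x y
    using that mp2_mult_closed SL2Z_mult by (auto simp: mp2_mult_def)
  show "\<exists>y\<in>carrier Mp2Z. y \<otimes>\<^bsub>Mp2Z\<^esub> x = \<one>\<^bsub>Mp2Z\<^esub>" if "x \<in> carrier Mp2Z" for x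
  proof (rule bexI)
    have x: "x \<in> mp2_carrier" "fst x \<in> SL2Z" using that by simp_all
    show "mp2_inv x \<otimes>\<^bsub>Mp2Z\<^esub> x = \<one>\<^bsub>Mp2Z\<^esub>" using mp2_inv(2)[OF x(1)] by simp
    have "fst (mp2_inv x) \<in> SL2Z" using x(2) by (simp add: mp2_inv_def Let_def SL2Z_iff det_2 mult.commute)
    then show "mp2_inv x \<in> carrier Mp2Z" using mp2_inv(1)[OF x(1)] by simp
  qed
qed (auto simp: mp2_mult_assoc mp2_mult_one)

text \<open>The quotient of two roots of the same function is continuous on the connected half plane
  with values 1 and -1, hence constant.\<close>

lemma mp2_eq_or_neg:
  assumes M: "M \<in> mp2_carrier" and N: "N \<in> mp2_carrier" and eq: "fst M = fst N"
  shows "M = N \<or> M = (fst N, \<lambda>\<tau>. - snd N \<tau>)"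
proof -
  define q where "q = (\<lambda>\<tau>. snd M \<tau> / snd N \<tau>)"
  have q1: "q \<tau> = 1 \<or> q \<tau> = -1" if "\<tau> \<in> upper_half_plane" for \<tau>
  proof -
    have "(q \<tau>)\<^sup>2 = 1"
      using mp2_carrierD(3)[OF M that] mp2_carrierD(3)[OF N that] eq autj_nonzero[OF mp2_carrierD(1)[OF N] that]
      by (simp add: q_def power_divide)
    then show ?thesis by (simp add: power2_eq_1_iff)
  qed
  have "q constant_on upper_half_plane"
  proof (rule continuous_finite_range_constant)
    show "connected upper_half_plane" using convex_upper_half_plane by (rule convex_connected)
    show "continuous_on upper_half_plane q" unfolding q_def
      using mp2_carrierD(2)[OF M] mp2_carrierD(2)[OF N] mp2_snd_nonzero[OF N]
      by (intro continuous_intros holomorphic_on_imp_continuous_on) auto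
    have "q ` upper_half_plane \<subseteq> {1, -1}" using q1 by auto
    then show "finite (q ` upper_half_plane)" using finite_subset by blast
  qed
  then obtain c where c: "\<And>\<tau>. \<tau> \<in> upper_half_plane \<Longrightarrow> q \<tau> = c" unfolding constant_on_def by blast
  have "c = 1 \<or> c = -1" using q1[of \<i>] c[of \<i>] by (simp add: upper_half_plane_iff)
  moreover have "snd M \<tau> = c * snd N \<tau>" for \<tau>
    using c[of \<tau>] mp2_snd_nonzero[OF N, of \<tau>] mp2_carrierD(4)[OF M, of \<tau>] mp2_carrierD(4)[OF N, of \<tau>]
    by (cases "\<tau> \<in> upper_half_plane") (auto simp: q_def field_simps)
  ultimately show ?thesis using eq by (auto simp: prod_eq_iff fun_eq_iff)
qed

section \<open>Generators of the metaplectic group\<close>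

text \<open>All integral powers of \<open>gen_T\<close> in one family, so that a division with
  remainder is a single multiplication.\<close>

definition mp2_T :: "int \<Rightarrow> mp2" where
  "mp2_T n = (mat22 1 (of_int n) 0 1, \<lambda>\<tau>. if \<tau> \<in> upper_half_plane then 1 else 0)"

lemma mp2_T_closed: "mp2_T n \<in> carrier Mp2Z"
  unfolding Mp2Z_simps mp2_T_def
  by (auto simp: SL2Z_iff det_2 autj_def intro!: mp2_carrierI intro: holomorphic_transform[of "\<lambda>_. 1"])

lemma gen_T_eq: "gen_T = mp2_T 1"
  by (simp add: gen_T_def mp2_T_def)

lemma csqrt_holomorphic: "csqrt holomorphic_on upper_half_plane"
  by (rule holomorphic_on_subset[OF holomorphic_on_csqrt]) (auto simp: upper_half_plane_iff complex_nonpos_Reals_iff)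

lemma gen_S_closed: "gen_S \<in> carrier Mp2Z"
  unfolding Mp2Z_simps gen_S_def
  by (auto simp: SL2Z_iff det_2 autj_def intro!: mp2_carrierI intro: holomorphic_transform[OF csqrt_holomorphic])

lemma mobius_S: "mobius (fst gen_S) \<tau> = - 1 / \<tau>"
  by (simp add: mobius_def gen_S_def)

lemma mobius_T: "mobius (fst (mp2_T n)) \<tau> = \<tau> + of_int n"
  by (simp add: mobius_def mp2_T_def)

lemma neg_inverse_in: "\<tau> \<in> upper_half_plane \<Longrightarrow> - 1 / \<tau> \<in> upper_half_plane"
  using mobius_in[of "fst gen_S" \<tau>] unfolding mobius_S by (simp add: gen_S_def det_2)

lemma csqrt_S: "\<tau> \<in> upper_half_plane \<Longrightarrow> (csqrt (- 1 / \<tau>) * csqrt \<tau>)\<^sup>2 = - 1"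
  by (auto simp: power_mult_distrib upper_half_plane_iff)

text \<open>The square of \<open>S\<close> has matrix minus the identity, and the product of the
  principal roots at \<open>t\<close> and at \<open>- 1 / t\<close> squares to -1; so the fourth
  power keeps the matrix and changes the sign of the root.\<close>

lemma mp2_S4:
  assumes Y: "Y \<in> mp2_carrier"
  shows "mp2_mult gen_S (mp2_mult gen_S (mp2_mult gen_S (mp2_mult gen_S Y))) = (fst Y, \<lambda>\<tau>. - snd Y \<tau>)"
proof -
  let ?S = "fst gen_S"
  have dS: "det ?S = 1" by (simp add: gen_S_def det_2)
  note dY = mp2_carrierD(1)[OF Y]
  have S2: "?S ** (?S ** X) = - X" for X :: "real^2^2"
    unfolding mat2_eq_iff by (simp add: mat2_mult_nth gen_S_def)
  have "snd (mp2_mult gen_S (mp2_mult gen_S (mp2_mult gen_S (mp2_mult gen_S Y)))) \<tau> = - snd Y \<tau>" for \<tau>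
  proof (cases "\<tau> \<in> upper_half_plane")
    case True
    define t where "t = mobius (fst Y) \<tau>"
    have t: "t \<in> upper_half_plane" unfolding t_def by (rule mobius_in[OF dY True])
    then have t0: "t \<noteq> 0" by (auto simp: upper_half_plane_iff)
    have dets: "det (?S ** fst Y) = 1" "det (?S ** (?S ** fst Y)) = 1" using dS dY by (simp_all add: det_mul)
    have m: "mobius (?S ** fst Y) \<tau> = - 1 / t" "mobius (?S ** (?S ** fst Y)) \<tau> = t"
        "mobius (?S ** (?S ** (?S ** fst Y))) \<tau> = - 1 / t"
      using mobius_mult[OF dS dY True] mobius_mult[OF dS dets(1) True] mobius_mult[OF dS dets(2) True] t0
      unfolding mobius_S by (simp_all add: t_def)
    have s: "snd gen_S z = csqrt z" if "z \<in> upper_half_plane" for z using that by (simp add: gen_S_def)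
    have "snd (mp2_mult gen_S (mp2_mult gen_S (mp2_mult gen_S (mp2_mult gen_S Y)))) \<tau>
        = (csqrt (- 1 / t) * csqrt t)\<^sup>2 * snd Y \<tau>"
      using t neg_inverse_in[OF t] unfolding mp2_mult_def fst_conv snd_conv m t_def[symmetric]
      by (simp add: s power2_eq_square mult_ac)
    then show ?thesis using csqrt_S[OF t] by simp
  next
    case False
    then show ?thesis using mp2_carrierD(4)[OF Y] by (simp add: mp2_mult_def)
  qed
  moreover have "fst (mp2_mult gen_S (mp2_mult gen_S (mp2_mult gen_S (mp2_mult gen_S Y)))) = fst Y"
    by (simp add: mp2_mult_def S2)
  ultimately show ?thesis by (simp add: prod_eq_iff fun_eq_iff)
qed

text \<open>The Euclidean algorithm on the first column: left multiplication by \<open>T\<^sup>n\<close> reduces \<open>a\<close> modulo \<open>c\<close>,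
  left multiplication by \<open>S\<close> interchanges \<open>a\<close> and \<open>c\<close>.\<close>

theorem Mp2Z_induct [consumes 1, case_names one T S]:
  assumes M: "M \<in> carrier Mp2Z"
    and one: "P mp2_one"
    and T: "\<And>n M. M \<in> carrier Mp2Z \<Longrightarrow> P M \<Longrightarrow> P (mp2_mult (mp2_T n) M)"
    and S: "\<And>M. M \<in> carrier Mp2Z \<Longrightarrow> P M \<Longrightarrow> P (mp2_mult gen_S M)"
  shows "P M"
proof -
  interpret group Mp2Z by (rule group_Mp2Z)
  have cl: "mp2_mult X Y \<in> carrier Mp2Z" if "X \<in> carrier Mp2Z" "Y \<in> carrier Mp2Z" for X Y
    using m_closed[OF that] by simp
  \<comment> \<open>Four factors \<open>S\<close> change the sign of the root, so \<open>P\<close>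
    passes to the other lift of the same matrix.\<close>
  have neg: "(fst Y, \<lambda>\<tau>. - snd Y \<tau>) \<in> carrier Mp2Z \<and> P (fst Y, \<lambda>\<tau>. - snd Y \<tau>)" if "Y \<in> carrier Mp2Z" "P Y" for Y
  proof -
    have "mp2_mult gen_S (mp2_mult gen_S (mp2_mult gen_S (mp2_mult gen_S Y))) \<in> carrier Mp2Z"
      by (intro cl gen_S_closed that(1))
    moreover have "P (mp2_mult gen_S (mp2_mult gen_S (mp2_mult gen_S (mp2_mult gen_S Y))))"
      by (intro cl S gen_S_closed that)
    ultimately show ?thesis using mp2_S4[of Y] that(1) by simp
  qed
  have Tone: "P (mp2_T n)" for n
    using T[of mp2_one n] one one_closed mp2_T_closed[of n] mp2_mult_one(2)[of "mp2_T n"] by simp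
  show ?thesis using M
  proof (induction "nat \<lfloor>\<bar>fst M $ 2 $ 1\<bar>\<rfloor>" arbitrary: M rule: less_induct)
    case less
    obtain A \<phi> where MA: "M = (A, \<phi>)" by (cases M)
    have A: "A \<in> SL2Z" and Mc: "M \<in> mp2_carrier" using less.prems MA by auto
    obtain a b c d :: int where abcd: "A$1$1 = a" "A$1$2 = b" "A$2$1 = c" "A$2$2 = d"
      using A unfolding SL2Z_iff by (auto elim!: Ints_cases)
    have det: "a * d - b * c = 1"
    proof -
      have "real_of_int (a * d - b * c) = 1" using A abcd by (simp add: SL2Z_iff det_2)
      then show ?thesis by linarith
    qed
    show ?case
    proof (cases "c = 0")
      case True
      then have "a * d = 1" using det by simp
      then have ad: "(a = 1 \<and> d = 1) \<or> (a = -1 \<and> d = -1)" by (rule zmult_eq_1_iff[THEN iffD1])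
      have "\<exists>N\<in>carrier Mp2Z. P N \<and> fst N = A"
      proof (cases "d = 1")
        case d1: True
        have "fst (mp2_T b) = A" using ad d1 True abcd by (simp add: mat2_eq_iff mp2_T_def)
        then show ?thesis using Tone mp2_T_closed by blast
      next
        case d1: False
        \<comment> \<open>\<open>S\<close> squared negates the matrix, hence the exponent
          \<open>- b\<close> produces the upper right entry \<open>b\<close>.\<close>
        have "fst (mp2_mult gen_S (mp2_mult gen_S (mp2_T (- b)))) = A"
          using ad d1 True abcd by (simp add: mat2_eq_iff mp2_T_def mp2_mult_def mat2_mult_nth gen_S_def)
        moreover have "P (mp2_mult gen_S (mp2_mult gen_S (mp2_T (- b))))"
          by (intro S cl gen_S_closed mp2_T_closed Tone)
        moreover have "mp2_mult gen_S (mp2_mult gen_S (mp2_T (- b))) \<in> carrier Mp2Z"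
          by (intro cl gen_S_closed mp2_T_closed)
        ultimately show ?thesis by blast
      qed
      then obtain N where N: "N \<in> carrier Mp2Z" "P N" "fst N = A" by blast
      then have "M = N \<or> M = (fst N, \<lambda>\<tau>. - snd N \<tau>)"
        using MA Mc by (intro mp2_eq_or_neg) auto
      then show ?thesis using N neg[of N] by auto
    next
      case False
      \<comment> \<open>Adding this multiple of the lower row turns the upper left entry into
        \<open>a mod c\<close>, which \<open>S\<close> then moves to the lower left.\<close>
      define n where "n = - (a div c)"
      define X where "X = mp2_mult (mp2_T n) M"
      define M' where "M' = mp2_mult gen_S X"
      have X: "X \<in> carrier Mp2Z" unfolding X_def by (intro cl mp2_T_closed less.prems)
      have M': "M' \<in> carrier Mp2Z" unfolding M'_def by (intro cl gen_S_closed X)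
      have "fst M' $ 2 $ 1 = of_int (a mod c)"
        using abcd MA by (simp add: M'_def X_def mp2_mult_def mat2_mult_nth gen_S_def mp2_T_def n_def
            flip: minus_div_mult_eq_mod)
      moreover have "\<bar>a mod c\<bar> < \<bar>c\<bar>" using False by (rule abs_mod_less)
      ultimately have "nat \<lfloor>\<bar>fst M' $ 2 $ 1\<bar>\<rfloor> < nat \<lfloor>\<bar>fst M $ 2 $ 1\<bar>\<rfloor>"
        using abcd MA by (simp flip: of_int_abs)
      then have PM': "P M'" using M' by (rule less.hyps)
      \<comment> \<open>Three further factors \<open>S\<close> undo the one in \<open>M'\<close> up
        to the sign of the root, which \<open>neg\<close> removes; so \<open>P\<close> descends from
        \<open>M'\<close> to \<open>X\<close> by left multiplications alone.\<close>
      let ?Y = "mp2_mult gen_S (mp2_mult gen_S (mp2_mult gen_S M'))"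
      have Y: "?Y \<in> carrier Mp2Z" by (intro cl gen_S_closed M')
      have PY: "P ?Y" by (intro cl S gen_S_closed M' PM')
      have "?Y = (fst X, \<lambda>\<tau>. - snd X \<tau>)" unfolding M'_def using X by (intro mp2_S4) simp
      then have "P X" using neg[OF Y PY] by simp
      then have "P (mp2_mult (mp2_T (- n)) X)" by (rule T[OF X])
      moreover have "mp2_mult (mp2_T (- n)) X = M"
      proof -
        have "mp2_mult (mp2_T (- n)) (mp2_T n) = mp2_one"
        proof -
          have "mobius (fst (mp2_T n)) \<tau> \<in> upper_half_plane" if "\<tau> \<in> upper_half_plane" for \<tau>
            using that unfolding mobius_T by (simp add: upper_half_plane_iff)
          then show ?thesis
            by (auto simp: mp2_mult_def mp2_one_def mp2_T_def mat2_eq_iff mat2_mult_nth fun_eq_iff)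
        qed
        moreover have "mp2_mult (mp2_T (- n)) X = mp2_mult (mp2_mult (mp2_T (- n)) (mp2_T n)) M"
          unfolding X_def using mp2_T_closed Mc by (intro mp2_mult_assoc[symmetric]) auto
        ultimately show ?thesis using mp2_mult_one(1)[OF Mc] by simp
      qed
      ultimately show ?thesis by simp
    qed
  qed
qed

text \<open>Infinitely many lower unipotent elements fall into finitely many cosets. Two in the same
  coset differ by an element of \<open>\<Gamma>\<close> whose lower left entry is the difference of
  theirs.\<close>

lemma finite_index_lower_left_nonzero:
  assumes \<Gamma>: "subgroup \<Gamma> Mp2Z" and fin: "finite (rcosets\<^bsub>Mp2Z\<^esub> \<Gamma>)"
  shows "\<exists>M\<in>\<Gamma>. fst M $ 2 $ 1 \<noteq> 0"
proof -
  interpret group Mp2Z by (rule group_Mp2Z)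
  define U where "U = (\<lambda>n::nat. (mat22 1 0 (real n) 1, \<lambda>\<tau>. if \<tau> \<in> upper_half_plane then csqrt (of_nat n * \<tau> + 1) else 0))"
  have U: "U n \<in> carrier Mp2Z" for n
  proof -
    have "(\<lambda>\<tau>. csqrt (of_nat n * \<tau> + 1)) holomorphic_on upper_half_plane"
    proof (intro holomorphic_intros)
      fix z :: complex assume z: "z \<in> upper_half_plane"
      show "of_nat n * z + 1 \<notin> \<real>\<^sub>\<le>\<^sub>0"
        using z by (cases "n = 0") (auto simp: upper_half_plane_iff complex_nonpos_Reals_iff)
    qed
    then have "(\<lambda>\<tau>. if \<tau> \<in> upper_half_plane then csqrt (of_nat n * \<tau> + 1) else 0) holomorphic_on upper_half_plane"
      by (rule holomorphic_transform) auto
    then show ?thesis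
      unfolding Mp2Z_simps U_def by (auto simp: SL2Z_iff det_2 autj_def intro!: mp2_carrierI)
  qed
  have "range (\<lambda>n. \<Gamma> #>\<^bsub>Mp2Z\<^esub> U n) \<subseteq> rcosets\<^bsub>Mp2Z\<^esub> \<Gamma>"
    using U unfolding RCOSETS_def by blast
  then have "finite (range (\<lambda>n. \<Gamma> #>\<^bsub>Mp2Z\<^esub> U n))" using fin finite_subset by blast
  then have "\<not> inj (\<lambda>n. \<Gamma> #>\<^bsub>Mp2Z\<^esub> U n)" using finite_imageD[of _ UNIV] infinite_UNIV_nat by blast
  then obtain m n where mn: "m \<noteq> n" "\<Gamma> #>\<^bsub>Mp2Z\<^esub> U m = \<Gamma> #>\<^bsub>Mp2Z\<^esub> U n" unfolding inj_def by blast
  have "U n \<in> \<Gamma> #>\<^bsub>Mp2Z\<^esub> U m" unfolding mn(2) by (rule rcos_self[OF U \<Gamma>])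
  then obtain h where h: "h \<in> \<Gamma>" "U n = mp2_mult h (U m)" unfolding r_coset_def by auto
  have "mat22 1 0 (real n) 1 = fst h ** mat22 1 0 (real m) 1"
    using arg_cong[OF h(2), of fst] by (simp add: U_def mp2_mult_def)
  then have "real n = fst h $ 2 $ 1 + fst h $ 2 $ 2 * real m" "1 = fst h $ 2 $ 2"
    unfolding mat2_eq_iff by (auto simp: mat2_mult_nth)
  then have "fst h $ 2 $ 1 = real n - real m" by (metis add_diff_cancel_right' mult_1)
  then show ?thesis using h(1) mn(1) by (intro bexI[of _ h]) auto
qed

section \<open>The involution\<close>

definition refl_pt :: "complex \<Rightarrow> complex" where "refl_pt \<tau> = - cnj \<tau>"

lemma refl_pt_in [simp]: "refl_pt \<tau> \<in> upper_half_plane \<longleftrightarrow> \<tau> \<in> upper_half_plane"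
  by (simp add: refl_pt_def upper_half_plane_iff)

lemma refl_pt_refl_pt [simp]: "refl_pt (refl_pt \<tau>) = \<tau>"
  by (simp add: refl_pt_def)

lemma mp2_tilde_tilde: "mp2_tilde (mp2_tilde M) = M"
  by (simp add: mp2_tilde_def prod_eq_iff mat2_eq_iff)

lemma snd_mp2_tilde: "snd (mp2_tilde M) (refl_pt \<tau>) = cnj (snd M \<tau>)"
  by (simp add: mp2_tilde_def refl_pt_def)

lemma mobius_tilde: "mobius (fst (mp2_tilde M)) (refl_pt \<tau>) = refl_pt (mobius (fst M) \<tau>)"
proof -
  let ?A = "fst M"
  have "mobius (fst (mp2_tilde M)) (refl_pt \<tau>) = - ((of_real (?A$1$1) * cnj \<tau> + of_real (?A$1$2)) / (of_real (?A$2$1) * cnj \<tau> + of_real (?A$2$2)))"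
    by (simp add: mobius_def mp2_tilde_def refl_pt_def flip: minus_divide_left)
       (metis (no_types, lifting) minus_add_distrib minus_divide_left diff_conv_add_uminus)
  then show ?thesis by (simp add: mobius_def refl_pt_def)
qed

lemma mp2_tilde_closed: "M \<in> carrier Mp2Z \<Longrightarrow> mp2_tilde M \<in> carrier Mp2Z"
proof -
  assume M: "M \<in> carrier Mp2Z"
  then have M': "M \<in> mp2_carrier" by simp
  define B where "B = fst (mp2_tilde M)"
  have "det B = 1" using mp2_carrierD(1)[OF M'] by (simp add: B_def mp2_tilde_def det_2)
  moreover have "(\<lambda>\<tau>. cnj (snd M (- cnj \<tau>))) holomorphic_on upper_half_plane"
  proof -
    have "(\<lambda>z. snd M (- z)) holomorphic_on cnj ` upper_half_plane"
    proof -
      have "snd M \<circ> uminus holomorphic_on cnj ` upper_half_plane"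
        by (rule holomorphic_on_compose_gen[OF _ mp2_carrierD(2)[OF M']])
           (auto intro!: holomorphic_intros simp: upper_half_plane_iff)
      then show ?thesis by (simp add: o_def)
    qed
    from holomorphic_on_compose_cnj_cnj[OF this open_upper_half_plane] show ?thesis by (simp add: o_def)
  qed
  moreover have "(cnj (snd M (- cnj \<tau>)))\<^sup>2 = autj B \<tau>" if "\<tau> \<in> upper_half_plane" for \<tau>
  proof -
    have "- cnj \<tau> \<in> upper_half_plane" using that by (simp add: upper_half_plane_iff)
    from mp2_carrierD(3)[OF M' this] have "(snd M (- cnj \<tau>))\<^sup>2 = autj (fst M) (- cnj \<tau>)" .
    then have "(cnj (snd M (- cnj \<tau>)))\<^sup>2 = cnj (autj (fst M) (- cnj \<tau>))" by (metis complex_cnj_power)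
    then show ?thesis by (simp add: autj_def B_def mp2_tilde_def)
  qed
  moreover have "cnj (snd M (- cnj \<tau>)) = 0" if "\<tau> \<notin> upper_half_plane" for \<tau>
    using that mp2_carrierD(4)[OF M', of "- cnj \<tau>"] by (simp add: upper_half_plane_iff)
  ultimately have "(B, \<lambda>\<tau>. cnj (snd M (- cnj \<tau>))) \<in> mp2_carrier" by (rule mp2_carrierI)
  then show ?thesis using M by (auto simp: B_def mp2_tilde_def SL2Z_iff det_2)
qed

lemma mp2_tilde_mult: "mp2_tilde (mp2_mult M N) = mp2_mult (mp2_tilde M) (mp2_tilde N)"
proof -
  have "snd (mp2_tilde (mp2_mult M N)) \<tau> = snd (mp2_mult (mp2_tilde M) (mp2_tilde N)) \<tau>" for \<tau>
  proof -
    define t where "t = refl_pt \<tau>"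
    have \<tau>: "\<tau> = refl_pt t" by (simp add: t_def)
    show ?thesis unfolding \<tau> snd_mp2_tilde unfolding mp2_mult_def snd_conv mobius_tilde snd_mp2_tilde by simp
  qed
  then show ?thesis
    by (auto simp: prod_eq_iff fun_eq_iff mp2_mult_def mat2_eq_iff mat2_mult_nth mp2_tilde_def)
qed

lemma mp2_tilde_one: "mp2_tilde mp2_one = mp2_one"
  by (auto simp: mp2_tilde_def mp2_one_def mat2_eq_iff fun_eq_iff upper_half_plane_iff)

lemma mp2_tilde_T: "mp2_tilde (mp2_T n) = mp2_T (- n)"
  by (auto simp: mp2_tilde_def mp2_T_def mat2_eq_iff fun_eq_iff upper_half_plane_iff)

text \<open>With \<open>mp2_tilde_T\<close>, the involution inverts both generators. As these act by
  symmetric matrices, twisting by it produces the contragredient representation.\<close>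

lemma mp2_tilde_S: "mp2_mult gen_S (mp2_tilde gen_S) = mp2_one"
proof -
  have "snd (mp2_mult gen_S (mp2_tilde gen_S)) \<tau> = snd mp2_one \<tau>" for \<tau>
  proof (cases "\<tau> \<in> upper_half_plane")
    case True
    define t where "t = refl_pt \<tau>"
    have t: "t \<in> upper_half_plane" "\<tau> = refl_pt t" using True by (auto simp: t_def)
    have t0: "t \<noteq> 0" using t by (auto simp: upper_half_plane_iff)
    have tt: "refl_pt (- 1 / t) = 1 / cnj t" by (simp add: refl_pt_def)
    have r: "1 / cnj t \<in> upper_half_plane" using neg_inverse_in[OF t(1)] unfolding tt[symmetric] by simp
    have "snd (mp2_mult gen_S (mp2_tilde gen_S)) \<tau> = csqrt (1 / cnj t) * cnj (csqrt t)"
      unfolding mp2_mult_def snd_conv t(2) mobius_tilde mobius_S snd_mp2_tilde tt using r t by (simp add: gen_S_def)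
    \<comment> \<open>Inversion followed by conjugation preserves the right half plane, which
      contains the principal root of \<open>t\<close>.\<close>
    also have "csqrt (1 / cnj t) = 1 / cnj (csqrt t)"
    proof (rule csqrt_unique)
      show "(1 / cnj (csqrt t))\<^sup>2 = 1 / cnj t"
        by (simp add: power_divide flip: complex_cnj_power)
      have "Re (csqrt t) > 0"
        using t(1) csqrt_principal[of t] by (smt (verit) Im_power2 mult_eq_0_iff power2_csqrt upper_half_plane_iff)
      then show "0 < Re (1 / cnj (csqrt t)) \<or> Re (1 / cnj (csqrt t)) = 0 \<and> 0 \<le> Im (1 / cnj (csqrt t))"
        by (simp add: Re_divide divide_pos_pos add_pos_nonneg)
    qed
    also have "1 / cnj (csqrt t) * cnj (csqrt t) = 1" using t0 by simp
    finally show ?thesis using True by (simp add: mp2_one_def)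
  next
    case False
    then show ?thesis by (auto simp: mp2_mult_def mp2_one_def mp2_tilde_def gen_S_def upper_half_plane_iff)
  qed
  then show ?thesis
    by (auto simp: prod_eq_iff fun_eq_iff mp2_mult_def mat2_eq_iff mat2_mult_nth mp2_tilde_def gen_S_def mp2_one_def)
qed

section \<open>The Weil representation\<close>

lemma sum_single_coeff:
  fixes f :: "'i \<Rightarrow> complex"
  assumes "finite A" "\<gamma> \<in> A"
  shows "(\<Sum>\<delta>\<in>A. (if \<gamma> = \<delta> then c else 0) * f \<delta>) = c * f \<gamma>"
proof -
  have "(\<Sum>\<delta>\<in>A. (if \<gamma> = \<delta> then c else 0) * f \<delta>) = (\<Sum>\<delta>\<in>A. if \<gamma> = \<delta> then c * f \<gamma> else 0)"
    by (intro sum.cong refl) auto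
  then show ?thesis using assms by (simp add: sum.delta')
qed

text \<open>\<open>c / j\<close> is the logarithmic derivative of \<open>j\<close>, and this is the
  logarithmic derivative of the relation \<open>autj_mult\<close>; the square comes from the
  derivative of \<open>mobius B\<close>.\<close>

lemma autj_cocycle:
  assumes "det A = 1" "det B = 1" "\<tau> \<in> upper_half_plane"
  shows "of_real ((A ** B)$2$1) / autj (A ** B) \<tau> =
    of_real (A$2$1) / (autj A (mobius B \<tau>) * (autj B \<tau>)\<^sup>2) + of_real (B$2$1) / autj B \<tau>"
proof -
  have j: "autj B \<tau> \<noteq> 0" "autj A (mobius B \<tau>) \<noteq> 0"
    using autj_nonzero mobius_in assms by blast+
  have d: "of_real (B$1$1) * of_real (B$2$2) - of_real (B$1$2) * of_real (B$2$1) = (1::complex)"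
    using arg_cong[OF assms(2), of "of_real :: real \<Rightarrow> complex"] by (simp add: det_2)
  have "of_real ((A ** B)$2$1) * autj B \<tau> - of_real (B$2$1) * autj (A ** B) \<tau>
      = of_real (A$2$1) * (of_real (B$1$1) * of_real (B$2$2) - of_real (B$1$2) * of_real (B$2$1))"
    by (simp add: autj_def mat2_mult_nth algebra_simps)
  then have "of_real ((A ** B)$2$1) * autj B \<tau> = of_real (A$2$1) + of_real (B$2$1) * (autj A (mobius B \<tau>) * autj B \<tau>)"
    unfolding d autj_mult[OF assms(2,3)] by (simp add: algebra_simps)
  then show ?thesis unfolding autj_mult[OF assms(2,3)] using j by (simp add: field_simps power2_eq_square)
qed

lemma basis_vec_group_algebra: "\<gamma> \<in> disc L \<Longrightarrow> basis_vec \<gamma> \<in> group_algebra L"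
  by (auto simp: basis_vec_def group_algebra_def)

lemma group_algebra_sum:
  "finite A \<Longrightarrow> (\<And>i. i \<in> A \<Longrightarrow> U i \<in> group_algebra L) \<Longrightarrow> (\<Sum>i\<in>A. vscale (c i) (U i)) \<in> group_algebra L"
  by (auto simp: group_algebra_def sum_apply vscale_def)

lemma vscale_group_algebra: "U \<in> group_algebra L \<Longrightarrow> vscale c U \<in> group_algebra L"
  by (auto simp: group_algebra_def vscale_def)

lemma representation_onD:
  assumes "representation_on G V \<rho>"
  shows "g \<in> carrier G \<Longrightarrow> U \<in> V \<Longrightarrow> \<rho> g U \<in> V"
    and "g \<in> carrier G \<Longrightarrow> U \<in> V \<Longrightarrow> W \<in> V \<Longrightarrow> \<rho> g (U + W) = \<rho> g U + \<rho> g W"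
    and "g \<in> carrier G \<Longrightarrow> U \<in> V \<Longrightarrow> \<rho> g (vscale c U) = vscale c (\<rho> g U)"
    and "U \<in> V \<Longrightarrow> \<rho> \<one>\<^bsub>G\<^esub> U = U"
    and "g \<in> carrier G \<Longrightarrow> h \<in> carrier G \<Longrightarrow> U \<in> V \<Longrightarrow> \<rho> (g \<otimes>\<^bsub>G\<^esub> h) U = \<rho> g (\<rho> h U)"
  using assms unfolding representation_on_def by blast+

lemma representation_sum:
  assumes \<rho>: "representation_on G (group_algebra L) \<rho>" and g: "g \<in> carrier G"
    and A: "finite A" "\<And>i. i \<in> A \<Longrightarrow> U i \<in> group_algebra L"
  shows "\<rho> g (\<Sum>i\<in>A. vscale (c i) (U i)) = (\<Sum>i\<in>A. vscale (c i) (\<rho> g (U i)))"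
  using A
proof (induction A rule: finite_induct)
  case empty
  have Z: "0 \<in> group_algebra L" by (simp add: group_algebra_def)
  have "vscale 0 U = 0" for U :: "'b set \<Rightarrow> complex" by (simp add: vscale_def fun_eq_iff)
  moreover have "\<rho> g (vscale 0 0) = vscale 0 (\<rho> g 0)"
    by (rule representation_onD(3)[OF \<rho> g Z])
  ultimately show ?case by (simp only: sum.empty)
next
  case (insert i A)
  have "vscale (c i) (U i) \<in> group_algebra L" using insert.prems by (intro vscale_group_algebra) simp
  moreover have "(\<Sum>i\<in>A. vscale (c i) (U i)) \<in> group_algebra L" using insert by (intro group_algebra_sum) auto
  ultimately have "\<rho> g (vscale (c i) (U i) + (\<Sum>i\<in>A. vscale (c i) (U i)))
      = \<rho> g (vscale (c i) (U i)) + \<rho> g (\<Sum>i\<in>A. vscale (c i) (U i))"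
    by (rule representation_onD(2)[OF \<rho> g])
  moreover have "\<rho> g (vscale (c i) (U i)) = vscale (c i) (\<rho> g (U i))"
    by (rule representation_onD(3)[OF \<rho> g]) (simp add: insert.prems)
  moreover have "\<rho> g (\<Sum>i\<in>A. vscale (c i) (U i)) = (\<Sum>i\<in>A. vscale (c i) (\<rho> g (U i)))"
    using insert.prems by (intro insert.IH) simp
  ultimately show ?case unfolding sum.insert[OF insert.hyps] by (simp only:)
qed

lemma group_algebra_expansion:
  assumes "finite (disc L)" "U \<in> group_algebra L"
  shows "U = (\<Sum>\<gamma>\<in>disc L. vscale (U \<gamma>) (basis_vec \<gamma>))"
proof (rule ext)
  fix \<delta>
  have "(\<Sum>\<gamma>\<in>disc L. vscale (U \<gamma>) (basis_vec \<gamma>)) \<delta> = (\<Sum>\<gamma>\<in>disc L. if \<delta> = \<gamma> then U \<delta> else 0)"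
    unfolding sum_apply by (intro sum.cong refl) (auto simp: vscale_def basis_vec_def)
  also have "\<dots> = U \<delta>" using assms by (auto simp: sum.delta' group_algebra_def)
  finally show "U \<delta> = (\<Sum>\<gamma>\<in>disc L. vscale (U \<gamma>) (basis_vec \<gamma>)) \<delta>" by simp
qed

lemma neg_lattice_simps [simp]:
  "lat (neg_lattice L) = lat L" "dual_lattice (neg_lattice L) = dual_lattice L"
  "disc (neg_lattice L) = disc L" "group_algebra (neg_lattice L) = group_algebra L"
proof -
  show 1: "lat (neg_lattice L) = lat L" by (simp add: neg_lattice_def)
  have "- r \<in> \<int> \<longleftrightarrow> r \<in> \<int>" for r :: real by (metis Ints_minus minus_minus)
  then show 2: "dual_lattice (neg_lattice L) = dual_lattice L" unfolding dual_lattice_def 1 by (simp add: neg_lattice_def)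
  show 3: "disc (neg_lattice L) = disc L" unfolding disc_def 1 2 ..
  show "group_algebra (neg_lattice L) = group_algebra L" unfolding group_algebra_def 3 ..
qed

context lat_gr
begin

section \<open>Theta components as a source of the Weil representation\<close>

definition "jacobi_act M \<tau> \<zeta> = mv (1 / autj (fst M) \<tau>) \<zeta>" for M :: mp2

text \<open>The automorphy factor of the theta components: weight half the dimension of each
  definite part, times the exponential of the index.\<close>

definition "jacobi_factor M \<tau> \<zeta> = snd M \<tau> ^ card Ep * cnj (snd M \<tau>) ^ card Em *
  ee (of_real (fst M$2$1) * Q (1 / autj (fst M) \<tau>) \<zeta> / 2)" for M :: mp2

lemma jacobi_act_mult:
  assumes "M \<in> mp2_carrier" "K \<in> mp2_carrier" "\<tau> \<in> UH"
  shows "jacobi_act (mp2_mult M K) \<tau> \<zeta> = jacobi_act M (mobius (fst K) \<tau>) (jacobi_act K \<tau> \<zeta>)"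
  unfolding jacobi_act_def mv_mv by (simp add: mp2_mult_def autj_mult[OF mp2_carrierD(1)[OF assms(2)] assms(3)])

text \<open>The exponents match by \<open>autj_cocycle\<close> on the positive part and by its
  complex conjugate on the negative part.\<close>

lemma jacobi_factor_mult:
  assumes M: "M \<in> mp2_carrier" and K: "K \<in> mp2_carrier" and \<tau>: "\<tau> \<in> UH"
  shows "jacobi_factor (mp2_mult M K) \<tau> \<zeta> = jacobi_factor M (mobius (fst K) \<tau>) (jacobi_act K \<tau> \<zeta>) * jacobi_factor K \<tau> \<zeta>"
proof -
  let ?A = "fst M" and ?B = "fst K"
  define j where "j = autj ?B \<tau>"
  define i where "i = autj ?A (mobius ?B \<tau>)"
  have c: "of_real ((?A ** ?B)$2$1) / autj (?A ** ?B) \<tau> = of_real (?A$2$1) / (i * j\<^sup>2) + of_real (?B$2$1) / j"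
    unfolding i_def j_def by (rule autj_cocycle[OF mp2_carrierD(1)[OF M] mp2_carrierD(1)[OF K] \<tau>])
  from arg_cong[OF c, of cnj] have c': "of_real ((?A ** ?B)$2$1) / cnj (autj (?A ** ?B) \<tau>) =
      of_real (?A$2$1) / (cnj i * (cnj j)\<^sup>2) + of_real (?B$2$1) / cnj j" by simp
  have "of_real ((?A ** ?B)$2$1) * Q (1 / autj (?A ** ?B) \<tau>) \<zeta> =
      of_real ((?A ** ?B)$2$1) / autj (?A ** ?B) \<tau> * Bp \<zeta> \<zeta> + of_real ((?A ** ?B)$2$1) / cnj (autj (?A ** ?B) \<tau>) * Bm \<zeta> \<zeta>"
    by (simp add: Q_def algebra_simps)
  also have "\<dots> = of_real (?A$2$1) * Q (1 / i) (mv (1 / j) \<zeta>) + of_real (?B$2$1) * Q (1 / j) \<zeta>"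
    unfolding c c' Q_def Bpm_mv by (simp add: algebra_simps power2_eq_square)
  finally have "ee (of_real ((?A ** ?B)$2$1) * Q (1 / autj (?A ** ?B) \<tau>) \<zeta> / 2) =
      ee (of_real (?A$2$1) * Q (1 / i) (mv (1 / j) \<zeta>) / 2) * ee (of_real (?B$2$1) * Q (1 / j) \<zeta> / 2)"
    by (simp add: ee_add[symmetric] add_divide_distrib)
  then show ?thesis
    unfolding jacobi_factor_def jacobi_act_def i_def[symmetric] j_def[symmetric] mp2_mult_def fst_conv snd_conv
    by (simp add: power_mult_distrib mult_ac)
qed

lemma jacobi_factor_nonzero: "M \<in> mp2_carrier \<Longrightarrow> \<tau> \<in> UH \<Longrightarrow> jacobi_factor M \<tau> \<zeta> \<noteq> 0"
  using mp2_snd_nonzero[of M \<tau>] by (simp add: jacobi_factor_def ee_nonzero)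

text \<open>Stated for an arbitrary matrix \<open>C\<close>, so that existence is an induction over
  generators and uniqueness a separate consequence of linear independence.\<close>

definition theta_transform :: "mp2 \<Rightarrow> ('v set \<Rightarrow> 'v set \<Rightarrow> complex) \<Rightarrow> bool" where
  "theta_transform M C \<longleftrightarrow> (\<forall>\<tau>\<in>UH. \<forall>\<zeta>. \<forall>\<gamma>\<in>disc L.
    th \<gamma> (mobius (fst M) \<tau>) (jacobi_act M \<tau> \<zeta>) = jacobi_factor M \<tau> \<zeta> * (\<Sum>\<delta>\<in>disc L. C \<gamma> \<delta> * th \<delta> \<tau> \<zeta>))"

lemma theta_transformD: "theta_transform M C \<Longrightarrow> \<tau> \<in> UH \<Longrightarrow> \<gamma> \<in> disc L \<Longrightarrow>
    th \<gamma> (mobius (fst M) \<tau>) (jacobi_act M \<tau> \<zeta>) = jacobi_factor M \<tau> \<zeta> * (\<Sum>\<delta>\<in>disc L. C \<gamma> \<delta> * th \<delta> \<tau> \<zeta>)"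
  unfolding theta_transform_def by blast

lemma theta_transform_mult:
  assumes M: "M \<in> mp2_carrier" "theta_transform M C" and K: "K \<in> mp2_carrier" "theta_transform K D"
  shows "theta_transform (mp2_mult M K) (\<lambda>\<gamma> \<epsilon>. \<Sum>\<delta>\<in>disc L. C \<gamma> \<delta> * D \<delta> \<epsilon>)"
  unfolding theta_transform_def
proof (intro ballI allI)
  fix \<tau> \<zeta> \<gamma> assume \<tau>: "\<tau> \<in> UH" and \<gamma>: "\<gamma> \<in> disc L"
  note dM = mp2_carrierD(1)[OF M(1)] and dK = mp2_carrierD(1)[OF K(1)]
  let ?t = "mobius (fst K) \<tau>" and ?z = "jacobi_act K \<tau> \<zeta>"
  have "th \<gamma> (mobius (fst (mp2_mult M K)) \<tau>) (jacobi_act (mp2_mult M K) \<tau> \<zeta>) = th \<gamma> (mobius (fst M) ?t) (jacobi_act M ?t ?z)"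
    unfolding jacobi_act_mult[OF M(1) K(1) \<tau>] by (simp add: mp2_mult_def mobius_mult[OF dM dK \<tau>])
  also have "\<dots> = jacobi_factor M ?t ?z * (\<Sum>\<delta>\<in>disc L. C \<gamma> \<delta> * th \<delta> ?t ?z)"
    by (rule theta_transformD[OF M(2) mobius_in[OF dK \<tau>] \<gamma>])
  also have "(\<Sum>\<delta>\<in>disc L. C \<gamma> \<delta> * th \<delta> ?t ?z) = (\<Sum>\<delta>\<in>disc L. C \<gamma> \<delta> * (jacobi_factor K \<tau> \<zeta> * (\<Sum>\<epsilon>\<in>disc L. D \<delta> \<epsilon> * th \<epsilon> \<tau> \<zeta>)))"
    by (intro sum.cong refl) (simp add: theta_transformD[OF K(2) \<tau>])
  also have "\<dots> = jacobi_factor K \<tau> \<zeta> * (\<Sum>\<delta>\<in>disc L. \<Sum>\<epsilon>\<in>disc L. C \<gamma> \<delta> * D \<delta> \<epsilon> * th \<epsilon> \<tau> \<zeta>)"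
    by (simp add: sum_distrib_left mult_ac)
  also have "(\<Sum>\<delta>\<in>disc L. \<Sum>\<epsilon>\<in>disc L. C \<gamma> \<delta> * D \<delta> \<epsilon> * th \<epsilon> \<tau> \<zeta>) = (\<Sum>\<epsilon>\<in>disc L. (\<Sum>\<delta>\<in>disc L. C \<gamma> \<delta> * D \<delta> \<epsilon>) * th \<epsilon> \<tau> \<zeta>)"
    by (subst sum.swap) (simp add: sum_distrib_right)
  finally show "th \<gamma> (mobius (fst (mp2_mult M K)) \<tau>) (jacobi_act (mp2_mult M K) \<tau> \<zeta>) =
      jacobi_factor (mp2_mult M K) \<tau> \<zeta> * (\<Sum>\<epsilon>\<in>disc L. (\<Sum>\<delta>\<in>disc L. C \<gamma> \<delta> * D \<delta> \<epsilon>) * th \<epsilon> \<tau> \<zeta>)"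
    unfolding jacobi_factor_mult[OF M(1) K(1) \<tau>] by (simp add: mult_ac)
qed

lemma theta_transform_T: "theta_transform (mp2_T n) (\<lambda>\<gamma> \<delta>. if \<gamma> = \<delta> then ee (of_real (qform L (rep \<gamma>)) / 2) powi n else 0)"
  unfolding theta_transform_def
proof (intro ballI allI)
  fix \<tau> \<zeta> \<gamma> assume \<tau>: "\<tau> \<in> UH" and \<gamma>: "\<gamma> \<in> disc L"
  have a: "jacobi_act (mp2_T n) \<tau> \<zeta> = \<zeta>" by (simp add: jacobi_act_def mp2_T_def autj_def)
  have jacobi_factor: "jacobi_factor (mp2_T n) \<tau> \<zeta> = 1" using \<tau> by (simp add: jacobi_factor_def mp2_T_def ee_0)
  show "th \<gamma> (mobius (fst (mp2_T n)) \<tau>) (jacobi_act (mp2_T n) \<tau> \<zeta>) =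
      jacobi_factor (mp2_T n) \<tau> \<zeta> * (\<Sum>\<delta>\<in>disc L. (if \<gamma> = \<delta> then ee (of_real (qform L (rep \<gamma>)) / 2) powi n else 0) * th \<delta> \<tau> \<zeta>)"
    unfolding mobius_T a jacobi_factor sum_single_coeff[OF finite_disc \<gamma>] using th_cls_T[OF rep_Ld[OF \<gamma>], of \<tau> n \<zeta>]
    by (simp add: cls_rep[OF \<gamma>])
qed

lemma theta_transform_one: "theta_transform mp2_one (\<lambda>\<gamma> \<delta>. if \<gamma> = \<delta> then 1 else 0)"
proof -
  have "mp2_one = mp2_T 0" by (simp add: mp2_one_def mp2_T_def mat2_eq_iff)
  then show ?thesis using theta_transform_T[of 0] unfolding power_int_0_right by simp
qed

definition "weil_const = ee ((of_nat (card Em) - of_nat (card Ep)) / 8) / of_real (sqrt (card (disc L)))"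

lemma theta_transform_S: "theta_transform gen_S (\<lambda>\<gamma> \<delta>. weil_const * ee (- of_real (bform L (rep \<gamma>) (rep \<delta>))))"
  unfolding theta_transform_def
proof (intro ballI allI)
  fix \<tau> \<zeta> \<gamma> assume \<tau>: "\<tau> \<in> UH" and \<gamma>: "\<gamma> \<in> disc L"
  have a: "jacobi_act gen_S \<tau> \<zeta> = mv (1 / \<tau>) \<zeta>" by (simp add: jacobi_act_def gen_S_def autj_def)
  have c: "ee ((of_nat (card Em) - of_nat (card Ep)) / 8) / of_real (sqrt (card (disc L))) = weil_const"
    by (simp add: weil_const_def)
  have jacobi_factor: "jacobi_factor gen_S \<tau> \<zeta> = inversion_weight \<tau> * ee (Q (1 / \<tau>) \<zeta> / 2)" using \<tau> by (simp add: jacobi_factor_def gen_S_def inversion_weight_def autj_def)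
  show "th \<gamma> (mobius (fst gen_S) \<tau>) (jacobi_act gen_S \<tau> \<zeta>) =
      jacobi_factor gen_S \<tau> \<zeta> * (\<Sum>\<delta>\<in>disc L. weil_const * ee (- of_real (bform L (rep \<gamma>) (rep \<delta>))) * th \<delta> \<tau> \<zeta>)"
    unfolding mobius_S a jacobi_factor using th_inversion[OF \<tau> rep_Ld[OF \<gamma>], of \<zeta>] unfolding c cls_rep[OF \<gamma>]
    by (simp add: sum_distrib_left mult.assoc)
qed

lemma theta_transform_unique:
  assumes M: "M \<in> mp2_carrier" and "theta_transform M C" "theta_transform M D" "\<gamma> \<in> disc L" "\<delta> \<in> disc L"
  shows "C \<gamma> \<delta> = D \<gamma> \<delta>"
proof (rule th_eq_coeffs[of \<i> "C \<gamma>" "D \<gamma>"])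
  show i: "\<i> \<in> UH" by (simp add: upper_half_plane_iff)
  show "(\<Sum>\<delta>\<in>disc L. C \<gamma> \<delta> * th \<delta> \<i> \<zeta>) = (\<Sum>\<delta>\<in>disc L. D \<gamma> \<delta> * th \<delta> \<i> \<zeta>)" for \<zeta>
    using theta_transformD[OF assms(2) i assms(4)] theta_transformD[OF assms(3) i assms(4)] jacobi_factor_nonzero[OF M i] by simp
qed fact

lemma theta_transform_exists: "M \<in> carrier Mp2Z \<Longrightarrow> \<exists>C. theta_transform M C"
proof (induction M rule: Mp2Z_induct)
  case one
  show ?case by (rule exI[of "theta_transform mp2_one", OF theta_transform_one])
next
  case (T n M)
  from T(2) obtain C where C: "theta_transform M C" by (rule exE)
  have "mp2_T n \<in> mp2_carrier" "M \<in> mp2_carrier" using mp2_T_closed[of n] T(1) by simp_all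
  from theta_transform_mult[OF this(1) theta_transform_T this(2) C] show ?case by (rule exI[of "theta_transform (mp2_mult (mp2_T n) M)"])
next
  case (S M)
  from S(2) obtain C where C: "theta_transform M C" by (rule exE)
  have "gen_S \<in> mp2_carrier" "M \<in> mp2_carrier" using gen_S_closed S(1) by simp_all
  from theta_transform_mult[OF this(1) theta_transform_S this(2) C] show ?case by (rule exI[of "theta_transform (mp2_mult gen_S M)"])
qed

definition "weil_matrix M = (SOME C. theta_transform M C)"

lemma theta_transform_weil_matrix: "M \<in> carrier Mp2Z \<Longrightarrow> theta_transform M (weil_matrix M)"
  unfolding weil_matrix_def by (rule someI_ex[OF theta_transform_exists])

text \<open>The representation read off from the theta components. It is the witness for the choice
  in \<open>weil_rep\<close>.\<close>

definition "weil_op M U = (\<lambda>\<gamma>. if \<gamma> \<in> disc L then \<Sum>\<delta>\<in>disc L. weil_matrix M \<gamma> \<delta> * U \<delta> else 0)"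

lemma weil_op_theta_transform:
  assumes "M \<in> carrier Mp2Z" "theta_transform M C"
  shows "weil_op M U = (\<lambda>\<gamma>. if \<gamma> \<in> disc L then \<Sum>\<delta>\<in>disc L. C \<gamma> \<delta> * U \<delta> else 0)"
  using theta_transform_unique[OF _ theta_transform_weil_matrix[OF assms(1)] assms(2)] assms(1) by (auto simp: weil_op_def fun_eq_iff intro!: sum.cong)

lemma weil_op_group_algebra: "weil_op M U \<in> group_algebra L"
  by (simp add: weil_op_def group_algebra_def)

lemma weil_op_one: "U \<in> group_algebra L \<Longrightarrow> weil_op mp2_one U = U"
  using weil_op_theta_transform[OF _ theta_transform_one] monoid.one_closed[OF group.is_monoid[OF group_Mp2Z]]
  by (auto simp: fun_eq_iff sum_single_coeff[OF finite_disc] group_algebra_def)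

lemma weil_op_T: "\<gamma> \<in> disc L \<Longrightarrow> weil_op (mp2_T n) U \<gamma> = ee (of_real (qform L (rep \<gamma>)) / 2) powi n * U \<gamma>"
  by (simp add: weil_op_theta_transform[OF mp2_T_closed theta_transform_T] sum_single_coeff[OF finite_disc])

lemma weil_op_S: "\<gamma> \<in> disc L \<Longrightarrow> weil_op gen_S U \<gamma> = weil_const * (\<Sum>\<delta>\<in>disc L. ee (- of_real (bform L (rep \<gamma>) (rep \<delta>))) * U \<delta>)"
  by (simp add: weil_op_theta_transform[OF gen_S_closed theta_transform_S] sum_distrib_left mult_ac)

lemma weil_op_mult:
  assumes "M \<in> carrier Mp2Z" "K \<in> carrier Mp2Z"
  shows "weil_op (mp2_mult M K) U = weil_op M (weil_op K U)"
proof -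
  have "mp2_mult M K \<in> carrier Mp2Z"
    using monoid.m_closed[OF group.is_monoid[OF group_Mp2Z] assms] by simp
  moreover have "theta_transform (mp2_mult M K) (\<lambda>\<gamma> \<epsilon>. \<Sum>\<delta>\<in>disc L. weil_matrix M \<gamma> \<delta> * weil_matrix K \<delta> \<epsilon>)"
    using assms by (intro theta_transform_mult theta_transform_weil_matrix) auto
  ultimately have "weil_op (mp2_mult M K) U = (\<lambda>\<gamma>. if \<gamma> \<in> disc L then \<Sum>\<epsilon>\<in>disc L. (\<Sum>\<delta>\<in>disc L. weil_matrix M \<gamma> \<delta> * weil_matrix K \<delta> \<epsilon>) * U \<epsilon> else 0)"
    by (rule weil_op_theta_transform)
  moreover have "(\<Sum>\<epsilon>\<in>disc L. (\<Sum>\<delta>\<in>disc L. weil_matrix M \<gamma> \<delta> * weil_matrix K \<delta> \<epsilon>) * U \<epsilon>) = (\<Sum>\<delta>\<in>disc L. weil_matrix M \<gamma> \<delta> * (\<Sum>\<epsilon>\<in>disc L. weil_matrix K \<delta> \<epsilon> * U \<epsilon>))" for \<gamma>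
    by (simp add: sum_distrib_left sum_distrib_right mult.assoc) (rule sum.swap)
  ultimately show ?thesis by (auto simp: weil_op_def fun_eq_iff intro!: sum.cong)
qed

lemma representation_weil_op: "representation_on Mp2Z (group_algebra L) weil_op"
  unfolding representation_on_def
proof (intro conjI ballI allI)
  show "weil_op g (U + W) = weil_op g U + weil_op g W" for g U W
    by (auto simp: weil_op_def fun_eq_iff distrib_left sum.distrib)
  show "weil_op g (vscale c U) = vscale c (weil_op g U)" for g c U
    by (auto simp: weil_op_def fun_eq_iff vscale_def sum_distrib_left mult_ac)
qed (simp_all add: weil_op_group_algebra weil_op_one weil_op_mult)

lemma is_weil_rep_weil_op: "is_weil_rep L weil_op"
  unfolding is_weil_rep_def
proof (rule conjI[OF representation_weil_op], intro conjI ballI)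
  fix \<gamma> assume \<gamma>: "\<gamma> \<in> disc L"
  show "weil_op gen_T (basis_vec \<gamma>) = vscale (ee (of_real (qform L (rep \<gamma>)) / 2)) (basis_vec \<gamma>)"
  proof (rule ext)
    show "weil_op gen_T (basis_vec \<gamma>) \<delta> = vscale (ee (of_real (qform L (rep \<gamma>)) / 2)) (basis_vec \<gamma>) \<delta>" for \<delta>
    proof (cases "\<delta> \<in> disc L")
      case True
      then show ?thesis using weil_op_T[of \<delta> 1 "basis_vec \<gamma>"] by (auto simp: gen_T_eq vscale_def basis_vec_def)
    next
      case False
      then show ?thesis using \<gamma> by (auto simp: weil_op_def vscale_def basis_vec_def)
    qed
  qed
  show "weil_op gen_S (basis_vec \<gamma>) = vscale (ee ((of_nat (snd (signature L)) - of_nat (fst (signature L))) / 8)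
                / of_real (sqrt (real (card (disc L)))))
          (\<Sum>\<delta>\<in>disc L. vscale (ee (- of_real (bform L (rep \<gamma>) (rep \<delta>)))) (basis_vec \<delta>))" (is "_ = vscale _ ?s")
  proof (rule ext)
    fix \<delta>
    have s: "?s \<delta> = (if \<delta> \<in> disc L then ee (- of_real (bform L (rep \<gamma>) (rep \<delta>))) else 0)"
    proof -
      have "?s \<delta> = (\<Sum>\<epsilon>\<in>disc L. if \<delta> = \<epsilon> then ee (- of_real (bform L (rep \<gamma>) (rep \<delta>))) else 0)"
        unfolding sum_apply by (intro sum.cong refl) (auto simp: vscale_def basis_vec_def)
      then show ?thesis using finite_disc by (simp add: sum.delta')
    qed
    have w: "(\<Sum>\<epsilon>\<in>disc L. ee (- of_real (bform L (rep \<delta>) (rep \<epsilon>))) * basis_vec \<gamma> \<epsilon>) = ee (- of_real (bform L (rep \<delta>) (rep \<gamma>)))"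
    proof -
      have "(\<Sum>\<epsilon>\<in>disc L. ee (- of_real (bform L (rep \<delta>) (rep \<epsilon>))) * basis_vec \<gamma> \<epsilon>)
          = (\<Sum>\<epsilon>\<in>disc L. if \<gamma> = \<epsilon> then ee (- of_real (bform L (rep \<delta>) (rep \<gamma>))) else 0)"
        by (intro sum.cong refl) (auto simp: basis_vec_def)
      then show ?thesis using finite_disc \<gamma> by (simp add: sum.delta')
    qed
    show "weil_op gen_S (basis_vec \<gamma>) \<delta> = vscale (ee ((of_nat (snd (signature L)) - of_nat (fst (signature L))) / 8)
                / of_real (sqrt (real (card (disc L))))) ?s \<delta>"
    proof (cases "\<delta> \<in> disc L")
      case True
      then show ?thesis unfolding weil_op_S[OF True] w unfolding vscale_def[of _ ?s] s signature_eq weil_const_def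
        using True sym[of "rep \<gamma>" "rep \<delta>"] by simp
    next
      case False
      then show ?thesis unfolding vscale_def[of _ ?s] s by (simp add: weil_op_def)
    qed
  qed
qed

text \<open>Only \<open>gen_T\<close> has a prescribed value. Since its eigenvalues are nonzero, the
  relation between consecutive powers reaches the negative ones as well.\<close>

lemma weil_rep_T:
  assumes \<rho>: "is_weil_rep L \<rho>" and U: "U \<in> group_algebra L" and \<gamma>: "\<gamma> \<in> disc L"
  shows "\<rho> (mp2_T n) U \<gamma> = ee (of_real (qform L (rep \<gamma>)) / 2) powi n * U \<gamma>"
proof -
  let ?e = "ee (of_real (qform L (rep \<gamma>)) / 2)"
  have rep\<rho>: "representation_on Mp2Z (group_algebra L) \<rho>" using \<rho> by (simp add: is_weil_rep_def)
  have cl: "\<rho> M W \<in> group_algebra L" if "M \<in> carrier Mp2Z" "W \<in> group_algebra L" for M W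
    by (rule representation_onD(1)[OF rep\<rho> that])
  have T1: "\<rho> (mp2_T 1) W \<gamma> = ?e * W \<gamma>" if W: "W \<in> group_algebra L" for W
  proof -
    have "\<rho> (mp2_T 1) W = (\<Sum>\<delta>\<in>disc L. vscale (W \<delta>) (\<rho> (mp2_T 1) (basis_vec \<delta>)))"
      by (subst group_algebra_expansion[OF finite_disc W])
        (intro representation_sum[OF rep\<rho> mp2_T_closed finite_disc] basis_vec_group_algebra)
    then have "\<rho> (mp2_T 1) W \<gamma> = (\<Sum>\<delta>\<in>disc L. W \<delta> * \<rho> (mp2_T 1) (basis_vec \<delta>) \<gamma>)"
      by (simp add: sum_apply vscale_def)
    also have "\<dots> = (\<Sum>\<delta>\<in>disc L. (if \<gamma> = \<delta> then ?e else 0) * W \<delta>)"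
      using \<rho> by (intro sum.cong refl) (auto simp: is_weil_rep_def gen_T_eq[symmetric] vscale_def basis_vec_def)
    finally show ?thesis unfolding sum_single_coeff[OF finite_disc \<gamma>] .
  qed
  have step: "\<rho> (mp2_T (m + 1)) U \<gamma> = ?e * \<rho> (mp2_T m) U \<gamma>" for m
  proof -
    have "mobius (fst (mp2_T m)) \<tau> \<in> UH \<longleftrightarrow> \<tau> \<in> UH" for \<tau>
      unfolding mobius_T by (simp add: upper_half_plane_iff)
    then have "mp2_T (m + 1) = mp2_mult (mp2_T 1) (mp2_T m)"
      by (auto simp: mp2_mult_def mp2_T_def mat2_eq_iff mat2_mult_nth fun_eq_iff)
    moreover have "\<rho> (mp2_mult (mp2_T 1) (mp2_T m)) U = \<rho> (mp2_T 1) (\<rho> (mp2_T m) U)"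
      using representation_onD(5)[OF rep\<rho> mp2_T_closed mp2_T_closed U] by simp
    ultimately show ?thesis using T1[OF cl[OF mp2_T_closed U]] by simp
  qed
  show ?thesis
  proof (induction n rule: int_induct[of _ 0])
    case base
    have "mp2_T 0 = \<one>\<^bsub>Mp2Z\<^esub>" by (simp add: mp2_one_def mp2_T_def mat2_eq_iff)
    moreover have "\<rho> \<one>\<^bsub>Mp2Z\<^esub> U = U" by (rule representation_onD(4)[OF rep\<rho> U])
    ultimately show ?case by simp
  next
    case (step1 i)
    then show ?case unfolding step by (simp add: power_int_add ee_nonzero)
  next
    case (step2 i)
    then show ?case using step[of "i - 1"] by (simp add: power_int_diff ee_nonzero field_simps)
  qed
qed

text \<open>Both sides are multiplicative and agree on \<open>mp2_T n\<close> and, by linearity from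
  basis vectors, on \<open>gen_S\<close>. So whatever map \<open>weil_rep\<close> chooses, it is
  \<open>weil_op\<close> where it matters.\<close>

lemma weil_rep_unique:
  assumes \<rho>: "is_weil_rep L \<rho>" and M: "M \<in> carrier Mp2Z"
  shows "U \<in> group_algebra L \<Longrightarrow> \<rho> M U = weil_op M U"
  using M
proof (induction M arbitrary: U rule: Mp2Z_induct)
  have rep\<rho>: "representation_on Mp2Z (group_algebra L) \<rho>" using \<rho> by (simp add: is_weil_rep_def)
  have mult: "\<rho> (mp2_mult M K) U = \<rho> M (\<rho> K U)" if "M \<in> carrier Mp2Z" "K \<in> carrier Mp2Z" "U \<in> group_algebra L" for M K U
    using representation_onD(5)[OF rep\<rho> that] by simp
  {
    case one
    then show ?case using representation_onD(4)[OF rep\<rho>] weil_op_one by simp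
  next
    case (T n M)
    have "\<rho> (mp2_T n) W = weil_op (mp2_T n) W" if W: "W \<in> group_algebra L" for W
    proof (rule ext)
      fix \<gamma> show "\<rho> (mp2_T n) W \<gamma> = weil_op (mp2_T n) W \<gamma>"
      proof (cases "\<gamma> \<in> disc L")
        case True
        then show ?thesis by (simp add: weil_rep_T[OF \<rho> W] weil_op_T)
      next
        case False
        have "\<rho> (mp2_T n) W \<in> group_algebra L" by (rule representation_onD(1)[OF rep\<rho> mp2_T_closed W])
        then show ?thesis using False weil_op_group_algebra[of "mp2_T n" W] by (simp add: group_algebra_def)
      qed
    qed
    then show ?case using T by (simp only: mult weil_op_mult mp2_T_closed weil_op_group_algebra)
  next
    case (S M)
    have "\<rho> gen_S W = weil_op gen_S W" if W: "W \<in> group_algebra L" for W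
    proof -
      have "\<rho> gen_S (basis_vec \<delta>) = weil_op gen_S (basis_vec \<delta>)" if "\<delta> \<in> disc L" for \<delta>
        using \<rho> is_weil_rep_weil_op that unfolding is_weil_rep_def by simp
      moreover have "\<rho> gen_S W = (\<Sum>\<delta>\<in>disc L. vscale (W \<delta>) (\<rho> gen_S (basis_vec \<delta>)))"
        by (subst group_algebra_expansion[OF finite_disc W])
          (intro representation_sum[OF rep\<rho> gen_S_closed finite_disc] basis_vec_group_algebra)
      moreover have "weil_op gen_S W = (\<Sum>\<delta>\<in>disc L. vscale (W \<delta>) (weil_op gen_S (basis_vec \<delta>)))"
        by (subst group_algebra_expansion[OF finite_disc W])
          (intro representation_sum[OF representation_weil_op gen_S_closed finite_disc] basis_vec_group_algebra)
      ultimately show ?thesis by simp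
    qed
    then show ?case using S by (simp only: mult weil_op_mult gen_S_closed weil_op_group_algebra)
  }
qed

theorem weil_rep_weil_op: "M \<in> carrier Mp2Z \<Longrightarrow> U \<in> group_algebra L \<Longrightarrow> weil_rep L M U = weil_op M U"
  unfolding weil_rep_def by (rule weil_rep_unique[OF someI[of "is_weil_rep L", OF is_weil_rep_weil_op]])

theorem th_transform:
  assumes "M \<in> carrier Mp2Z" "\<tau> \<in> UH" "\<gamma> \<in> disc L"
  shows "th \<gamma> (mobius (fst M) \<tau>) (jacobi_act M \<tau> \<zeta>) = jacobi_factor M \<tau> \<zeta> * weil_op M (\<lambda>\<delta>. th \<delta> \<tau> \<zeta>) \<gamma>"
  using theta_transformD[OF theta_transform_weil_matrix[OF assms(1)] assms(2,3)] assms(3) by (simp add: weil_op_def)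

lemma weil_op_S_tilde_S: "U \<in> group_algebra L \<Longrightarrow> weil_op gen_S (weil_op (mp2_tilde gen_S) U) = U"
  using weil_op_mult[OF gen_S_closed mp2_tilde_closed[OF gen_S_closed], of U] weil_op_one by (simp add: mp2_tilde_S)

text \<open>For \<open>T\<close> the eigenvalues of the two factors are reciprocal. For
  \<open>S\<close> the matrix is symmetric, so it moves to the other argument, where it cancels its
  inverse \<open>mp2_tilde gen_S\<close>.\<close>

lemma weil_op_pairing:
  assumes M: "M \<in> carrier Mp2Z"
  shows "U \<in> group_algebra L \<Longrightarrow> W \<in> group_algebra L \<Longrightarrow> pairing L (weil_op M U) (weil_op (mp2_tilde M) W) = pairing L U W"
  using M
proof (induction M rule: Mp2Z_induct)
  case one
  then show ?case by (simp add: mp2_tilde_one weil_op_one)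
next
  case (T n M)
  have "weil_op (mp2_T n) U' \<gamma> * weil_op (mp2_T (- n)) W' \<gamma> = U' \<gamma> * W' \<gamma>" if "\<gamma> \<in> disc L" for U' W' \<gamma>
    by (simp add: weil_op_T[OF that] power_int_minus ee_nonzero field_simps)
  then have "pairing L (weil_op (mp2_T n) U') (weil_op (mp2_T (- n)) W') = pairing L U' W'" for U' W'
    unfolding pairing_def by (intro sum.cong refl)
  then show ?case using T
    by (simp only: mp2_tilde_mult mp2_tilde_T weil_op_mult[OF mp2_T_closed T(1)] weil_op_mult[OF mp2_T_closed mp2_tilde_closed[OF T(1)]])
next
  case (S M)
  have "pairing L (weil_op gen_S U') (weil_op (mp2_tilde gen_S) W') = pairing L U' W'" if W': "W' \<in> group_algebra L" for U' W'
  proof -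
    let ?V = "weil_op (mp2_tilde gen_S) W'"
    have "pairing L (weil_op gen_S U') ?V = (\<Sum>\<gamma>\<in>disc L. \<Sum>\<delta>\<in>disc L. weil_const * ee (- of_real (bform L (rep \<gamma>) (rep \<delta>))) * U' \<delta> * ?V \<gamma>)"
      unfolding pairing_def by (intro sum.cong refl) (simp add: weil_op_S sum_distrib_left sum_distrib_right mult_ac)
    also have "\<dots> = (\<Sum>\<delta>\<in>disc L. \<Sum>\<gamma>\<in>disc L. weil_const * ee (- of_real (bform L (rep \<gamma>) (rep \<delta>))) * U' \<delta> * ?V \<gamma>)"
      by (rule sum.swap)
    also have "\<dots> = (\<Sum>\<delta>\<in>disc L. U' \<delta> * weil_op gen_S ?V \<delta>)"
      by (intro sum.cong refl) (simp add: weil_op_S sum_distrib_left mult_ac sym)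
    finally show ?thesis unfolding weil_op_S_tilde_S[OF W'] pairing_def .
  qed
  then show ?case using S
    by (simp only: mp2_tilde_mult weil_op_mult[OF gen_S_closed S(1)]
        weil_op_mult[OF mp2_tilde_closed[OF gen_S_closed] mp2_tilde_closed[OF S(1)]] weil_op_group_algebra)
qed

lemma bform_rep_diff:
  assumes "\<gamma> \<in> disc L" "\<epsilon> \<in> disc L" "\<delta> \<in> disc L"
  shows "ee (of_real (bform L (rep \<delta>) (rep \<gamma>))) * ee (- of_real (bform L (rep \<delta>) (rep \<epsilon>)))
    = ee (of_real (bform L (rep \<delta>) (rep (cls (rep \<gamma> - rep \<epsilon>)))))"
proof -
  have "ee (of_real (bform L (rep \<delta>) (rep (cls (rep \<gamma> - rep \<epsilon>))))) = ee (of_real (bform L (rep \<delta>) (rep \<gamma> - rep \<epsilon>)))"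
    using assms by (intro bform_rep_cls rep_Ld Ld_diff)
  then show ?thesis by (simp add: bf_simps ee_add[symmetric])
qed

lemma character_orthogonality:
  assumes \<gamma>: "\<gamma> \<in> disc L" and \<epsilon>: "\<epsilon> \<in> disc L"
  shows "(\<Sum>\<delta>\<in>disc L. ee (of_real (bform L (rep \<delta>) (rep \<gamma>))) * ee (- of_real (bform L (rep \<delta>) (rep \<epsilon>))))
    = (if \<gamma> = \<epsilon> then of_nat (card (disc L)) else 0)"
proof -
  have "(\<Sum>\<delta>\<in>disc L. ee (of_real (bform L (rep \<delta>) (rep \<gamma>))) * ee (- of_real (bform L (rep \<delta>) (rep \<epsilon>))))
      = (\<Sum>\<delta>\<in>disc L. ee (of_real (bform L (rep \<delta>) (rep (cls (rep \<gamma> - rep \<epsilon>))))))"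
    by (simp add: bform_rep_diff[OF \<gamma> \<epsilon>])
  also have "\<dots> = (if cls (rep \<gamma> - rep \<epsilon>) = cls 0 then of_nat (card (disc L)) else 0)"
    using \<gamma> \<epsilon> by (subst character_sum) (auto intro!: cls_disc Ld_diff rep_Ld)
  also have "cls (rep \<gamma> - rep \<epsilon>) = cls 0 \<longleftrightarrow> \<gamma> = \<epsilon>"
    using cls_eq_iff[OF Ld_diff[OF rep_Ld[OF \<gamma>] rep_Ld[OF \<epsilon>]] Ld_0] cls_eq_iff[OF rep_Ld[OF \<gamma>] rep_Ld[OF \<epsilon>]]
    by (auto simp: cls_rep[OF \<gamma>] cls_rep[OF \<epsilon>])
  finally show ?thesis .
qed

section \<open>The dual representation as a twist by the involution\<close>

lemma card_Ep_neg: "card (lat_gr.Ep (neg_lattice L) (prod.swap v)) = card Em"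
  "card (lat_gr.Em (neg_lattice L) (prod.swap v)) = card Ep"
proof -
  interpret M: lat_gr "neg_lattice L" b "prod.swap v" by (rule lat_gr_neg)
  have "neg_lattice (neg_lattice L) = L" by (simp add: neg_lattice_def)
  then show "card M.Ep = card Em" "card M.Em = card Ep" by (simp_all add: M.Ep_def M.Em_def Ep_def Em_def)
qed

text \<open>The prescribed values for the negated lattice are checked on generators: inverting
  \<open>gen_T\<close> inverts its eigenvalues, and for \<open>gen_S\<close> the prescribed value
  \<open>W\<close> is verified by applying \<open>gen_S\<close> to it, which avoids inverting the
  matrix.\<close>

lemma is_weil_rep_dual: "is_weil_rep (neg_lattice L) (\<lambda>M. weil_op (mp2_tilde M))"
  unfolding is_weil_rep_def neg_lattice_simps
proof (intro conjI ballI)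
  interpret M: lat_gr "neg_lattice L" b "prod.swap v" by (rule lat_gr_neg)
  have q: "qform (neg_lattice L) x = - qform L x" for x by (simp add: neg_lattice_def)
  show "representation_on Mp2Z (group_algebra L) (\<lambda>M. weil_op (mp2_tilde M))"
    using representation_weil_op unfolding representation_on_def
    by (auto simp: mp2_tilde_closed mp2_tilde_mult weil_op_mult mp2_tilde_one simp del: Mp2Z_simps(1))
  fix \<gamma> assume \<gamma>: "\<gamma> \<in> disc L"
  show "weil_op (mp2_tilde gen_T) (basis_vec \<gamma>) = vscale (ee (of_real (qform (neg_lattice L) (rep \<gamma>)) / 2)) (basis_vec \<gamma>)"
  proof (rule ext)
    show "weil_op (mp2_tilde gen_T) (basis_vec \<gamma>) \<delta> = vscale (ee (of_real (qform (neg_lattice L) (rep \<gamma>)) / 2)) (basis_vec \<gamma>) \<delta>" for \<delta>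
    proof (cases "\<delta> \<in> disc L")
      case True
      then show ?thesis
        using weil_op_T[of \<delta> "-1" "basis_vec \<gamma>"] unfolding q
        by (auto simp: gen_T_eq mp2_tilde_T vscale_def basis_vec_def power_int_minus ee_minus inverse_eq_divide)
    next
      case False
      then show ?thesis using \<gamma> by (auto simp: weil_op_def vscale_def basis_vec_def)
    qed
  qed
  define k where "k = ee ((of_nat (snd (signature (neg_lattice L))) - of_nat (fst (signature (neg_lattice L)))) / 8)
                / of_real (sqrt (real (card (disc L))))"
  define W where "W = vscale k (\<Sum>\<delta>\<in>disc L. vscale (ee (- of_real (bform (neg_lattice L) (rep \<gamma>) (rep \<delta>)))) (basis_vec \<delta>))"
  have Wg: "W \<in> group_algebra L" unfolding W_def
    by (intro vscale_group_algebra group_algebra_sum finite_disc basis_vec_group_algebra)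
  have W: "W \<delta> = k * ee (of_real (bform L (rep \<gamma>) (rep \<delta>)))" if "\<delta> \<in> disc L" for \<delta>
  proof -
    have "(\<Sum>\<epsilon>\<in>disc L. vscale (ee (- of_real (bform (neg_lattice L) (rep \<gamma>) (rep \<epsilon>)))) (basis_vec \<epsilon>)) \<delta>
        = (\<Sum>\<epsilon>\<in>disc L. if \<delta> = \<epsilon> then ee (of_real (bform L (rep \<gamma>) (rep \<delta>))) else 0)"
      unfolding sum_apply by (intro sum.cong refl) (auto simp: vscale_def basis_vec_def neg_lattice_def)
    then show ?thesis unfolding W_def vscale_def[of k] using finite_disc that by (simp add: sum.delta')
  qed
  \<comment> \<open>Swapping the signature inverts the eighth root of unity, so the two roots
    cancel, and the two square roots combine to the order of the discriminant group.\<close>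
  have kk: "weil_const * k * of_nat (card (disc L)) = 1"
  proof -
    have s: "of_real (sqrt (card (disc L))) * of_real (sqrt (card (disc L))) = (of_nat (card (disc L)) :: complex)"
      by (simp flip: of_real_mult)
    have "of_nat (card (disc L)) \<noteq> (0::complex)" using card_disc_pos by simp
    moreover have "weil_const * k = 1 / of_nat (card (disc L))"
      unfolding weil_const_def k_def M.signature_eq s[symmetric] card_Ep_neg fst_conv snd_conv
      by (simp add: ee_add[symmetric] ee_0 diff_divide_distrib)
    ultimately show ?thesis by simp
  qed
  have "weil_op gen_S W = basis_vec \<gamma>"
  proof (rule ext)
    fix \<epsilon> show "weil_op gen_S W \<epsilon> = basis_vec \<gamma> \<epsilon>"
    proof (cases "\<epsilon> \<in> disc L")
      case \<epsilon>: True
      have "weil_op gen_S W \<epsilon> = weil_const * (\<Sum>\<delta>\<in>disc L. k * (ee (of_real (bform L (rep \<delta>) (rep \<gamma>))) * ee (- of_real (bform L (rep \<delta>) (rep \<epsilon>)))))"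
        unfolding weil_op_S[OF \<epsilon>] by (intro arg_cong[where f = "(*) weil_const"] sum.cong refl) (simp add: W sym mult_ac)
      also have "\<dots> = (if \<gamma> = \<epsilon> then 1 else 0)"
        unfolding sum_distrib_left[symmetric] character_orthogonality[OF \<gamma> \<epsilon>] using kk by (simp add: mult.assoc)
      finally show ?thesis by (auto simp: basis_vec_def)
    next
      case False
      then show ?thesis using \<gamma> by (auto simp: weil_op_def basis_vec_def)
    qed
  qed
  moreover have "weil_op (mp2_tilde gen_S) (weil_op gen_S W) = W"
  proof -
    have "mp2_mult (mp2_tilde gen_S) gen_S = mp2_one"
      using arg_cong[OF mp2_tilde_S, of mp2_tilde] by (simp add: mp2_tilde_mult mp2_tilde_tilde mp2_tilde_one)
    then show ?thesis using weil_op_mult[OF mp2_tilde_closed[OF gen_S_closed] gen_S_closed, of W] weil_op_one[OF Wg] by simp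
  qed
  ultimately show "weil_op (mp2_tilde gen_S) (basis_vec \<gamma>) = vscale (ee ((of_nat (snd (signature (neg_lattice L))) - of_nat (fst (signature (neg_lattice L)))) / 8)
                / of_real (sqrt (real (card (disc L))))) (\<Sum>\<delta>\<in>disc L. vscale (ee (- of_real (bform (neg_lattice L) (rep \<gamma>) (rep \<delta>)))) (basis_vec \<delta>))"
    unfolding W_def k_def by simp
qed

theorem weil_rep_dual_weil_op:
  assumes "M \<in> carrier Mp2Z" "U \<in> group_algebra L"
  shows "weil_rep_dual L M U = weil_op (mp2_tilde M) U"
proof -
  interpret M: lat_gr "neg_lattice L" b "prod.swap v" by (rule lat_gr_neg)
  show ?thesis
    using M.weil_rep_weil_op[OF assms(1), of U] M.weil_rep_unique[OF is_weil_rep_dual assms(1), of U] assms(2)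
    by (simp add: weil_rep_dual_def)
qed

end

section \<open>Modular forms and the involution\<close>

lemma module_fscale: "module fscale"
  by standard (auto simp: fscale_def fun_eq_iff algebra_simps)

text \<open>Weights enter through the floor of their double; subtracting half a dimension shifts
  that floor by exactly an integer.\<close>

lemma floor_weight: "\<lfloor>2 * (x - real n / 2)\<rfloor> = \<lfloor>2 * x\<rfloor> - int n"
proof -
  have "2 * (x - real n / 2) = 2 * x - of_int (int n)" by simp
  then show ?thesis by (simp only: floor_diff_of_int)
qed

lemma modular_formsD:
  assumes "F \<in> modular_forms V \<rho> p q \<Gamma>"
  shows "F \<tau> \<in> V" "\<tau> \<notin> upper_half_plane \<Longrightarrow> F \<tau> = 0" "smooth_on upper_half_plane (\<lambda>\<tau>. F \<tau> i)"
    "\<tau> \<in> upper_half_plane \<Longrightarrow> M \<in> \<Gamma> \<Longrightarrow>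
      F (mobius (fst M) \<tau>) = vscale (snd M \<tau> powi \<lfloor>2 * p\<rfloor> * cnj (snd M \<tau>) powi \<lfloor>2 * q\<rfloor>) (\<rho> M (F \<tau>))"
    "lin_exp_growth (\<lambda>\<tau>. F \<tau> i)"
proof -
  note * = assms[unfolded modular_forms_def mem_Collect_eq]
  show "F \<tau> \<in> V" using * by blast
  show "F \<tau> = 0" if "\<tau> \<notin> upper_half_plane" using * that by (elim conjE) (drule spec, erule (1) mp)
  show "smooth_on upper_half_plane (\<lambda>\<tau>. F \<tau> i)" "lin_exp_growth (\<lambda>\<tau>. F \<tau> i)" using * by blast+
  assume \<tau>: "\<tau> \<in> upper_half_plane" and M: "M \<in> \<Gamma>"
  have "\<forall>\<tau>\<in>upper_half_plane. \<forall>(A, \<phi>)\<in>\<Gamma>. F (mobius A \<tau>) =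
          vscale ((\<phi> \<tau>) powi \<lfloor>2 * p\<rfloor> * (cnj (\<phi> \<tau>)) powi \<lfloor>2 * q\<rfloor>) (\<rho> (A, \<phi>) (F \<tau>))" using * by blast
  from bspec[OF bspec[OF this \<tau>] M]
  show "F (mobius (fst M) \<tau>) = vscale (snd M \<tau> powi \<lfloor>2 * p\<rfloor> * cnj (snd M \<tau>) powi \<lfloor>2 * q\<rfloor>) (\<rho> M (F \<tau>))"
    by (simp add: case_prod_unfold)
qed

lemma modular_formsI:
  assumes "\<And>\<tau>. F \<tau> \<in> V" "\<And>\<tau>. \<tau> \<notin> upper_half_plane \<Longrightarrow> F \<tau> = 0" "\<And>i. smooth_on upper_half_plane (\<lambda>\<tau>. F \<tau> i)"
    and "\<And>\<tau> M. \<tau> \<in> upper_half_plane \<Longrightarrow> M \<in> \<Gamma> \<Longrightarrow>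
      F (mobius (fst M) \<tau>) = vscale (snd M \<tau> powi \<lfloor>2 * p\<rfloor> * cnj (snd M \<tau>) powi \<lfloor>2 * q\<rfloor>) (\<rho> M (F \<tau>))"
    and "\<And>i. lin_exp_growth (\<lambda>\<tau>. F \<tau> i)"
  shows "F \<in> modular_forms V \<rho> p q \<Gamma>"
  unfolding modular_forms_def mem_Collect_eq case_prod_unfold prod.collapse
  by (intro conjI allI ballI impI assms)

section \<open>Stability of smoothness, growth and modularity\<close>

lemma smooth_on_add: "open S \<Longrightarrow> smooth_on S f \<Longrightarrow> smooth_on S g \<Longrightarrow> smooth_on S (\<lambda>x. f x + g x)"
  unfolding smooth_on_def by (intro allI Ck_on_add) auto

lemma smooth_on_cmult:
  fixes f :: "'a::real_normed_vector \<Rightarrow> complex"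
  shows "open S \<Longrightarrow> smooth_on S f \<Longrightarrow> smooth_on S (\<lambda>x. c * f x)"
  unfolding smooth_on_def by (intro allI Ck_on_mult Ck_on_const) auto

lemma smooth_on_const: "open S \<Longrightarrow> smooth_on S (\<lambda>x. c)"
  unfolding smooth_on_def by (intro allI Ck_on_const)

lemma lin_exp_growthD:
  assumes "lin_exp_growth f" "A \<in> SL2Z"
  obtains C where "\<And>X. bounded X \<Longrightarrow> \<exists>K Y. \<forall>x\<in>X. \<forall>y. y > 0 \<and> y \<ge> Y \<longrightarrow> cmod (f (mobius A (Complex x y))) \<le> K * exp (C * y)"
  using assms unfolding lin_exp_growth_def by blast

lemma lin_exp_growth_const: "lin_exp_growth (\<lambda>\<tau>. c)"
  unfolding lin_exp_growth_def by (rule ballI, rule exI[of _ 0], intro allI impI, rule exI[of _ "cmod c"]) simp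

lemma lin_exp_growth_cmult:
  assumes "lin_exp_growth f"
  shows "lin_exp_growth (\<lambda>\<tau>. c * f \<tau>)"
  unfolding lin_exp_growth_def
proof
  fix A assume "A \<in> SL2Z"
  from lin_exp_growthD[OF assms this] obtain C where C: "\<And>X. bounded X \<Longrightarrow> \<exists>K Y. \<forall>x\<in>X. \<forall>y. y > 0 \<and> y \<ge> Y \<longrightarrow> cmod (f (mobius A (Complex x y))) \<le> K * exp (C * y)" by blast
  show "\<exists>C. \<forall>X. bounded X \<longrightarrow> (\<exists>K Y. \<forall>x\<in>X. \<forall>y. y > 0 \<and> y \<ge> Y \<longrightarrow> cmod (c * f (mobius A (Complex x y))) \<le> K * exp (C * y))"
  proof (rule exI[of _ C], intro allI impI)
    fix X :: "real set" assume "bounded X"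
    from C[OF this] obtain K Y where KY: "\<And>x y. x \<in> X \<Longrightarrow> y > 0 \<Longrightarrow> y \<ge> Y \<Longrightarrow> cmod (f (mobius A (Complex x y))) \<le> K * exp (C * y)" by blast
    show "\<exists>K Y. \<forall>x\<in>X. \<forall>y. y > 0 \<and> y \<ge> Y \<longrightarrow> cmod (c * f (mobius A (Complex x y))) \<le> K * exp (C * y)"
    proof (rule exI[of _ "cmod c * K"], rule exI[of _ Y], intro ballI allI impI)
      fix x y assume "x \<in> X" "y > 0 \<and> y \<ge> Y"
      then have "cmod (f (mobius A (Complex x y))) \<le> K * exp (C * y)" using KY by blast
      from mult_left_mono[OF this, of "cmod c"]
      show "cmod (c * f (mobius A (Complex x y))) \<le> cmod c * K * exp (C * y)" by (simp add: norm_mult mult.assoc)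
    qed
  qed
qed

lemma lin_exp_growth_add:
  assumes f: "lin_exp_growth f" and g: "lin_exp_growth g"
  shows "lin_exp_growth (\<lambda>\<tau>. f \<tau> + g \<tau>)"
  unfolding lin_exp_growth_def
proof
  fix A assume A: "A \<in> SL2Z"
  obtain C where C: "\<And>X. bounded X \<Longrightarrow> \<exists>K Y. \<forall>x\<in>X. \<forall>y. y > 0 \<and> y \<ge> Y \<longrightarrow> cmod (f (mobius A (Complex x y))) \<le> K * exp (C * y)"
    using lin_exp_growthD[OF f A] by blast
  obtain D where D: "\<And>X. bounded X \<Longrightarrow> \<exists>K Y. \<forall>x\<in>X. \<forall>y. y > 0 \<and> y \<ge> Y \<longrightarrow> cmod (g (mobius A (Complex x y))) \<le> K * exp (D * y)"
    using lin_exp_growthD[OF g A] by blast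
  show "\<exists>C. \<forall>X. bounded X \<longrightarrow> (\<exists>K Y. \<forall>x\<in>X. \<forall>y. y > 0 \<and> y \<ge> Y \<longrightarrow> cmod (f (mobius A (Complex x y)) + g (mobius A (Complex x y))) \<le> K * exp (C * y))"
  proof (rule exI[of _ "max C D"], intro allI impI)
    fix X :: "real set" assume X: "bounded X"
    from C[OF X] obtain K Y where KY: "\<And>x y. x \<in> X \<Longrightarrow> y > 0 \<Longrightarrow> y \<ge> Y \<Longrightarrow> cmod (f (mobius A (Complex x y))) \<le> K * exp (C * y)" by blast
    from D[OF X] obtain K' Y' where KY': "\<And>x y. x \<in> X \<Longrightarrow> y > 0 \<Longrightarrow> y \<ge> Y' \<Longrightarrow> cmod (g (mobius A (Complex x y))) \<le> K' * exp (D * y)" by blast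
    show "\<exists>K Y. \<forall>x\<in>X. \<forall>y. y > 0 \<and> y \<ge> Y \<longrightarrow> cmod (f (mobius A (Complex x y)) + g (mobius A (Complex x y))) \<le> K * exp (max C D * y)"
    proof (rule exI[of _ "\<bar>K\<bar> + \<bar>K'\<bar>"], rule exI[of _ "max Y Y'"], intro ballI allI impI)
      fix x y assume x: "x \<in> X" and y: "y > 0 \<and> y \<ge> max Y Y'"
      have b: "k * exp (c * y) \<le> \<bar>k\<bar> * exp (max C D * y)" if "c = C \<or> c = D" for k c
        using that y by (intro mult_mono) auto
      have "cmod (f (mobius A (Complex x y)) + g (mobius A (Complex x y))) \<le> K * exp (C * y) + K' * exp (D * y)"
        using x y by (intro norm_triangle_le add_mono KY KY') auto
      also have "\<dots> \<le> \<bar>K\<bar> * exp (max C D * y) + \<bar>K'\<bar> * exp (max C D * y)" by (intro add_mono b) auto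
      finally show "cmod (f (mobius A (Complex x y)) + g (mobius A (Complex x y))) \<le> (\<bar>K\<bar> + \<bar>K'\<bar>) * exp (max C D * y)"
        by (simp add: distrib_right)
    qed
  qed
qed

lemma lin_exp_growth_cong:
  assumes "lin_exp_growth f" "\<And>\<tau>. \<tau> \<in> upper_half_plane \<Longrightarrow> g \<tau> = f \<tau>"
  shows "lin_exp_growth g"
proof -
  have "g (mobius A (Complex x y)) = f (mobius A (Complex x y))" if "A \<in> SL2Z" "y > 0" for A x y
    using that by (intro assms(2) mobius_in) (auto simp: SL2Z_def upper_half_plane_iff)
  then show ?thesis using assms(1) unfolding lin_exp_growth_def by simp
qed

text \<open>The reflected matrix is integral again, and a bounded set of real parts stays bounded
  under negation.\<close>

lemma lin_exp_growth_refl: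
  assumes "lin_exp_growth f"
  shows "lin_exp_growth (\<lambda>\<tau>. f (refl_pt \<tau>))"
  unfolding lin_exp_growth_def
proof
  fix A assume A: "A \<in> SL2Z"
  define B where "B = fst (mp2_tilde (A, \<lambda>_. 0))"
  have B: "B \<in> SL2Z" using A by (simp add: B_def mp2_tilde_def SL2Z_iff det_2)
  have eq: "refl_pt (mobius A (Complex x y)) = mobius B (Complex (- x) y)" for x y
  proof -
    have "refl_pt (Complex x y) = Complex (- x) y" by (simp add: refl_pt_def complex_eq_iff)
    then show ?thesis using mobius_tilde[of "(A, \<lambda>_. 0)" "Complex x y"] by (simp add: B_def)
  qed
  from lin_exp_growthD[OF assms B] obtain C where C: "\<And>X. bounded X \<Longrightarrow> \<exists>K Y. \<forall>x\<in>X. \<forall>y. y > 0 \<and> y \<ge> Y \<longrightarrow> cmod (f (mobius B (Complex x y))) \<le> K * exp (C * y)" by blast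
  show "\<exists>C. \<forall>X. bounded X \<longrightarrow> (\<exists>K Y. \<forall>x\<in>X. \<forall>y. y > 0 \<and> y \<ge> Y \<longrightarrow> cmod (f (refl_pt (mobius A (Complex x y)))) \<le> K * exp (C * y))"
  proof (rule exI[of _ C], intro allI impI)
    fix X :: "real set" assume "bounded X"
    then have "bounded (uminus ` X)" by simp
    from C[OF this] show "\<exists>K Y. \<forall>x\<in>X. \<forall>y. y > 0 \<and> y \<ge> Y \<longrightarrow> cmod (f (refl_pt (mobius A (Complex x y)))) \<le> K * exp (C * y)"
      unfolding eq by simp
  qed
qed

lemma bounded_linear_refl_pt: "bounded_linear refl_pt"
  unfolding refl_pt_def[abs_def] by (intro bounded_linear_minus bounded_linear_cnj)

lemma smooth_on_refl:
  assumes "smooth_on upper_half_plane f"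
  shows "smooth_on upper_half_plane (\<lambda>\<tau>. f (refl_pt \<tau>))"
  unfolding smooth_on_def
proof
  fix n
  have "Ck_on n upper_half_plane (\<lambda>\<tau>. f (0 + refl_pt \<tau>))"
    by (rule Ck_on_compose_affine[OF open_upper_half_plane open_upper_half_plane bounded_linear_refl_pt])
       (simp, use assms[unfolded smooth_on_def] in \<open>rule spec\<close>)
  then show "Ck_on n upper_half_plane (\<lambda>\<tau>. f (refl_pt \<tau>))" by simp
qed

text \<open>Reflection intertwines \<open>M\<close> with \<open>mp2_tilde M\<close> and conjugates
  the root, so the two weights change places. With \<open>V\<close> and the representations
  arbitrary, it serves both the passage to the dual representation and the way back.\<close>

lemma modular_forms_refl:
  assumes F: "F \<in> modular_forms V \<rho> p q (mp2_tilde ` \<Gamma>)"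
    and \<rho>: "\<And>M U. M \<in> \<Gamma> \<Longrightarrow> U \<in> V \<Longrightarrow> \<rho>' M U = \<rho> (mp2_tilde M) U"
  shows "(\<lambda>\<tau>. F (refl_pt \<tau>)) \<in> modular_forms V \<rho>' q p \<Gamma>"
proof (rule modular_formsI)
  note F' = modular_formsD[OF F]
  fix \<tau> i M
  show "F (refl_pt \<tau>) \<in> V" by (rule F'(1))
  show "F (refl_pt \<tau>) = 0" if "\<tau> \<notin> upper_half_plane" using that by (intro F'(2)) simp
  show "smooth_on upper_half_plane (\<lambda>\<tau>. F (refl_pt \<tau>) i)" by (rule smooth_on_refl[OF F'(3)])
  show "lin_exp_growth (\<lambda>\<tau>. F (refl_pt \<tau>) i)" by (rule lin_exp_growth_refl[OF F'(5)])
  assume \<tau>: "\<tau> \<in> upper_half_plane" and M: "M \<in> \<Gamma>"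
  have "refl_pt \<tau> \<in> upper_half_plane" using \<tau> by simp
  from F'(4)[OF this imageI[OF M]]
  show "F (refl_pt (mobius (fst M) \<tau>)) =
      vscale (snd M \<tau> powi \<lfloor>2 * q\<rfloor> * cnj (snd M \<tau>) powi \<lfloor>2 * p\<rfloor>) (\<rho>' M (F (refl_pt \<tau>)))"
    unfolding mobius_tilde snd_mp2_tilde \<rho>[OF M F'(1)] by (simp add: mult.commute)
qed

lemma modular_forms_subspace:
  fixes V :: "('i \<Rightarrow> complex) set"
  assumes \<rho>: "representation_on G V \<rho>" and \<Gamma>: "\<Gamma> \<subseteq> carrier G"
    and V: "0 \<in> V" "\<And>U W. U \<in> V \<Longrightarrow> W \<in> V \<Longrightarrow> U + W \<in> V" "\<And>c U. U \<in> V \<Longrightarrow> vscale c U \<in> V"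
  shows "module.subspace fscale (modular_forms V \<rho> p q \<Gamma>)"
  unfolding module.subspace_def[OF module_fscale]
proof (intro conjI ballI allI)
  let ?M = "modular_forms V \<rho> p q \<Gamma>"
  have v0: "vscale 0 U = 0" "vscale c 0 = 0" for c and U :: "'i \<Rightarrow> complex"
    by (auto simp: vscale_def fun_eq_iff)
  have \<rho>0: "\<rho> M 0 = 0" if "M \<in> \<Gamma>" for M
    using representation_onD(3)[OF \<rho> subsetD[OF \<Gamma> that] V(1), of 0] unfolding v0 .
  show "0 \<in> ?M"
  proof (rule modular_formsI)
    show "(0 :: complex \<Rightarrow> 'i \<Rightarrow> complex) (mobius (fst M) \<tau>) =
      vscale (snd M \<tau> powi \<lfloor>2 * p\<rfloor> * cnj (snd M \<tau>) powi \<lfloor>2 * q\<rfloor>) (\<rho> M ((0 :: complex \<Rightarrow> 'i \<Rightarrow> complex) \<tau>))"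
      if "M \<in> \<Gamma>" for M \<tau>
      unfolding zero_fun_apply \<rho>0[OF that] v0 ..
  qed (simp_all add: V(1) smooth_on_const open_upper_half_plane lin_exp_growth_const)
  fix F assume F: "F \<in> ?M"
  note F' = modular_formsD[OF F]
  show "fscale c F \<in> ?M" for c
  proof (rule modular_formsI)
    have e: "fscale c F \<tau> = vscale c (F \<tau>)" for \<tau> by (simp add: fscale_def vscale_def)
    show "fscale c F \<tau> \<in> V" for \<tau> unfolding e by (intro V(3) F'(1))
    show "fscale c F \<tau> = 0" if "\<tau> \<notin> upper_half_plane" for \<tau> unfolding e F'(2)[OF that] v0 ..
    show "smooth_on upper_half_plane (\<lambda>\<tau>. fscale c F \<tau> i)" for i
      unfolding fscale_def by (rule smooth_on_cmult[OF open_upper_half_plane F'(3)])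
    show "lin_exp_growth (\<lambda>\<tau>. fscale c F \<tau> i)" for i
      unfolding fscale_def by (rule lin_exp_growth_cmult[OF F'(5)])
    show "fscale c F (mobius (fst M) \<tau>) = vscale (snd M \<tau> powi \<lfloor>2 * p\<rfloor> * cnj (snd M \<tau>) powi \<lfloor>2 * q\<rfloor>) (\<rho> M (fscale c F \<tau>))"
      if "\<tau> \<in> upper_half_plane" "M \<in> \<Gamma>" for \<tau> M
      unfolding e F'(4)[OF that] representation_onD(3)[OF \<rho> subsetD[OF \<Gamma> that(2)] F'(1)]
      by (simp add: vscale_def mult.left_commute)
  qed
  fix G assume G: "G \<in> ?M"
  note G' = modular_formsD[OF G]
  show "F + G \<in> ?M"
  proof (rule modular_formsI)
    show "(F + G) \<tau> \<in> V" for \<tau> unfolding plus_fun_apply[of F G] by (intro V(2) F'(1) G'(1))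
    show "(F + G) \<tau> = 0" if "\<tau> \<notin> upper_half_plane" for \<tau> using F'(2)[OF that] G'(2)[OF that] by simp
    show "smooth_on upper_half_plane (\<lambda>\<tau>. (F + G) \<tau> i)" for i
      unfolding plus_fun_apply by (rule smooth_on_add[OF open_upper_half_plane F'(3) G'(3)])
    show "lin_exp_growth (\<lambda>\<tau>. (F + G) \<tau> i)" for i
      unfolding plus_fun_apply by (rule lin_exp_growth_add[OF F'(5) G'(5)])
    show "(F + G) (mobius (fst M) \<tau>) = vscale (snd M \<tau> powi \<lfloor>2 * p\<rfloor> * cnj (snd M \<tau>) powi \<lfloor>2 * q\<rfloor>) (\<rho> M ((F + G) \<tau>))"
      if "\<tau> \<in> upper_half_plane" "M \<in> \<Gamma>" for \<tau> M
      unfolding plus_fun_apply[of F G] F'(4)[OF that] G'(4)[OF that] representation_onD(2)[OF \<rho> subsetD[OF \<Gamma> that(2)] F'(1) G'(1)]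
      by (simp add: vscale_def fun_eq_iff distrib_left)
  qed
qed

section \<open>Wirtinger derivatives and antiholomorphic powers\<close>

lemma wirtinger_eq: "(f has_derivative D) (at \<tau>) \<Longrightarrow> wirtinger f \<tau> = (D 1 - \<i> * D \<i>) / 2"
  unfolding wirtinger_def by (simp add: frechet_derivative_at[symmetric])

lemma smooth_on_differentiable:
  assumes "smooth_on S f" "x \<in> S"
  shows "(f has_derivative frechet_derivative f (at x)) (at x)"
  using assms Ck_on_SucD[of 0 S f x] unfolding smooth_on_def by blast

text \<open>Reflection exchanges the two Wirtinger operators, so the condition becomes the
  Cauchy-Riemann equation \<open>D \<i> = \<i> * D 1\<close>.\<close>

lemma wirtinger_refl_eq_0_iff:
  assumes f: "f differentiable (at (refl_pt \<tau>))"
  shows "wirtinger (\<lambda>t. f (refl_pt t)) \<tau> = 0 \<longleftrightarrow> f field_differentiable (at (refl_pt \<tau>))"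
proof -
  obtain D where D: "(f has_derivative D) (at (refl_pt \<tau>))" using f unfolding differentiable_def by blast
  have lin: "linear D" by (rule bounded_linear.linear[OF has_derivative_bounded_linear[OF D]])
  have "((\<lambda>t. f (refl_pt t)) has_derivative (\<lambda>s. D (refl_pt s))) (at \<tau>)"
    by (rule has_derivative_compose[OF bounded_linear.has_derivative[OF bounded_linear_refl_pt has_derivative_ident] D])
  then have w: "wirtinger (\<lambda>t. f (refl_pt t)) \<tau> = - (D 1 + \<i> * D \<i>) / 2"
    by (simp add: wirtinger_eq refl_pt_def linear_neg[OF lin])
  show ?thesis
  proof
    assume "wirtinger (\<lambda>t. f (refl_pt t)) \<tau> = 0"
    then have "- (D 1 + \<i> * D \<i>) / 2 = 0" unfolding w .
    then have "\<i> * (D 1 + \<i> * D \<i>) = 0" by (simp only: divide_eq_0_iff neg_equal_0_iff_equal mult_eq_0_iff) simp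
    then have i: "D \<i> = \<i> * D 1" by (simp add: distrib_left flip: mult.assoc)
    have "D s = D 1 * s" for s
    proof -
      have s: "Re s *\<^sub>R 1 + Im s *\<^sub>R \<i> = s" by (simp add: complex_eq_iff)
      have "D s = D (Re s *\<^sub>R 1 + Im s *\<^sub>R \<i>)" unfolding s ..
      also have "\<dots> = of_real (Re s) * D 1 + of_real (Im s) * (\<i> * D 1)"
        unfolding linear_add[OF lin] linear_scale[OF lin] i by (simp add: scaleR_conv_of_real)
      also have "\<dots> = D 1 * (of_real (Re s) + \<i> * of_real (Im s))" by (simp add: algebra_simps)
      also have "of_real (Re s) + \<i> * of_real (Im s) = s" by (simp add: complex_eq_iff)
      finally show ?thesis .
    qed
    then have "(f has_field_derivative D 1) (at (refl_pt \<tau>))"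
      unfolding has_field_derivative_def by (intro has_derivative_eq_rhs[OF D] ext)
    then show "f field_differentiable (at (refl_pt \<tau>))" unfolding field_differentiable_def by blast
  next
    assume "f field_differentiable (at (refl_pt \<tau>))"
    then obtain d where "(f has_derivative (\<lambda>s. d * s)) (at (refl_pt \<tau>))"
      unfolding field_differentiable_def has_field_derivative_def by (rule exE)
    then have "D = (\<lambda>s. d * s)" by (rule has_derivative_unique[OF D])
    then have "D 1 = d" "D \<i> = \<i> * d" by (simp_all add: mult.commute)
    then show "wirtinger (\<lambda>t. f (refl_pt t)) \<tau> = 0" unfolding w by simp
  qed
qed

text \<open>The derivative of the power is conjugate-linear and that of \<open>h\<close> is
  complex-linear; a form that is both is zero, and with \<open>c \<noteq> 0\<close> this forces
  \<open>n = 0\<close>.\<close>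

lemma antiholomorphic_power:
  fixes c d :: real
  assumes S: "open S" "t \<in> S" and h: "h holomorphic_on S"
    and eq: "\<And>\<tau>. \<tau> \<in> S \<Longrightarrow> h \<tau> = (of_real c * cnj \<tau> + of_real d) powi n"
    and nz: "of_real c * cnj t + of_real d \<noteq> (0::complex)" and c: "c \<noteq> 0"
  shows "n = 0"
proof -
  define w where "w = of_real c * cnj t + of_real d"
  obtain h' where h': "(h has_field_derivative h') (at t)"
    using h S unfolding holomorphic_on_def by (metis at_within_open field_differentiable_def)
  have "((\<lambda>\<tau>. of_real c * cnj \<tau> + of_real d) has_derivative (\<lambda>s. of_real c * cnj s)) (at t)"
    by (auto intro!: derivative_eq_intros bounded_linear.has_derivative[OF bounded_linear_cnj])
  moreover have "((\<lambda>z. z powi n) has_field_derivative of_int n * w powi (n - 1)) (at w)"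
    using nz by (auto intro!: derivative_eq_intros simp: w_def)
  ultimately have "((\<lambda>\<tau>. (of_real c * cnj \<tau> + of_real d) powi n) has_derivative (\<lambda>s. of_int n * w powi (n - 1) * (of_real c * cnj s))) (at t)"
    unfolding has_field_derivative_def w_def by (rule has_derivative_compose)
  then have "(h has_derivative (\<lambda>s. of_int n * w powi (n - 1) * (of_real c * cnj s))) (at t)"
    by (rule has_derivative_transform_within_open[OF _ S]) (simp add: eq)
  from has_derivative_unique[OF this h'[unfolded has_field_derivative_def]]
  have e: "of_int n * w powi (n - 1) * (of_real c * cnj s) = h' * s" for s by (rule fun_cong)
  have "of_int n * w powi (n - 1) * of_real c = - (of_int n * w powi (n - 1) * of_real c)"
    using e[of 1] e[of \<i>] by (simp add: algebra_simps)
  then have "of_int n * w powi (n - 1) * of_real c = 0" by (simp only: eq_neg_iff_add_eq_0 mult_2[symmetric]) simp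
  then show "n = 0" using nz c by (simp add: w_def[symmetric])
qed

section \<open>Theta lifts\<close>

lemma cholomorphicD:
  assumes "cholomorphic g"
  shows "(g has_derivative frechet_derivative g (at \<zeta>)) (at \<zeta>)"
    and "frechet_derivative g (at \<zeta>) (cscale c \<xi>) = c * frechet_derivative g (at \<zeta>) \<xi>"
proof -
  obtain D where D: "(g has_derivative D) (at \<zeta>)" "\<forall>c \<xi>. D (cscale c \<xi>) = c * D \<xi>"
    using assms unfolding cholomorphic_def by blast
  have "frechet_derivative g (at \<zeta>) = D" using D(1) by (rule frechet_derivative_at[symmetric])
  then show "(g has_derivative frechet_derivative g (at \<zeta>)) (at \<zeta>)"
    "frechet_derivative g (at \<zeta>) (cscale c \<xi>) = c * frechet_derivative g (at \<zeta>) \<xi>"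
    by (simp only: D(1), simp only: D(2)[THEN spec, THEN spec])
qed

lemma cholomorphic_sum:
  assumes "\<And>i. i \<in> I \<Longrightarrow> cholomorphic (f i)"
  shows "cholomorphic (\<lambda>\<zeta>. \<Sum>i\<in>I. a i * f i \<zeta>)"
  unfolding cholomorphic_def
proof (rule allI, rule exI, rule conjI)
  fix \<zeta>
  show "((\<lambda>\<zeta>. \<Sum>i\<in>I. a i * f i \<zeta>) has_derivative (\<lambda>\<xi>. \<Sum>i\<in>I. a i * frechet_derivative (f i) (at \<zeta>) \<xi>)) (at \<zeta>)"
    by (intro has_derivative_sum has_derivative_mult_right cholomorphicD(1) assms)
  show "\<forall>c \<xi>. (\<Sum>i\<in>I. a i * frechet_derivative (f i) (at \<zeta>) (cscale c \<xi>)) = c * (\<Sum>i\<in>I. a i * frechet_derivative (f i) (at \<zeta>) \<xi>)"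
    by (simp add: cholomorphicD(2)[OF assms] sum_distrib_left mult.left_commute)
qed

lemma cholomorphic_line_holomorphic:
  assumes "cholomorphic g"
  shows "line_holomorphic g"
  unfolding line_holomorphic_def
proof (intro conjI allI)
  show "continuous_on UNIV g"
    by (intro continuous_at_imp_continuous_on ballI has_derivative_continuous[OF cholomorphicD(1)[OF assms]])
  fix \<zeta> \<xi>
  have "((\<lambda>w. g (\<zeta> + cscale w \<xi>)) has_field_derivative frechet_derivative g (at (\<zeta> + cscale w \<xi>)) \<xi>) (at w)" for w
  proof -
    have "((\<lambda>w. \<zeta> + cscale w \<xi>) has_derivative (\<lambda>h. cscale h \<xi>)) (at w)"
      using has_derivative_add[OF has_derivative_const bounded_linear.has_derivative[OF bounded_linear_cscale has_derivative_ident]]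
      by simp
    from has_derivative_compose[OF this cholomorphicD(1)[OF assms]]
    show ?thesis unfolding has_field_derivative_def cholomorphicD(2)[OF assms]
      by (rule has_derivative_eq_rhs) (simp add: fun_eq_iff mult.commute)
  qed
  then show "(\<lambda>w. g (\<zeta> + cscale w \<xi>)) holomorphic_on UNIV"
    unfolding holomorphic_on_def field_differentiable_def by auto
qed

context lat_gr
begin

lemma jacobi_forms_iff:
  "\<Phi> \<in> jacobi_forms L v p q \<Gamma> \<longleftrightarrow>
     (\<forall>\<tau>. \<tau> \<notin> UH \<longrightarrow> \<Phi> \<tau> = 0) \<and>
     smooth_on (UH \<times> UNIV) (\<lambda>z. \<Phi> (fst z) (snd z)) \<and>
     (\<forall>\<tau>\<in>UH. \<forall>\<zeta>. \<forall>\<sigma>\<in>lat L. \<forall>\<nu>\<in>lat L.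
        \<Phi> \<tau> (\<zeta> + mv \<tau> (emb \<sigma>) + emb \<nu>) = ee (- Q \<tau> (emb \<sigma>) / 2 - Bc (emb \<sigma>) \<zeta>) * \<Phi> \<tau> \<zeta>) \<and>
     (\<forall>\<tau>\<in>UH. \<forall>\<zeta>. \<forall>M\<in>\<Gamma>.
        \<Phi> (mobius (fst M) \<tau>) (jacobi_act M \<tau> \<zeta>) =
          snd M \<tau> powi \<lfloor>2 * p\<rfloor> * cnj (snd M \<tau>) powi \<lfloor>2 * q\<rfloor>
          * ee (of_real (fst M $2$1) * Q (1 / autj (fst M) \<tau>) \<zeta> / 2) * \<Phi> \<tau> \<zeta>) \<and>
     (\<forall>\<tau>\<in>UH. cholomorphic (\<Phi> \<tau>)) \<and>
     (\<exists>f. (\<forall>\<tau>\<in>UH. \<forall>\<zeta>. ((\<lambda>x. f x \<tau> * theta_term L v \<tau> \<zeta> x) has_sum \<Phi> \<tau> \<zeta>) Ld) \<and>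
          (\<forall>x\<in>Ld. lin_exp_growth (f x)))"
proof -
  have eq1: "\<zeta> + cscale \<tau> (emb (proj_plus v \<sigma>)) + cscale (cnj \<tau>) (emb (proj_minus v \<sigma>)) + emb \<nu> = \<zeta> + mv \<tau> (emb \<sigma>) + emb \<nu>"
    for \<zeta> \<tau> \<sigma> \<nu> by (simp add: mv_def cp_emb cm_emb pp_def pm_def add.assoc)
  have eq2: "ee (- \<tau> * of_real (qform L (proj_plus v \<sigma>)) / 2 - cnj \<tau> * of_real (qform L (proj_minus v \<sigma>)) / 2 - cbform L (emb \<sigma>) \<zeta>)
     = ee (- Q \<tau> (emb \<sigma>) / 2 - Bc (emb \<sigma>) \<zeta>)" for \<zeta> \<tau> \<sigma>
    by (simp add: Q_def Bpm_emb qp_def qm_def pp_def pm_def field_simps)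
  have eq3: "cscale (1 / autj A \<tau>) (cproj_plus v \<zeta>) + cscale (1 / cnj (autj A \<tau>)) (cproj_minus v \<zeta>) = mv (1 / autj A \<tau>) \<zeta>"
    for A \<tau> \<zeta> by (simp add: mv_def cproj_eq)
  have eq4: "ee (of_real (A$2$1) * cqform L (cproj_plus v \<zeta>) / (2 * autj A \<tau>) + of_real (A$2$1) * cqform L (cproj_minus v \<zeta>) / (2 * cnj (autj A \<tau>)))
     = ee (of_real (A$2$1) * Q (1 / autj A \<tau>) \<zeta> / 2)" for A \<tau> \<zeta>
    by (simp add: Q_def cproj_eq Bp_def Bm_def field_simps add_divide_distrib)
  show ?thesis
    unfolding jacobi_forms_def mem_Collect_eq eq1 eq2 eq3 eq4 case_prod_unfold jacobi_act_def by (rule refl)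
qed

lemma theta_lift_eq: "theta_lift L v F \<tau> \<zeta> = (\<Sum>\<gamma>\<in>disc L. F \<tau> \<gamma> * th \<gamma> \<tau> \<zeta>)"
  unfolding theta_lift_def pairing_def siegel_theta_eq by (simp add: mult.commute)

text \<open>Theta components transform under \<open>M\<close>, coefficients under
  \<open>mp2_tilde M\<close>, and \<open>weil_op_pairing\<close> makes their pairing invariant up to
  the automorphy factor.\<close>

lemma pairing_transform:
  assumes U: "U \<in> group_algebra L" and M: "M \<in> carrier Mp2Z" and \<tau>: "\<tau> \<in> UH"
  shows "(\<Sum>\<gamma>\<in>disc L. vscale k (weil_op (mp2_tilde M) U) \<gamma> * th \<gamma> (mobius (fst M) \<tau>) (jacobi_act M \<tau> \<zeta>))
    = k * jacobi_factor M \<tau> \<zeta> * (\<Sum>\<gamma>\<in>disc L. U \<gamma> * th \<gamma> \<tau> \<zeta>)"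
proof -
  let ?\<Theta> = "\<lambda>\<delta>. if \<delta> \<in> disc L then th \<delta> \<tau> \<zeta> else 0"
  have \<Theta>: "?\<Theta> \<in> group_algebra L" by (simp add: group_algebra_def)
  have w: "weil_op M (\<lambda>\<delta>. th \<delta> \<tau> \<zeta>) = weil_op M ?\<Theta>" by (auto simp: weil_op_def fun_eq_iff intro!: sum.cong)
  have "(\<Sum>\<gamma>\<in>disc L. vscale k (weil_op (mp2_tilde M) U) \<gamma> * th \<gamma> (mobius (fst M) \<tau>) (jacobi_act M \<tau> \<zeta>))
      = k * jacobi_factor M \<tau> \<zeta> * pairing L (weil_op M ?\<Theta>) (weil_op (mp2_tilde M) U)"
    unfolding pairing_def sum_distrib_left vscale_def w[symmetric]
    by (intro sum.cong refl) (simp add: th_transform[OF M \<tau>] mult_ac)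
  also have "\<dots> = k * jacobi_factor M \<tau> \<zeta> * (\<Sum>\<gamma>\<in>disc L. U \<gamma> * th \<gamma> \<tau> \<zeta>)"
    unfolding weil_op_pairing[OF M \<Theta> U] unfolding pairing_def by (simp add: mult.commute)
  finally show ?thesis .
qed

lemma jacobi_factor_weight:
  assumes "M \<in> carrier Mp2Z" "\<tau> \<in> UH"
  shows "(snd M \<tau> powi \<lfloor>2 * (p - real (card Ep) / 2)\<rfloor> * cnj (snd M \<tau>) powi \<lfloor>2 * (q - real (card Em) / 2)\<rfloor>) * jacobi_factor M \<tau> \<zeta> =
    snd M \<tau> powi \<lfloor>2 * p\<rfloor> * cnj (snd M \<tau>) powi \<lfloor>2 * q\<rfloor> * ee (of_real (fst M $2$1) * Q (1 / autj (fst M) \<tau>) \<zeta> / 2)"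
  using mp2_snd_nonzero[of M \<tau>] assms unfolding floor_weight jacobi_factor_def by (simp add: power_int_diff)

lemma Ck_on_fst: "Ck_on n UH f \<Longrightarrow> Ck_on n (UH \<times> UNIV) (\<lambda>z :: complex \<times> 'v cplx. f (fst z))"
  using Ck_on_compose_affine[OF open_upper_half_plane open_Times[OF open_upper_half_plane open_UNIV] bounded_linear_fst, of 0 n f]
  by auto

theorem theta_lift_jacobi:
  assumes F: "F \<in> modular_forms (group_algebra (neg_lattice L)) (weil_rep_dual L) (p - real (card Ep) / 2) (q - real (card Em) / 2) \<Gamma>"
    and \<Gamma>: "\<Gamma> \<subseteq> carrier Mp2Z"
  shows "theta_lift L v F \<in> jacobi_forms L v p q \<Gamma>"
  unfolding jacobi_forms_iff
proof (intro conjI allI impI ballI)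
  note F' = modular_formsD[OF F, unfolded neg_lattice_simps]
  show "theta_lift L v F \<tau> = 0" if "\<tau> \<notin> UH" for \<tau>
    using F'(2)[OF that] by (simp add: fun_eq_iff theta_lift_eq)
  show "smooth_on (UH \<times> UNIV) (\<lambda>z. theta_lift L v F (fst z) (snd z))"
    unfolding smooth_on_def theta_lift_eq
  proof
    have o: "open (UH \<times> (UNIV :: 'v cplx set))" by (intro open_Times open_upper_half_plane open_UNIV)
    show "Ck_on n (UH \<times> UNIV) (\<lambda>z. \<Sum>\<gamma>\<in>disc L. F (fst z) \<gamma> * th \<gamma> (fst z) (snd z))" for n
      using F'(3) unfolding smooth_on_def
      by (intro Ck_on_sum[OF o] Ck_on_mult[OF o] TH_Ck lattice_subset_disc exp_bounded_const Ck_on_fst) blast+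
  qed
  show "theta_lift L v F \<tau> (\<zeta> + mv \<tau> (emb \<sigma>) + emb \<nu>) = ee (- Q \<tau> (emb \<sigma>) / 2 - Bc (emb \<sigma>) \<zeta>) * theta_lift L v F \<tau> \<zeta>"
    if \<sigma>: "\<sigma> \<in> lat L" and \<nu>: "\<nu> \<in> lat L" for \<tau> \<zeta> \<sigma> \<nu>
  proof -
    have "th \<gamma> \<tau> (\<zeta> + mv \<tau> (emb \<sigma>) + emb \<nu>) = ee (- Q \<tau> (emb \<sigma>) / 2 - Bc (emb \<sigma>) \<zeta>) * th \<gamma> \<tau> \<zeta>" if \<gamma>: "\<gamma> \<in> disc L" for \<gamma>
    proof -
      have "cls (rep \<gamma> + \<sigma>) = cls (rep \<gamma>)"
        using \<sigma> by (subst cls_eq_iff) (auto intro: Ld_add lat_Ld rep_Ld[OF \<gamma>])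
      then have "tr \<sigma> \<gamma> = \<gamma>" using tr_cls[OF rep_Ld[OF \<gamma>] lat_Ld[OF \<sigma>]] by (simp add: cls_rep[OF \<gamma>])
      then show ?thesis
        unfolding th_disc_period[OF \<gamma> lat_Ld[OF \<nu>]] th_disc_shift[OF \<gamma> lat_Ld[OF \<sigma>]]
        using ee_int[OF Ld_lat_Ints[OF rep_Ld[OF \<gamma>] \<nu>]] by simp
    qed
    then show ?thesis unfolding theta_lift_eq by (simp add: sum_distrib_left mult.left_commute)
  qed
  show "theta_lift L v F (mobius (fst M) \<tau>) (jacobi_act M \<tau> \<zeta>) =
          snd M \<tau> powi \<lfloor>2 * p\<rfloor> * cnj (snd M \<tau>) powi \<lfloor>2 * q\<rfloor>
          * ee (of_real (fst M $2$1) * Q (1 / autj (fst M) \<tau>) \<zeta> / 2) * theta_lift L v F \<tau> \<zeta>"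
    if \<tau>: "\<tau> \<in> UH" and M: "M \<in> \<Gamma>" for \<tau> \<zeta> M
  proof -
    have M': "M \<in> carrier Mp2Z" using M \<Gamma> by (rule subsetD[rotated])
    show ?thesis
      unfolding theta_lift_eq F'(4)[OF \<tau> M, unfolded weil_rep_dual_weil_op[OF M' F'(1)]]
        pairing_transform[OF F'(1) M' \<tau>] jacobi_factor_weight[OF M' \<tau>] ..
  qed
  show "cholomorphic (theta_lift L v F \<tau>)" if \<tau>: "\<tau> \<in> UH" for \<tau>
    unfolding theta_lift_eq[abs_def] by (intro cholomorphic_sum TH_cholomorphic lattice_subset_disc exp_bounded_const \<tau>)
  show "\<exists>f. (\<forall>\<tau>\<in>UH. \<forall>\<zeta>. ((\<lambda>x. f x \<tau> * theta_term L v \<tau> \<zeta> x) has_sum theta_lift L v F \<tau> \<zeta>) Ld) \<and> (\<forall>x\<in>Ld. lin_exp_growth (f x))"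
  proof (rule exI[of _ "\<lambda>x \<tau>. F \<tau> (cls x)"], intro conjI ballI allI)
    show "((\<lambda>x. F \<tau> (cls x) * theta_term L v \<tau> \<zeta> x) has_sum theta_lift L v F \<tau> \<zeta>) Ld" if "\<tau> \<in> UH" for \<tau> \<zeta>
      unfolding theta_lift_eq theta_term_efun mult.assoc[symmetric] by (rule th_series_has_sum[OF that])
    show "lin_exp_growth (\<lambda>\<tau>. F \<tau> (cls x))" for x by (rule F'(5))
  qed
qed

theorem theta_lift_inj:
  assumes F: "\<And>\<tau>. F \<tau> \<in> group_algebra L" "\<And>\<tau>. \<tau> \<notin> UH \<Longrightarrow> F \<tau> = 0"
    and G: "\<And>\<tau>. G \<tau> \<in> group_algebra L" "\<And>\<tau>. \<tau> \<notin> UH \<Longrightarrow> G \<tau> = 0"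
    and eq: "theta_lift L v F = theta_lift L v G"
  shows "F = G"
proof (rule ext, rule ext)
  fix \<tau> \<gamma>
  show "F \<tau> \<gamma> = G \<tau> \<gamma>"
  proof (cases "\<tau> \<in> UH \<and> \<gamma> \<in> disc L")
    case True
    have "(\<Sum>\<gamma>\<in>disc L. F \<tau> \<gamma> * th \<gamma> \<tau> \<zeta>) = (\<Sum>\<gamma>\<in>disc L. G \<tau> \<gamma> * th \<gamma> \<tau> \<zeta>)" for \<zeta>
      using fun_cong[OF fun_cong[OF eq], of \<tau> \<zeta>] unfolding theta_lift_eq .
    then show ?thesis using True by (intro th_eq_coeffs[of \<tau> "F \<tau>" "G \<tau>"]) auto
  next
    case False
    then consider "\<tau> \<notin> UH" | "\<gamma> \<notin> disc L" by blast
    then show ?thesis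
    proof cases
      case 1
      then show ?thesis using F(2) G(2) by simp
    next
      case 2
      then show ?thesis using F(1)[of \<tau>] G(1)[of \<tau>] by (simp add: group_algebra_def)
    qed
  qed
qed

lemma th_nonzero_exists:
  assumes "\<tau> \<in> UH" "\<gamma> \<in> disc L"
  shows "\<exists>\<zeta>. th \<gamma> \<tau> \<zeta> \<noteq> 0"
proof (rule ccontr)
  assume "\<nexists>\<zeta>. th \<gamma> \<tau> \<zeta> \<noteq> 0"
  then have "th \<gamma> \<tau> \<zeta> = 0" for \<zeta> by blast
  then have "(\<Sum>\<delta>\<in>disc L. (if \<gamma> = \<delta> then 1 else 0) * th \<delta> \<tau> (0 + emb x')) = 0" for x'
    unfolding sum_single_coeff[OF finite_disc assms(2)] by simp
  then have "(if \<gamma> = \<gamma> then 1 else (0::complex)) = 0" by (rule th_independent[OF assms(1) _ assms(2)])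
  then show False by simp
qed

text \<open>This yields the smoothness in \<open>\<tau>\<close> of the theta coefficients of a Jacobi form: near a point with
  \<open>\<theta>\<^sub>\<gamma>(\<tau>, \<zeta>) \<noteq> 0\<close> one divides by it.\<close>

lemma coefficient_from_translates:
  assumes "\<gamma> \<in> disc L"
  shows "(\<Sum>\<nu>\<in>disc L. ee (- of_real (bform L (rep \<nu>) (rep \<gamma>))) * (\<Sum>\<delta>\<in>disc L. c \<delta> * th \<delta> \<tau> (\<zeta> + emb (rep \<nu>))))
    = of_nat (card (disc L)) * c \<gamma> * th \<gamma> \<tau> \<zeta>"
proof -
  have "(\<Sum>\<nu>\<in>disc L. ee (- of_real (bform L (rep \<nu>) (rep \<gamma>))) * (\<Sum>\<delta>\<in>disc L. c \<delta> * th \<delta> \<tau> (\<zeta> + emb (rep \<nu>))))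
      = (\<Sum>\<nu>\<in>disc L. \<Sum>\<delta>\<in>disc L. (ee (of_real (bform L (rep \<nu>) (rep \<delta>))) * ee (- of_real (bform L (rep \<nu>) (rep \<gamma>)))) * (c \<delta> * th \<delta> \<tau> \<zeta>))"
    unfolding sum_distrib_left by (intro sum.cong refl) (simp add: th_disc_period rep_Ld sym mult_ac)
  also have "\<dots> = (\<Sum>\<delta>\<in>disc L. (\<Sum>\<nu>\<in>disc L. ee (of_real (bform L (rep \<nu>) (rep \<delta>))) * ee (- of_real (bform L (rep \<nu>) (rep \<gamma>)))) * (c \<delta> * th \<delta> \<tau> \<zeta>))"
    unfolding sum_distrib_right by (rule sum.swap)
  also have "\<dots> = (\<Sum>\<delta>\<in>disc L. (if \<gamma> = \<delta> then of_nat (card (disc L)) else 0) * (c \<delta> * th \<delta> \<tau> \<zeta>))"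
    by (intro sum.cong refl) (auto simp: character_orthogonality[OF _ assms])
  also have "\<dots> = of_nat (card (disc L)) * c \<gamma> * th \<gamma> \<tau> \<zeta>"
    unfolding sum_single_coeff[OF finite_disc assms] by (simp add: mult.assoc)
  finally show ?thesis .
qed

theorem theta_lift_surj:
  assumes \<Phi>: "\<Phi> \<in> jacobi_forms L v p q \<Gamma>" and \<Gamma>: "\<Gamma> \<subseteq> carrier Mp2Z"
  shows "\<exists>F\<in>modular_forms (group_algebra (neg_lattice L)) (weil_rep_dual L) (p - real (card Ep) / 2) (q - real (card Em) / 2) \<Gamma>.
    theta_lift L v F = \<Phi>"
proof -
  note * = \<Phi>[unfolded jacobi_forms_iff]
  have off: "\<Phi> \<tau> = 0" if "\<tau> \<notin> UH" for \<tau> using *[THEN conjunct1] that by simp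
  have smooth: "smooth_on (UH \<times> UNIV) (\<lambda>z. \<Phi> (fst z) (snd z))" by (rule *[THEN conjunct2, THEN conjunct1])
  have ell: "\<Phi> \<tau> (\<zeta> + mv \<tau> (emb \<sigma>) + emb \<nu>) = ee (- Q \<tau> (emb \<sigma>) / 2 - Bc (emb \<sigma>) \<zeta>) * \<Phi> \<tau> \<zeta>"
    if "\<tau> \<in> UH" "\<sigma> \<in> lat L" "\<nu> \<in> lat L" for \<tau> \<zeta> \<sigma> \<nu>
    using *[THEN conjunct2, THEN conjunct2, THEN conjunct1] that by blast
  have mod: "\<Phi> (mobius (fst M) \<tau>) (jacobi_act M \<tau> \<zeta>) = snd M \<tau> powi \<lfloor>2 * p\<rfloor> * cnj (snd M \<tau>) powi \<lfloor>2 * q\<rfloor>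
      * ee (of_real (fst M $2$1) * Q (1 / autj (fst M) \<tau>) \<zeta> / 2) * \<Phi> \<tau> \<zeta>" if "\<tau> \<in> UH" "M \<in> \<Gamma>" for \<tau> \<zeta> M
    by (rule bspec[OF spec[OF bspec[OF *[THEN conjunct2, THEN conjunct2, THEN conjunct2, THEN conjunct1] that(1)]] that(2)])
  have chol: "cholomorphic (\<Phi> \<tau>)" if "\<tau> \<in> UH" for \<tau>
    by (rule bspec[OF *[THEN conjunct2, THEN conjunct2, THEN conjunct2, THEN conjunct2, THEN conjunct1] that])
  from *[THEN conjunct2, THEN conjunct2, THEN conjunct2, THEN conjunct2, THEN conjunct2]
  obtain f where f: "\<forall>\<tau>\<in>UH. \<forall>\<zeta>. ((\<lambda>x. f x \<tau> * theta_term L v \<tau> \<zeta> x) has_sum \<Phi> \<tau> \<zeta>) Ld"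
    and growth: "\<forall>x\<in>Ld. lin_exp_growth (f x)" by (elim exE conjE)
  \<comment> \<open>The coefficient of a coset is read off at its representative. The values 0 off
    the discriminant group and off the half plane are those that \<open>modular_forms\<close>
    demands.\<close>
  define F where "F = (\<lambda>\<tau> \<gamma>. if \<gamma> \<in> disc L \<and> \<tau> \<in> UH then f (rep \<gamma>) \<tau> else 0)"
  have Fg: "F \<tau> \<in> group_algebra L" for \<tau> by (simp add: group_algebra_def F_def)
  have lift: "theta_lift L v F \<tau> \<zeta> = \<Phi> \<tau> \<zeta>" if \<tau>: "\<tau> \<in> UH" for \<tau> \<zeta>
  proof -
    have "\<exists>c. \<forall>\<zeta>. \<Phi> \<tau> \<zeta> = (\<Sum>\<gamma>\<in>disc L. c \<gamma> * th \<gamma> \<tau> \<zeta>)"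
    proof (rule elliptic_is_theta[OF \<tau> cholomorphic_line_holomorphic[OF chol[OF \<tau>]]])
      show "\<Phi> \<tau> (\<zeta> + emb \<nu>) = \<Phi> \<tau> \<zeta>" if "\<nu> \<in> lat L" for \<nu> \<zeta>
        using ell[OF \<tau> lat_0 that, of \<zeta>] by (simp add: emb_simps Q_def ee_0)
      show "\<Phi> \<tau> (\<zeta> + mv \<tau> (emb \<sigma>)) = ee (- Q \<tau> (emb \<sigma>) / 2 - Bc (emb \<sigma>) \<zeta>) * \<Phi> \<tau> \<zeta>" if "\<sigma> \<in> lat L" for \<sigma> \<zeta>
        using ell[OF \<tau> that lat_0, of \<zeta>] by (simp add: emb_simps)
    qed
    then obtain c where c: "\<And>\<zeta>. \<Phi> \<tau> \<zeta> = (\<Sum>\<gamma>\<in>disc L. c \<gamma> * th \<gamma> \<tau> \<zeta>)" by blast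
    \<comment> \<open>Uniqueness of Fourier coefficients identifies the given \<open>f\<close> with
      the theta coefficients, so \<open>f x\<close> depends only on the coset of \<open>x\<close>,
      and its growth passes to \<open>F\<close>.\<close>
    have "f x \<tau> = c (cls x)" if x: "x \<in> Ld" for x
    proof -
      have "(f x \<tau> - c (cls x)) * ee (Q \<tau> (emb x) / 2) = 0"
      proof (rule fourier_unique[where X = Ld and \<zeta> = 0, OF subset_refl _ x])
        fix x'
        have "((\<lambda>x. f x \<tau> * theta_term L v \<tau> (0 + emb x') x) has_sum \<Phi> \<tau> (0 + emb x')) Ld"
          using f \<tau> by blast
        from has_sum_minus[OF this th_series_has_sum[OF \<tau>, of c "0 + emb x'"]]
        show "((\<lambda>x. (f x \<tau> - c (cls x)) * ee (Q \<tau> (emb x) / 2) * efun x (0 + emb x')) has_sum 0) Ld"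
          unfolding c theta_term_efun by (simp add: left_diff_distrib mult.assoc)
      qed
      then show ?thesis by (simp add: ee_nonzero)
    qed
    then have "F \<tau> \<gamma> = c \<gamma>" if "\<gamma> \<in> disc L" for \<gamma> using that \<tau> by (simp add: F_def rep_Ld cls_rep)
    then show ?thesis unfolding theta_lift_eq c by simp
  qed
  then have liftF: "theta_lift L v F = \<Phi>"
  proof (intro ext)
    show "theta_lift L v F \<tau> \<zeta> = \<Phi> \<tau> \<zeta>" for \<tau> \<zeta>
      using lift off[of \<tau>] by (cases "\<tau> \<in> UH") (simp_all add: theta_lift_eq F_def)
  qed
  have "F \<in> modular_forms (group_algebra (neg_lattice L)) (weil_rep_dual L) (p - real (card Ep) / 2) (q - real (card Em) / 2) \<Gamma>"
  proof (rule modular_formsI, unfold neg_lattice_simps)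
    show "F \<tau> \<in> group_algebra L" for \<tau> by (rule Fg)
    show "F \<tau> = 0" if "\<tau> \<notin> UH" for \<tau> using that by (simp add: F_def fun_eq_iff)
    show "lin_exp_growth (\<lambda>\<tau>. F \<tau> \<gamma>)" for \<gamma>
    proof (cases "\<gamma> \<in> disc L")
      case True
      from bspec[OF growth rep_Ld[OF True]] show ?thesis
        by (rule lin_exp_growth_cong) (simp add: F_def True)
    next
      case False
      then show ?thesis by (simp add: F_def lin_exp_growth_const)
    qed
    show "smooth_on UH (\<lambda>\<tau>. F \<tau> \<gamma>)" for \<gamma>
    proof (cases "\<gamma> \<in> disc L")
      case False
      then show ?thesis by (simp add: F_def smooth_on_const open_upper_half_plane)
    next
      case \<gamma>: True
      show ?thesis unfolding smooth_on_def
      proof (rule allI, rule Ck_on_local)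
        fix n \<tau> assume \<tau>: "\<tau> \<in> UH"
        obtain \<zeta> where \<zeta>: "th \<gamma> \<tau> \<zeta> \<noteq> 0" using th_nonzero_exists[OF \<tau> \<gamma>] by blast
        have ins: "Ck_on m UH (\<lambda>t. g t z)" if "Ck_on m (UH \<times> UNIV) (\<lambda>z. g (fst z) (snd z))" for m g and z :: "'v cplx"
        proof -
          have "Ck_on m UH (\<lambda>t. (\<lambda>y. g (fst y) (snd y)) ((0, z) + (t, 0)))"
            by (rule Ck_on_compose_affine[OF open_Times[OF open_upper_half_plane open_UNIV] open_upper_half_plane
                  bounded_linear_Pair[OF bounded_linear_ident bounded_linear_zero]]) (simp, rule that)
          then show ?thesis by simp
        qed
        have thC: "Ck_on m UH (\<lambda>t. th \<gamma> t \<zeta>)" for m by (intro ins TH_Ck lattice_subset_disc \<gamma> exp_bounded_const)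
        define U where "U = {t \<in> UH. th \<gamma> t \<zeta> \<noteq> 0}"
        have U: "open U"
        proof -
          have "U = UH \<inter> (\<lambda>t. th \<gamma> t \<zeta>) -` (- {0})" by (auto simp: U_def)
          moreover have "open (- {0 :: complex})" by (rule open_Compl[OF closed_singleton])
          ultimately show ?thesis
            using continuous_open_preimage[OF Ck_on_imp_continuous[OF thC[of 0]] open_upper_half_plane] by simp
        qed
        have CkU: "Ck_on n U (\<lambda>t. (\<Sum>\<nu>\<in>disc L. ee (- of_real (bform L (rep \<nu>) (rep \<gamma>))) * \<Phi> t (\<zeta> + emb (rep \<nu>))) *
            inverse (of_nat (card (disc L)) * th \<gamma> t \<zeta>))"
        proof (intro Ck_on_mult[OF U] Ck_on_sum[OF U] Ck_on_inverse[OF U] Ck_on_const[OF U])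
          show "Ck_on n U (\<lambda>t. \<Phi> t (\<zeta> + emb (rep \<nu>)))" for \<nu>
            by (rule Ck_on_subset[OF ins[OF smooth[unfolded smooth_on_def, rule_format]]]) (simp add: U_def)
          show "Ck_on n U (\<lambda>t. th \<gamma> t \<zeta>)" by (rule Ck_on_subset[OF thC]) (auto simp: U_def)
          show "of_nat (card (disc L)) * th \<gamma> t \<zeta> \<noteq> 0" if "t \<in> U" for t
            using that card_disc_pos by (simp add: U_def)
        qed
        have eqU: "(\<Sum>\<nu>\<in>disc L. ee (- of_real (bform L (rep \<nu>) (rep \<gamma>))) * \<Phi> t (\<zeta> + emb (rep \<nu>))) *
            inverse (of_nat (card (disc L)) * th \<gamma> t \<zeta>) = F t \<gamma>" if "t \<in> U" for t
        proof -
          have "of_nat (card (disc L)) * th \<gamma> t \<zeta> \<noteq> 0" using that card_disc_pos by (simp add: U_def)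
          then show ?thesis
            unfolding liftF[symmetric] theta_lift_eq coefficient_from_translates[OF \<gamma>, of "F t" t \<zeta>]
            by (simp add: field_simps)
        qed
        have "Ck_on n U (\<lambda>\<tau>. F \<tau> \<gamma>)" by (rule iffD1[OF Ck_on_cong[OF U eqU] CkU])
        moreover have "\<tau> \<in> U" "UH \<inter> U = U" using \<tau> \<zeta> by (auto simp: U_def)
        ultimately show "\<exists>U. open U \<and> \<tau> \<in> U \<and> Ck_on n (UH \<inter> U) (\<lambda>\<tau>. F \<tau> \<gamma>)"
          using U by (intro exI[of _ U]) simp
      qed
    qed
    fix \<tau> M assume \<tau>: "\<tau> \<in> UH" and M: "M \<in> \<Gamma>"
    have M': "M \<in> carrier Mp2Z" using M \<Gamma> by (rule subsetD[rotated])
    then have Mc: "M \<in> mp2_carrier" by simp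
    note dM = mp2_carrierD(1)[OF Mc]
    let ?k = "snd M \<tau> powi \<lfloor>2 * (p - real (card Ep) / 2)\<rfloor> * cnj (snd M \<tau>) powi \<lfloor>2 * (q - real (card Em) / 2)\<rfloor>"
    let ?W = "vscale ?k (weil_op (mp2_tilde M) (F \<tau>))"
    have "?W \<gamma> = F (mobius (fst M) \<tau>) \<gamma>" if "\<gamma> \<in> disc L" for \<gamma>
    proof (rule th_eq_coeffs[OF mobius_in[OF dM \<tau>] _ that])
      fix z
      \<comment> \<open>Any argument at the transformed point arises from some
        \<open>\<zeta>\<close>, since \<open>M\<close> acts invertibly on the second variable; so
        the modular law can be compared for all arguments.\<close>
      define \<zeta> where "\<zeta> = mv (autj (fst M) \<tau>) z"
      have z: "z = jacobi_act M \<tau> \<zeta>" using autj_nonzero[OF dM \<tau>] by (simp add: jacobi_act_def \<zeta>_def mv_mv)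
      show "(\<Sum>\<gamma>\<in>disc L. ?W \<gamma> * th \<gamma> (mobius (fst M) \<tau>) z) = (\<Sum>\<gamma>\<in>disc L. F (mobius (fst M) \<tau>) \<gamma> * th \<gamma> (mobius (fst M) \<tau>) z)"
        unfolding z pairing_transform[OF Fg M' \<tau>] jacobi_factor_weight[OF M' \<tau>]
        using mod[OF \<tau> M, of \<zeta>] unfolding liftF[symmetric] theta_lift_eq by simp
    qed
    moreover have "?W \<in> group_algebra L" by (intro vscale_group_algebra weil_op_group_algebra)
    ultimately show "F (mobius (fst M) \<tau>) = vscale ?k (weil_rep_dual L M (F \<tau>))"
      using Fg[of "mobius (fst M) \<tau>"] unfolding weil_rep_dual_weil_op[OF M' Fg] group_algebra_def
      by (intro ext) (metis (mono_tags, lifting) mem_Collect_eq)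
  qed
  with liftF show ?thesis by blast
qed

end

section \<open>Skew-holomorphic lifts and the constraint on the weight\<close>

context lat_gr
begin

lemma omega_id: "U \<in> group_algebra L \<Longrightarrow> omega L U = U"
  unfolding omega_def by (rule group_algebra_expansion[OF finite_disc, symmetric])

lemma cpartial_theta_sum:
  assumes "exp_bounded p" "\<tau> \<in> UH"
  shows "cpartial e (\<lambda>\<zeta>. \<Sum>\<gamma>\<in>disc L. a \<gamma> * TH \<gamma> p \<tau> \<zeta>) =
    (\<lambda>\<zeta>. \<Sum>\<gamma>\<in>disc L. (2 * of_real pi * \<i> * a \<gamma>) * TH \<gamma> (\<lambda>x. p x * of_real (bform L x e)) \<tau> \<zeta>)"
proof
  fix \<zeta>
  have d: "((\<lambda>w. TH \<gamma> p \<tau> (\<zeta> + cscale w (emb e))) has_field_derivative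
      2 * of_real pi * \<i> * TH \<gamma> (\<lambda>x. p x * of_real (bform L x e)) \<tau> \<zeta>) (at 0)" if "\<gamma> \<in> disc L" for \<gamma>
    using TH_line_derivative[OF lattice_subset_disc[OF that] assms, of \<zeta> "emb e" 0] by (simp add: Bc_emb cscale_simps)
  have "((\<lambda>w. \<Sum>\<gamma>\<in>disc L. a \<gamma> * TH \<gamma> p \<tau> (\<zeta> + cscale w (emb e))) has_field_derivative
      (\<Sum>\<gamma>\<in>disc L. a \<gamma> * (2 * of_real pi * \<i> * TH \<gamma> (\<lambda>x. p x * of_real (bform L x e)) \<tau> \<zeta>))) (at 0)"
    by (intro DERIV_sum DERIV_cmult d)
  then show "cpartial e (\<lambda>\<zeta>. \<Sum>\<gamma>\<in>disc L. a \<gamma> * TH \<gamma> p \<tau> \<zeta>) \<zeta> =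
      (\<Sum>\<gamma>\<in>disc L. (2 * of_real pi * \<i> * a \<gamma>) * TH \<gamma> (\<lambda>x. p x * of_real (bform L x e)) \<tau> \<zeta>)"
    unfolding cpartial_def by (simp add: DERIV_imp_deriv mult_ac)
qed

text \<open>Two derivatives along \<open>e\<close> give \<open>(2 * pi * \<i>)\<^sup>2\<close> times
  the squared pairing with \<open>e\<close>, and over an orthonormal basis of the positive part the
  squares add up to \<open>qp\<close>.\<close>

lemma hol_laplacian_theta_lift:
  assumes \<tau>: "\<tau> \<in> UH"
  shows "hol_laplacian L P (theta_lift L v F \<tau>) \<zeta> =
    - 4 * (of_real pi)\<^sup>2 * (\<Sum>\<gamma>\<in>disc L. F \<tau> \<gamma> * TH \<gamma> (\<lambda>x. of_real (qp x)) \<tau> \<zeta>)"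
proof -
  let ?b = "\<lambda>e x. of_real (bform L x e) :: complex"
  have "cpartial e (cpartial e (theta_lift L v F \<tau>)) \<zeta> =
      (\<Sum>\<gamma>\<in>disc L. - 4 * (of_real pi)\<^sup>2 * F \<tau> \<gamma> * TH \<gamma> (\<lambda>x. ?b e x * ?b e x) \<tau> \<zeta>)" for e
  proof -
    have "cpartial e (theta_lift L v F \<tau>) = (\<lambda>\<zeta>. \<Sum>\<gamma>\<in>disc L. (2 * of_real pi * \<i> * F \<tau> \<gamma>) * TH \<gamma> (\<lambda>x. 1 * ?b e x) \<tau> \<zeta>)"
      unfolding theta_lift_eq[abs_def] by (rule cpartial_theta_sum[OF exp_bounded_const \<tau>])
    moreover have "cpartial e (\<lambda>\<zeta>. \<Sum>\<gamma>\<in>disc L. (2 * of_real pi * \<i> * F \<tau> \<gamma>) * TH \<gamma> (\<lambda>x. 1 * ?b e x) \<tau> \<zeta>) =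
        (\<lambda>\<zeta>. \<Sum>\<gamma>\<in>disc L. (2 * of_real pi * \<i> * (2 * of_real pi * \<i> * F \<tau> \<gamma>)) * TH \<gamma> (\<lambda>x. 1 * ?b e x * ?b e x) \<tau> \<zeta>)"
      by (rule cpartial_theta_sum[OF exp_bounded_mult[OF exp_bounded_const exp_bounded_bform] \<tau>])
    moreover have "2 * of_real pi * \<i> * (2 * of_real pi * \<i> * c) = - 4 * (of_real pi)\<^sup>2 * c" for c :: complex
      by (simp add: power2_eq_square algebra_simps)
    ultimately show ?thesis by (simp only: mult_1_left)
  qed
  then have "hol_laplacian L P (theta_lift L v F \<tau>) \<zeta> =
      (\<Sum>e\<in>Ep. \<Sum>\<gamma>\<in>disc L. - 4 * (of_real pi)\<^sup>2 * F \<tau> \<gamma> * TH \<gamma> (\<lambda>x. ?b e x * ?b e x) \<tau> \<zeta>)"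
    unfolding hol_laplacian_def Ep_def[symmetric] by simp
  also have "\<dots> = (\<Sum>\<gamma>\<in>disc L. \<Sum>e\<in>Ep. - 4 * (of_real pi)\<^sup>2 * F \<tau> \<gamma> * TH \<gamma> (\<lambda>x. ?b e x * ?b e x) \<tau> \<zeta>)"
    by (rule sum.swap)
  also have "\<dots> = (\<Sum>\<gamma>\<in>disc L. - 4 * (of_real pi)\<^sup>2 * F \<tau> \<gamma> * TH \<gamma> (\<lambda>x. of_real (qp x)) \<tau> \<zeta>)"
    by (intro sum.cong refl) (simp only: sum_distrib_left[symmetric] TH_qp[OF lattice_subset_disc \<tau>])
  finally show ?thesis by (simp add: sum_distrib_left mult.assoc)
qed

text \<open>Product rule; the part of the theta derivative that carries \<open>qm\<close> is
  conjugate-linear and drops out.\<close>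

lemma wirtinger_theta_lift:
  assumes \<tau>: "\<tau> \<in> UH" and F: "\<And>\<gamma>. smooth_on UH (\<lambda>\<tau>. F \<tau> \<gamma>)"
  shows "wirtinger (\<lambda>t. theta_lift L v F t \<zeta>) \<tau> =
    (\<Sum>\<gamma>\<in>disc L. wirtinger (\<lambda>t. F t \<gamma>) \<tau> * th \<gamma> \<tau> \<zeta>) +
    of_real pi * \<i> * (\<Sum>\<gamma>\<in>disc L. F \<tau> \<gamma> * TH \<gamma> (\<lambda>x. of_real (qp x)) \<tau> \<zeta>)"
proof -
  define D where "D = (\<lambda>\<gamma>. frechet_derivative (\<lambda>t. F t \<gamma>) (at \<tau>))"
  define A where "A = (\<lambda>\<gamma>. TH \<gamma> (\<lambda>x. of_real (qp x)) \<tau> \<zeta>)"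
  define B where "B = (\<lambda>\<gamma>. TH \<gamma> (\<lambda>x. of_real (qm x)) \<tau> \<zeta>)"
  have D: "((\<lambda>t. F t \<gamma>) has_derivative D \<gamma>) (at \<tau>)" for \<gamma>
    unfolding D_def by (rule smooth_on_differentiable[OF F \<tau>])
  have T: "((\<lambda>t. th \<gamma> t \<zeta>) has_derivative (\<lambda>s. of_real pi * \<i> * (s * A \<gamma> + cnj s * B \<gamma>))) (at \<tau>)" if "\<gamma> \<in> disc L" for \<gamma>
    using TH_has_derivative_\<tau>[OF lattice_subset_disc[OF that] exp_bounded_const \<tau>, of 1 \<zeta>] by (simp add: A_def B_def)
  have "((\<lambda>t. \<Sum>\<gamma>\<in>disc L. F t \<gamma> * th \<gamma> t \<zeta>) has_derivative
      (\<lambda>s. \<Sum>\<gamma>\<in>disc L. F \<tau> \<gamma> * (of_real pi * \<i> * (s * A \<gamma> + cnj s * B \<gamma>)) + D \<gamma> s * th \<gamma> \<tau> \<zeta>)) (at \<tau>)"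
    by (intro has_derivative_sum has_derivative_mult D T)
  from wirtinger_eq[OF this]
  have "wirtinger (\<lambda>t. theta_lift L v F t \<zeta>) \<tau> = (\<Sum>\<gamma>\<in>disc L.
      ((F \<tau> \<gamma> * (of_real pi * \<i> * (1 * A \<gamma> + cnj 1 * B \<gamma>)) + D \<gamma> 1 * th \<gamma> \<tau> \<zeta>)
       - \<i> * (F \<tau> \<gamma> * (of_real pi * \<i> * (\<i> * A \<gamma> + cnj \<i> * B \<gamma>)) + D \<gamma> \<i> * th \<gamma> \<tau> \<zeta>)) / 2)"
    unfolding theta_lift_eq sum_divide_distrib[symmetric] sum_subtractf sum_distrib_left[symmetric] .
  also have "\<dots> = (\<Sum>\<gamma>\<in>disc L. wirtinger (\<lambda>t. F t \<gamma>) \<tau> * th \<gamma> \<tau> \<zeta> + of_real pi * \<i> * (F \<tau> \<gamma> * A \<gamma>))"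
  proof (rule sum.cong[OF refl])
    fix \<gamma>
    show "((F \<tau> \<gamma> * (of_real pi * \<i> * (1 * A \<gamma> + cnj 1 * B \<gamma>)) + D \<gamma> 1 * th \<gamma> \<tau> \<zeta>)
       - \<i> * (F \<tau> \<gamma> * (of_real pi * \<i> * (\<i> * A \<gamma> + cnj \<i> * B \<gamma>)) + D \<gamma> \<i> * th \<gamma> \<tau> \<zeta>)) / 2
      = wirtinger (\<lambda>t. F t \<gamma>) \<tau> * th \<gamma> \<tau> \<zeta> + of_real pi * \<i> * (F \<tau> \<gamma> * A \<gamma>)"
      unfolding wirtinger_eq[OF D] by (simp add: field_simps)
  qed
  finally show ?thesis unfolding A_def by (simp only: sum.distrib sum_distrib_left)
qed

text \<open>The contribution of the theta functions, \<open>4 * pi * \<i>\<close> times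
  \<open>pi * \<i>\<close>, cancels the Laplacian, so a combination of theta components with the
  derivatives of \<open>F\<close> as coefficients remains; linear independence separates
  them.\<close>

lemma skew_holomorphic_iff:
  assumes F: "\<And>\<gamma>. smooth_on UH (\<lambda>\<tau>. F \<tau> \<gamma>)"
  shows "skew_holomorphic L v (theta_lift L v F) \<longleftrightarrow> (\<forall>\<tau>\<in>UH. \<forall>\<gamma>\<in>disc L. wirtinger (\<lambda>t. F t \<gamma>) \<tau> = 0)"
proof -
  have eq: "4 * of_real pi * \<i> * wirtinger (\<lambda>t. theta_lift L v F t \<zeta>) \<tau> - hol_laplacian L P (theta_lift L v F \<tau>) \<zeta> =
      4 * of_real pi * \<i> * (\<Sum>\<gamma>\<in>disc L. wirtinger (\<lambda>t. F t \<gamma>) \<tau> * th \<gamma> \<tau> \<zeta>)" if \<tau>: "\<tau> \<in> UH" for \<tau> \<zeta>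
    unfolding wirtinger_theta_lift[OF \<tau> F] hol_laplacian_theta_lift[OF \<tau>]
    by (simp add: algebra_simps power2_eq_square)
  have "skew_holomorphic L v (theta_lift L v F) \<longleftrightarrow>
      (\<forall>\<tau>\<in>UH. \<forall>\<zeta>. (\<Sum>\<gamma>\<in>disc L. wirtinger (\<lambda>t. F t \<gamma>) \<tau> * th \<gamma> \<tau> \<zeta>) = 0)"
    unfolding skew_holomorphic_def by (simp add: eq)
  also have "\<dots> \<longleftrightarrow> (\<forall>\<tau>\<in>UH. \<forall>\<gamma>\<in>disc L. wirtinger (\<lambda>t. F t \<gamma>) \<tau> = 0)"
  proof (intro iffI ballI allI)
    fix \<tau> \<gamma> assume h: "\<forall>\<tau>\<in>UH. \<forall>\<zeta>. (\<Sum>\<gamma>\<in>disc L. wirtinger (\<lambda>t. F t \<gamma>) \<tau> * th \<gamma> \<tau> \<zeta>) = 0"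
      and \<tau>: "\<tau> \<in> UH" and \<gamma>: "\<gamma> \<in> disc L"
    show "wirtinger (\<lambda>t. F t \<gamma>) \<tau> = 0"
      by (rule th_independent[OF \<tau> spec[OF bspec[OF h \<tau>]] \<gamma>])
  qed simp
  finally show ?thesis .
qed

text \<open>In the law under \<open>M\<close> every factor but a power of the conjugated root is
  holomorphic. Where the transformed component is nonzero, that power is therefore holomorphic as
  well.\<close>

lemma weakly_holomorphic_weight:
  assumes G: "G \<in> modular_forms (group_algebra L) (weil_rep L) p q \<Gamma>" and \<Gamma>: "\<Gamma> \<subseteq> carrier Mp2Z"
    and M: "M \<in> \<Gamma>" "fst M $ 2 $ 1 \<noteq> 0" and hol: "weakly_holomorphic G" and nz: "G \<noteq> 0"
  shows "\<lfloor>2 * q\<rfloor> = 0"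
proof -
  note G' = modular_formsD[OF G]
  have M': "M \<in> carrier Mp2Z" using M(1) \<Gamma> by (rule subsetD[rotated])
  then have Mc: "M \<in> mp2_carrier" by simp
  note dM = mp2_carrierD(1)[OF Mc]
  let ?m = "\<lfloor>2 * p\<rfloor>" and ?n = "\<lfloor>2 * q\<rfloor>"
  obtain t where t0: "G t \<noteq> 0" using nz by (auto simp: fun_eq_iff)
  then have t: "t \<in> UH" using G'(2) by blast
  \<comment> \<open>The operator is invertible, so a nonzero value stays nonzero and some component
    \<open>\<gamma>\<close> survives near \<open>t\<close>.\<close>
  have "weil_op M (G t) \<noteq> 0"
  proof
    assume 0: "weil_op M (G t) = 0"
    obtain K where K: "K \<in> carrier Mp2Z" "mp2_mult K M = mp2_one"
      using group.l_inv_ex[OF group_Mp2Z M'] by auto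
    have "G t = weil_op K (weil_op M (G t))" using weil_op_mult[OF K(1) M', of "G t"] weil_op_one[OF G'(1)[of t]] K(2) by simp
    also have "\<dots> = 0" unfolding 0 by (simp add: weil_op_def fun_eq_iff)
    finally show False using t0 by simp
  qed
  then obtain \<gamma> where \<gamma>0: "weil_op M (G t) \<gamma> \<noteq> 0" by (auto simp: fun_eq_iff)
  then have \<gamma>: "\<gamma> \<in> disc L" by (auto simp: weil_op_def split: if_splits)
  define H where "H = (\<lambda>\<tau>. weil_op M (G \<tau>) \<gamma>)"
  have Gh: "(\<lambda>\<tau>. G \<tau> \<delta>) holomorphic_on UH" for \<delta> using hol unfolding weakly_holomorphic_def by blast
  have H: "H holomorphic_on UH" using \<gamma> Gh unfolding H_def weil_op_def by (auto intro!: holomorphic_intros)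
  define S where "S = UH \<inter> H -` (- {0})"
  have S: "open S" unfolding S_def
    by (rule continuous_open_preimage[OF holomorphic_on_imp_continuous_on[OF H] open_upper_half_plane open_Compl[OF closed_singleton]])
  \<comment> \<open>Squared, because only the square of the root is the linear function
    \<open>c * \<tau> + d\<close>.\<close>
  define h where "h = (\<lambda>\<tau>. (G (mobius (fst M) \<tau>) \<gamma> / (snd M \<tau> powi ?m * H \<tau>))\<^sup>2)"
  have "(\<lambda>\<tau>. G \<tau> \<gamma>) \<circ> mobius (fst M) holomorphic_on UH"
    by (rule holomorphic_on_compose_gen[OF mobius_holomorphic[OF dM] Gh]) (use mobius_in[OF dM] in auto)
  then have Gm: "(\<lambda>\<tau>. G (mobius (fst M) \<tau>) \<gamma>) holomorphic_on UH" by (simp add: o_def)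
  have SU: "S \<subseteq> UH" and HS: "\<And>\<tau>. \<tau> \<in> S \<Longrightarrow> H \<tau> \<noteq> 0" by (auto simp: S_def)
  have nzs: "\<And>\<tau>. \<tau> \<in> S \<Longrightarrow> snd M \<tau> \<noteq> 0" using mp2_snd_nonzero[OF Mc] SU by blast
  have hS: "h holomorphic_on S" unfolding h_def using HS nzs
    by (intro holomorphic_intros holomorphic_on_subset[OF Gm SU] holomorphic_on_subset[OF mp2_carrierD(2)[OF Mc] SU]
        holomorphic_on_subset[OF H SU]) (auto simp: power_int_eq_0_iff)
  show ?thesis
  proof (rule antiholomorphic_power[OF S _ hS])
    show "t \<in> S" using t \<gamma>0 by (simp add: S_def H_def)
    show "h \<tau> = (of_real (fst M $ 2 $ 1) * cnj \<tau> + of_real (fst M $ 2 $ 2)) powi ?n" if "\<tau> \<in> S" for \<tau>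
    proof -
      have \<tau>: "\<tau> \<in> UH" using that SU by blast
      have "G (mobius (fst M) \<tau>) \<gamma> = snd M \<tau> powi ?m * cnj (snd M \<tau>) powi ?n * H \<tau>"
        unfolding G'(4)[OF \<tau> M(1)] weil_rep_weil_op[OF M' G'(1)] by (simp add: vscale_def H_def)
      then have "h \<tau> = (cnj (snd M \<tau>) powi ?n)\<^sup>2"
        using HS[OF that] nzs[OF that] by (simp add: h_def)
      also have "\<dots> = (cnj ((snd M \<tau>)\<^sup>2)) powi ?n"
        by (simp add: power2_eq_square power_int_mult_distrib)
      finally show ?thesis unfolding mp2_carrierD(3)[OF Mc \<tau>] by (simp add: autj_def)
    qed
    have "cnj (autj (fst M) t) \<noteq> 0" using autj_nonzero[OF dM t] by simp
    then show "of_real (fst M $ 2 $ 1) * cnj t + of_real (fst M $ 2 $ 2) \<noteq> (0::complex)" by (simp add: autj_def)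
  qed fact
qed

end

theorem proposition3p3:
  fixes L :: "'v::real_normed_vector lattice_form"
    and v :: "'v set \<times> 'v set"
    and \<Gamma> :: "mp2 set"
    and bp bm :: nat
    and k l :: real
  assumes "even_lattice L"
    and "signature L = (bp, bm)"
    and "v \<in> grassmannian L"
    and "subgroup \<Gamma> Mp2Z"
    and "finite (rcosets\<^bsub>Mp2Z\<^esub> \<Gamma>)"
    and "2 * k \<in> \<int>" and "2 * l \<in> \<int>"
  shows "(\<forall>G \<in> modular_forms (group_algebra L) (weil_rep L)
                 (k - bm / 2) (l - bp / 2) (mp2_tilde ` \<Gamma>).
            tilde_form L G \<in> modular_forms (group_algebra (neg_lattice L)) (weil_rep_dual L)
                 (l - bp / 2) (k - bm / 2) \<Gamma>) \<and>
         linear_isomorphism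
           (modular_forms (group_algebra L) (weil_rep L)
              (k - bm / 2) (l - bp / 2) (mp2_tilde ` \<Gamma>))
           (jacobi_forms L v l k \<Gamma>)
           (tilde_lift L v) \<and>
         (\<forall>G \<in> modular_forms (group_algebra L) (weil_rep L)
                 (k - bm / 2) (l - bp / 2) (mp2_tilde ` \<Gamma>).
            (skew_holomorphic L v (tilde_lift L v G) \<longleftrightarrow> weakly_holomorphic G) \<and>
            (weakly_holomorphic G \<and> G \<noteq> 0 \<longrightarrow> l = bp / 2))"
proof -
  obtain b where "lat_gr L b v" using even_lattice_lat_gr[OF assms(1,3)] .
  then interpret lat_gr L b v .
  have bp: "bp = card Ep" and bm: "bm = card Em" using assms(2) signature_eq by simp_all
  have \<Gamma>: "\<Gamma> \<subseteq> carrier Mp2Z" by (rule subgroup.subset[OF assms(4)])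
  have \<Gamma>': "mp2_tilde ` \<Gamma> \<subseteq> carrier Mp2Z" using \<Gamma> mp2_tilde_closed by blast
  define V where "V = modular_forms (group_algebra L) (weil_rep L) (k - bm / 2) (l - bp / 2) (mp2_tilde ` \<Gamma>)"
  define V' where "V' = modular_forms (group_algebra (neg_lattice L)) (weil_rep_dual L) (l - bp / 2) (k - bm / 2) \<Gamma>"
  let ?W = "jacobi_forms L v l k \<Gamma>"
  have weil: "is_weil_rep L (weil_rep L)" unfolding weil_rep_def by (rule someI[of "is_weil_rep L", OF is_weil_rep_weil_op])
  have VG: "G \<tau> \<in> group_algebra L" "\<tau> \<notin> UH \<Longrightarrow> G \<tau> = 0" if "G \<in> V" for G \<tau>
    using modular_formsD(1,2)[OF that[unfolded V_def]] by auto
  have tilde: "tilde_form L G = (\<lambda>\<tau>. G (refl_pt \<tau>))" if "G \<in> V" for G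
    unfolding tilde_form_def refl_pt_def[symmetric] omega_id[OF VG(1)[OF that]] ..
  have dual: "weil_rep_dual L M U = weil_rep L (mp2_tilde M) U" if "M \<in> carrier Mp2Z" "U \<in> group_algebra L" for M U
    unfolding weil_rep_dual_weil_op[OF that] weil_rep_weil_op[OF mp2_tilde_closed[OF that(1)] that(2)] ..
  have tilde_in: "tilde_form L G \<in> V'" if "G \<in> V" for G
    unfolding tilde[OF that] V'_def neg_lattice_simps
    by (rule modular_forms_refl[OF that[unfolded V_def]]) (rule dual, erule subsetD[OF \<Gamma>])
  \<comment> \<open>The involution has order two, so the reflection lemma for the image of
    \<open>\<Gamma>\<close> leads back to the original space.\<close>
  have tilde_out: "\<exists>G\<in>V. tilde_form L G = F" if "F \<in> V'" for F
  proof -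
    have "mp2_tilde ` mp2_tilde ` \<Gamma> = \<Gamma>" by (simp add: image_image mp2_tilde_tilde)
    then have F: "F \<in> modular_forms (group_algebra L) (weil_rep_dual L) (l - bp / 2) (k - bm / 2) (mp2_tilde ` mp2_tilde ` \<Gamma>)"
      using that unfolding V'_def neg_lattice_simps by simp
    have FV: "(\<lambda>\<tau>. F (refl_pt \<tau>)) \<in> V" unfolding V_def
    proof (rule modular_forms_refl[OF F])
      fix M U assume M: "M \<in> mp2_tilde ` \<Gamma>" and U: "U \<in> group_algebra L"
      show "weil_rep L M U = weil_rep_dual L (mp2_tilde M) U"
        using dual[OF mp2_tilde_closed[OF subsetD[OF \<Gamma>' M]] U] by (simp add: mp2_tilde_tilde)
    qed
    show ?thesis by (rule bexI[OF _ FV]) (simp add: tilde[OF FV])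
  qed
  have lift_in: "theta_lift L v F \<in> ?W" if "F \<in> V'" for F
    by (rule theta_lift_jacobi[OF that[unfolded V'_def bp bm] \<Gamma>])
  have lift_V': "F \<tau> \<in> group_algebra L" "\<tau> \<notin> UH \<Longrightarrow> F \<tau> = 0" if "F \<in> V'" for F \<tau>
    using modular_formsD(1,2)[OF that[unfolded V'_def]] by auto
  have bij: "bij_betw (tilde_lift L v) V ?W"
    unfolding bij_betw_def
  proof
    show "inj_on (tilde_lift L v) V"
    proof (rule inj_onI)
      fix F G assume F: "F \<in> V" and G: "G \<in> V" and eq: "tilde_lift L v F = tilde_lift L v G"
      have "tilde_form L F = tilde_form L G"
        using eq unfolding tilde_lift_def
        by (intro theta_lift_inj lift_V'[OF tilde_in[OF F]] lift_V'[OF tilde_in[OF G]])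
      then have "(\<lambda>\<tau>. F (refl_pt \<tau>)) = (\<lambda>\<tau>. G (refl_pt \<tau>))" unfolding tilde[OF F] tilde[OF G] .
      then have "F (refl_pt (refl_pt \<tau>)) = G (refl_pt (refl_pt \<tau>))" for \<tau> by (rule fun_cong)
      then show "F = G" by (intro ext) simp
    qed
    show "tilde_lift L v ` V = ?W"
    proof
      show "tilde_lift L v ` V \<subseteq> ?W" unfolding tilde_lift_def by (intro image_subsetI lift_in tilde_in)
      show "?W \<subseteq> tilde_lift L v ` V"
      proof
        fix \<Phi> assume "\<Phi> \<in> ?W"
        from theta_lift_surj[OF this \<Gamma>] obtain F where "F \<in> V'" "theta_lift L v F = \<Phi>"
          unfolding V'_def bp bm by (rule bexE)
        moreover from tilde_out[OF this(1)] obtain G where "G \<in> V" "tilde_form L G = F" by (rule bexE)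
        ultimately show "\<Phi> \<in> tilde_lift L v ` V" unfolding tilde_lift_def by (intro image_eqI[of _ _ G]) simp_all
      qed
    qed
  qed
  have Vsub: "module.subspace fscale V" unfolding V_def
  proof (rule modular_forms_subspace[OF _ \<Gamma>'])
    show "representation_on Mp2Z (group_algebra L) (weil_rep L)" using weil by (simp add: is_weil_rep_def)
    show "0 \<in> group_algebra L" by (simp add: group_algebra_def)
    show "U + W \<in> group_algebra L" if "U \<in> group_algebra L" "W \<in> group_algebra L" for U W
      using that by (simp add: group_algebra_def)
  qed (rule vscale_group_algebra)
  note sub = module.subspace_def[OF module_fscale]
  have add_V: "F + G \<in> V" if "F \<in> V" "G \<in> V" for F G using Vsub that unfolding sub by blast
  have scale_V: "fscale c F \<in> V" if "F \<in> V" for F c using Vsub that unfolding sub by blast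
  have add: "tilde_lift L v (F + G) = tilde_lift L v F + tilde_lift L v G" if "F \<in> V" "G \<in> V" for F G
    unfolding tilde_lift_def tilde[OF that(1)] tilde[OF that(2)] tilde[OF add_V[OF that]]
    by (intro ext) (simp add: theta_lift_eq distrib_right sum.distrib)
  have scale: "tilde_lift L v (fscale c F) = fscale c (tilde_lift L v F)" if "F \<in> V" for F c
    unfolding tilde_lift_def tilde[OF that] tilde[OF scale_V[OF that]]
    by (intro ext) (simp add: theta_lift_eq fscale_def sum_distrib_left mult.assoc)
  have W: "?W = tilde_lift L v ` V" using bij by (simp add: bij_betw_def)
  \<comment> \<open>Obtained as the image of a subspace under a linear map, once surjectivity is
    known.\<close>
  have "module.subspace fscale ?W"
    unfolding sub W
  proof (intro conjI ballI allI)
    have "(0 :: complex \<Rightarrow> 'v set \<Rightarrow> complex) \<in> V" using Vsub unfolding sub by blast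
    moreover have "tilde_lift L v 0 = 0"
      unfolding tilde_lift_def tilde[OF calculation] by (intro ext) (simp add: theta_lift_eq)
    ultimately show "0 \<in> tilde_lift L v ` V" by (intro image_eqI[of _ _ 0]) simp_all
    fix \<Phi> \<Psi> assume "\<Phi> \<in> tilde_lift L v ` V" "\<Psi> \<in> tilde_lift L v ` V"
    then obtain F G where "F \<in> V" "G \<in> V" "\<Phi> = tilde_lift L v F" "\<Psi> = tilde_lift L v G" by (elim imageE)
    then show "\<Phi> + \<Psi> \<in> tilde_lift L v ` V" using add add_V by (intro image_eqI[of _ _ "F + G"]) simp_all
  next
    fix c \<Phi> assume "\<Phi> \<in> tilde_lift L v ` V"
    then obtain F where "F \<in> V" "\<Phi> = tilde_lift L v F" by (elim imageE)
    then show "fscale c \<Phi> \<in> tilde_lift L v ` V" using scale scale_V by (intro image_eqI[of _ _ "fscale c F"]) simp_all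
  qed
  then have iso: "linear_isomorphism V ?W (tilde_lift L v)"
    unfolding linear_isomorphism_def using Vsub add scale bij by blast
  have skew: "skew_holomorphic L v (tilde_lift L v G) \<longleftrightarrow> weakly_holomorphic G" if G: "G \<in> V" for G
  proof -
    have sm: "smooth_on UH (\<lambda>\<tau>. G \<tau> \<gamma>)" for \<gamma> using modular_formsD(3)[OF G[unfolded V_def]] .
    have d: "(\<lambda>\<tau>. G \<tau> \<gamma>) differentiable (at \<tau>)" if "\<tau> \<in> UH" for \<tau> \<gamma>
      using smooth_on_differentiable[OF sm that] unfolding differentiable_def by blast
    have "skew_holomorphic L v (tilde_lift L v G) \<longleftrightarrow> (\<forall>\<tau>\<in>UH. \<forall>\<gamma>\<in>disc L. wirtinger (\<lambda>t. G (refl_pt t) \<gamma>) \<tau> = 0)"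
      unfolding tilde_lift_def tilde[OF G] by (rule skew_holomorphic_iff[OF smooth_on_refl[OF sm]])
    also have "\<dots> \<longleftrightarrow> (\<forall>\<tau>\<in>UH. \<forall>\<gamma>\<in>disc L. (\<lambda>t. G t \<gamma>) field_differentiable (at (refl_pt \<tau>)))"
      by (intro ball_cong refl wirtinger_refl_eq_0_iff d) simp
    also have "\<dots> \<longleftrightarrow> (\<forall>\<tau>\<in>UH. \<forall>\<gamma>\<in>disc L. (\<lambda>t. G t \<gamma>) field_differentiable (at \<tau>))"
    proof (intro iffI ballI)
      fix \<tau> \<gamma> assume "\<forall>\<tau>\<in>UH. \<forall>\<gamma>\<in>disc L. (\<lambda>t. G t \<gamma>) field_differentiable (at (refl_pt \<tau>))" "\<tau> \<in> UH" "\<gamma> \<in> disc L"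
      then show "(\<lambda>t. G t \<gamma>) field_differentiable (at \<tau>)"
        by (metis refl_pt_in refl_pt_refl_pt)
    qed simp
    also have "\<dots> \<longleftrightarrow> weakly_holomorphic G"
    proof -
      have "(\<lambda>t. G t \<gamma>) = (\<lambda>t. 0)" if "\<gamma> \<notin> disc L" for \<gamma>
        using VG(1)[OF G] that by (simp add: group_algebra_def)
      then have "(\<forall>\<gamma>\<in>disc L. (\<lambda>t. G t \<gamma>) holomorphic_on UH) \<longleftrightarrow> weakly_holomorphic G"
        unfolding weakly_holomorphic_def by (metis holomorphic_on_const)
      moreover have "(\<lambda>t. G t \<gamma>) holomorphic_on UH \<longleftrightarrow> (\<forall>\<tau>\<in>UH. (\<lambda>t. G t \<gamma>) field_differentiable (at \<tau>))" for \<gamma>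
        unfolding holomorphic_on_def by (intro ball_cong refl) (simp add: at_within_open[OF _ open_upper_half_plane])
      ultimately show ?thesis by blast
    qed
    finally show ?thesis .
  qed
  have weight: "l = bp / 2" if G: "G \<in> V" and wh: "weakly_holomorphic G" "G \<noteq> 0" for G
  proof -
    obtain M where M: "M \<in> \<Gamma>" "fst M $ 2 $ 1 \<noteq> 0" using finite_index_lower_left_nonzero[OF assms(4,5)] by (rule bexE)
    have "fst (mp2_tilde M) $ 2 $ 1 \<noteq> 0" using M(2) by (simp add: mp2_tilde_def)
    from weakly_holomorphic_weight[OF G[unfolded V_def] \<Gamma>' imageI[OF M(1)] this wh]
    have "\<lfloor>2 * l\<rfloor> = int bp" unfolding floor_weight by simp
    \<comment> \<open>Integrality of \<open>2 * l\<close> lets its floor determine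
      \<open>l\<close>.\<close>
    moreover have "of_int \<lfloor>2 * l\<rfloor> = 2 * l" using assms(7) by (auto elim: Ints_cases)
    ultimately show ?thesis by simp
  qed
  show ?thesis unfolding V_def[symmetric] V'_def[symmetric] using tilde_in iso skew weight by blast
qed

end
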